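(* Let $j\ge2$ and $n-j\ge2$. The projections $PGC_{n,j}\to HH_{n,j}$ and $PGC'_{n,j}\to HH_{n,j}$ are quasi-isomorphisms. In particular, the projection $PGC'_{n,j}\to PGC_{n,j}$ is a quasi-isomorphism.
   Context: Fix integers $j\ge 2$, $n$ with $n-j\ge 2$. Coefficients are in $\mathbb Q$. **Plain graphs.** A plain graph is a finite graph with three types of vertices (white, external black, internal black) and two types of edges (dashed, solid). White vertices have at least three dashed half-edges and no solid one; internal black vertices have at least three solid half-edges and no dashed one; external black vertices carry arbitrary numbers of both. Each component contains an external black vertex. Double edges (two edges of the same type joining the same two vertices) and loop edges are allowed. A plain graph is admissible if every external black vertex has at least one dashed edge. A chord is a dashed edge joining two black vertices; a multiple edge is a pair of a dashed and a solid edge joining the same two black vertices. Degrees: dashed edge $n-1$, solid edge $j-1$, white vertex $-n$, black vertex $-j$; $|\Gamma|$ is the sum of all these degrees. A label is an ordering of $E(\Gamma)\cup V(\Gamma)$ (solid edges before dashed ones, black vertices before white ones) and a choice of orientation of every edge; interchanging two neighbouring elements of degrees $d,d'$ changes the orientation of the graph by $(-1)^{dd'}$, reversing an edge of degree $d$ changes it by $(-1)^{d+1}$. Orientation relations: two labeled graphs with the same underlying graph are identified up to the corresponding sign. **Contractions.** For an edge $e=\{p,q\}$, $q>p$, $\Gamma/e$ is the contraction (the new vertex takes the place of $p$; it is external black if an endpoint is external black) and $\sigma(e)=(-1)^{|\Gamma|+1}(-1)^{\deg V(\Gamma/e)}\Phi(e)\tau(e)\eta(e)$, where $\deg V$ is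 the sum of the degrees of the vertices, $\tau(e)$ (resp. $\Phi(e)$) is the Koszul sign of moving $e$ (resp. $q$) to the end of the ordered graded set $E(\Gamma)$ (resp. $V(\Gamma)$), and $\eta(e)=1$ if $e$ is oriented from $p$ to $q$, otherwise $(-1)^j$ for $e$ solid and $(-1)^n$ for $e$ dashed. **$PGC_{n,j}$** is spanned by connected labeled admissible plain graphs modulo orientation relations and modulo graphs having double or loop edges; $d\Gamma=\sum_e\sigma(e)\Gamma/e$ over the edges which are not loop edges, members of double edges, chords or members of multiple edges. **$PGC'_{n,j}$** is spanned by connected labeled admissible plain graphs modulo orientation relations only (double and loop edges are allowed); $d\Gamma=\sum_e\sigma(e)\Gamma/e$ over all edges which are neither chords nor loop edges. **$HH_{n,j}$.** A chord graph is a plain graph without white vertices and internal black vertices. $HH_{n,j}$ is spanned by connected labeled admissible chord graphs modulo orientation relations, graphs with double or loop edges, and Arnold relations: for three distinct vertices $h,i,l$ and for a fixed edge type (solid or dashed), $\Gamma_1+\Gamma_2+\Gamma_3=0$ where the three labeled graphs coincide except for two edges (labeled $a$ and $b$) of that type, which are $a:h\to i,\ b:i\to l$ in $\Gamma_1$; $a:i\to l,\ b:l\to h$ in $\Gamma_2$; $b:h\to i,\ a:l\to h$ in $\Gamma_3$. The differential is induced by that of $PGC_{n,j}$ (contraction of solid edges not in multiple edges). The projections $PGC_{n,j}\to HH_{n,j}$ and $PGC'_{n,j}\to HH_{n,j}$ send chord graphs to their classes and all plain graphs with a white or internal black vertex to $0$ (and graphs with double or loop edges to $0$); $PGC'_{n,j}\to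 PGC_{n,j}$ sends graphs with double or loop edges to $0$. *)

theory Defs
  imports "HOL-Algebra.Coset" "HOL-Library.Poly_Mapping" "HOL-Combinatorics.Transposition" Complex_Main
begin

section \<open>Cochain complexes of groups and quasi-isomorphisms\<close>

text \<open>
  The map of quotients induced by \<open>f\<close>: it sends a coset \<open>X\<close> to \<open>N + f(X)\<close>. If \<open>f\<close> is a
  homomorphism carrying the subgroup divided out in the source into \<open>N\<close>, this is the coset
  \<open>N + f(x)\<close> for any \<open>x\<close> in \<open>X\<close>; otherwise the value on some coset fails to be a coset of \<open>N\<close>,
  so that membership of \<open>induced_map\<close> in \<^const>\<open>hom\<close> includes well-definedness.
\<close>

definition induced_map ::
    "('b, 'm) monoid_scheme \<Rightarrow> 'b set \<Rightarrow> ('a \<Rightarrow> 'b) \<Rightarrow> 'a set \<Rightarrow> 'b set"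
  where "induced_map H N f X = N <#>\<^bsub>H\<^esub> (f ` X)"

definition cochain_complex :: "(int \<Rightarrow> 'a monoid) \<Rightarrow> (int \<Rightarrow> 'a \<Rightarrow> 'a) \<Rightarrow> bool"
  where "cochain_complex C d \<longleftrightarrow>
    (\<forall>k. comm_group (C k) \<and> d k \<in> hom (C k) (C (k + 1)) \<and>
         (\<forall>x\<in>carrier (C k). d (k + 1) (d k x) = \<one>\<^bsub>C (k + 2)\<^esub>))"

definition cochain_map ::
    "(int \<Rightarrow> 'a monoid) \<Rightarrow> (int \<Rightarrow> 'a \<Rightarrow> 'a) \<Rightarrow> (int \<Rightarrow> 'b monoid) \<Rightarrow> (int \<Rightarrow> 'b \<Rightarrow> 'b) \<Rightarrow>
      (int \<Rightarrow> 'a \<Rightarrow> 'b) \<Rightarrow> bool"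
  where "cochain_map C d C' d' f \<longleftrightarrow>
    (\<forall>k. f k \<in> hom (C k) (C' k) \<and> (\<forall>x\<in>carrier (C k). f (k + 1) (d k x) = d' k (f k x)))"

definition coboundaries :: "(int \<Rightarrow> 'a monoid) \<Rightarrow> (int \<Rightarrow> 'a \<Rightarrow> 'a) \<Rightarrow> int \<Rightarrow> 'a set"
  where "coboundaries C d k = d (k - 1) ` carrier (C (k - 1))"

definition cocycle_group :: "(int \<Rightarrow> 'a monoid) \<Rightarrow> (int \<Rightarrow> 'a \<Rightarrow> 'a) \<Rightarrow> int \<Rightarrow> 'a monoid"
  where "cocycle_group C d k = (C k)\<lparr>carrier := kernel (C k) (C (k + 1)) (d k)\<rparr>"

definition cohomology_group :: "(int \<Rightarrow> 'a monoid) \<Rightarrow> (int \<Rightarrow> 'a \<Rightarrow> 'a) \<Rightarrow> int \<Rightarrow> 'a set monoid"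
  where "cohomology_group C d k = cocycle_group C d k Mod coboundaries C d k"

definition quasi_isomorphism ::
    "(int \<Rightarrow> 'a monoid) \<Rightarrow> (int \<Rightarrow> 'a \<Rightarrow> 'a) \<Rightarrow> (int \<Rightarrow> 'b monoid) \<Rightarrow> (int \<Rightarrow> 'b \<Rightarrow> 'b) \<Rightarrow>
      (int \<Rightarrow> 'a \<Rightarrow> 'b) \<Rightarrow> bool"
  where "quasi_isomorphism C d C' d' f \<longleftrightarrow>
    cochain_complex C d \<and> cochain_complex C' d' \<and> cochain_map C d C' d' f \<and>
    (\<forall>k. induced_map (cocycle_group C' d' k) (coboundaries C' d' k) (f k)
           \<in> iso (cohomology_group C d k) (cohomology_group C' d' k))"


section \<open>Rational vector spaces given by generators and relations\<close>

text \<open>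
  The analogue over the rationals of \<open>free_Abelian_group\<close>. Only the additive group is recorded:
  an additive map between rational vector spaces is automatically linear.
\<close>

definition free_rat :: "'a set \<Rightarrow> ('a \<Rightarrow>\<^sub>0 rat) monoid"
  where "free_rat S =
    \<lparr>carrier = {x. Poly_Mapping.keys x \<subseteq> S}, monoid.mult = (+), one = 0\<rparr>"

definition scale_rat :: "rat \<Rightarrow> ('a \<Rightarrow>\<^sub>0 rat) \<Rightarrow> ('a \<Rightarrow>\<^sub>0 rat)"
  where "scale_rat c = Poly_Mapping.map ((*) c)"

definition linear_extension :: "('a \<Rightarrow> ('b \<Rightarrow>\<^sub>0 rat)) \<Rightarrow> ('a \<Rightarrow>\<^sub>0 rat) \<Rightarrow> ('b \<Rightarrow>\<^sub>0 rat)"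
  where "linear_extension F x =
    (\<Sum>g\<in>Poly_Mapping.keys x. scale_rat (Poly_Mapping.lookup x g) (F g))"

definition rat_span :: "('a \<Rightarrow>\<^sub>0 rat) set \<Rightarrow> ('a \<Rightarrow>\<^sub>0 rat) set"
  where "rat_span = module.span scale_rat"

definition presented :: "'a set \<Rightarrow> ('a \<Rightarrow>\<^sub>0 rat) set \<Rightarrow> ('a \<Rightarrow>\<^sub>0 rat) set monoid"
  where "presented S R = free_rat S Mod rat_span R"

definition presented_map ::
    "'b set \<Rightarrow> ('b \<Rightarrow>\<^sub>0 rat) set \<Rightarrow> ('a \<Rightarrow> ('b \<Rightarrow>\<^sub>0 rat)) \<Rightarrow> ('a \<Rightarrow>\<^sub>0 rat) set \<Rightarrow> ('b \<Rightarrow>\<^sub>0 rat) set"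
  where "presented_map S R F = induced_map (free_rat S) (rat_span R) (linear_extension F)"


section \<open>Labeled plain graphs\<close>

datatype vertex_kind = White | ExtBlack | IntBlack

datatype edge_kind = Solid | Dashed

datatype edge = Edge (ekind: edge_kind) (src: nat) (tgt: nat)

text \<open>
  A labeled graph is encoded up to isomorphism: the vertices are \<open>0, \<dots>, N - 1\<close>, numbered by
  the label and given by the list of their kinds; the edges are listed in the order of the label,
  each with its orientation. (The label is an ordering of the union of the edges and the vertices
  which only compares edges with edges and vertices with vertices.)
\<close>

datatype lgraph = LGraph (vkinds: "vertex_kind list") (edges: "edge list")

abbreviation num_vertices :: "lgraph \<Rightarrow> nat"
  where "num_vertices G \<equiv> length (vkinds G)"

abbreviation num_edges :: "lgraph \<Rightarrow> nat"
  where "num_edges G \<equiv> length (edges G)"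

definition ends :: "edge \<Rightarrow> nat set"
  where "ends e = {src e, tgt e}"

text \<open>The number of half-edges of a given kind at a vertex; a loop edge contributes two.\<close>

definition half_edges :: "edge_kind \<Rightarrow> lgraph \<Rightarrow> nat \<Rightarrow> nat"
  where "half_edges K G v =
    card {i. i < num_edges G \<and> ekind (edges G ! i) = K \<and> src (edges G ! i) = v} +
    card {i. i < num_edges G \<and> ekind (edges G ! i) = K \<and> tgt (edges G ! i) = v}"

definition well_labeled :: "lgraph \<Rightarrow> bool"
  where "well_labeled G \<longleftrightarrow>
    (\<forall>e\<in>set (edges G). src e < num_vertices G \<and> tgt e < num_vertices G) \<and>
    (\<forall>v w. v < w \<and> w < num_vertices G \<and> vkinds G ! v = White \<longrightarrow> vkinds G ! w = White) \<and>
    (\<forall>i i'. i < i' \<and> i' < num_edges G \<and> ekind (edges G ! i) = Dashed \<longrightarrow>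
        ekind (edges G ! i') = Dashed)"

definition reachable :: "lgraph \<Rightarrow> nat \<Rightarrow> nat \<Rightarrow> bool"
  where "reachable G v w \<longleftrightarrow> (v, w) \<in> {(x, y). \<exists>e\<in>set (edges G). ends e = {x, y}}\<^sup>*"

definition plain_graph :: "lgraph \<Rightarrow> bool"
  where "plain_graph G \<longleftrightarrow> well_labeled G \<and>
    (\<forall>v<num_vertices G.
       (vkinds G ! v = White \<longrightarrow> half_edges Dashed G v \<ge> 3 \<and> half_edges Solid G v = 0) \<and>
       (vkinds G ! v = IntBlack \<longrightarrow> half_edges Solid G v \<ge> 3 \<and> half_edges Dashed G v = 0)) \<and>
    (\<forall>v<num_vertices G. \<exists>w<num_vertices G. reachable G v w \<and> vkinds G ! w = ExtBlack)"

definition connected_graph :: "lgraph \<Rightarrow> bool"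
  where "connected_graph G \<longleftrightarrow> num_vertices G > 0 \<and>
    (\<forall>v<num_vertices G. \<forall>w<num_vertices G. reachable G v w)"

definition admissible :: "lgraph \<Rightarrow> bool"
  where "admissible G \<longleftrightarrow>
    (\<forall>v<num_vertices G. vkinds G ! v = ExtBlack \<longrightarrow>
       (\<exists>e\<in>set (edges G). ekind e = Dashed \<and> v \<in> ends e))"

definition chord_graph :: "lgraph \<Rightarrow> bool"
  where "chord_graph G \<longleftrightarrow> plain_graph G \<and> set (vkinds G) \<subseteq> {ExtBlack}"


text \<open>In the following predicates an edge is referred to by its position in the edge list.\<close>

definition is_chord :: "lgraph \<Rightarrow> nat \<Rightarrow> bool"
  where "is_chord G i \<longleftrightarrow> ekind (edges G ! i) = Dashed \<and>
    (\<forall>v\<in>ends (edges G ! i). vkinds G ! v \<noteq> White)"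

definition is_loop :: "lgraph \<Rightarrow> nat \<Rightarrow> bool"
  where "is_loop G i \<longleftrightarrow> src (edges G ! i) = tgt (edges G ! i)"

definition in_double_edge :: "lgraph \<Rightarrow> nat \<Rightarrow> bool"
  where "in_double_edge G i \<longleftrightarrow> \<not> is_loop G i \<and>
    (\<exists>i'<num_edges G. i' \<noteq> i \<and> ekind (edges G ! i') = ekind (edges G ! i) \<and>
       ends (edges G ! i') = ends (edges G ! i))"

definition in_multiple_edge :: "lgraph \<Rightarrow> nat \<Rightarrow> bool"
  where "in_multiple_edge G i \<longleftrightarrow> \<not> is_loop G i \<and>
    (\<forall>v\<in>ends (edges G ! i). vkinds G ! v \<noteq> White) \<and>
    (\<exists>i'<num_edges G. ekind (edges G ! i') \<noteq> ekind (edges G ! i) \<and>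
       ends (edges G ! i') = ends (edges G ! i))"

definition has_double_or_loop :: "lgraph \<Rightarrow> bool"
  where "has_double_or_loop G \<longleftrightarrow> (\<exists>i<num_edges G. is_loop G i \<or> in_double_edge G i)"


section \<open>Degrees and orientation relations\<close>

abbreviation sgn_pow :: "int \<Rightarrow> rat"
  where "sgn_pow k \<equiv> (-1) powi k"

fun edge_degree :: "int \<Rightarrow> int \<Rightarrow> edge_kind \<Rightarrow> int"
  where
    "edge_degree n j Dashed = n - 1"
  | "edge_degree n j Solid = j - 1"

fun vertex_degree :: "int \<Rightarrow> int \<Rightarrow> vertex_kind \<Rightarrow> int"
  where
    "vertex_degree n j White = - n"
  | "vertex_degree n j ExtBlack = - j"
  | "vertex_degree n j IntBlack = - j"

definition edge_degrees :: "int \<Rightarrow> int \<Rightarrow> lgraph \<Rightarrow> int list"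
  where "edge_degrees n j G = map (\<lambda>e. edge_degree n j (ekind e)) (edges G)"

definition vertex_degrees :: "int \<Rightarrow> int \<Rightarrow> lgraph \<Rightarrow> int list"
  where "vertex_degrees n j G = map (vertex_degree n j) (vkinds G)"

definition graph_degree :: "int \<Rightarrow> int \<Rightarrow> lgraph \<Rightarrow> int"
  where "graph_degree n j G = sum_list (edge_degrees n j G) + sum_list (vertex_degrees n j G)"

definition swap_adjacent :: "nat \<Rightarrow> 'a list \<Rightarrow> 'a list"
  where "swap_adjacent i xs = xs[i := xs ! Suc i, Suc i := xs ! i]"

definition relabel_edge :: "(nat \<Rightarrow> nat) \<Rightarrow> edge \<Rightarrow> edge"
  where "relabel_edge r e = Edge (ekind e) (r (src e)) (r (tgt e))"

definition swap_edges :: "nat \<Rightarrow> lgraph \<Rightarrow> lgraph"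
  where "swap_edges i G = LGraph (vkinds G) (swap_adjacent i (edges G))"

definition swap_vertices :: "nat \<Rightarrow> lgraph \<Rightarrow> lgraph"
  where "swap_vertices v G =
    LGraph (swap_adjacent v (vkinds G)) (map (relabel_edge (transpose v (Suc v))) (edges G))"

definition reverse_edge :: "nat \<Rightarrow> lgraph \<Rightarrow> lgraph"
  where "reverse_edge i G = LGraph (vkinds G)
    ((edges G)[i := Edge (ekind (edges G ! i)) (tgt (edges G ! i)) (src (edges G ! i))])"

text \<open>
  \<open>relabeling n j G H s\<close>: an elementary change of the label of \<open>G\<close> yields \<open>H\<close> and changes the
  orientation by the sign \<open>s\<close>.
\<close>

inductive relabeling :: "int \<Rightarrow> int \<Rightarrow> lgraph \<Rightarrow> lgraph \<Rightarrow> rat \<Rightarrow> bool"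
  for n j :: int and G :: lgraph
  where
    "Suc i < num_edges G \<Longrightarrow>
       relabeling n j G (swap_edges i G)
         (sgn_pow (edge_degrees n j G ! i * edge_degrees n j G ! Suc i))"
  | "Suc v < num_vertices G \<Longrightarrow>
       relabeling n j G (swap_vertices v G)
         (sgn_pow (vertex_degrees n j G ! v * vertex_degrees n j G ! Suc v))"
  | "i < num_edges G \<Longrightarrow>
       relabeling n j G (reverse_edge i G) (sgn_pow (edge_degrees n j G ! i + 1))"

abbreviation basis_vector :: "lgraph \<Rightarrow> (lgraph \<Rightarrow>\<^sub>0 rat)"
  where "basis_vector G \<equiv> Poly_Mapping.single G 1"

text \<open>
  Requiring both graphs to lie in \<open>S\<close> excludes interchanges which would put a dashed edge before a
  solid one or a white vertex before a black one.
\<close>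

definition orientation_relations :: "int \<Rightarrow> int \<Rightarrow> lgraph set \<Rightarrow> (lgraph \<Rightarrow>\<^sub>0 rat) set"
  where "orientation_relations n j S =
    {basis_vector H - Poly_Mapping.single G s | G H s. G \<in> S \<and> H \<in> S \<and> relabeling n j G H s}"

definition double_loop_relations :: "lgraph set \<Rightarrow> (lgraph \<Rightarrow>\<^sub>0 rat) set"
  where "double_loop_relations S = {basis_vector G | G. G \<in> S \<and> has_double_or_loop G}"

text \<open>The two edges labeled \<open>a\<close> and \<open>b\<close> are those at positions \<open>a\<close> and \<open>b\<close> of the edge list.\<close>

definition arnold_relations :: "lgraph set \<Rightarrow> (lgraph \<Rightarrow>\<^sub>0 rat) set"
  where "arnold_relations S =
    {basis_vector G1 + basis_vector G2 + basis_vector G3 | G1 G2 G3 vs es a b K h i l.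
       distinct [h, i, l] \<and> a \<noteq> b \<and> a < length es \<and> b < length es \<and>
       G1 = LGraph vs (es[a := Edge K h i, b := Edge K i l]) \<and>
       G2 = LGraph vs (es[a := Edge K i l, b := Edge K l h]) \<and>
       G3 = LGraph vs (es[b := Edge K h i, a := Edge K l h]) \<and>
       G1 \<in> S \<and> G2 \<in> S \<and> G3 \<in> S}"


section \<open>Contractions\<close>

text \<open>
  Contraction of the edge at position \<open>i\<close> with ends \<open>p < q\<close>. As black vertices precede white ones,
  \<open>p\<close> is black as soon as one of the ends is.
\<close>

definition contract :: "lgraph \<Rightarrow> nat \<Rightarrow> lgraph"
  where "contract G i =
    (let e = edges G ! i; p = min (src e) (tgt e); q = max (src e) (tgt e);
         K = (if ExtBlack \<in> {vkinds G ! p, vkinds G ! q} then ExtBlack else vkinds G ! p);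
         r = (\<lambda>v. if v = q then p else if v > q then v - 1 else v)
     in LGraph (take q ((vkinds G)[p := K]) @ drop (Suc q) (vkinds G))
               (map (relabel_edge r) (take i (edges G) @ drop (Suc i) (edges G))))"

text \<open>The Koszul sign of moving the element at position \<open>i\<close> of an ordered graded set to the end.\<close>

definition koszul_to_end :: "int list \<Rightarrow> nat \<Rightarrow> rat"
  where "koszul_to_end ds i = sgn_pow (ds ! i * sum_list (drop (Suc i) ds))"

definition eta_sign :: "int \<Rightarrow> int \<Rightarrow> edge \<Rightarrow> rat"
  where "eta_sign n j e =
    (if src e < tgt e then 1 else case ekind e of Solid \<Rightarrow> sgn_pow j | Dashed \<Rightarrow> sgn_pow n)"

definition contraction_sign :: "int \<Rightarrow> int \<Rightarrow> lgraph \<Rightarrow> nat \<Rightarrow> rat"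
  where "contraction_sign n j G i =
    (let e = edges G ! i
     in sgn_pow (graph_degree n j G + 1) *
        sgn_pow (sum_list (vertex_degrees n j (contract G i))) *
        koszul_to_end (vertex_degrees n j G) (max (src e) (tgt e)) *
        koszul_to_end (edge_degrees n j G) i *
        eta_sign n j e)"

definition contraction_sum ::
    "int \<Rightarrow> int \<Rightarrow> (lgraph \<Rightarrow> nat \<Rightarrow> bool) \<Rightarrow> lgraph \<Rightarrow> (lgraph \<Rightarrow>\<^sub>0 rat)"
  where "contraction_sum n j P G =
    (\<Sum>i | i < num_edges G \<and> P G i. Poly_Mapping.single (contract G i) (contraction_sign n j G i))"


section \<open>The complexes\<close>

definition plain_generators :: "int \<Rightarrow> int \<Rightarrow> int \<Rightarrow> lgraph set"
  where "plain_generators n j k =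
    {G. plain_graph G \<and> connected_graph G \<and> admissible G \<and> graph_degree n j G = k}"

definition chord_generators :: "int \<Rightarrow> int \<Rightarrow> int \<Rightarrow> lgraph set"
  where "chord_generators n j k =
    {G. chord_graph G \<and> connected_graph G \<and> admissible G \<and> graph_degree n j G = k}"


definition PGC_relations :: "int \<Rightarrow> int \<Rightarrow> int \<Rightarrow> (lgraph \<Rightarrow>\<^sub>0 rat) set"
  where "PGC_relations n j k =
    orientation_relations n j (plain_generators n j k) \<union>
    double_loop_relations (plain_generators n j k)"

definition PGC :: "int \<Rightarrow> int \<Rightarrow> int \<Rightarrow> (lgraph \<Rightarrow>\<^sub>0 rat) set monoid"
  where "PGC n j k = presented (plain_generators n j k) (PGC_relations n j k)"

definition PGC_boundary :: "int \<Rightarrow> int \<Rightarrow> lgraph \<Rightarrow> (lgraph \<Rightarrow>\<^sub>0 rat)"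
  where "PGC_boundary n j = contraction_sum n j
    (\<lambda>G i. \<not> is_loop G i \<and> \<not> in_double_edge G i \<and> \<not> is_chord G i \<and> \<not> in_multiple_edge G i)"

definition PGC_diff :: "int \<Rightarrow> int \<Rightarrow> int \<Rightarrow> (lgraph \<Rightarrow>\<^sub>0 rat) set \<Rightarrow> (lgraph \<Rightarrow>\<^sub>0 rat) set"
  where "PGC_diff n j k =
    presented_map (plain_generators n j (k + 1)) (PGC_relations n j (k + 1)) (PGC_boundary n j)"


definition PGC'_relations :: "int \<Rightarrow> int \<Rightarrow> int \<Rightarrow> (lgraph \<Rightarrow>\<^sub>0 rat) set"
  where "PGC'_relations n j k = orientation_relations n j (plain_generators n j k)"

definition PGC' :: "int \<Rightarrow> int \<Rightarrow> int \<Rightarrow> (lgraph \<Rightarrow>\<^sub>0 rat) set monoid"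
  where "PGC' n j k = presented (plain_generators n j k) (PGC'_relations n j k)"

definition PGC'_boundary :: "int \<Rightarrow> int \<Rightarrow> lgraph \<Rightarrow> (lgraph \<Rightarrow>\<^sub>0 rat)"
  where "PGC'_boundary n j = contraction_sum n j (\<lambda>G i. \<not> is_chord G i \<and> \<not> is_loop G i)"

definition PGC'_diff :: "int \<Rightarrow> int \<Rightarrow> int \<Rightarrow> (lgraph \<Rightarrow>\<^sub>0 rat) set \<Rightarrow> (lgraph \<Rightarrow>\<^sub>0 rat) set"
  where "PGC'_diff n j k =
    presented_map (plain_generators n j (k + 1)) (PGC'_relations n j (k + 1)) (PGC'_boundary n j)"


definition HH_relations :: "int \<Rightarrow> int \<Rightarrow> int \<Rightarrow> (lgraph \<Rightarrow>\<^sub>0 rat) set"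
  where "HH_relations n j k =
    orientation_relations n j (chord_generators n j k) \<union>
    double_loop_relations (chord_generators n j k) \<union>
    arnold_relations (chord_generators n j k)"

definition HH :: "int \<Rightarrow> int \<Rightarrow> int \<Rightarrow> (lgraph \<Rightarrow>\<^sub>0 rat) set monoid"
  where "HH n j k = presented (chord_generators n j k) (HH_relations n j k)"

text \<open>In a chord graph every dashed edge is a chord, so only solid edges are contracted here.\<close>

definition HH_diff :: "int \<Rightarrow> int \<Rightarrow> int \<Rightarrow> (lgraph \<Rightarrow>\<^sub>0 rat) set \<Rightarrow> (lgraph \<Rightarrow>\<^sub>0 rat) set"
  where "HH_diff n j k =
    presented_map (chord_generators n j (k + 1)) (HH_relations n j (k + 1)) (PGC_boundary n j)"


section \<open>The projections\<close>

definition chord_part :: "lgraph \<Rightarrow> (lgraph \<Rightarrow>\<^sub>0 rat)"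
  where "chord_part G = (if chord_graph G \<and> \<not> has_double_or_loop G then basis_vector G else 0)"

definition simple_part :: "lgraph \<Rightarrow> (lgraph \<Rightarrow>\<^sub>0 rat)"
  where "simple_part G = (if has_double_or_loop G then 0 else basis_vector G)"

definition PGC_to_HH :: "int \<Rightarrow> int \<Rightarrow> int \<Rightarrow> (lgraph \<Rightarrow>\<^sub>0 rat) set \<Rightarrow> (lgraph \<Rightarrow>\<^sub>0 rat) set"
  where "PGC_to_HH n j k = presented_map (chord_generators n j k) (HH_relations n j k) chord_part"

definition PGC'_to_HH :: "int \<Rightarrow> int \<Rightarrow> int \<Rightarrow> (lgraph \<Rightarrow>\<^sub>0 rat) set \<Rightarrow> (lgraph \<Rightarrow>\<^sub>0 rat) set"
  where "PGC'_to_HH n j k = presented_map (chord_generators n j k) (HH_relations n j k) chord_part"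

definition PGC'_to_PGC :: "int \<Rightarrow> int \<Rightarrow> int \<Rightarrow> (lgraph \<Rightarrow>\<^sub>0 rat) set \<Rightarrow> (lgraph \<Rightarrow>\<^sub>0 rat) set"
  where "PGC'_to_PGC n j k =
    presented_map (plain_generators n j k) (PGC_relations n j k) simple_part"

end

theory Submission
  imports Defs "HOL-Library.Multiset"
begin

text \<open>
  The projections are surjective, so one has to show that their kernels are acyclic. Contracting an edge
  with an internal end preserves the number of external vertices, contracting any other edge lowers it.
  The part of the differential of the first kind (\<open>udiff False\<close>) is exact on the graphs with internal
  vertices. To see this, mark the external vertices one after the other. Blowing up the last marked
  vertex, that is moving its half-edges towards vertices not yet marked to a new internal neighbour, is a
  contracting homotopy up to graphs in which the marked vertex has no such half-edge, or a single one
  leading to an external vertex. Once all external vertices are of this type for both kinds of edges,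
  none is adjacent to an internal vertex, and connectedness leaves no internal vertex.

  Modulo orientation, the relations of \<open>HH\<close> are the boundaries of the first kind of the graphs with one
  internal vertex: loops, double edges and Arnold sums are boundaries of blow-ups, and conversely
  the boundary of a star follows from the Arnold relation by induction on the valence. The kernels
  are then acyclic by induction on the number of external vertices.
\<close>

text \<open>Two obstacles shape the constructions. A choice of an external vertex is not invariant
  under relabeling, so the homotopy is defined on graphs that carry a list of marked vertices; a
  mark is added by averaging over all unmarked external vertices, which needs rational coefficients,
  and is removed after use. Moreover, blowing up undoes a contraction only up to a change of label,
  so the homotopy identities are congruences modulo the span of the orientation relations, and the
  arguments on graphs never mention quotients. The new vertex and edge are inserted at the last
  admissible positions: then every relabeling of a graph lifts to its blow-up, and the sign of
  contracting the new edge depends only on counts that relabeling preserves. Contractions and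
  blow-ups preserve the presence of double edges or loops, so one argument with a flag
  \<open>dl\<close> serves both complexes of plain graphs. That the differential respects the Arnold
  relations is not computed but deduced from the vanishing of its square, once these relations are
  known to be boundaries.\<close>

abbreviation keys :: "('a \<Rightarrow>\<^sub>0 rat) \<Rightarrow> 'a set" where "keys \<equiv> Poly_Mapping.keys"
abbreviation single :: "'a \<Rightarrow> rat \<Rightarrow> ('a \<Rightarrow>\<^sub>0 rat)" where "single \<equiv> Poly_Mapping.single"
abbreviation lookup :: "('a \<Rightarrow>\<^sub>0 rat) \<Rightarrow> 'a \<Rightarrow> rat" where "lookup \<equiv> Poly_Mapping.lookup"
abbreviation kind_at :: "lgraph \<Rightarrow> nat \<Rightarrow> edge_kind" where "kind_at G l \<equiv> ekind (edges G ! l)"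
abbreviation ends_at :: "lgraph \<Rightarrow> nat \<Rightarrow> nat set" where "ends_at G l \<equiv> ends (edges G ! l)"
abbreviation src_at :: "lgraph \<Rightarrow> nat \<Rightarrow> nat" where "src_at G l \<equiv> src (edges G ! l)"
abbreviation tgt_at :: "lgraph \<Rightarrow> nat \<Rightarrow> nat" where "tgt_at G l \<equiv> tgt (edges G ! l)"
abbreviation vkind :: "lgraph \<Rightarrow> nat \<Rightarrow> vertex_kind" where "vkind G v \<equiv> vkinds G ! v"

section \<open>Linear algebra of formal combinations\<close>

lemma lookup_scale_rat [simp]: "lookup (scale_rat c x) g = c * lookup x g"
  unfolding scale_rat_def by transfer (auto simp: when_def)

interpretation rv: vector_space scale_rat
  by unfold_locales (auto intro!: poly_mapping_eqI simp: lookup_add algebra_simps)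

abbreviation lin :: "('a \<Rightarrow> ('b \<Rightarrow>\<^sub>0 rat)) \<Rightarrow> ('a \<Rightarrow>\<^sub>0 rat) \<Rightarrow> ('b \<Rightarrow>\<^sub>0 rat)"
  where "lin \<equiv> linear_extension"

abbreviation bv :: "'a \<Rightarrow> ('a \<Rightarrow>\<^sub>0 rat)"
  where "bv g \<equiv> single g 1"

lemma rat_span_eq: "rat_span R = rv.span R" by (simp add: rat_span_def)

lemma span_cong: "x - y \<in> rv.span R \<Longrightarrow> x \<in> rv.span R \<longleftrightarrow> y \<in> rv.span R"
  using rv.span_add[of "x - y" R y] rv.span_diff[of x R "x - y"] by auto

lemma scale_single [simp]: "scale_rat c (single g d) = single g (c * d)"
  by (rule poly_mapping_eqI) (simp add: lookup_single when_def)

lemma keys_scale_subset: "keys (scale_rat c x) \<subseteq> keys x" by (auto simp: in_keys_iff)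

lemma keys_diff_subset:
  "keys (x - y :: 'a \<Rightarrow>\<^sub>0 rat) \<subseteq> keys x \<union> keys y"
  by (auto simp: in_keys_iff lookup_minus)

lemma keys_sum_subset:
  "keys (\<Sum>i\<in>I. f i :: 'a \<Rightarrow>\<^sub>0 rat) \<subseteq> (\<Union>i\<in>I. keys (f i))"
proof (cases "finite I")
  case True
  thus ?thesis by (induction I) (use keys_add in fastforce)+
qed simp

lemma lin_superset:
  assumes "finite A" "keys x \<subseteq> A"
  shows "lin F x = (\<Sum>g\<in>A. scale_rat (lookup x g) (F g))" unfolding linear_extension_def
  by (rule sum.mono_neutral_left) (use assms in "auto simp: in_keys_iff")

lemma lin_add: "lin F (x + y) = lin F x + lin F y"
proof -
  let ?A = "keys x \<union> keys y"
  have "lin F (x + y) = (\<Sum>g\<in>?A. scale_rat (lookup (x + y) g) (F g))"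
    by (rule lin_superset) (auto simp: keys_add)
  also have "\<dots> = (\<Sum>g\<in>?A. scale_rat (lookup x g) (F g))
      + (\<Sum>g\<in>?A. scale_rat (lookup y g) (F g))"
    by (simp add: lookup_add rv.scale_left_distrib sum.distrib)
  also have "\<dots> = lin F x + lin F y" by (simp add: lin_superset[of ?A x] lin_superset[of ?A y])
  finally show ?thesis .
qed

lemma lin_scale: "lin F (scale_rat c x) = scale_rat c (lin F x)"
proof -
  have "lin F (scale_rat c x) =
      (\<Sum>g\<in>keys x. scale_rat (lookup (scale_rat c x) g) (F g))"
    by (rule lin_superset) (auto simp: keys_scale_subset)
  thus ?thesis by (simp add: linear_extension_def rv.scale_sum_right)
qed

lemma lin_zero [simp]: "lin F 0 = 0" by (simp add: linear_extension_def)

lemma lin_diff: "lin F (x - y) = lin F x - lin F y" using lin_add[of F "x - y" y] by simp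

lemma lin_sum: "lin F (\<Sum>i\<in>I. f i) = (\<Sum>i\<in>I. lin F (f i))"
  by (induction I rule: infinite_finite_induct) (auto simp: lin_add)

lemma lin_single [simp]: "lin F (single g c) = scale_rat c (F g)"
  by (cases "c = 0") (auto simp: linear_extension_def)

lemma lin_cong: "(\<And>g. g \<in> keys x \<Longrightarrow> F g = G g) \<Longrightarrow> lin F x = lin G x"
  unfolding linear_extension_def by (rule sum.cong) auto

lemma lin_bv [simp]: "lin bv x = x"
proof (rule poly_mapping_eqI)
  fix g
  have "lookup (lin bv x) g =
      (\<Sum>h\<in>keys x. if h = g then lookup x g else 0)" unfolding linear_extension_def
    by (simp only: lookup_sum) (rule sum.cong, auto simp: lookup_single)
  thus "lookup (lin bv x) g = lookup x g" by (simp add: in_keys_iff)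
qed

lemma lin_lin: "lin G (lin F x) = lin (\<lambda>g. lin G (F g)) x"
  by (simp add: linear_extension_def[of F] linear_extension_def[of "\<lambda>g. lin G (F g)"]
      lin_sum lin_scale)

lemma lin_fun_diff: "lin (\<lambda>g. F g - G g) x = lin F x - lin G x"
  by (simp add: linear_extension_def rv.scale_right_diff_distrib sum_subtractf)

lemma lin_in_span:
  assumes "\<And>g. g \<in> keys x \<Longrightarrow> F g \<in> rv.span W"
  shows "lin F x \<in> rv.span W" unfolding linear_extension_def by (intro rv.span_sum rv.span_scale assms)

lemma lin_span_image:
  assumes "\<And>r. r \<in> R \<Longrightarrow> lin F r \<in> rv.span W" and "x \<in> rv.span R"
  shows "lin F x \<in> rv.span W" using assms(2) by (induction rule: rv.span_induct_alt)
    (auto simp: lin_add lin_scale rv.span_zero intro!: rv.span_add rv.span_scale assms(1))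

lemma lin_diff_in_span:
  assumes "\<And>g. g \<in> keys x \<Longrightarrow> F g - G g \<in> rv.span W"
  shows "lin F x - lin G x \<in> rv.span W"
  unfolding lin_fun_diff[symmetric] by (rule lin_in_span) (rule assms)

lemma keys_lin_subset:
  "keys (lin F x) \<subseteq> (\<Union>g\<in>keys x. keys (F g))"
  unfolding linear_extension_def using keys_sum_subset keys_scale_subset by fastforce

lemma keys_span_subset:
  assumes "\<And>r. r \<in> R \<Longrightarrow> keys r \<subseteq> S" "x \<in> rv.span R"
  shows "keys x \<subseteq> S" using assms(2)
proof (induction rule: rv.span_induct_alt)
  case (step c r y)
  thus ?case using keys_add[of "scale_rat c r" y] keys_scale_subset[of c r] assms(1) by blast
qed simp

text \<open>Projection onto the coordinates with property \<open>P\<close>. It serves to pick out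
  the part of a given degree, of a given number of external vertices, or without internal
  vertices.\<close>

definition restrict_to :: "('a \<Rightarrow> bool) \<Rightarrow> ('a \<Rightarrow>\<^sub>0 rat) \<Rightarrow> ('a \<Rightarrow>\<^sub>0 rat)"
  where "restrict_to P = lin (\<lambda>g. if P g then bv g else 0)"

lemma lookup_restrict_to:
  "lookup (restrict_to P x) g = (if P g then lookup x g else 0)"
proof -
  have "lookup (restrict_to P x) g =
      (\<Sum>h\<in>keys x. if h = g then (if P g then lookup x g else 0) else 0)"
    unfolding linear_extension_def restrict_to_def
    by (simp only: lookup_sum) (rule sum.cong, auto simp: lookup_single)
  thus ?thesis by (simp add: in_keys_iff)
qed

lemma keys_restrict_to: "keys (restrict_to P x) = {g \<in> keys x. P g}"
  by (auto simp: in_keys_iff lookup_restrict_to split: if_splits)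

lemma restrict_to_add: "restrict_to P (x + y) = restrict_to P x + restrict_to P y"
  and restrict_to_diff: "restrict_to P (x - y) = restrict_to P x - restrict_to P y"
  and restrict_to_scale: "restrict_to P (scale_rat c x) = scale_rat c (restrict_to P x)"
  by (simp_all add: restrict_to_def lin_add lin_diff lin_scale)

lemma restrict_to_id: "(\<And>g. g \<in> keys x \<Longrightarrow> P g) \<Longrightarrow> restrict_to P x = x"
  by (rule poly_mapping_eqI) (auto simp: lookup_restrict_to in_keys_iff)

lemma restrict_to_zero: "(\<And>g. g \<in> keys x \<Longrightarrow> \<not> P g) \<Longrightarrow> restrict_to P x = 0"
  by (rule poly_mapping_eqI) (auto simp: lookup_restrict_to in_keys_iff)

section \<open>Surjective cochain maps with acyclic kernel\<close>

lemma comm_group_imp_group: "comm_group G \<Longrightarrow> group G" by (rule comm_group.axioms)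

lemma comm_group_subgroup:
  assumes "comm_group G" "subgroup H G"
  shows "comm_group (G\<lparr>carrier := H\<rparr>)"
proof -
  interpret comm_group G by fact
  show ?thesis by (rule group.group_comm_groupI[OF subgroup.subgroup_is_group[OF assms(2) group_axioms]])
      (use m_comm subgroup.mem_carrier[OF assms(2)] in auto)
qed

lemma (in group) rcosets_eq_iff:
  assumes "subgroup H G" "x \<in> carrier G" "y \<in> carrier G"
  shows "H #> x = H #> y \<longleftrightarrow> x \<otimes> inv y \<in> H"
proof
  assume "H #> x = H #> y"
  hence "x \<in> H #> y" using assms rcos_self by blast
  then obtain h where "h \<in> H" "x = h \<otimes> y" by (auto simp: r_coset_def)
  thus "x \<otimes> inv y \<in> H" using assms by (simp add: subgroup.mem_carrier m_assoc)
next
  assume h: "x \<otimes> inv y \<in> H"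
  have "x = (x \<otimes> inv y) \<otimes> y" using assms by (simp add: m_assoc)
  hence "x \<in> H #> y" using h by (auto simp: r_coset_def)
  thus "H #> x = H #> y" using repr_independence assms by blast
qed

lemma induced_map_coset:
  assumes "group H" "subgroup B G" "subgroup N H" "group G" "f \<in> hom G H" "f ` B \<subseteq> N" "x \<in> carrier G"
  shows "induced_map H N f (B #>\<^bsub>G\<^esub> x) = N #>\<^bsub>H\<^esub> f x"
proof -
  interpret G: group G by fact
  interpret H: group H by fact
  have fx: "f x \<in> carrier H" using assms by (auto simp: hom_def)
  have NN: "m \<otimes>\<^bsub>H\<^esub> n \<in> N" if "m \<in> N" "n \<in> N" for m n
    using that assms(3) by (simp add: subgroup.m_closed)
  have one: "\<one>\<^bsub>G\<^esub> \<in> B" "f \<one>\<^bsub>G\<^esub> = \<one>\<^bsub>H\<^esub>"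
    using assms by (auto simp: subgroup.one_closed hom_one)
  have im: "f ` (B #>\<^bsub>G\<^esub> x) = (\<lambda>b. f b \<otimes>\<^bsub>H\<^esub> f x) ` B"
    using assms(5,7) subgroup.mem_carrier[OF assms(2)] by (fastforce simp: r_coset_def hom_mult image_iff)
  show ?thesis
  proof (intro equalityI subsetI)
    fix z assume "z \<in> induced_map H N f (B #>\<^bsub>G\<^esub> x)"
    then obtain m b where mb: "m \<in> N" "b \<in> B" "z = m \<otimes>\<^bsub>H\<^esub> (f b \<otimes>\<^bsub>H\<^esub> f x)"
      unfolding induced_map_def im set_mult_def by auto
    hence "z = (m \<otimes>\<^bsub>H\<^esub> f b) \<otimes>\<^bsub>H\<^esub> f x"
      using fx assms(3,6) subgroup.mem_carrier[OF assms(3)] by (subst H.m_assoc) auto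
    moreover have "m \<otimes>\<^bsub>H\<^esub> f b \<in> N" using mb NN assms(6) by blast
    ultimately show "z \<in> N #>\<^bsub>H\<^esub> f x" by (auto simp: r_coset_def)
  next
    fix z assume "z \<in> N #>\<^bsub>H\<^esub> f x"
    then obtain m where m: "m \<in> N" "z = m \<otimes>\<^bsub>H\<^esub> f x" by (auto simp: r_coset_def)
    hence "z = m \<otimes>\<^bsub>H\<^esub> (f \<one>\<^bsub>G\<^esub> \<otimes>\<^bsub>H\<^esub> f x)"
      using one fx by simp
    thus "z \<in> induced_map H N f (B #>\<^bsub>G\<^esub> x)"
      unfolding induced_map_def im set_mult_def using m(1) one(1) by auto
  qed
qed

lemma induced_map_iso:
  assumes Z: "comm_group Z" "subgroup B Z" and Z': "comm_group Z'" "subgroup B' Z'"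
    and f: "f \<in> hom Z Z'" "f ` B \<subseteq> B'"
    and inj: "\<And>x. x \<in> carrier Z \<Longrightarrow> f x \<in> B' \<Longrightarrow> x \<in> B"
    and surj: "\<And>y. y \<in> carrier Z' \<Longrightarrow> \<exists>x\<in>carrier Z. y \<otimes>\<^bsub>Z'\<^esub> inv\<^bsub>Z'\<^esub> f x \<in> B'"
  shows "induced_map Z' B' f \<in> iso (Z Mod B) (Z' Mod B')"
proof -
  interpret Z: comm_group Z by fact
  interpret Z': comm_group Z' by fact
  interpret f: group_hom Z Z' f by unfold_locales (use f in auto)
  have nB: "B \<lhd> Z" and nB': "B' \<lhd> Z'"
    using Z(2) Z'(2) Z.normal_iff_subgroup Z'.normal_iff_subgroup by auto
  interpret nB: normal B Z by fact
  interpret nB': normal B' Z' by fact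
  have ind: "induced_map Z' B' f (B #>\<^bsub>Z\<^esub> x) = B' #>\<^bsub>Z'\<^esub> f x" if "x \<in> carrier Z" for x
    using that f Z(2) Z'(2) by (intro induced_map_coset) (auto intro: Z.group_axioms Z'.group_axioms)
  have hom: "induced_map Z' B' f \<in> hom (Z Mod B) (Z' Mod B')"
    by (rule homI) (auto simp: FactGroup_def RCOSETS_def ind nB.rcos_sum nB'.rcos_sum)
  have "inj_on (induced_map Z' B' f) (carrier (Z Mod B))"
  proof (rule inj_onI)
    fix X Y assume XY: "X \<in> carrier (Z Mod B)" "Y \<in> carrier (Z Mod B)"
      and eq: "induced_map Z' B' f X = induced_map Z' B' f Y"
    then obtain x y where xy: "x \<in> carrier Z" "y \<in> carrier Z" "X = B #>\<^bsub>Z\<^esub> x" "Y = B #>\<^bsub>Z\<^esub> y"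
      by (auto simp: FactGroup_def RCOSETS_def)
    with eq have "B' #>\<^bsub>Z'\<^esub> f x = B' #>\<^bsub>Z'\<^esub> f y" by (simp add: ind)
    hence "f x \<otimes>\<^bsub>Z'\<^esub> inv\<^bsub>Z'\<^esub> f y \<in> B'"
      using Z'.rcosets_eq_iff[OF Z'(2)] xy by auto
    hence "f (x \<otimes>\<^bsub>Z\<^esub> inv\<^bsub>Z\<^esub> y) \<in> B'" using xy by simp
    hence "x \<otimes>\<^bsub>Z\<^esub> inv\<^bsub>Z\<^esub> y \<in> B" using inj xy by simp
    thus "X = Y" using Z.rcosets_eq_iff[OF Z(2)] xy by auto
  qed
  moreover have "induced_map Z' B' f ` carrier (Z Mod B) = carrier (Z' Mod B')"
  proof
    show "induced_map Z' B' f ` carrier (Z Mod B) \<subseteq> carrier (Z' Mod B')"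
      using hom by (auto simp: hom_def)
    show "carrier (Z' Mod B') \<subseteq> induced_map Z' B' f ` carrier (Z Mod B)"
    proof
      fix Y assume "Y \<in> carrier (Z' Mod B')"
      then obtain y where y: "y \<in> carrier Z'" "Y = B' #>\<^bsub>Z'\<^esub> y"
        by (auto simp: FactGroup_def RCOSETS_def)
      then obtain x where x: "x \<in> carrier Z" "y \<otimes>\<^bsub>Z'\<^esub> inv\<^bsub>Z'\<^esub> f x \<in> B'"
        using surj by blast
      hence "Y = induced_map Z' B' f (B #>\<^bsub>Z\<^esub> x)"
        using Z'.rcosets_eq_iff[OF Z'(2)] y by (auto simp: ind)
      moreover have "B #>\<^bsub>Z\<^esub> x \<in> carrier (Z Mod B)"
        using x by (auto simp: FactGroup_def RCOSETS_def)
      ultimately show "Y \<in> induced_map Z' B' f ` carrier (Z Mod B)" by blast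
    qed
  qed
  ultimately show ?thesis using hom by (auto simp: iso_def bij_betw_def)
qed

lemma cochain_complex_facts:
  assumes "cochain_complex C d"
  shows "comm_group (C k)" "group_hom (C k) (C (k + 1)) (d k)" "comm_group (cocycle_group C d k)"
    and "subgroup (coboundaries C d k) (cocycle_group C d k)"
    and "y \<in> carrier (cocycle_group C d k) \<Longrightarrow> inv\<^bsub>cocycle_group C d k\<^esub> y = inv\<^bsub>C k\<^esub> y"
proof -
  show gC: "comm_group (C k)" for k using assms by (simp add: cochain_complex_def)
  have ddC: "x \<in> carrier (C k) \<Longrightarrow> d (k + 1) (d k x) = \<one>\<^bsub>C (k + 2)\<^esub>" for k x
    using assms by (auto simp: cochain_complex_def)
  show gh: "group_hom (C k) (C (k + 1)) (d k)" for k
    using comm_group_imp_group[OF gC] assms by (auto simp: group_hom_def group_hom_axioms_def cochain_complex_def)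
  have ker: "subgroup (kernel (C k) (C (k + 1)) (d k)) (C k)" by (rule group_hom.subgroup_kernel[OF gh])
  have im: "subgroup (coboundaries C d k) (C k)"
    using group_hom.img_is_subgroup[OF gh[of "k - 1"]] by (simp add: coboundaries_def)
  have "coboundaries C d k \<subseteq> kernel (C k) (C (k + 1)) (d k)"
    using ddC[of _ "k - 1"] subgroup.subset[OF im] by (auto simp: coboundaries_def kernel_def add.commute)
  thus "subgroup (coboundaries C d k) (cocycle_group C d k)"
    unfolding cocycle_group_def by (intro group.subgroup_incl[OF comm_group_imp_group[OF gC] im ker])
  show "comm_group (cocycle_group C d k)"
    unfolding cocycle_group_def by (rule comm_group_subgroup[OF gC ker])
  show "y \<in> carrier (cocycle_group C d k) \<Longrightarrow> inv\<^bsub>cocycle_group C d k\<^esub> y = inv\<^bsub>C k\<^esub> y"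
    unfolding cocycle_group_def using ker comm_group_imp_group[OF gC] by (intro group.m_inv_consistent) auto
qed

text \<open>The long exact sequence in elementary form: whatever goes wrong when a cocycle or a
  primitive is lifted along \<open>f\<close> lies in the kernel of \<open>f\<close> and is closed
  there, so \<open>acyc\<close> removes it.\<close>

theorem quasi_isomorphismI:
  assumes C: "cochain_complex C d" and C': "cochain_complex C' d'" and f: "cochain_map C d C' d' f"
    and surj: "\<And>k. carrier (C' k) \<subseteq> f k ` carrier (C k)"
    and acyc: "\<And>k x. \<lbrakk>x \<in> carrier (C (k + 1)); f (k + 1) x = \<one>\<^bsub>C' (k + 1)\<^esub>; d (k + 1) x = \<one>\<^bsub>C (k + 2)\<^esub>\<rbrakk>
        \<Longrightarrow> \<exists>y\<in>carrier (C k). f k y = \<one>\<^bsub>C' k\<^esub> \<and> d k y = x"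
  shows "quasi_isomorphism C d C' d' f"
proof -
  note gC = cochain_complex_facts(1)[OF C] and ghd = cochain_complex_facts(2)[OF C]
  have ddC: "x \<in> carrier (C k) \<Longrightarrow> d (k + 1) (d k x) = \<one>\<^bsub>C (k + 2)\<^esub>" for k x
    using C by (auto simp: cochain_complex_def)
  have fd: "x \<in> carrier (C k) \<Longrightarrow> f (k + 1) (d k x) = d' k (f k x)" for k x
    using f by (auto simp: cochain_map_def)
  have ghf: "group_hom (C k) (C' k) (f k)" for k
    using f comm_group_imp_group[OF gC] comm_group_imp_group[OF cochain_complex_facts(1)[OF C']]
    by (auto simp: group_hom_def group_hom_axioms_def cochain_map_def)
  have cocycle: "x \<in> carrier (cocycle_group D e k) \<longleftrightarrow> x \<in> carrier (D k) \<and> e k x = \<one>\<^bsub>D (k + 1)\<^esub>"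
    for D :: "int \<Rightarrow> 'c monoid" and e x k by (simp add: cocycle_group_def kernel_def)
  have "induced_map (cocycle_group C' d' k) (coboundaries C' d' k) (f k)
           \<in> iso (cohomology_group C d k) (cohomology_group C' d' k)" for k
    unfolding cohomology_group_def
  proof (rule induced_map_iso)
    interpret c: comm_group "C k" by (rule gC)
    interpret c': comm_group "C' k" by (rule cochain_complex_facts(1)[OF C'])
    interpret d: group_hom "C k" "C (k + 1)" "d k" by (rule ghd)
    interpret f: group_hom "C k" "C' k" "f k" by (rule ghf)
    have km: "k - 1 + 1 = k" "k - 1 + 2 = k + 1" by auto
    show "comm_group (cocycle_group C d k)" "subgroup (coboundaries C d k) (cocycle_group C d k)"
      "comm_group (cocycle_group C' d' k)" "subgroup (coboundaries C' d' k) (cocycle_group C' d' k)"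
      by (fact cochain_complex_facts(3,4)[OF C] cochain_complex_facts(3,4)[OF C'])+
    show "f k \<in> hom (cocycle_group C d k) (cocycle_group C' d' k)"
      using group_hom.hom_one[OF ghf[of "k + 1"]]
      by (intro homI) (auto simp: cocycle simp flip: fd, auto simp: cocycle_group_def kernel_def)
    show "f k ` coboundaries C d k \<subseteq> coboundaries C' d' k"
      using fd[of _ "k - 1"] group_hom.hom_closed[OF ghf[of "k - 1"]] by (auto simp: coboundaries_def)
    show "x \<in> coboundaries C d k" if x: "x \<in> carrier (cocycle_group C d k)" and fx: "f k x \<in> coboundaries C' d' k" for x
    proof -
      \<comment> \<open>The difference of \<open>x\<close> and the coboundary of \<open>y\<close> is
        a cocycle in the kernel of \<open>f\<close>, hence the coboundary of some \<open>u\<close>;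
        the product of \<open>u\<close> and \<open>y\<close> is then a primitive of
        \<open>x\<close>.\<close>
      obtain y where y: "y \<in> carrier (C (k - 1))" "f k x = d' (k - 1) (f (k - 1) y)"
        using fx surj[of "k - 1"] by (fastforce simp: coboundaries_def)
      let ?dy = "d (k - 1) y"
      have dy: "?dy \<in> carrier (C k)" "d k ?dy = \<one>\<^bsub>C (k + 1)\<^esub>" "f k ?dy = f k x"
        using group_hom.hom_closed[OF ghd[of "k - 1"]] ddC[of y "k - 1"] fd[of y "k - 1"] y km by simp_all
      note x = x[unfolded cocycle]
      obtain u where u: "u \<in> carrier (C (k - 1))" "d (k - 1) u = x \<otimes>\<^bsub>C k\<^esub> inv\<^bsub>C k\<^esub> ?dy"
        using acyc[of "x \<otimes>\<^bsub>C k\<^esub> inv\<^bsub>C k\<^esub> ?dy" "k - 1"] x dy km by auto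
      have "d (k - 1) (u \<otimes>\<^bsub>C (k - 1)\<^esub> y) = x"
        using u y x dy group_hom.hom_mult[OF ghd[of "k - 1"]] by (simp add: c.m_assoc)
      thus ?thesis using monoid.m_closed[OF group.is_monoid[OF comm_group_imp_group[OF gC]]] u y
        by (auto simp: coboundaries_def intro!: image_eqI)
    qed
    show "\<exists>x\<in>carrier (cocycle_group C d k). y \<otimes>\<^bsub>cocycle_group C' d' k\<^esub> inv\<^bsub>cocycle_group C' d' k\<^esub> f k x \<in> coboundaries C' d' k"
      if y: "y \<in> carrier (cocycle_group C' d' k)" for y
    proof -
      note yC = y[unfolded cocycle]
      obtain x where x: "x \<in> carrier (C k)" "f k x = y" using yC surj[of k] by auto
      \<comment> \<open>The lift \<open>x\<close> of the cocycle need not be closed, but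
        \<open>d k x\<close> lies in the kernel of \<open>f\<close>. Dividing by \<open>z\<close>
        makes the lift closed without changing its image.\<close>
      obtain z where z: "z \<in> carrier (C k)" "f k z = \<one>\<^bsub>C' k\<^esub>" "d k z = d k x"
        using acyc[of "d k x" k] fd[OF x(1)] ddC[OF x(1)] x yC by auto
      let ?x = "x \<otimes>\<^bsub>C k\<^esub> inv\<^bsub>C k\<^esub> z"
      have fx: "f k ?x = y" and xc: "?x \<in> carrier (cocycle_group C d k)"
        using x z yC by (simp_all add: cocycle)
      have "y \<otimes>\<^bsub>cocycle_group C' d' k\<^esub> inv\<^bsub>cocycle_group C' d' k\<^esub> f k ?x = \<one>\<^bsub>C' k\<^esub>"
        unfolding fx cochain_complex_facts(5)[OF C' y] using yC by (simp add: cocycle_group_def)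
      moreover have "\<one>\<^bsub>C' k\<^esub> \<in> coboundaries C' d' k"
        using subgroup.one_closed[OF cochain_complex_facts(4)[OF C', of k]] by (simp add: cocycle_group_def)
      ultimately show ?thesis using xc by (intro bexI[of _ ?x]) simp_all
    qed
  qed
  thus ?thesis using C C' f by (auto simp: quasi_isomorphism_def)
qed


section \<open>Complexes given by generators and relations\<close>

abbreviation span_coset :: "('a \<Rightarrow>\<^sub>0 rat) set \<Rightarrow> ('a \<Rightarrow>\<^sub>0 rat) \<Rightarrow> ('a \<Rightarrow>\<^sub>0 rat) set"
  where "span_coset R x \<equiv> (\<lambda>r. r + x) ` rv.span R"

lemma free_rat_simps [simp]:
  "carrier (free_rat S) = {x. keys x \<subseteq> S}"
  "x \<otimes>\<^bsub>free_rat S\<^esub> y = x + y" "\<one>\<^bsub>free_rat S\<^esub> = 0"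
  by (simp_all add: free_rat_def)

lemma comm_group_free_rat: "comm_group (free_rat S)"
proof (rule comm_groupI)
  show "x \<otimes>\<^bsub>free_rat S\<^esub> y \<in> carrier (free_rat S)"
    if "x \<in> carrier (free_rat S)" "y \<in> carrier (free_rat S)" for x y
    using that keys_add[of x y] by auto
  show "\<exists>y\<in>carrier (free_rat S). y \<otimes>\<^bsub>free_rat S\<^esub> x = \<one>\<^bsub>free_rat S\<^esub>"
    if "x \<in> carrier (free_rat S)" for x using that by (intro bexI[of _ "- x"]) auto
qed (auto simp: algebra_simps)

lemma inv_free_rat: "x \<in> carrier (free_rat S) \<Longrightarrow> inv\<^bsub>free_rat S\<^esub> x = - x"
  by (rule group.inv_equality[OF comm_group_imp_group[OF comm_group_free_rat]]) auto

lemma subgroup_span: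
  assumes "\<And>r. r \<in> R \<Longrightarrow> keys r \<subseteq> S"
  shows "subgroup (rv.span R) (free_rat S)" using keys_span_subset[OF assms, of R]
  by (unfold_locales) (auto simp: inv_free_rat rv.span_zero intro: rv.span_add rv.span_neg)

lemma span_coset_eq_iff: "span_coset R x = span_coset R y \<longleftrightarrow> x - y \<in> rv.span R"
proof
  assume "span_coset R x = span_coset R y"
  moreover have "x \<in> span_coset R x" by (auto intro!: image_eqI[of _ _ 0] simp: rv.span_zero)
  ultimately obtain r where "r \<in> rv.span R" "x = r + y" by auto
  thus "x - y \<in> rv.span R" by simp
next
  assume xy: "x - y \<in> rv.span R"
  have "span_coset R x \<subseteq> span_coset R y" if "x - y \<in> rv.span R" for x y :: "'a \<Rightarrow>\<^sub>0 rat"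
    using that rv.span_add by (fastforce intro!: image_eqI[of _ _ "_ + (x - y)"])
  from this[OF xy] this[of y x] show "span_coset R x = span_coset R y" using xy rv.span_neg[OF xy] by auto
qed

lemma r_coset_free_rat: "rv.span R #>\<^bsub>free_rat S\<^esub> x = span_coset R x"
  by (auto simp: r_coset_def)

lemma carrier_presented:
  "carrier (presented S R) = span_coset R ` {x. keys x \<subseteq> S}"
  by (auto simp: presented_def FactGroup_def RCOSETS_def rat_span_eq r_coset_free_rat)

lemma one_presented: "\<one>\<^bsub>presented S R\<^esub> = span_coset R 0"
  by (simp add: presented_def FactGroup_def rat_span_eq)

lemma span_coset_eq_one: "span_coset R x = \<one>\<^bsub>presented S R\<^esub> \<longleftrightarrow> x \<in> rv.span R"
  unfolding one_presented span_coset_eq_iff by simp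

lemma mult_presented:
  "span_coset R x \<otimes>\<^bsub>presented S R\<^esub> span_coset R y = span_coset R (x + y)"
proof -
  have "(\<exists>a\<in>rv.span R. \<exists>b\<in>rv.span R. z = a + x + (b + y)) \<longleftrightarrow> (\<exists>a\<in>rv.span R. z = a + (x + y))"
    for z
  proof
    assume "\<exists>a\<in>rv.span R. \<exists>b\<in>rv.span R. z = a + x + (b + y)"
    then obtain a b where "a \<in> rv.span R" "b \<in> rv.span R" "z = a + x + (b + y)" by blast
    thus "\<exists>a\<in>rv.span R. z = a + (x + y)"
      by (intro bexI[of _ "a + b"]) (auto simp: rv.span_add algebra_simps)
  next
    assume "\<exists>a\<in>rv.span R. z = a + (x + y)"
    then obtain a where "a \<in> rv.span R" "z = a + (x + y)" by blast
    thus "\<exists>a\<in>rv.span R. \<exists>b\<in>rv.span R. z = a + x + (b + y)"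
      by (intro bexI[of _ a] bexI[of _ 0]) (auto simp: rv.span_zero algebra_simps)
  qed
  thus ?thesis unfolding presented_def FactGroup_def rat_span_eq set_mult_def
    by (simp add: set_eq_iff image_iff)
qed

lemma comm_group_presented:
  assumes "\<And>r. r \<in> R \<Longrightarrow> keys r \<subseteq> S"
  shows "comm_group (presented S R)" unfolding presented_def rat_span_eq
  by (rule comm_group.abelian_FactGroup[OF comm_group_free_rat subgroup_span[OF assms]])

lemma presented_map_coset:
  assumes "\<forall>r\<in>R. lin F r \<in> rv.span R'"
  shows "presented_map S' R' F (span_coset R x) = span_coset R' (lin F x)"
proof -
  have *: "lin F r \<in> rv.span R'" if "r \<in> rv.span R" for r
    by (rule lin_span_image[OF _ that]) (use assms in auto)
  show ?thesis
  proof (intro equalityI subsetI)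
    fix z assume "z \<in> presented_map S' R' F (span_coset R x)"
    then obtain a r where "a \<in> rv.span R'" "r \<in> rv.span R" "z = a + lin F (r + x)"
      by (auto simp: presented_map_def induced_map_def set_mult_def rat_span_eq)
    thus "z \<in> span_coset R' (lin F x)"
      using * by (auto simp: lin_add algebra_simps intro!: image_eqI[of _ _ "a + lin F r"] rv.span_add)
  next
    fix z assume "z \<in> span_coset R' (lin F x)"
    then obtain a where "a \<in> rv.span R'" "z = a + lin F (0 + x)" by auto
    moreover have "0 \<in> rv.span R" by (rule rv.span_zero)
    ultimately show "z \<in> presented_map S' R' F (span_coset R x)"
      unfolding presented_map_def induced_map_def set_mult_def rat_span_eq by (simp del: add_0) blast
  qed
qed

text \<open>The map \<open>D\<close> is given on generators only. These conditions make it descend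
  to the quotients with square zero: relations go into the span of relations, and applying
  \<open>D\<close> twice lands in that span without having to vanish.\<close>

definition presented_complex :: "(int \<Rightarrow> 'a set) \<Rightarrow> (int \<Rightarrow> ('a \<Rightarrow>\<^sub>0 rat) set) \<Rightarrow> ('a \<Rightarrow> ('a \<Rightarrow>\<^sub>0 rat)) \<Rightarrow> bool"
  where "presented_complex S R D \<longleftrightarrow> (\<forall>k. (\<forall>r\<in>R k. keys r \<subseteq> S k \<and> lin D r \<in> rv.span (R (k + 1))) \<and>
    (\<forall>g\<in>S k. keys (D g) \<subseteq> S (k + 1) \<and> lin D (D g) \<in> rv.span (R (k + 2))))"

lemma presented_map_hom:
  assumes "\<And>g. g \<in> S \<Longrightarrow> keys (F g) \<subseteq> S'" "\<forall>r\<in>R. lin F r \<in> rv.span R'"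
  shows "presented_map S' R' F \<in> hom (presented S R) (presented S' R')"
proof (rule homI)
  fix X assume "X \<in> carrier (presented S R)"
  then obtain x where x: "keys x \<subseteq> S" "X = span_coset R x" by (auto simp: carrier_presented)
  have "keys (lin F x) \<subseteq> S'" using x(1) assms(1) keys_lin_subset[of F x] by blast
  thus "presented_map S' R' F X \<in> carrier (presented S' R')"
    unfolding x(2) presented_map_coset[OF assms(2)] carrier_presented by blast
qed (auto simp: carrier_presented mult_presented presented_map_coset[OF assms(2)] lin_add)

lemma cochain_complex_presented:
  assumes "presented_complex S R D"
  shows "cochain_complex (\<lambda>k. presented (S k) (R k)) (\<lambda>k. presented_map (S (k + 1)) (R (k + 1)) D)"
  unfolding cochain_complex_def
proof (intro allI conjI ballI)
  have DR: "\<forall>r\<in>R k. lin D r \<in> rv.span (R (k + 1))" for k using assms by (simp add: presented_complex_def)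
  fix k x assume "x \<in> carrier (presented (S k) (R k))"
  then obtain y where y: "keys y \<subseteq> S k" "x = span_coset (R k) y" by (auto simp: carrier_presented)
  have "lin D (lin D y) \<in> rv.span (R (k + 2))"
    unfolding lin_lin by (rule lin_in_span) (use y assms in "auto simp: presented_complex_def")
  thus "presented_map (S (k + 1 + 1)) (R (k + 1 + 1)) D
      (presented_map (S (k + 1)) (R (k + 1)) D x) = \<one>\<^bsub>presented (S (k + 2)) (R (k + 2))\<^esub>"
    unfolding y(2) presented_map_coset[OF DR] by (simp add: span_coset_eq_one add.assoc)
qed (use assms in "simp_all add: presented_complex_def comm_group_presented presented_map_hom")

text \<open>The last place where cosets occur: every hypothesis is a statement on formal
  combinations modulo a span, and this is the form in which the graph arguments deliver them. The
  generators of the target are among those of the source, and \<open>P\<close> fixes them up to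
  relations.\<close>

theorem presented_quasi_isomorphism:
  assumes C: "presented_complex S R D" and C': "presented_complex S' R' D'"
    and P: "\<And>k g. g \<in> S k \<Longrightarrow> keys (P g) \<subseteq> S' k"
    and PR: "\<And>k r. r \<in> R k \<Longrightarrow> lin P r \<in> rv.span (R' k)"
    and PD: "\<And>k g. g \<in> S k \<Longrightarrow> lin P (D g) - lin D' (P g) \<in> rv.span (R' (k + 1))"
    and surj: "\<And>k g. g \<in> S' k \<Longrightarrow> g \<in> S k \<and> bv g - P g \<in> rv.span (R' k)"
    and acyc: "\<And>k x. \<lbrakk>keys x \<subseteq> S (k + 1); lin P x \<in> rv.span (R' (k + 1));
        lin D x \<in> rv.span (R (k + 2))\<rbrakk>
      \<Longrightarrow> \<exists>y. keys y \<subseteq> S k \<and> lin P y \<in> rv.span (R' k) \<and> x - lin D y \<in> rv.span (R (k + 1))"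
  shows "quasi_isomorphism (\<lambda>k. presented (S k) (R k)) (\<lambda>k. presented_map (S (k + 1)) (R (k + 1)) D)
    (\<lambda>k. presented (S' k) (R' k)) (\<lambda>k. presented_map (S' (k + 1)) (R' (k + 1)) D')
    (\<lambda>k. presented_map (S' k) (R' k) P)"
proof (rule quasi_isomorphismI[OF cochain_complex_presented[OF C] cochain_complex_presented[OF C']])
  have DR: "\<forall>r\<in>R k. lin D r \<in> rv.span (R (k + 1))" and DR': "\<forall>r\<in>R' k. lin D' r \<in> rv.span (R' (k + 1))"
    and PR': "\<forall>r\<in>R k. lin P r \<in> rv.span (R' k)" for k
    using C C' PR by (auto simp: presented_complex_def)
  note coset = presented_map_coset[OF DR] presented_map_coset[OF DR'] presented_map_coset[OF PR']
  show "cochain_map (\<lambda>k. presented (S k) (R k)) (\<lambda>k. presented_map (S (k + 1)) (R (k + 1)) D)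
    (\<lambda>k. presented (S' k) (R' k)) (\<lambda>k. presented_map (S' (k + 1)) (R' (k + 1)) D')
    (\<lambda>k. presented_map (S' k) (R' k) P)" unfolding cochain_map_def
  proof (intro allI conjI ballI)
    show "presented_map (S' k) (R' k) P \<in> hom (presented (S k) (R k)) (presented (S' k) (R' k))" for k
      by (rule presented_map_hom) (fact P PR')+
    fix k x assume "x \<in> carrier (presented (S k) (R k))"
    then obtain y where y: "keys y \<subseteq> S k" "x = span_coset (R k) y"
      by (auto simp: carrier_presented)
    have "lin P (lin D y) - lin D' (lin P y) \<in> rv.span (R' (k + 1))"
      unfolding lin_lin by (rule lin_diff_in_span) (use y PD in auto)
    thus "presented_map (S' (k + 1)) (R' (k + 1)) P (presented_map (S (k + 1)) (R (k + 1)) D x)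
      = presented_map (S' (k + 1)) (R' (k + 1)) D' (presented_map (S' k) (R' k) P x)"
      unfolding y(2) coset by (simp add: span_coset_eq_iff)
  qed
  show "carrier (presented (S' k) (R' k)) \<subseteq> presented_map (S' k) (R' k) P ` carrier (presented (S k) (R k))" for k
  proof
    fix x assume "x \<in> carrier (presented (S' k) (R' k))"
    then obtain y where y: "keys y \<subseteq> S' k" "x = span_coset (R' k) y"
      by (auto simp: carrier_presented)
    have "lin bv y - lin P y \<in> rv.span (R' k)" by (rule lin_diff_in_span) (use y surj in blast)
    hence "x = presented_map (S' k) (R' k) P (span_coset (R k) y)"
      unfolding y(2) coset by (simp add: span_coset_eq_iff)
    moreover have "keys y \<subseteq> S k" using y(1) surj by blast
    ultimately show "x \<in> presented_map (S' k) (R' k) P ` carrier (presented (S k) (R k))"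
      by (simp add: carrier_presented)
  qed
  fix k x
  assume "x \<in> carrier (presented (S (k + 1)) (R (k + 1)))"
    and Px: "presented_map (S' (k + 1)) (R' (k + 1)) P x = \<one>\<^bsub>presented (S' (k + 1)) (R' (k + 1))\<^esub>"
    and Dx: "presented_map (S (k + 1 + 1)) (R (k + 1 + 1)) D x = \<one>\<^bsub>presented (S (k + 2)) (R (k + 2))\<^esub>"
  then obtain y where y: "keys y \<subseteq> S (k + 1)" "x = span_coset (R (k + 1)) y"
    by (auto simp: carrier_presented)
  have "lin P y \<in> rv.span (R' (k + 1))" "lin D y \<in> rv.span (R (k + 2))"
    using Px Dx unfolding y(2) coset by (simp_all add: span_coset_eq_one add.assoc)
  then obtain z where z: "keys z \<subseteq> S k" "lin P z \<in> rv.span (R' k)"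
    "y - lin D z \<in> rv.span (R (k + 1))" using acyc y by blast
  hence "presented_map (S' k) (R' k) P (span_coset (R k) z) = \<one>\<^bsub>presented (S' k) (R' k)\<^esub>"
    "presented_map (S (k + 1)) (R (k + 1)) D (span_coset (R k) z) = x"
    unfolding coset y(2) using rv.span_neg[OF z(3)] by (simp_all add: span_coset_eq_one span_coset_eq_iff)
  thus "\<exists>y\<in>carrier (presented (S k) (R k)).
      presented_map (S' k) (R' k) P y = \<one>\<^bsub>presented (S' k) (R' k)\<^esub> \<and>
      presented_map (S (k + 1)) (R (k + 1)) D y = x" using z(1) by (auto simp: carrier_presented)
qed

section \<open>Lists with one element removed or inserted\<close>

text \<open>Contraction deletes one entry of the vertex list and one of the edge list, blowing up
  inserts one entry in each. That they undo each other rests on \<open>del_ins_at\<close> and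
  \<open>ins_del_at\<close>.\<close>

definition del_at :: "nat \<Rightarrow> 'a list \<Rightarrow> 'a list"
  where "del_at i xs = take i xs @ drop (Suc i) xs"

definition ins_at :: "nat \<Rightarrow> 'a \<Rightarrow> 'a list \<Rightarrow> 'a list"
  where "ins_at i x xs = take i xs @ x # drop i xs"

lemma length_del_at [simp]: "i < length xs \<Longrightarrow> length (del_at i xs) = length xs - 1"
  by (simp add: del_at_def)

lemma length_ins_at [simp]: "length (ins_at i x xs) = Suc (length xs)" by (simp add: ins_at_def)

lemma nth_del_at: "i < length xs \<Longrightarrow> k < length xs - 1 \<Longrightarrow> del_at i xs ! k = (if k < i then xs ! k else xs ! Suc k)"
  by (auto simp: del_at_def nth_append min_def)

lemma nth_ins_at: "i \<le> length xs \<Longrightarrow> k \<le> length xs \<Longrightarrow>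
    ins_at i x xs ! k = (if k < i then xs ! k else if k = i then x else xs ! (k - 1))"
  by (auto simp: ins_at_def nth_append min_def nth_Cons' dest: less_antisym)

lemma map_del_at: "map f (del_at i xs) = del_at i (map f xs)" by (simp add: del_at_def take_map drop_map)

lemma map_ins_at: "map f (ins_at i x xs) = ins_at i (f x) (map f xs)"
  by (simp add: ins_at_def take_map drop_map)

lemma del_ins_at [simp]: "i \<le> length xs \<Longrightarrow> del_at i (ins_at i x xs) = xs"
  by (simp add: del_at_def ins_at_def min_def)

lemma ins_del_at: "i < length xs \<Longrightarrow> ins_at i (xs ! i) (del_at i xs) = xs"
  by (simp add: del_at_def ins_at_def min_def Cons_nth_drop_Suc)

lemma set_del_at: "i < length xs \<Longrightarrow> set xs = insert (xs ! i) (set (del_at i xs))"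
  by (metis id_take_nth_drop del_at_def list.simps(15) set_append Un_insert_right)

lemma set_del_at_subset: "set (del_at i xs) \<subseteq> set xs"
  by (auto simp: del_at_def dest: in_set_takeD in_set_dropD)

lemma set_ins_at [simp]: "i \<le> length xs \<Longrightarrow> set (ins_at i x xs) = insert x (set xs)"
  unfolding ins_at_def by (metis append_take_drop_id list.simps(15) set_append Un_insert_right)

lemma mset_del_at: "i < length xs \<Longrightarrow> mset xs = add_mset (xs ! i) (mset (del_at i xs))"
  by (drule id_take_nth_drop, drule arg_cong[of _ _ mset]) (simp add: del_at_def)

lemma mset_ins_at [simp]: "i \<le> length xs \<Longrightarrow> mset (ins_at i x xs) = add_mset x (mset xs)"
proof -
  have "mset (take i xs) + mset (drop i xs) = mset xs" by (simp flip: mset_append)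
  thus ?thesis by (simp add: ins_at_def)
qed

lemma sum_list_del_at: "i < length xs \<Longrightarrow> sum_list xs = xs ! i + sum_list (del_at i xs)"
  for xs :: "'a :: comm_monoid_add list" by (metis mset_del_at sum_mset.add_mset sum_mset_sum_list)

lemma sum_list_ins_at [simp]: "i \<le> length xs \<Longrightarrow> sum_list (ins_at i x xs) = x + sum_list xs"
  for xs :: "'a :: comm_monoid_add list" by (metis mset_ins_at sum_mset.add_mset sum_mset_sum_list)

lemma length_swap_adjacent [simp]: "length (swap_adjacent i xs) = length xs"
  by (simp add: swap_adjacent_def)

lemma nth_swap_adjacent: "Suc i < length xs \<Longrightarrow> k < length xs \<Longrightarrow> swap_adjacent i xs ! k = xs ! (transpose i (Suc i) k)"
  by (auto simp: swap_adjacent_def nth_list_update transpose_def)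

lemma mset_swap_adjacent [simp]: "Suc i < length xs \<Longrightarrow> mset (swap_adjacent i xs) = mset xs"
  unfolding swap_adjacent_def by (rule mset_swap) auto

lemma map_swap_adjacent: "Suc i < length xs \<Longrightarrow> map f (swap_adjacent i xs) = swap_adjacent i (map f xs)"
  by (simp add: swap_adjacent_def map_update)


section \<open>Half-edges\<close>

text \<open>The predicate is evaluated at the opposite end of a half-edge, and a loop counts twice.
  Thus one count yields the valence, the half-edges towards or away from marked vertices, and those
  towards internal vertices.\<close>

definition half_weight :: "edge_kind \<Rightarrow> (nat \<Rightarrow> bool) \<Rightarrow> nat \<Rightarrow> edge \<Rightarrow> nat"
  where "half_weight K P v e =
    (if ekind e = K then of_bool (src e = v \<and> P (tgt e)) + of_bool (tgt e = v \<and> P (src e)) else 0)"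

definition half_count :: "edge_kind \<Rightarrow> (nat \<Rightarrow> bool) \<Rightarrow> nat \<Rightarrow> edge list \<Rightarrow> nat"
  where "half_count K P v es = sum_list (map (half_weight K P v) es)"

abbreviation out_count :: "edge_kind \<Rightarrow> nat set \<Rightarrow> nat \<Rightarrow> edge list \<Rightarrow> nat"
  where "out_count K T \<equiv> half_count K (\<lambda>x. x \<notin> T)"

abbreviation in_count :: "edge_kind \<Rightarrow> nat set \<Rightarrow> nat \<Rightarrow> edge list \<Rightarrow> nat"
  where "in_count K T \<equiv> half_count K (\<lambda>x. x \<in> T)"

abbreviation valence :: "edge_kind \<Rightarrow> nat \<Rightarrow> edge list \<Rightarrow> nat"
  where "valence K \<equiv> half_count K (\<lambda>_. True)"

lemma half_edges_eq: "half_edges K G v = valence K v (edges G)"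
proof -
  have card: "card {i. i < length es \<and> Q (es ! i)} = sum_list (map (\<lambda>e. of_bool (Q e)) es)" for Q and es :: "edge list"
    by (simp add: length_filter_conv_card[symmetric] sum_list_map_filter'[symmetric]
        sum_list_triv of_bool_def filter_map comp_def)
  have "half_edges K G v = sum_list (map (\<lambda>e. of_bool (ekind e = K \<and> src e = v)) (edges G)) +
      sum_list (map (\<lambda>e. of_bool (ekind e = K \<and> tgt e = v)) (edges G))"
    unfolding half_edges_def card[symmetric] ..
  also have "\<dots> = sum_list (map (half_weight K (\<lambda>_. True) v) (edges G))"
    unfolding sum_list_addf[symmetric] by (rule arg_cong[of _ _ sum_list]) (auto simp: half_weight_def)
  finally show ?thesis by (simp add: half_count_def)
qed

lemma half_count_mset_cong: "mset es = mset es' \<Longrightarrow> half_count K P v es = half_count K P v es'"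
  unfolding half_count_def by (metis mset_map sum_mset_sum_list)

lemma half_count_del_at:
  "i < length es \<Longrightarrow> half_count K P v es = half_weight K P v (es ! i) + half_count K P v (del_at i es)"
  unfolding half_count_def by (subst sum_list_del_at[of i]) (auto simp: map_del_at)

lemma half_count_ins_at:
  "i \<le> length es \<Longrightarrow> half_count K P v (ins_at i e es) = half_weight K P v e + half_count K P v es"
  unfolding half_count_def by (simp add: map_ins_at)

lemma half_count_zero_iff:
  "half_count K P v es = 0 \<longleftrightarrow>
    (\<forall>e\<in>set es. ekind e = K \<longrightarrow> (src e = v \<longrightarrow> \<not> P (tgt e)) \<and> (tgt e = v \<longrightarrow> \<not> P (src e)))"
  by (simp add: half_count_def) (auto simp: half_weight_def)

lemma half_count_cong:
  assumes "\<And>e. e \<in> set es \<Longrightarrow> half_weight K P v e = half_weight K' P' v' (f e)"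
  shows "half_count K P v es = half_count K' P' v' (map f es)"
  unfolding half_count_def using assms by (auto intro!: arg_cong[of _ _ sum_list])

lemma relabel_edge_simps [simp]:
  "ekind (relabel_edge r e) = ekind e" "src (relabel_edge r e) = r (src e)" "tgt (relabel_edge r e) = r (tgt e)"
  by (simp_all add: relabel_edge_def)

lemma relabel_edge_comp: "relabel_edge r (relabel_edge r' e) = relabel_edge (r \<circ> r') e"
  by (simp add: relabel_edge_def)

lemma relabel_edge_cong: "r (src e) = r' (src e) \<Longrightarrow> r (tgt e) = r' (tgt e) \<Longrightarrow> relabel_edge r e = relabel_edge r' e"
  by (simp add: relabel_edge_def)

section \<open>Admissible connected graphs\<close>

text \<open>The local conditions in terms of the dashed valence \<open>d\<close> and the solid
  valence \<open>s\<close>; for external vertices this is admissibility.\<close>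

fun vertex_ok :: "vertex_kind \<Rightarrow> nat \<Rightarrow> nat \<Rightarrow> bool"
  where
    "vertex_ok White d s \<longleftrightarrow> d \<ge> 3 \<and> s = 0"
  | "vertex_ok IntBlack d s \<longleftrightarrow> s \<ge> 3 \<and> d = 0"
  | "vertex_ok ExtBlack d s \<longleftrightarrow> d \<ge> 1"

definition good :: "lgraph \<Rightarrow> bool"
  where "good G \<longleftrightarrow> plain_graph G \<and> connected_graph G \<and> admissible G"

lemma reachable_refl [simp]: "reachable G v v" by (simp add: reachable_def)

lemma reachable_trans: "reachable G u v \<Longrightarrow> reachable G v w \<Longrightarrow> reachable G u w"
  unfolding reachable_def by (rule rtrancl_trans)

lemma reachable_sym: "reachable G u v \<Longrightarrow> reachable G v u"
proof -
  have "sym {(x, y). \<exists>e\<in>set (edges G). ends e = {x, y}}" by (auto simp: sym_def insert_commute)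
  thus "reachable G u v \<Longrightarrow> reachable G v u"
    unfolding reachable_def by (rule symD[OF sym_rtrancl])
qed

lemma reachable_edge: "e \<in> set (edges G) \<Longrightarrow> reachable G (src e) (tgt e)"
  unfolding reachable_def by (rule r_into_rtrancl) (auto simp: ends_def)

lemma reachable_map:
  assumes "\<And>e. e \<in> set (edges G) \<Longrightarrow> reachable H (f (src e)) (f (tgt e))" and "reachable G v w"
  shows "reachable H (f v) (f w)" using assms(2) unfolding reachable_def[of G]
proof (induction rule: rtrancl_induct)
  case (step y z)
  then obtain e where "e \<in> set (edges G)" "{src e, tgt e} = {y, z}" by (auto simp: ends_def)
  hence "reachable H (f y) (f z)"
    using assms(1)[of e] reachable_sym[of H "f (src e)" "f (tgt e)"] by (auto simp: doubleton_eq_iff)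
  with step.IH show ?case by (rule reachable_trans)
qed simp

text \<open>By connectedness, the requirement that every vertex reach an external one amounts to the
  existence of a single external vertex; all other conditions are local.\<close>

lemma good_iff:
  "good G \<longleftrightarrow> well_labeled G \<and> connected_graph G \<and> ExtBlack \<in> set (vkinds G) \<and>
    (\<forall>v<num_vertices G. vertex_ok (vkind G v) (valence Dashed v (edges G)) (valence Solid v (edges G)))"
  (is "?L \<longleftrightarrow> ?R")
proof -
  have adm: "(\<exists>e\<in>set (edges G). ekind e = Dashed \<and> v \<in> ends e) \<longleftrightarrow> valence Dashed v (edges G) \<ge> 1" for v
    using half_count_zero_iff[of Dashed "\<lambda>_. True" v "edges G"] by (auto simp: ends_def not_less_eq_eq)
  show ?thesis
  proof
    assume L: ?L
    hence pl: "plain_graph G" and con: "connected_graph G" and ad: "admissible G" by (auto simp: good_def)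
    have "vertex_ok (vkind G v) (valence Dashed v (edges G)) (valence Solid v (edges G))"
      if "v < num_vertices G" for v
      using that pl ad unfolding plain_graph_def admissible_def half_edges_eq adm
      by (cases "vkind G v") auto
    moreover have "ExtBlack \<in> set (vkinds G)"
    proof -
      have "0 < num_vertices G" using con by (simp add: connected_graph_def)
      then obtain w where "w < num_vertices G" "vkind G w = ExtBlack"
        using pl unfolding plain_graph_def by blast
      thus ?thesis by (metis nth_mem)
    qed
    ultimately show ?R using pl con by (auto simp: plain_graph_def)
  next
    assume R: ?R
    hence ok: "vertex_ok (vkind G v) (valence Dashed v (edges G)) (valence Solid v (edges G))"
      if "v < num_vertices G" for v using that by blast
    have "admissible G" unfolding admissible_def adm using ok by fastforce
    moreover have "plain_graph G" unfolding plain_graph_def half_edges_eq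
    proof (intro conjI allI impI)
      fix v assume v: "v < num_vertices G"
      obtain w where "w < num_vertices G" "vkind G w = ExtBlack" using R by (auto simp: in_set_conv_nth)
      thus "\<exists>w<num_vertices G. reachable G v w \<and> vkind G w = ExtBlack"
        using R v by (auto simp: connected_graph_def)
    qed (use R ok in fastforce)+
    ultimately show ?L using R by (simp add: good_def)
  qed
qed

text \<open>The half of the vertex conditions that forbids half-edges, read off at an edge, together
  with the bound on its ends. This is the form used to decide which kinds the ends of an edge can
  have.\<close>

definition typed :: "lgraph \<Rightarrow> bool"
  where "typed G \<longleftrightarrow> (\<forall>e\<in>set (edges G). \<forall>v\<in>ends e. v < num_vertices G \<and>
    (ekind e = Solid \<longrightarrow> vkind G v \<noteq> White) \<and> (ekind e = Dashed \<longrightarrow> vkind G v \<noteq> IntBlack))"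

lemma good_typed: "good G \<Longrightarrow> typed G" unfolding typed_def
proof (intro ballI)
  fix e v assume g: "good G" and e: "e \<in> set (edges G)" and v: "v \<in> ends e"
  hence vN: "v < num_vertices G" by (auto simp: good_iff well_labeled_def ends_def)
  have "valence (ekind e) v (edges G) \<noteq> 0" using e v by (auto simp: half_count_zero_iff ends_def)
  moreover have "vertex_ok (vkind G v) (valence Dashed v (edges G)) (valence Solid v (edges G))"
    using g vN by (auto simp: good_iff)
  ultimately show "v < num_vertices G \<and> (ekind e = Solid \<longrightarrow> vkind G v \<noteq> White) \<and>
      (ekind e = Dashed \<longrightarrow> vkind G v \<noteq> IntBlack)"
    using vN by (cases "vkind G v"; cases "ekind e") auto
qed

definition black_count :: "lgraph \<Rightarrow> nat"
  where "black_count G = length (filter (\<lambda>k. k \<noteq> White) (vkinds G))"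

definition solid_count :: "lgraph \<Rightarrow> nat"
  where "solid_count G = length (filter (\<lambda>e. ekind e = Solid) (edges G))"

lemma initial_segment_filter:
  assumes "\<And>i k. i < k \<Longrightarrow> k < length xs \<Longrightarrow> Q (xs ! k) \<Longrightarrow> Q (xs ! i)" "k < length xs"
  shows "Q (xs ! k) \<longleftrightarrow> k < length (filter Q xs)"
proof -
  let ?A = "{i. i < length xs \<and> Q (xs ! i)}"
  have len: "length (filter Q xs) = card ?A" by (rule length_filter_conv_card)
  show ?thesis
  proof
    assume "Q (xs ! k)"
    hence "{..k} \<subseteq> ?A" using assms by (auto simp: le_less)
    hence "card {..k} \<le> card ?A" by (intro card_mono) auto
    thus "k < length (filter Q xs)" by (simp add: len)
  next
    assume k: "k < length (filter Q xs)"
    show "Q (xs ! k)"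
    proof (rule ccontr)
      assume n: "\<not> Q (xs ! k)"
      have "?A \<subseteq> {..<k}"
      proof
        fix i assume i: "i \<in> ?A"
        hence "i \<noteq> k" using n by auto
        moreover have "\<not> k < i" using i assms(1)[of k i] n by auto
        ultimately show "i \<in> {..<k}" by simp
      qed
      hence "card ?A \<le> card {..<k}" by (intro card_mono) auto
      thus False using k len by simp
    qed
  qed
qed

text \<open>The order conditions mean that the black vertices and the solid edges form initial
  segments. Their lengths are the places where an internal black vertex and a solid edge will be
  inserted.\<close>

lemma well_labeled_iff:
  "well_labeled G \<longleftrightarrow> (\<forall>e\<in>set (edges G). src e < num_vertices G \<and> tgt e < num_vertices G) \<and>
    (\<forall>v<num_vertices G. vkind G v \<noteq> White \<longleftrightarrow> v < black_count G) \<and>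
    (\<forall>l<num_edges G. kind_at G l = Solid \<longleftrightarrow> l < solid_count G)" (is "?L \<longleftrightarrow> ?R")
proof
  assume L: ?L
  have "vkind G v \<noteq> White \<longleftrightarrow> v < black_count G" if "v < num_vertices G" for v
    unfolding black_count_def by (rule initial_segment_filter[of "vkinds G" "\<lambda>k. k \<noteq> White"])
      (use L that in "auto simp: well_labeled_def")
  moreover have "kind_at G l = Solid \<longleftrightarrow> l < solid_count G" if "l < num_edges G" for l
    unfolding solid_count_def
  proof (rule initial_segment_filter[of "edges G" "\<lambda>e. ekind e = Solid"])
    fix i k assume "i < k" "k < num_edges G" "kind_at G k = Solid"
    thus "kind_at G i = Solid"
      using L unfolding well_labeled_def by (metis edge_kind.distinct(1) edge_kind.exhaust)
  qed (fact that)
  ultimately show ?R using L by (auto simp: well_labeled_def)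
next
  assume R: ?R
  have w: "vkind G w = White" if "v < w" "w < num_vertices G" "vkind G v = White" for v w
    using R that by (metis less_trans)
  have d: "kind_at G l = Dashed" if "i < l" "l < num_edges G" "kind_at G i = Dashed" for i l
  proof -
    have "\<not> i < solid_count G" using R that by (metis edge_kind.distinct(1) less_trans)
    hence "\<not> l < solid_count G" using that(1) by simp
    thus ?thesis using R that(2) by (metis edge_kind.exhaust)
  qed
  show ?L unfolding well_labeled_def using R w d by blast
qed

lemma black_count_le: "black_count G \<le> num_vertices G" by (simp add: black_count_def)

lemma solid_count_le: "solid_count G \<le> num_edges G" by (simp add: solid_count_def)

section \<open>Contractions\<close>

definition merge :: "nat \<Rightarrow> nat \<Rightarrow> nat \<Rightarrow> nat"
  where "merge p q v = (if v = q then p else if v > q then v - 1 else v)"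

abbreviation cmin :: "lgraph \<Rightarrow> nat \<Rightarrow> nat"
  where "cmin G l \<equiv> min (src_at G l) (tgt_at G l)"

abbreviation cmax :: "lgraph \<Rightarrow> nat \<Rightarrow> nat"
  where "cmax G l \<equiv> max (src_at G l) (tgt_at G l)"

definition cmap :: "lgraph \<Rightarrow> nat \<Rightarrow> nat \<Rightarrow> nat"
  where "cmap G l = merge (cmin G l) (cmax G l)"

definition merged_kind :: "vertex_kind \<Rightarrow> vertex_kind \<Rightarrow> vertex_kind"
  where "merged_kind a b = (if ExtBlack \<in> {a, b} then ExtBlack else a)"

text \<open>The edges contracted by the differential: for \<open>b = False\<close> only those which keep the number
  of external vertices, for \<open>b = True\<close> all of them.\<close>

definition contractible :: "bool \<Rightarrow> lgraph \<Rightarrow> nat \<Rightarrow> bool"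
  where "contractible b G l \<longleftrightarrow> l < num_edges G \<and> src_at G l \<noteq> tgt_at G l \<and>
    ((\<exists>v\<in>ends_at G l. vkind G v \<noteq> ExtBlack) \<or> b \<and> kind_at G l = Solid)"

lemma merge_simps [simp]: "merge p q q = p" "p < q \<Longrightarrow> merge p q p = p"
  by (auto simp: merge_def)

lemma merge_less: "p < q \<Longrightarrow> q < N \<Longrightarrow> v < N \<Longrightarrow> merge p q v < N - 1"
  by (auto simp: merge_def)

lemma merge_eq_iff: "p < q \<Longrightarrow> merge p q v = merge p q w \<longleftrightarrow> v = w \<or> {v, w} = {p, q}"
  by (auto simp: merge_def doubleton_eq_iff)

lemma merge_inv: "p < q \<Longrightarrow> merge p q (if u < q then u else Suc u) = u"
  by (auto simp: merge_def)

lemma contractible_less: "contractible b G l \<Longrightarrow> l < num_edges G"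
  by (simp add: contractible_def)

lemma cmin_less_cmax: "contractible b G l \<Longrightarrow> cmin G l < cmax G l"
  by (auto simp: contractible_def)

lemma cmax_less: "typed G \<Longrightarrow> l < num_edges G \<Longrightarrow> cmax G l < num_vertices G"
  by (auto simp: typed_def ends_def)

lemma cmap_ends: "contractible b G l \<Longrightarrow> cmap G l (src_at G l) = cmin G l"
  "contractible b G l \<Longrightarrow> cmap G l (tgt_at G l) = cmin G l"
  by (auto simp: cmap_def contractible_def merge_def)

lemma ends_min_max: "ends_at G l = {cmin G l, cmax G l}" by (auto simp: ends_def min_def max_def)

lemma contract_eq:
  assumes "src_at G l \<noteq> tgt_at G l"
  shows "contract G l = LGraph
    (del_at (cmax G l) ((vkinds G)[cmin G l := merged_kind (vkinds G ! cmin G l) (vkinds G ! cmax G l)]))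
    (map (relabel_edge (cmap G l)) (del_at l (edges G)))" using assms
  by (simp add: contract_def Let_def del_at_def cmap_def merge_def[abs_def] merged_kind_def take_map drop_map)

lemma edges_contract: "contractible b G l \<Longrightarrow>
    edges (contract G l) = map (relabel_edge (cmap G l)) (del_at l (edges G))"
  by (simp add: contract_eq contractible_def)

lemma num_edges_contract: "contractible b G l \<Longrightarrow> num_edges (contract G l) = num_edges G - 1"
  by (simp add: edges_contract contractible_less)

lemma num_vertices_contract:
  "contractible b G l \<Longrightarrow> typed G \<Longrightarrow> num_vertices (contract G l) = num_vertices G - 1"
  using cmax_less[of G l] by (simp add: contract_eq contractible_def)

lemma nth_edges_contract:
  assumes "contractible b G l" "m < num_edges G - 1"
  shows "edges (contract G l) ! m = relabel_edge (cmap G l) (edges G ! (if m < l then m else Suc m))"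
  using assms contractible_less[OF assms(1)] by (auto simp: edges_contract[OF assms(1)] nth_del_at)

lemma nth_vkinds_contract:
  assumes "contractible b G l" "typed G" "u < num_vertices G - 1"
  shows "vkind (contract G l) u =
    (if u = cmin G l then merged_kind (vkinds G ! cmin G l) (vkinds G ! cmax G l)
     else vkind G (if u < cmax G l then u else Suc u))"
  using assms cmax_less[of G l] cmin_less_cmax[OF assms(1)]
  by (auto simp: contract_eq contractible_def nth_del_at nth_list_update)

lemma vkinds_contract_cmap:
  assumes "contractible b G l" "typed G" "v < num_vertices G"
  shows "vkinds (contract G l) ! cmap G l v =
    (if v \<in> ends_at G l then merged_kind (vkinds G ! cmin G l) (vkinds G ! cmax G l)
     else vkind G v)"
proof -
  obtain p q where pq: "cmin G l = p" "cmax G l = q" by blast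
  note l = cmin_less_cmax[OF assms(1)]
  have q: "cmax G l < num_vertices G" using assms(2) contractible_less[OF assms(1)] by (rule cmax_less)
  have "cmap G l v < num_vertices G - 1" unfolding cmap_def using l q assms(3) by (rule merge_less)
  thus ?thesis unfolding ends_min_max using nth_vkinds_contract[OF assms(1,2), of "cmap G l v"] l q assms(3)
    unfolding cmap_def pq by (auto simp: merge_def)
qed

text \<open>The position of the former entry \<open>m\<close> once entry \<open>l\<close> is gone;
  meaningful for \<open>m \<noteq> l\<close>.\<close>

definition after_del :: "nat \<Rightarrow> nat \<Rightarrow> nat"
  where "after_del l m = (if m < l then m else m - 1)"

lemma nth_edges_after_del:
  assumes "contractible b G l" "m < num_edges G" "m \<noteq> l"
  shows "edges (contract G l) ! after_del l m = relabel_edge (cmap G l) (edges G ! m)"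
    and "after_del l m < num_edges (contract G l)"
proof -
  have l: "l < num_edges G" using assms(1) by (simp add: contractible_def)
  show "after_del l m < num_edges (contract G l)"
    using l assms num_edges_contract[OF assms(1)] by (auto simp: after_del_def)
  thus "edges (contract G l) ! after_del l m = relabel_edge (cmap G l) (edges G ! m)"
    using l assms num_edges_contract[OF assms(1)]
    by (subst nth_edges_contract[OF assms(1)]) (auto simp: after_del_def)
qed

text \<open>A contractible dashed edge has an end that is not external and cannot be internal black,
  so it is white; as white vertices are numbered last, the larger end is white. Solid edges never
  meet white vertices.\<close>

lemma edge_classes:
  assumes "good G" "contractible b G l"
  shows "kind_at G l = Dashed \<Longrightarrow> vkinds G ! cmax G l = White \<and> vkinds G ! cmin G l \<noteq> IntBlack"
    and "kind_at G l = Solid \<Longrightarrow> vkinds G ! cmax G l \<noteq> White \<and> vkinds G ! cmin G l \<noteq> White"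
proof -
  have t: "typed G" and wl: "well_labeled G" using assms good_typed by (auto simp: good_iff)
  have l: "l < num_edges G" and e: "edges G ! l \<in> set (edges G)"
    using assms by (auto simp: contractible_def)
  have q: "cmax G l < num_vertices G" using t l by (rule cmax_less)
  note lt = cmin_less_cmax[OF assms(2)]
  have in_ends: "cmax G l \<in> ends_at G l" "cmin G l \<in> ends_at G l" by (auto simp: ends_min_max)
  show "vkinds G ! cmax G l \<noteq> White \<and> vkinds G ! cmin G l \<noteq> White" if "kind_at G l = Solid"
    using t e in_ends that unfolding typed_def by blast
  assume d: "kind_at G l = Dashed"
  hence ni: "vkinds G ! cmax G l \<noteq> IntBlack" "vkinds G ! cmin G l \<noteq> IntBlack"
    using t e in_ends unfolding typed_def by blast+
  have "\<exists>v\<in>{cmin G l, cmax G l}. vkind G v \<noteq> ExtBlack"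
    using assms(2) d unfolding contractible_def ends_min_max by simp
  then obtain v where v: "v \<in> {cmin G l, cmax G l}" "vkind G v \<noteq> ExtBlack" by blast
  moreover have "vkind G v \<noteq> IntBlack" using ni v(1) by blast
  ultimately have "vkind G v = White" by (cases "vkind G v") auto
  with v(1) have "vkinds G ! cmax G l = White \<or> vkinds G ! cmin G l = White" by blast
  thus "vkinds G ! cmax G l = White \<and> vkinds G ! cmin G l \<noteq> IntBlack"
    using wl lt q ni unfolding well_labeled_def by blast
qed

text \<open>Only the valence of the merged vertex needs care. Along the kind of the contracted edge
  it is the sum of the two valences minus two: at least \<open>3 + 3 - 2\<close> for two internal
  vertices, and at least \<open>1 + 3 - 2\<close> dashed half-edges when an external vertex absorbs
  a white one.\<close>

lemma good_contract:
  assumes "good G" "contractible b G l"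
  shows "good (contract G l)"
proof -
  obtain p q where pq: "cmin G l = p" "cmax G l = q" by blast
  let ?H = "contract G l" and ?r = "cmap G l"
  let ?N = "num_vertices G"
  let ?K = "merged_kind (vkind G p) (vkind G q)"
  define o' where "o' u = (if u < q then u else Suc u)" for u
  have t: "typed G" and wl: "well_labeled G" and con: "connected_graph G"
    and ok: "\<And>v. v < ?N \<Longrightarrow> vertex_ok (vkind G v) (valence Dashed v (edges G)) (valence Solid v (edges G))"
    using assms good_typed by (auto simp: good_iff)
  have l: "l < num_edges G" using assms by (auto simp: contractible_def)
  have q: "q < ?N" using cmax_less[OF t l] by (simp only: pq)
  have lt: "p < q" using cmin_less_cmax[OF assms(2)] by (simp only: pq)
  have ends: "ends_at G l = {p, q}" by (simp only: ends_min_max pq)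
  have r: "?r = merge p q" by (simp only: cmap_def pq)
  note cls = edge_classes[OF assms, unfolded pq]
  note nv = num_vertices_contract[OF assms(2) t]
  have rlt: "?r v < ?N - 1" if "v < ?N" for v unfolding r using lt q that by (rule merge_less)
  have r_o': "?r (o' u) = u" for u unfolding r o'_def using lt by (rule merge_inv)
  have o'_lt: "o' u < ?N" if "u < ?N - 1" for u using that by (auto simp: o'_def)
  have o'_mono: "o' u < o' v" if "u < v" for u v using that by (auto simp: o'_def)
  have KW: "?K = White \<longleftrightarrow> vkind G p = White"
  proof -
    have "vkind G p = White \<longrightarrow> vkind G q = White"
      using wl lt q unfolding well_labeled_def by blast
    thus ?thesis by (auto simp: merged_kind_def)
  qed
  have kW: "vkind ?H u = White \<longleftrightarrow> vkinds G ! o' u = White" if "u < ?N - 1" for u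
    using that lt KW by (subst nth_vkinds_contract[OF assms(2) t, unfolded pq]) (auto simp: o'_def)
  have wlH: "well_labeled ?H" unfolding well_labeled_def nv
  proof (intro conjI ballI allI impI)
    fix e assume "e \<in> set (edges ?H)"
    hence "e \<in> relabel_edge ?r ` set (del_at l (edges G))" by (simp add: edges_contract[OF assms(2)])
    then obtain e' where e': "e = relabel_edge ?r e'" "e' \<in> set (del_at l (edges G))" by (rule imageE)
    have "e' \<in> set (edges G)" using e'(2) set_del_at_subset[of l "edges G"] by (rule subsetD[rotated])
    with e'(1) show "src e < ?N - 1" "tgt e < ?N - 1" using rlt wl by (auto simp: well_labeled_def)
  next
    fix v w assume vw: "v < w \<and> w < ?N - 1 \<and> vkind ?H v = White"
    hence "vkinds G ! o' v = White" using kW[of v] by auto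
    moreover have "o' v < o' w" "o' w < ?N" using vw o'_mono o'_lt by auto
    ultimately have "vkinds G ! o' w = White" using wl unfolding well_labeled_def by blast
    thus "vkind ?H w = White" using kW[of w] vw by auto
  next
    fix i k assume ik: "i < k \<and> k < num_edges ?H \<and> kind_at ?H i = Dashed"
    hence lt: "k < num_edges G - 1" "i < num_edges G - 1" "i < k"
      using num_edges_contract[OF assms(2)] by auto
    have "kind_at G (if i < l then i else Suc i) = Dashed"
      using ik lt by (simp add: nth_edges_contract[OF assms(2)])
    moreover have "(if i < l then i else Suc i) < (if k < l then k else Suc k)"
      "(if k < l then k else Suc k) < num_edges G" using lt by auto
    ultimately have "kind_at G (if k < l then k else Suc k) = Dashed"
      using wl unfolding well_labeled_def by blast
    thus "kind_at ?H k = Dashed" using lt by (simp add: nth_edges_contract[OF assms(2)])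
  qed
  have conH: "connected_graph ?H" unfolding connected_graph_def nv
  proof (intro conjI allI impI)
    show "0 < ?N - 1" using lt q by linarith
    fix v w assume "v < ?N - 1" "w < ?N - 1"
    hence "reachable G (o' v) (o' w)" using con o'_lt by (auto simp: connected_graph_def)
    hence "reachable ?H (?r (o' v)) (?r (o' w))"
    proof (rule reachable_map[rotated])
      fix e assume "e \<in> set (edges G)"
      hence "e = edges G ! l \<or> e \<in> set (del_at l (edges G))" using set_del_at[OF l] by auto
      thus "reachable ?H (?r (src e)) (?r (tgt e))"
      proof
        assume "e \<in> set (del_at l (edges G))"
        hence "relabel_edge ?r e \<in> set (edges ?H)" by (simp add: edges_contract[OF assms(2)])
        from reachable_edge[OF this] show ?thesis by simp
      qed (simp only: cmap_ends[OF assms(2)] reachable_refl)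
    qed
    thus "reachable ?H v w" by (simp add: r_o')
  qed
  obtain x where x: "x < ?N" "vkind G x = ExtBlack" using assms(1) by (auto simp: good_iff in_set_conv_nth)
  hence "vkinds ?H ! ?r x = ExtBlack"
    using vkinds_contract_cmap[OF assms(2) t x(1), unfolded pq] x by (auto simp: ends merged_kind_def)
  hence ext: "ExtBlack \<in> set (vkinds ?H)" using rlt[OF x(1)] nv by (metis nth_mem)
  have val: "valence K u (edges ?H) = valence K (o' u) (del_at l (edges G)) +
      (if u = p then valence K q (del_at l (edges G)) else 0)" if "u < ?N - 1" for K u
  proof -
    have iff: "?r x = u \<longleftrightarrow> x = o' u \<or> (u = p \<and> x = q)" for x
      using lt by (auto simp: r merge_def o'_def)
    have "half_weight K (\<lambda>_. True) u (relabel_edge ?r e) = half_weight K (\<lambda>_. True) (o' u) e +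
       (if u = p then half_weight K (\<lambda>_. True) q e else 0)" for e
      using lt by (auto simp: half_weight_def iff o'_def)
    thus ?thesis unfolding edges_contract[OF assms(2)] half_count_def map_map comp_def
      by (simp add: sum_list_addf)
  qed
  have w: "half_weight K (\<lambda>_. True) v (edges G ! l) = (if K = kind_at G l \<and> v \<in> {p, q} then 1 else 0)" for K v
    using lt ends by (auto simp: half_weight_def ends_def doubleton_eq_iff)
  have val': "valence K v (edges G) = (if K = kind_at G l \<and> v \<in> {p, q} then 1 else 0) + valence K v (del_at l (edges G))" for K v
    by (subst half_count_del_at[OF l]) (simp add: w)
  have "vertex_ok (vkind ?H u) (valence Dashed u (edges ?H)) (valence Solid u (edges ?H))"
    if u: "u < ?N - 1" for u
  proof (cases "u = p")
    case False
    hence "o' u \<noteq> p" "o' u \<noteq> q" using lt by (auto simp: o'_def)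
    moreover have "vkind ?H u = vkinds G ! o' u"
      using False by (simp add: nth_vkinds_contract[OF assms(2) t u, unfolded pq] o'_def)
    ultimately show ?thesis using ok[OF o'_lt[OF u]] val[OF u] val'[of _ "o' u"] False by simp
  next
    case True
    hence "o' u = p" using lt by (simp add: o'_def)
    moreover have "vkind ?H u = ?K" using True nth_vkinds_contract[OF assms(2) t u, unfolded pq] by simp
    ultimately show ?thesis using ok[of p] ok[of q] lt q val[OF u] val'[of _ "p"] val'[of _ "q"] True cls
      by (cases "vkind G p"; cases "vkind G q"; cases "kind_at G l")
        (auto simp: merged_kind_def)
  qed
  thus ?thesis using wlH conH ext by (simp add: good_iff nv)
qed

locale degrees =
  fixes n j :: int
begin

abbreviation csign :: "lgraph \<Rightarrow> nat \<Rightarrow> rat" where "csign \<equiv> contraction_sign n j"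
abbreviation cvec :: "lgraph \<Rightarrow> nat \<Rightarrow> (lgraph \<Rightarrow>\<^sub>0 rat)" where "cvec G l \<equiv> single (contract G l) (csign G l)"
abbreviation kdeg :: "edge_kind \<Rightarrow> int" where "kdeg \<equiv> edge_degree n j"
abbreviation gdeg :: "lgraph \<Rightarrow> int" where "gdeg \<equiv> graph_degree n j"
abbreviation relab :: "lgraph \<Rightarrow> lgraph \<Rightarrow> rat \<Rightarrow> bool" where "relab \<equiv> relabeling n j"
abbreviation orient_rel :: "lgraph set \<Rightarrow> (lgraph \<Rightarrow>\<^sub>0 rat) set" where "orient_rel \<equiv> orientation_relations n j"
abbreviation plain_gen :: "int \<Rightarrow> lgraph set" where "plain_gen \<equiv> plain_generators n j"
abbreviation chord_gen :: "int \<Rightarrow> lgraph set" where "chord_gen \<equiv> chord_generators n j"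
abbreviation HH_rel :: "int \<Rightarrow> (lgraph \<Rightarrow>\<^sub>0 rat) set" where "HH_rel \<equiv> HH_relations n j"

section \<open>Signs\<close>

lemma sgn_pow_if: "sgn_pow k = (if even k then 1 else -1)" by (auto simp: power_int_minus_left)

lemma sgn_pow_mult: "sgn_pow a * sgn_pow b = sgn_pow (a + b)" by (auto simp: sgn_pow_if)

lemma sgn_pow_eqI: "even (a - b) \<Longrightarrow> sgn_pow a = sgn_pow b" by (auto simp: sgn_pow_if)

lemma sgn_pow_square [simp]: "sgn_pow a * sgn_pow a = 1" by (auto simp: sgn_pow_if)

definition edeg :: "lgraph \<Rightarrow> nat \<Rightarrow> int"
  where "edeg G l = kdeg (kind_at G l)"

definition vdeg :: "lgraph \<Rightarrow> nat \<Rightarrow> int"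
  where "vdeg G v = vertex_degree n j (vkind G v)"

definition edeg_sum :: "lgraph \<Rightarrow> int"
  where "edeg_sum G = (\<Sum>l<num_edges G. edeg G l)"

definition edeg_after :: "lgraph \<Rightarrow> nat \<Rightarrow> int"
  where "edeg_after G l = (\<Sum>m\<in>{l<..<num_edges G}. edeg G m)"

definition vdeg_after :: "lgraph \<Rightarrow> nat \<Rightarrow> int"
  where "vdeg_after G v = (\<Sum>w\<in>{v<..<num_vertices G}. vdeg G w)"

text \<open>The exponent of the contraction sign reduced modulo two: the vertex degrees before and
  after contraction nearly cancel, leaving \<open>edeg G l\<close>, and \<open>edeg G l + 1\<close>
  is both the parity of the degree of the removed vertex and the exponent for a reversed
  edge.\<close>

definition csign_exp :: "lgraph \<Rightarrow> nat \<Rightarrow> int"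
  where "csign_exp G l = edeg_sum G + edeg G l + (edeg G l + 1) * vdeg_after G (cmax G l)
    + edeg G l * edeg_after G l
    + (if src_at G l < tgt_at G l then 0 else edeg G l + 1)"

lemma sum_list_drop_Suc: "sum_list (drop (Suc i) xs) = (\<Sum>m\<in>{i<..<length xs}. xs ! m)"
  for xs :: "int list"
proof -
  have "sum_list (drop (Suc i) xs) = (\<Sum>m<length xs - Suc i. xs ! (Suc i + m))"
    by (simp add: sum_list_sum_nth lessThan_atLeast0)
  also have "\<dots> = (\<Sum>m\<in>{i<..<length xs}. xs ! m)"
    by (rule sum.reindex_bij_witness[of _ "\<lambda>m. m - Suc i" "\<lambda>m. Suc i + m"]) auto
  finally show ?thesis .
qed

lemma edge_degrees_nth: "l < num_edges G \<Longrightarrow> edge_degrees n j G ! l = edeg G l"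
  by (simp add: edge_degrees_def edeg_def)

lemma vertex_degrees_nth: "v < num_vertices G \<Longrightarrow> vertex_degrees n j G ! v = vdeg G v"
  by (simp add: vertex_degrees_def vdeg_def)

lemma length_degrees [simp]: "length (edge_degrees n j G) = num_edges G" "length (vertex_degrees n j G) = num_vertices G"
  by (simp_all add: edge_degrees_def vertex_degrees_def)

lemma sum_edge_degrees: "sum_list (edge_degrees n j G) = edeg_sum G"
  by (simp add: sum_list_sum_nth edeg_sum_def edge_degrees_nth lessThan_atLeast0)

lemma koszul_edge:
  assumes "l < num_edges G"
  shows "koszul_to_end (edge_degrees n j G) l = sgn_pow (edeg G l * edeg_after G l)"
  unfolding koszul_to_end_def sum_list_drop_Suc using assms by (simp add: edge_degrees_nth edeg_after_def)

lemma koszul_vertex: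
  assumes "v < num_vertices G"
  shows "koszul_to_end (vertex_degrees n j G) v = sgn_pow (vdeg G v * vdeg_after G v)"
  unfolding koszul_to_end_def sum_list_drop_Suc using assms by (simp add: vertex_degrees_nth vdeg_after_def)

text \<open>The removed end is white for a dashed edge and black for a solid one. Edge and vertex
  together therefore have degree \<open>-1\<close>, which is why contraction raises the degree by
  one.\<close>

lemma vdeg_cmax:
  assumes "good G" "contractible b G l"
  shows "vdeg G (cmax G l) = - (edeg G l + 1)" using edge_classes[OF assms]
  by (cases "kind_at G l"; cases "vkinds G ! cmax G l") (auto simp: vdeg_def edeg_def)

lemma sum_vertex_degrees_contract:
  assumes "good G" "contractible b G l"
  shows "sum_list (vertex_degrees n j (contract G l)) = sum_list (vertex_degrees n j G) + edeg G l + 1"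
proof -
  obtain p q where pq: "cmin G l = p" "cmax G l = q" by blast
  have lt: "p < q" using cmin_less_cmax[OF assms(2)] by (simp only: pq)
  have q: "q < num_vertices G"
    using cmax_less[OF good_typed[OF assms(1)] contractible_less[OF assms(2)]] by (simp only: pq)
  have K: "vertex_degree n j (merged_kind (vkind G p) (vkind G q)) = vertex_degree n j (vkind G p)"
    using edge_classes[OF assms, unfolded pq]
    by (cases "kind_at G l"; cases "vkind G p"; cases "vkind G q") (auto simp: merged_kind_def)
  have "vertex_degrees n j (contract G l) =
      del_at q ((vertex_degrees n j G)[p := vertex_degree n j (merged_kind (vkind G p) (vkind G q))])"
    using assms(2) by (simp add: contract_eq contractible_def vertex_degrees_def map_del_at map_update pq)
  also have "\<dots> = del_at q (vertex_degrees n j G)"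
    using lt q unfolding K by (intro arg_cong[of _ _ "del_at q"] list_update_same_conv[THEN iffD2])
      (auto simp: vertex_degrees_def)
  finally show ?thesis using sum_list_del_at[of q "vertex_degrees n j G"] q vdeg_cmax[OF assms]
    by (simp add: vertex_degrees_nth pq)
qed

lemma contraction_sign_eq:
  assumes "good G" "contractible b G l"
  shows "csign G l = sgn_pow (csign_exp G l)"
proof -
  let ?e = "edges G ! l"
  have q: "cmax G l < num_vertices G"
    using cmax_less[OF good_typed[OF assms(1)] contractible_less[OF assms(2)]] .
  have eta: "eta_sign n j ?e = sgn_pow (if src ?e < tgt ?e then 0 else edeg G l + 1)"
    by (cases "ekind ?e") (auto simp: eta_sign_def edeg_def)
  have "csign G l = sgn_pow (gdeg G + 1) *
      sgn_pow (sum_list (vertex_degrees n j (contract G l))) *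
      sgn_pow (vdeg G (cmax G l) * vdeg_after G (cmax G l)) *
      sgn_pow (edeg G l * edeg_after G l) * sgn_pow (if src ?e < tgt ?e then 0 else edeg G l + 1)"
    unfolding contraction_sign_def Let_def koszul_edge[OF contractible_less[OF assms(2)]]
      koszul_vertex[OF q] eta ..
  also have "\<dots> = sgn_pow (csign_exp G l)"
    unfolding sgn_pow_mult sum_vertex_degrees_contract[OF assms] vdeg_cmax[OF assms] graph_degree_def
      sum_edge_degrees csign_exp_def by (rule sgn_pow_eqI) (auto simp: algebra_simps)
  finally show ?thesis .
qed

lemma graph_degree_contract:
  assumes "good G" "contractible b G l"
  shows "gdeg (contract G l) = gdeg G + 1"
proof -
  have "edge_degrees n j (contract G l) = del_at l (edge_degrees n j G)"
    unfolding edge_degrees_def edges_contract[OF assms(2)]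
    by (simp add: map_del_at comp_def del_at_def take_map drop_map)
  thus ?thesis using sum_list_del_at[of l "edge_degrees n j G"] contractible_less[OF assms(2)]
      sum_vertex_degrees_contract[OF assms] by (simp add: graph_degree_def edge_degrees_nth)
qed

section \<open>Elementary changes of the label\<close>

text \<open>\<open>rstep G H vp ep s\<close> refines \<^const>\<open>relabeling\<close>: the vertex \<open>v\<close> becomes \<open>vp v\<close> and the edge
  at position \<open>l\<close> moves to position \<open>ep l\<close>.\<close>

inductive rstep :: "lgraph \<Rightarrow> lgraph \<Rightarrow> (nat \<Rightarrow> nat) \<Rightarrow> (nat \<Rightarrow> nat) \<Rightarrow> rat \<Rightarrow> bool" for G :: lgraph
  where
    edges: "Suc i < num_edges G \<Longrightarrow> rstep G (swap_edges i G) id (transpose i (Suc i))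
       (sgn_pow (edeg G i * edeg G (Suc i)))"
  | vertices: "Suc v < num_vertices G \<Longrightarrow> rstep G (swap_vertices v G) (transpose v (Suc v)) id
       (sgn_pow (vdeg G v * vdeg G (Suc v)))"
  | reverse: "i < num_edges G \<Longrightarrow> rstep G (reverse_edge i G) id id (sgn_pow (edeg G i + 1))"

lemma relabeling_iff: "relab G H s \<longleftrightarrow> (\<exists>vp ep. rstep G H vp ep s)"
proof
  assume "relab G H s"
  thus "\<exists>vp ep. rstep G H vp ep s"
  proof cases
    case (1 i) thus ?thesis using rstep.edges[of i G] by (auto simp: edge_degrees_nth)
  next
    case (2 v) thus ?thesis using rstep.vertices[of v G] by (auto simp: vertex_degrees_nth)
  next
    case (3 i) thus ?thesis using rstep.reverse[of i G] by (auto simp: edge_degrees_nth)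
  qed
next
  assume "\<exists>vp ep. rstep G H vp ep s"
  then obtain vp ep where "rstep G H vp ep s" by blast
  thus "relab G H s"
  proof cases
    case (edges i) thus ?thesis using relabeling.intros(1)[of i G n j] by (simp add: edge_degrees_nth)
  next
    case (vertices v) thus ?thesis using relabeling.intros(2)[of v G n j] by (simp add: vertex_degrees_nth)
  next
    case (reverse i) thus ?thesis using relabeling.intros(3)[of i G n j] by (simp add: edge_degrees_nth)
  qed
qed

type_synonym dgraph = "lgraph \<times> nat list"

text \<open>Orientation relations for graphs with a list of marked vertices. The marks follow the
  vertices along \<open>vp\<close>; changes that concern only edges leave them alone.\<close>

definition dec_relations :: "(dgraph \<Rightarrow>\<^sub>0 rat) set"
  where "dec_relations = {bv (H, map vp ms) - single (G, ms) s | G H vp ep s ms.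
    good G \<and> good H \<and> rstep G H vp ep s}"

lemma merge_transpose:
  "merge v (Suc v) (transpose v (Suc v) x) = merge v (Suc v) x"
  "p < v \<Longrightarrow> merge p (Suc v) (transpose v (Suc v) x) = merge p v x"
  "p < v \<Longrightarrow> merge p v (transpose v (Suc v) x) = merge p (Suc v) x"
  "Suc v < q \<Longrightarrow> p < q \<Longrightarrow> merge (transpose v (Suc v) p) q (transpose v (Suc v) x) =
    transpose v (Suc v) (merge p q x)"
  "p < q \<Longrightarrow> q < v \<Longrightarrow> merge p q (transpose v (Suc v) x) =
    transpose (v - 1) v (merge p q x)" by (auto simp: merge_def transpose_def)

text \<open>Deleting one of two swapped neighbours leaves no trace of the swap, deleting any other
  entry leaves a swap of neighbours. Applied to edges and to vertices alike, this is the dichotomy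
  of \<open>contract_rstep\<close>.\<close>

lemma del_at_swap_adjacent:
  assumes "Suc i < length xs" "l < length xs"
  shows "del_at (transpose i (Suc i) l) (swap_adjacent i xs) =
    (if l = i \<or> l = Suc i then del_at l xs else swap_adjacent (after_del l i) (del_at l xs))"
proof (cases "l = i \<or> l = Suc i")
  case True
  with assms have "del_at (transpose i (Suc i) l) (swap_adjacent i xs) = del_at l xs"
    by (intro nth_equalityI) (auto simp: nth_del_at nth_swap_adjacent transpose_def)
  with True show ?thesis by auto
next
  case False
  hence "transpose i (Suc i) l = l" by (simp add: transpose_def)
  moreover have "del_at l (swap_adjacent i xs) = swap_adjacent (after_del l i) (del_at l xs)"
    using assms False by (intro nth_equalityI)
      (auto simp: nth_del_at nth_swap_adjacent transpose_def after_del_def)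
  ultimately show ?thesis using False by auto
qed

lemma transpose_Suc_bij: "bij (transpose i (Suc i))" by (rule bij_transpose)

lemma transpose_Suc_less: "Suc i < N \<Longrightarrow> transpose i (Suc i) m < N \<longleftrightarrow> m < N"
  by (auto simp: transpose_def)

lemma sum_transpose_all:
  assumes "Suc i < N"
  shows "(\<Sum>m<N. f (transpose i (Suc i) m)) = (\<Sum>m<N. f m)" using assms
  by (intro sum.reindex_bij_witness[of _ "transpose i (Suc i)" "transpose i (Suc i)"])
    (auto simp: transpose_Suc_less)

lemma sum_transpose_after:
  fixes f :: "nat \<Rightarrow> int"
  assumes "Suc i < N"
  shows "(\<Sum>m\<in>{l<..<N}. f (transpose i (Suc i) m)) =
    (if l = i then f i + (\<Sum>m\<in>{Suc i<..<N}. f m) else (\<Sum>m\<in>{l<..<N}. f m))"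
proof (cases "l = i")
  case True
  have "{i<..<N} = insert (Suc i) {Suc i<..<N}" using assms by auto
  moreover have "(\<Sum>m\<in>{Suc i<..<N}. f (transpose i (Suc i) m)) = (\<Sum>m\<in>{Suc i<..<N}. f m)"
    by (rule sum.cong) (auto simp: transpose_def)
  ultimately show ?thesis using True by simp
next
  case False
  have "(\<Sum>m\<in>{l<..<N}. f (transpose i (Suc i) m)) = (\<Sum>m\<in>{l<..<N}. f m)" using assms False
    by (intro sum.reindex_bij_witness[of _ "transpose i (Suc i)" "transpose i (Suc i)"])
      (auto simp: transpose_def)
  thus ?thesis using False by simp
qed

lemma sum_after_Suc:
  fixes f :: "nat \<Rightarrow> int"
  shows "Suc i < N \<Longrightarrow> (\<Sum>m\<in>{i<..<N}. f m) = f (Suc i) + (\<Sum>m\<in>{Suc i<..<N}. f m)"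
proof -
  assume "Suc i < N"
  hence "{i<..<N} = insert (Suc i) {Suc i<..<N}" by auto
  thus ?thesis by simp
qed

lemma del_at_list_update:
  assumes "l < length xs" "i < length xs"
  shows "del_at l (xs[i := x]) = (if i = l then del_at l xs else (del_at l xs)[after_del l i := x])"
  using assms by (intro nth_equalityI) (auto simp: nth_del_at nth_list_update after_del_def)

lemma rstep_num:
  assumes "rstep G H vp ep s"
  shows "num_vertices H = num_vertices G" "num_edges H = num_edges G"
  using assms by (cases; simp add: swap_edges_def swap_vertices_def reverse_edge_def)+

lemma rstep_bij:
  assumes "rstep G H vp ep s"
  shows "bij vp" "vp v < num_vertices G \<longleftrightarrow> v < num_vertices G" "bij ep" "ep l < num_edges G \<longleftrightarrow> l < num_edges G"
  using assms by (cases; simp add: transpose_Suc_less bij_id[unfolded id_def])+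

lemma rstep_sign:
  assumes "rstep G H vp ep s"
  shows "s * s = 1" using assms by cases auto

lemma nth_vkinds_rstep:
  assumes "rstep G H vp ep s" "v < num_vertices G"
  shows "vkinds H ! vp v = vkind G v" using assms
  by cases (auto simp: swap_edges_def swap_vertices_def reverse_edge_def nth_swap_adjacent transpose_Suc_less)

definition flip_edge :: "edge \<Rightarrow> edge"
  where "flip_edge e = Edge (ekind e) (tgt e) (src e)"

lemma nth_edges_rstep:
  assumes "rstep G H vp ep s" "l < num_edges G"
  shows "edges H ! ep l = relabel_edge vp (edges G ! l) \<or> edges H ! ep l = relabel_edge vp (flip_edge (edges G ! l))"
  using assms
  by cases (auto simp: swap_edges_def swap_vertices_def reverse_edge_def nth_swap_adjacent nth_list_update
      transpose_Suc_less flip_edge_def relabel_edge_def id_def)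

lemma nth_edges_rstep':
  assumes "rstep G H vp ep s" "l < num_edges G"
  shows "ekind (edges H ! ep l) = kind_at G l"
    and "ends (edges H ! ep l) = vp ` ends_at G l"
    and "src (edges H ! ep l) = tgt (edges H ! ep l) \<longleftrightarrow> src_at G l = tgt_at G l"
  using nth_edges_rstep[OF assms] rstep_bij(1)[OF assms(1)]
  by (auto simp: ends_def flip_edge_def bij_def inj_eq)

lemma ends_bounded: "typed G \<Longrightarrow> l < num_edges G \<Longrightarrow> v \<in> ends_at G l \<Longrightarrow> v < num_vertices G"
  unfolding typed_def by auto

lemma contractible_rstep:
  assumes "good G" "rstep G H vp ep s" "contractible b G l"
  shows "contractible b H (ep l)"
proof -
  note l = contractible_less[OF assms(3)]
  have "\<exists>v\<in>ends (edges H ! ep l). vkind H v \<noteq> ExtBlack"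
    if "v \<in> ends_at G l" "vkind G v \<noteq> ExtBlack" for v
    using that nth_vkinds_rstep[OF assms(2), of v] ends_bounded[OF good_typed[OF assms(1)] l that(1)]
    by (intro bexI[of _ "vp v"]) (auto simp: nth_edges_rstep'[OF assms(2) l])
  thus ?thesis using assms(3) rstep_bij(4)[OF assms(2)] rstep_num[OF assms(2)]
    by (auto simp: contractible_def nth_edges_rstep'[OF assms(2) l])
qed

lemma vdeg_cmap:
  assumes "good G" "contractible b G l" "u < num_vertices (contract G l)"
  shows "vdeg (contract G l) u = vdeg G (if u < cmax G l then u else Suc u)"
proof -
  obtain p q where pq: "cmin G l = p" "cmax G l = q" by blast
  have lt: "p < q" using cmin_less_cmax[OF assms(2)] by (simp only: pq)
  have "vertex_degree n j (merged_kind (vkind G p) (vkind G q)) = vertex_degree n j (vkind G p)"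
    using edge_classes[OF assms(1,2), unfolded pq]
    by (cases "kind_at G l"; cases "vkind G p"; cases "vkind G q") (auto simp: merged_kind_def)
  thus ?thesis using nth_vkinds_contract[OF assms(2) good_typed[OF assms(1)], of u, unfolded pq] assms(3) lt
      num_vertices_contract[OF assms(2) good_typed[OF assms(1)]] by (simp add: vdeg_def pq)
qed

text \<open>If the relabeling involves the contracted edge or the removed vertex, it disappears and
  its sign is absorbed by the contraction sign; otherwise it survives on the contracted graph with
  the same sign \<open>s\<close>. In both cases the term of \<open>H\<close> is \<open>s\<close>
  times that of \<open>G\<close> modulo relations.\<close>

lemma contract_rstep:
  assumes "good G" "good H" "rstep G H vp ep s" "contractible b G l"
  shows "(contract H (ep l) = contract G l \<and> (\<forall>v. cmap H (ep l) (vp v) = cmap G l v) \<and>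
      csign H (ep l) = s * csign G l) \<or>
    (\<exists>vp' ep'. rstep (contract G l) (contract H (ep l)) vp' ep' s \<and>
      (\<forall>v. cmap H (ep l) (vp v) = vp' (cmap G l v)) \<and>
      csign H (ep l) = csign G l)"
proof -
  note l = contractible_less[OF assms(4)]
  note cH = contractible_rstep[OF assms(1,3,4)]
  note sgG = contraction_sign_eq[OF assms(1,4)] and sgH = contraction_sign_eq[OF assms(2) cH]
  have ne: "src_at G l \<noteq> tgt_at G l" "src (edges H ! ep l) \<noteq> tgt (edges H ! ep l)"
    using assms(4) cH by (auto simp: contractible_def)
  note cG_eq = contract_eq[OF ne(1)] and cH_eq = contract_eq[OF ne(2)]
  note nums = rstep_num[OF assms(3)]
  show ?thesis using assms(3)
  proof cases
    case (edges i)
    let ?T = "transpose i (Suc i)"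
    have eH: "edges H = swap_adjacent i (edges G)" "vkinds H = vkinds G"
      using edges by (simp_all add: swap_edges_def)
    have nH: "edges H ! m = edges G ! ?T m" if "m < num_edges G" for m
      using that edges(5) by (simp add: eH nth_swap_adjacent)
    have same: "edges H ! ep l = edges G ! l" using edges l nH[of "ep l"] by (simp add: transpose_Suc_less)
    hence cm: "cmap H (ep l) = cmap G l" by (simp add: cmap_def)
    have esum: "edeg_sum H = edeg_sum G" using sum_transpose_all[OF edges(5), of "edeg G"] nums
      by (simp add: edeg_sum_def edeg_def nH)
    have aft: "edeg_after H m = (if m = i then edeg G i + edeg_after G (Suc i) else edeg_after G m)" for m
      using sum_transpose_after[OF edges(5), of "edeg G" m] nums by (simp add: edeg_after_def edeg_def nH)
    have vaft: "vdeg_after H v = vdeg_after G v" for v by (simp add: vdeg_after_def vdeg_def eH)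
    have ed: "edeg H (ep l) = edeg G l" by (simp add: edeg_def same)
    note dl = del_at_swap_adjacent[OF edges(5) l]
    note cH' = cH_eq[unfolded same cm eH(2)]
    show ?thesis
    proof (cases "l = i \<or> l = Suc i")
      case True
      hence "contract H (ep l) = contract G l" using dl unfolding cG_eq cH' by (simp add: eH(1) edges(3))
      moreover have "sgn_pow (csign_exp H (ep l)) = s * sgn_pow (csign_exp G l)"
        unfolding edges(4) sgn_pow_mult
      proof (rule sgn_pow_eqI)
        have "edeg_after G i = edeg G (Suc i) + edeg_after G (Suc i)"
          unfolding edeg_after_def by (rule sum_after_Suc[OF edges(5)])
        thus "even (csign_exp H (ep l) - (edeg G i * edeg G (Suc i) + csign_exp G l))"
          using True unfolding csign_exp_def esum vaft ed same unfolding aft edges(3)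
          by (auto simp: transpose_def ring_distribs)
      qed
      ultimately show ?thesis using cm edges(2) unfolding sgG sgH by simp
    next
      case False
      let ?i = "after_del l i"
      have i': "after_del l (Suc i) = Suc ?i" using False by (auto simp: after_del_def)
      have il: "i \<noteq> l" "Suc i \<noteq> l" "i < num_edges G" using False edges(5) by auto
      have epl: "ep l = l" using False edges(3) by (simp add: transpose_def)
      have len: "Suc ?i < num_edges (contract G l)"
        using nth_edges_after_del(2)[OF assms(4) edges(5) il(2)] i' by simp
      have "contract H (ep l) = swap_edges ?i (contract G l)"
        using dl False len num_edges_contract[OF assms(4)] l unfolding cG_eq cH' swap_edges_def
        by (simp add: eH(1) edges(3) map_swap_adjacent)
      moreover have "s = sgn_pow (edeg (contract G l) ?i * edeg (contract G l) (Suc ?i))"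
        using nth_edges_after_del(1)[OF assms(4) edges(5) il(2)] nth_edges_after_del(1)[OF assms(4) il(3,1)]
        by (simp add: edges(4) edeg_def i')
      moreover have "csign_exp H (ep l) = csign_exp G l"
        using False unfolding csign_exp_def esum vaft ed[unfolded epl] same[unfolded epl] aft epl by simp
      ultimately have "rstep (contract G l) (contract H (ep l)) id (transpose ?i (Suc ?i)) s"
        "csign H (ep l) = csign G l" using rstep.edges[OF len] unfolding sgG sgH by simp_all
      thus ?thesis using cm edges(2) by (intro disjI2) auto
    qed
  next
    case (reverse i)
    have eH: "edges H = (edges G)[i := flip_edge (edges G ! i)]" "vkinds H = vkinds G"
      using reverse by (simp_all add: reverse_edge_def flip_edge_def)
    have epl: "ep l = l" using reverse by simp
    have nH: "edges H ! m = (if m = i then flip_edge (edges G ! i) else edges G ! m)" if "m < num_edges G" for m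
      using that by (simp add: eH nth_list_update)
    have mm: "cmin H l = cmin G l" "cmax H l = cmax G l"
      using nH[OF l] by (auto simp: flip_edge_def min.commute max.commute)
    hence cm: "cmap H l = cmap G l" by (simp add: cmap_def)
    have edH: "edeg H m = edeg G m" if "m < num_edges G" for m
      using nH[OF that] by (simp add: edeg_def flip_edge_def)
    have sums: "edeg_sum H = edeg_sum G" "edeg_after H m = edeg_after G m" for m
      using nums edH by (auto simp: edeg_sum_def edeg_after_def intro!: sum.cong)
    have vaft: "vdeg_after H v = vdeg_after G v" for v by (simp add: vdeg_after_def vdeg_def eH)
    note dl = del_at_list_update[OF l reverse(5), of "flip_edge (edges G ! i)"]
    note cH' = cH_eq[unfolded epl mm cm eH(2)]
    show ?thesis
    proof (cases "l = i")
      case True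
      hence "contract H l = contract G l" using dl unfolding cG_eq cH' by (simp add: eH(1))
      moreover have "sgn_pow (csign_exp H l) = s * sgn_pow (csign_exp G l)"
        unfolding reverse(4) sgn_pow_mult
      proof (rule sgn_pow_eqI)
        show "even (csign_exp H l - (edeg G i + 1 + csign_exp G l))"
          unfolding csign_exp_def sums vaft mm edH[OF l] nH[OF l]
          using True ne(1) by (auto simp: flip_edge_def)
      qed
      ultimately show ?thesis using cm reverse(2) epl unfolding sgG sgH by simp
    next
      case False
      let ?i = "after_del l i"
      have len: "?i < num_edges (contract G l)"
        using nth_edges_after_del(2)[OF assms(4) reverse(5)] False by simp
      have nth: "edges (contract G l) ! ?i = relabel_edge (cmap G l) (edges G ! i)"
        using nth_edges_after_del(1)[OF assms(4) reverse(5)] False by simp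
      have "contract H l = reverse_edge ?i (contract G l)"
        using dl False nth unfolding cG_eq cH' reverse_edge_def
        by (simp add: eH(1) map_update flip_edge_def relabel_edge_def)
      moreover have "s = sgn_pow (edeg (contract G l) ?i + 1)" by (simp add: reverse(4) edeg_def nth)
      moreover have "csign_exp H l = csign_exp G l"
        using False unfolding csign_exp_def sums vaft mm edH[OF l] nH[OF l] by simp
      ultimately have "rstep (contract G l) (contract H (ep l)) id id s"
        "csign H (ep l) = csign G l"
        using rstep.reverse[OF len] unfolding sgG sgH[unfolded epl] epl by simp_all
      thus ?thesis using cm reverse(2) epl by (intro disjI2) auto
    qed
  next
    case (vertices v)
    let ?T = "transpose v (Suc v)"
    let ?N = "num_vertices G"
    obtain p q where pq: "cmin G l = p" "cmax G l = q" by blast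
    have lt: "p < q" using cmin_less_cmax[OF assms(4)] by (simp only: pq)
    have qN: "q < ?N" using cmax_less[OF good_typed[OF assms(1)] l] by (simp only: pq)
    have eH: "edges H = map (relabel_edge ?T) (edges G)" "vkinds H = swap_adjacent v (vkinds G)"
      using vertices by (simp_all add: swap_vertices_def)
    have epl: "ep l = l" using vertices by simp
    have nE: "edges H ! l = relabel_edge ?T (edges G ! l)" using l by (simp add: eH)
    have nV: "vkind H w = vkinds G ! ?T w" if "w < ?N" for w
      using that vertices(5) by (simp add: eH nth_swap_adjacent)
    have edH: "edeg H m = edeg G m" if "m < num_edges G" for m using that by (simp add: edeg_def eH)
    have sums: "edeg_sum H = edeg_sum G" "edeg_after H m = edeg_after G m" for m
      using nums edH by (auto simp: edeg_sum_def edeg_after_def intro!: sum.cong)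
    have vaft: "vdeg_after H w = (if w = v then vdeg G v + vdeg_after G (Suc v) else vdeg_after G w)" for w
      using sum_transpose_after[OF vertices(5), of "vdeg G" w] nums
      by (simp add: vdeg_after_def vdeg_def nV)
    have vaftv: "vdeg_after G v = vdeg G (Suc v) + vdeg_after G (Suc v)"
      unfolding vdeg_after_def by (rule sum_after_Suc[OF vertices(5)])
    have sge: "(src_at G l = p \<and> tgt_at G l = q) \<or> (src_at G l = q \<and> tgt_at G l = p)"
      using pq by (auto simp: min_def max_def split: if_splits)
    have mapdel: "map (relabel_edge (cmap H l)) (del_at l (edges H)) =
        map (relabel_edge (cmap H l \<circ> ?T)) (del_at l (edges G))"
      unfolding eH map_del_at map_map by (simp add: comp_def relabel_edge_comp)
    have vq: "vdeg G q = - (edeg G l + 1)" using vdeg_cmax[OF assms(1,4)] by (simp only: pq)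
    have "swap_adjacent v ((vkinds G)[p := k]) = (vkinds H)[?T p := k]" for k
      using vertices(5) lt qN unfolding eH by (intro nth_equalityI) (auto simp: nth_swap_adjacent nth_list_update transpose_def)
    hence del: "del_at (?T q) ((vkinds H)[?T p := k]) = (if q = v \<or> q = Suc v then del_at q ((vkinds G)[p := k])
        else swap_adjacent (after_del q v) (del_at q ((vkinds G)[p := k])))" for k
      using del_at_swap_adjacent[of v "(vkinds G)[p := k]" q] vertices(5) qN by simp
    \<comment> \<open>(A) the swapped vertices are the two ends of the edge; (B) the removed end is
      swapped, the kept one is not; (D) the removed end comes after both swapped vertices; (E) it
      comes before both.\<close>
    consider (A) "p = v" "q = Suc v" | (B) "q = v \<or> q = Suc v \<and> p < v" | (D) "Suc v < q" | (E) "q < v"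
      using lt by linarith
    thus ?thesis
    proof cases
      case A
      have mm: "cmin H l = v" "cmax H l = Suc v" using sge A by (auto simp: nE)
      have cm: "cmap H l (?T w) = cmap G l w" for w
        unfolding cmap_def mm pq using A merge_transpose(1)[of v w] by simp
      \<comment> \<open>Since both labels put black vertices before white ones, swapped neighbours
        are both black or both white. The sign of the swap is then the orientation sign of the edge,
        whose ends trade places in the numbering.\<close>
      have cls: "vkind G p = White \<longleftrightarrow> vkind G q = White"
      proof
        assume "vkind G p = White"
        thus "vkind G q = White" using assms(1) lt qN unfolding good_iff well_labeled_def by blast
      next
        assume "vkind G q = White"
        hence "vkind H v = White" using A nV[of v] qN by simp
        hence "vkinds H ! Suc v = White"
          using assms(2) vertices(5) nums unfolding good_iff well_labeled_def by (metis lessI)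
        thus "vkind G p = White" using A nV[of "Suc v"] qN by simp
      qed
      have K: "merged_kind (vkind G q) (vkind G p) = merged_kind (vkind G p) (vkind G q)"
        using cls by (cases "vkind G p"; cases "vkind G q") (auto simp: merged_kind_def)
      have "del_at (Suc v) ((vkinds H)[v := k]) = del_at (Suc v) ((vkinds G)[v := k])" for k
        using vertices(5) nums
        by (intro nth_equalityI) (auto simp: nth_del_at nth_list_update nV transpose_def)
      hence "contract H l = contract G l" using cH_eq[unfolded epl] qN A K unfolding cG_eq mapdel
        by (simp add: mm pq nV cm comp_def)
      moreover have "sgn_pow (csign_exp H l) = s * sgn_pow (csign_exp G l)"
        unfolding vertices(4) sgn_pow_mult
      proof (rule sgn_pow_eqI)
        have "vdeg G v = vdeg G (Suc v)"
          using cls A by (cases "vkind G p"; cases "vkind G q") (auto simp: vdeg_def)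
        thus "even (csign_exp H l - (vdeg G v * vdeg G (Suc v) + csign_exp G l))"
          unfolding csign_exp_def sums vaft mm pq edH[OF l] nE using A vq sge by (auto simp: ring_distribs)
      qed
      ultimately show ?thesis using cm vertices(2) epl unfolding sgG sgH by simp
    next
      case B
      have mm: "cmin H l = p" "cmax H l = ?T q" using sge B lt by (auto simp: nE transpose_def)
      have cm: "cmap H l (?T w) = cmap G l w" for w
        unfolding cmap_def mm pq using B lt merge_transpose(2,3)[of p v w] by auto
      have "del_at (?T q) ((vkinds H)[p := k]) = del_at q ((vkinds G)[p := k])" for k
        using del[of k] lt B by (auto simp: transpose_def split: if_splits)
      hence "contract H l = contract G l"
        using cH_eq[unfolded epl] qN lt vertices(5) B unfolding cG_eq mapdel
        by (auto simp: mm pq nV cm comp_def)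
      moreover have "sgn_pow (csign_exp H l) = s * sgn_pow (csign_exp G l)"
        unfolding vertices(4) sgn_pow_mult
      proof (rule sgn_pow_eqI)
        show "even (csign_exp H l - (vdeg G v * vdeg G (Suc v) + csign_exp G l))"
          unfolding csign_exp_def sums vaft mm pq edH[OF l] nE
          using B vq sge lt vaftv by (auto simp: ring_distribs transpose_def)
      qed
      ultimately show ?thesis using cm vertices(2) epl unfolding sgG sgH by simp
    next
      case D
      have mm: "cmin H l = ?T p" "cmax H l = q" using sge D lt by (auto simp: nE transpose_def)
      have cm: "cmap H l (?T w) = ?T (cmap G l w)" for w
        unfolding cmap_def mm pq using D lt merge_transpose(4)[of v q p w] by simp
      have nvc: "num_vertices (contract G l) = ?N - 1"
        using num_vertices_contract[OF assms(4) good_typed[OF assms(1)]] .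
      have "del_at q ((vkinds H)[?T p := k]) = swap_adjacent v (del_at q ((vkinds G)[p := k]))" for k
        using del[of k] D by (simp add: after_del_def)
      hence "contract H l = swap_vertices v (contract G l)"
        using cH_eq[unfolded epl] qN lt D transpose_Suc_less[OF vertices(5), of p]
        unfolding cG_eq mapdel swap_vertices_def by (simp add: mm pq nV cm comp_def relabel_edge_def)
      moreover have len: "Suc v < num_vertices (contract G l)" using D qN nvc by simp
      moreover have "vdeg (contract G l) w = vdeg G w" if "w < q" for w
        using vdeg_cmap[OF assms(1,4), of w, unfolded pq] that qN nvc by simp
      hence "s = sgn_pow (vdeg (contract G l) v * vdeg (contract G l) (Suc v))"
        using D by (simp add: vertices(4))
      moreover have "sgn_pow (csign_exp H l) = sgn_pow (csign_exp G l)"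
        unfolding csign_exp_def sums vaft mm pq edH[OF l] nE using D sge lt by (auto simp: transpose_def)
      ultimately have "rstep (contract G l) (contract H (ep l)) ?T id s"
        "csign H (ep l) = csign G l"
        using rstep.vertices[OF len] unfolding sgG sgH[unfolded epl] epl by simp_all
      thus ?thesis using cm vertices(2) epl by (intro disjI2) auto
    next
      case E
      let ?T' = "transpose (v - 1) v"
      have mm: "cmin H l = p" "cmax H l = q" using sge E lt by (auto simp: nE transpose_def)
      have cm: "cmap H l (?T w) = ?T' (cmap G l w)" for w
        unfolding cmap_def mm pq using E lt merge_transpose(5)[of p q v w] by simp
      have nvc: "num_vertices (contract G l) = ?N - 1"
        using num_vertices_contract[OF assms(4) good_typed[OF assms(1)]] .
      have Sv: "Suc (v - 1) = v" using E by simp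
      have Tpq: "?T p = p" "?T q = q" using E lt by (auto simp: transpose_def)
      have "del_at q ((vkinds H)[p := k]) = swap_adjacent (v - 1) (del_at q ((vkinds G)[p := k]))" for k
        using del[of k] E by (simp add: after_del_def Tpq)
      hence "contract H l = swap_vertices (v - 1) (contract G l)" using cH_eq[unfolded epl] qN lt Tpq
        unfolding cG_eq mapdel swap_vertices_def Sv by (simp add: mm pq nV cm comp_def relabel_edge_def)
      moreover have len: "Suc (v - 1) < num_vertices (contract G l)" using E vertices(5) nvc by simp
      moreover have "vdeg (contract G l) w = vdeg G (Suc w)" if "q \<le> w" "w < ?N - 1" for w
        using vdeg_cmap[OF assms(1,4), of w, unfolded pq] that nvc by simp
      hence "s = sgn_pow (vdeg (contract G l) (v - 1) * vdeg (contract G l) (Suc (v - 1)))"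
        using E vertices(5) by (simp add: vertices(4))
      moreover have "sgn_pow (csign_exp H l) = sgn_pow (csign_exp G l)"
        unfolding csign_exp_def sums vaft mm pq edH[OF l] nE using E sge lt by (auto simp: transpose_def)
      ultimately have "rstep (contract G l) (contract H (ep l)) ?T' id s"
        "csign H (ep l) = csign G l"
        using rstep.vertices[OF len] unfolding sgG sgH[unfolded epl] epl Sv by simp_all
      thus ?thesis using cm vertices(2) epl by (intro disjI2) auto
    qed
  qed
qed

section \<open>The differential on graphs with marked vertices\<close>

definition contractions :: "bool \<Rightarrow> lgraph \<Rightarrow> nat set"
  where "contractions b G = {l. contractible b G l}"

lemma finite_contractions [simp]: "finite (contractions b G)"
  by (rule finite_subset[of _ "{..<num_edges G}"]) (auto simp: contractions_def contractible_def)

definition cterm :: "dgraph \<Rightarrow> nat \<Rightarrow> (dgraph \<Rightarrow>\<^sub>0 rat)"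
  where "cterm X l = single (contract (fst X) l, map (cmap (fst X) l) (snd X))
    (csign (fst X) l)"

definition ddiff :: "bool \<Rightarrow> dgraph \<Rightarrow> (dgraph \<Rightarrow>\<^sub>0 rat)"
  where "ddiff b X = (\<Sum>l\<in>contractions b (fst X). cterm X l)"

lemma cterm_rstep:
  assumes "good G" "good H" "rstep G H vp ep s" "contractible b G l"
  shows "cterm (H, map vp ms) (ep l) - scale_rat s (cterm (G, ms) l) \<in> rv.span (dec_relations)"
  using contract_rstep[OF assms]
proof (elim disjE exE conjE)
  assume "contract H (ep l) = contract G l" "\<forall>v. cmap H (ep l) (vp v) = cmap G l v"
    "csign H (ep l) = s * csign G l"
  thus ?thesis by (simp add: cterm_def comp_def rv.span_zero)
next
  fix vp' ep'
  assume *: "rstep (contract G l) (contract H (ep l)) vp' ep' s"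
    "\<forall>v. cmap H (ep l) (vp v) = vp' (cmap G l v)" "csign H (ep l) = csign G l"
  have "good (contract G l)" "good (contract H (ep l))"
    using good_contract assms contractible_rstep[OF assms(1,3,4)] by auto
  with *(1) have "bv (contract H (ep l), map vp' (map (cmap G l) ms)) -
      single (contract G l, map (cmap G l) ms) s \<in> dec_relations" unfolding dec_relations_def by blast
  from rv.span_scale[OF rv.span_base[OF this], of "csign G l"] show ?thesis
    using *(2,3) by (simp add: cterm_def rv.scale_right_diff_distrib comp_def mult.commute)
qed

lemma contractions_rstep:
  assumes "good G" "good H" "rstep G H vp ep s"
  shows "contractions b H = ep ` contractions b G"
proof
  show "ep ` contractions b G \<subseteq> contractions b H"
    using contractible_rstep[OF assms(1,3)] by (auto simp: contractions_def)
  show "contractions b H \<subseteq> ep ` contractions b G"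
  proof
    fix l' assume "l' \<in> contractions b H"
    hence c: "contractible b H l'" by (simp add: contractions_def)
    obtain l where l: "l' = ep l" using rstep_bij(3)[OF assms(3)] by (metis bij_pointE)
    hence lG: "l < num_edges G"
      using contractible_less[OF c] rstep_bij(4)[OF assms(3)] rstep_num[OF assms(3)] by simp
    have "\<exists>v\<in>ends_at G l. vkind G v \<noteq> ExtBlack"
      if ex: "\<exists>v\<in>ends (edges H ! ep l). vkind H v \<noteq> ExtBlack"
    proof -
      from ex obtain v where "v \<in> ends_at G l" "vkinds H ! vp v \<noteq> ExtBlack"
        by (auto simp: nth_edges_rstep'(2)[OF assms(3) lG])
      thus ?thesis using nth_vkinds_rstep[OF assms(3)] ends_bounded[OF good_typed[OF assms(1)] lG] by metis
    qed
    hence "contractible b G l" using c lG unfolding l contractible_def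
      by (auto simp: nth_edges_rstep'(1,3)[OF assms(3) lG])
    thus "l' \<in> ep ` contractions b G" using l by (auto simp: contractions_def)
  qed
qed

lemma ddiff_relations:
  assumes "r \<in> dec_relations"
  shows "lin (ddiff b) r \<in> rv.span (dec_relations)"
proof -
  obtain G H vp ep s ms where r: "r = bv (H, map vp ms) - single (G, ms) s"
    and g: "good G" "good H" "rstep G H vp ep s" using assms by (auto simp: dec_relations_def)
  have "ddiff b (H, map vp ms) = (\<Sum>l\<in>contractions b G. cterm (H, map vp ms) (ep l))"
    unfolding ddiff_def using rstep_bij(3)[OF g(3)]
    by (simp add: contractions_rstep[OF g] sum.reindex[OF inj_on_subset[OF bij_is_inj]])
  hence "lin (ddiff b) r = (\<Sum>l\<in>contractions b G.
      cterm (H, map vp ms) (ep l) - scale_rat s (cterm (G, ms) l))"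
    by (simp add: r lin_diff sum_subtractf rv.scale_sum_right ddiff_def)
  also have "\<dots> \<in> rv.span (dec_relations)"
    using cterm_rstep[OF g] by (intro rv.span_sum) (auto simp: contractions_def)
  finally show ?thesis .
qed

text \<open>The kinds after contraction are expressed through the fibres of \<open>cmap\<close>
  alone. In this form two successive contractions can be compared regardless of their order.\<close>

lemma contract_kind_fibre:
  assumes "good G" "contractible b G l" "v < num_vertices G"
  shows "vkinds (contract G l) ! cmap G l v = ExtBlack \<longleftrightarrow>
      (\<exists>w<num_vertices G. cmap G l w = cmap G l v \<and> vkind G w = ExtBlack)"
    and "vkinds (contract G l) ! cmap G l v \<noteq> ExtBlack \<Longrightarrow> vkinds (contract G l) ! cmap G l v = vkind G v"
proof -
  obtain p q where pq: "cmin G l = p" "cmax G l = q" by blast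
  have lt: "p < q" using cmin_less_cmax[OF assms(2)] by (simp only: pq)
  have qN: "q < num_vertices G"
    using cmax_less[OF good_typed[OF assms(1)] contractible_less[OF assms(2)]] by (simp only: pq)
  have r: "cmap G l = merge p q" by (simp only: cmap_def pq)
  have ends: "ends_at G l = {p, q}" by (simp only: ends_min_max pq)
  have k: "vkinds (contract G l) ! cmap G l v = (if v \<in> {p, q} then merged_kind (vkind G p) (vkind G q) else vkind G v)"
    using vkinds_contract_cmap[OF assms(2) good_typed[OF assms(1)] assms(3), unfolded pq ends] .
  have iff: "cmap G l w = cmap G l v \<longleftrightarrow> w = v \<or> w \<in> {p, q} \<and> v \<in> {p, q}" for w
    unfolding r merge_eq_iff[OF lt] by (auto simp: doubleton_eq_iff)
  show "vkinds (contract G l) ! cmap G l v = ExtBlack \<longleftrightarrow>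
      (\<exists>w<num_vertices G. cmap G l w = cmap G l v \<and> vkind G w = ExtBlack)"
  proof -
    have "p < num_vertices G" using lt qN by simp
    hence "(if v \<in> {p, q} then vkind G p = ExtBlack \<or> vkind G q = ExtBlack else vkind G v = ExtBlack)
      \<longleftrightarrow> (\<exists>w<num_vertices G. (w = v \<or> w \<in> {p, q} \<and> v \<in> {p, q}) \<and> vkind G w = ExtBlack)"
      using qN assms(3) by (cases "v \<in> {p, q}"; simp only: if_True if_False; blast)
    thus ?thesis unfolding iff k by (simp add: merged_kind_def) metis
  qed
  show "vkinds (contract G l) ! cmap G l v = vkind G v" if "vkinds (contract G l) ! cmap G l v \<noteq> ExtBlack"
    using that edge_classes[OF assms(1,2), unfolded pq] unfolding k
    by (cases "kind_at G l"; cases "vkind G p"; cases "vkind G q") (auto simp: merged_kind_def split: if_splits)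
qed

lemma cmap_less:
  assumes "good G" "contractible b G l" "v < num_vertices G"
  shows "cmap G l v < num_vertices (contract G l)"
  unfolding num_vertices_contract[OF assms(2) good_typed[OF assms(1)]] cmap_def
  using cmin_less_cmax[OF assms(2)] cmax_less[OF good_typed[OF assms(1)] contractible_less[OF assms(2)]] assms(3)
  by (rule merge_less)

lemma cmap_surj:
  assumes "good G" "contractible b G l" "u < num_vertices (contract G l)"
  obtains v where "v < num_vertices G" "cmap G l v = u"
proof
  show "(if u < cmax G l then u else Suc u) < num_vertices G"
    using assms(3) num_vertices_contract[OF assms(2) good_typed[OF assms(1)]] by auto
  show "cmap G l (if u < cmax G l then u else Suc u) = u"
    unfolding cmap_def by (rule merge_inv[OF cmin_less_cmax[OF assms(2)]])
qed

lemma vdeg_after_contract: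
  assumes "good G" "contractible b G l" "u < num_vertices (contract G l)"
  shows "vdeg_after (contract G l) u =
    (if u < cmax G l then vdeg_after G u - vdeg G (cmax G l) else vdeg_after G (Suc u))"
proof -
  obtain q where q: "cmax G l = q" by blast
  have qN: "q < num_vertices G"
    using cmax_less[OF good_typed[OF assms(1)] contractible_less[OF assms(2)]] by (simp only: q)
  note nv = num_vertices_contract[OF assms(2) good_typed[OF assms(1)]]
  define o' where "o' w = (if w < q then w else Suc w)" for w
  have "vdeg_after (contract G l) u = (\<Sum>w\<in>{u<..<num_vertices G - 1}. vdeg G (o' w))"
    unfolding vdeg_after_def nv by (rule sum.cong) (auto simp: vdeg_cmap[OF assms(1,2)] nv o'_def q)
  also have "\<dots> = (\<Sum>w\<in>{o' u<..<num_vertices G} - {q}. vdeg G w)"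
    by (rule sum.reindex_bij_witness[of _ "\<lambda>w. if w < q then w else w - 1" o'])
      (use qN in "auto simp: o'_def split: if_splits")
  also have "\<dots> = vdeg_after G (o' u) - (if o' u < q then vdeg G q else 0)"
    using qN by (simp add: vdeg_after_def sum_diff1)
  finally show ?thesis by (auto simp: o'_def q)
qed

lemma edeg_contract:
  assumes "contractible b G i" "m < num_edges G" "m \<noteq> i"
  shows "edeg (contract G i) (after_del i m) = edeg G m"
  using nth_edges_after_del(1)[OF assms] by (simp add: edeg_def)

lemma edeg_sum_contract:
  assumes "contractible b G i"
  shows "edeg_sum (contract G i) = edeg_sum G - edeg G i"
proof -
  have "edge_degrees n j (contract G i) = del_at i (edge_degrees n j G)"
    unfolding edge_degrees_def edges_contract[OF assms] by (simp add: map_del_at comp_def)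
  thus ?thesis using sum_list_del_at[of i "edge_degrees n j G"] contractible_less[OF assms]
    by (simp add: edge_degrees_nth flip: sum_edge_degrees)
qed

lemma edeg_after_contract:
  assumes "contractible b G i" "m < num_edges G" "m \<noteq> i"
  shows "edeg_after (contract G i) (after_del i m) = edeg_after G m - (if m < i then edeg G i else 0)"
proof -
  note i = contractible_less[OF assms(1)]
  note ne = num_edges_contract[OF assms(1)]
  have "edeg_after (contract G i) (after_del i m) = (\<Sum>k\<in>{m<..<num_edges G} - {i}. edeg G k)"
    unfolding edeg_after_def ne
    by (rule sum.reindex_bij_witness[of _ "after_del i" "\<lambda>k. if k < i then k else Suc k"])
      (use i assms in "auto simp: after_del_def edeg_contract[OF assms(1), symmetric] split: if_splits")
  thus ?thesis using i by (simp add: edeg_after_def sum_diff1)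
qed

lemma del_at_del_at:
  assumes "i < length xs" "k < length xs" "i \<noteq> k"
  shows "del_at (after_del i k) (del_at i xs) = del_at (after_del k i) (del_at k xs)"
  using assms by (intro nth_equalityI) (auto simp: nth_del_at after_del_def)

text \<open>Parallel edges are excluded because contracting one makes the other a loop. The
  remaining danger is that the first contraction turns the internal end of the other edge into an
  external one.\<close>

lemma contractible_contract_sym:
  assumes "good G" "contractible b G i" "contractible b (contract G i) (after_del i k)" "k < num_edges G" "k \<noteq> i"
  shows "contractible b G k" "contractible b (contract G k) (after_del k i)" "ends_at G i \<noteq> ends_at G k"
proof -
  note t = good_typed[OF assms(1)]
  note i = contractible_less[OF assms(2)]
  obtain p q where pq: "cmin G i = p" "cmax G i = q" by blast
  have lt: "p < q" using cmin_less_cmax[OF assms(2)] by (simp only: pq)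
  have e: "ends_at G i = {p, q}" by (simp only: ends_min_max pq)
  obtain x y where xy: "src_at G k = x" "tgt_at G k = y" by blast
  have f: "ends_at G k = {x, y}" by (simp add: ends_def xy)
  have N: "p < num_vertices G" "q < num_vertices G" "x < num_vertices G" "y < num_vertices G"
    using ends_bounded[OF t i] ends_bounded[OF t assms(4)] e f by auto
  note nf = nth_edges_after_del(1)[OF assms(2,4,5)]
  have r: "cmap G i = merge p q" by (simp only: cmap_def pq)
  have "merge p q x \<noteq> merge p q y" using assms(3) unfolding contractible_def nf by (simp add: xy r)
  hence nl: "x \<noteq> y" "{x, y} \<noteq> {p, q}" using lt by (auto simp: doubleton_eq_iff)
  thus "ends_at G i \<noteq> ends_at G k" by (simp add: e f)
  have kd: "vkinds (contract G i) ! merge p q v = (if v \<in> {p, q} then merged_kind (vkind G p) (vkind G q) else vkind G v)"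
    if "v < num_vertices G" for v using vkinds_contract_cmap[OF assms(2) t that, unfolded pq e r] .
  have Pe: "(\<exists>v\<in>{p, q}. vkind G v \<noteq> ExtBlack) \<or> b \<and> kind_at G i = Solid"
    using assms(2) unfolding contractible_def e by blast
  have Pf: "(\<exists>v\<in>{x, y}. (if v \<in> {p, q} then vkind G p \<noteq> ExtBlack \<and> vkind G q \<noteq> ExtBlack else vkind G v \<noteq> ExtBlack))
      \<or> b \<and> kind_at G k = Solid" using assms(3) N unfolding contractible_def nf ends_def
    by (auto simp: xy r kd merged_kind_def split: if_splits)
  thus ck: "contractible b G k"
    using assms(4) nl(1) unfolding contractible_def f by (auto simp: xy split: if_splits)
  obtain p' q' where pq': "cmin G k = p'" "cmax G k = q'" by blast
  have lt': "p' < q'" using cmin_less_cmax[OF ck] by (simp only: pq')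
  have f': "{p', q'} = {x, y}" using f by (simp only: ends_min_max pq')
  have r': "cmap G k = merge p' q'" by (simp only: cmap_def pq')
  note ne = nth_edges_after_del[OF ck i assms(5)[symmetric]]
  have st: "{src_at G i, tgt_at G i} = {p, q}" using e by (simp add: ends_def)
  have kd': "vkinds (contract G k) ! merge p' q' v = (if v \<in> {p', q'} then merged_kind (vkind G p') (vkind G q') else vkind G v)"
    if "v < num_vertices G" for v using vkinds_contract_cmap[OF ck t that, unfolded pq' ends_min_max r'] .
  have typd: "\<not> (kind_at G i = Dashed \<and> kind_at G k = Solid \<and> v \<in> {p, q} \<and> v \<in> {x, y} \<and> vkind G v \<noteq> ExtBlack)" for v
  proof
    assume *: "kind_at G i = Dashed \<and> kind_at G k = Solid \<and> v \<in> {p, q} \<and> v \<in> {x, y} \<and> vkind G v \<noteq> ExtBlack"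
    hence "vkind G v \<noteq> IntBlack" "vkind G v \<noteq> White"
      using t nth_mem[OF i] nth_mem[OF assms(4)] unfolding typed_def e[symmetric] f[symmetric] by blast+
    with * show False by (cases "vkind G v") auto
  qed
  have "(\<exists>v\<in>{p, q}. (if v \<in> {x, y} then vkind G x \<noteq> ExtBlack \<and> vkind G y \<noteq> ExtBlack else vkind G v \<noteq> ExtBlack))
      \<or> b \<and> kind_at G i = Solid"
  \<comment> \<open>If \<open>i\<close> is no longer contractible after \<open>k\<close>, then its
    internal end \<open>u\<close> is shared with \<open>k\<close> and the far ends \<open>u'\<close>
    and \<open>z\<close> are external. Contracting \<open>i\<close> first makes \<open>k\<close> an
    edge between external vertices, so \<open>k\<close> is solid, \<open>b\<close> holds and
    \<open>i\<close> is dashed; but \<open>u\<close> cannot be an internal end of edges of both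
    kinds.\<close>
  proof (rule ccontr)
    assume neg: "\<not> ?thesis"
    then obtain u where u: "u \<in> {p, q}" "vkind G u \<noteq> ExtBlack" using Pe by blast
    have neg1: "\<forall>v\<in>{p, q}. \<not> (if v \<in> {x, y} then vkind G x \<noteq> ExtBlack \<and> vkind G y \<noteq> ExtBlack
        else vkind G v \<noteq> ExtBlack)" using neg by blast
    have ux: "u \<in> {x, y}" using neg1[rule_format, OF u(1)] u(2) by (cases "u \<in> {x, y}") simp_all
    obtain u' where u': "{u, u'} = {p, q}" using u by blast
    obtain z where z: "{u, z} = {x, y}" using ux by blast
    have u'u: "u' \<noteq> u" using u' lt by (metis doubleton_eq_iff less_irrefl)
    have zu: "z \<noteq> u" using z nl(1) by (metis doubleton_eq_iff)
    have u'x: "u' \<notin> {x, y}"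
    proof
      assume "u' \<in> {x, y}"
      hence "u' = z" using z u'u by blast
      thus False using u' z nl(2) by simp
    qed
    have zp: "z \<notin> {p, q}"
    proof
      assume "z \<in> {p, q}"
      hence "u' = z" using u' zu by blast
      thus False using u' z nl(2) by simp
    qed
    have "u' \<in> {p, q}" using u' by blast
    from neg1[rule_format, OF this] u'x have u'E: "vkind G u' = ExtBlack" by simp
    have "\<not> (vkind G x \<noteq> ExtBlack \<and> vkind G y \<noteq> ExtBlack)"
      using neg1[rule_format, OF u(1)] ux by (simp only: if_True) blast
    hence "\<exists>v\<in>{u, z}. vkind G v = ExtBlack" unfolding z by blast
    hence zE: "vkind G z = ExtBlack" using u(2) by blast
    have pqE: "\<not> (vkind G p \<noteq> ExtBlack \<and> vkind G q \<noteq> ExtBlack)"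
      using u'E \<open>u' \<in> {p, q}\<close> by blast
    have bf: "b \<and> kind_at G k = Solid"
    proof (rule ccontr)
      assume "\<not> ?thesis"
      then obtain v where v: "v \<in> {u, z}" "if v \<in> {p, q} then vkind G p \<noteq> ExtBlack \<and> vkind G q \<noteq> ExtBlack
          else vkind G v \<noteq> ExtBlack" using Pf unfolding z by blast
      thus False using pqE zE zp u(1) by (cases "v \<in> {p, q}") auto
    qed
    hence "kind_at G i = Dashed" using neg by (cases "kind_at G i") auto
    thus False using typd[of u] bf u ux by blast
  qed
  hence "(\<exists>v\<in>{p, q}. (if v \<in> {p', q'} then vkind G p' \<noteq> ExtBlack \<and> vkind G q' \<noteq> ExtBlack else vkind G v \<noteq> ExtBlack))
      \<or> b \<and> kind_at G i = Solid" using f' by (auto simp: doubleton_eq_iff)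
  hence "(\<exists>v\<in>{p, q}. vkinds (contract G k) ! merge p' q' v \<noteq> ExtBlack) \<or> b \<and> kind_at G i = Solid"
    using kd' N by (auto simp: merged_kind_def split: if_splits)
  moreover have "ends (edges (contract G k) ! after_del k i) = merge p' q' ` {p, q}"
    using st by (simp add: ne ends_def r') (metis image_insert image_empty)
  moreover have "merge p' q' (src_at G i) \<noteq> merge p' q' (tgt_at G i)"
    unfolding merge_eq_iff[OF lt'] using st f' nl lt by (auto simp: doubleton_eq_iff)
  ultimately show "contractible b (contract G k) (after_del k i)"
    using ne unfolding contractible_def by (simp add: r')
qed

text \<open>Pairs of ends are compared by the larger, then by the smaller end. With \<open>e\<close>
  and \<open>f\<close> the degrees of the two edges, distinct larger ends give the total
  \<open>e + f + (e + 1) * (f + 1) + e * f\<close>, which is odd. If the larger ends agree, then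
  \<open>e = f\<close>, the first contraction reverses the second edge in one of the two orders, and
  the total is \<open>e * e + e + 1\<close>.\<close>

lemma contract_contract_ordered:
  assumes g: "good G" and ci: "contractible b G i" and cik: "contractible b (contract G i) (after_del i k)"
    and k: "k < num_edges G" "k \<noteq> i"
    and ord: "cmax G i < cmax G k \<or> cmax G i = cmax G k \<and> cmin G i < cmin G k"
  shows "cmap (contract G i) (after_del i k) (cmap G i v) = cmap (contract G k) (after_del k i) (cmap G k v)"
    and "csign G i * csign (contract G i) (after_del i k) =
      - (csign G k * csign (contract G k) (after_del k i))"
proof -
  note sym = contractible_contract_sym[OF g ci cik k]
  note t = good_typed[OF g]
  note i = contractible_less[OF ci]
  obtain p q where pq: "cmin G i = p" "cmax G i = q" by blast
  obtain p' q' where pq': "cmin G k = p'" "cmax G k = q'" by blast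
  have lt: "p < q" using cmin_less_cmax[OF ci] by (simp only: pq)
  have lt': "p' < q'" using cmin_less_cmax[OF sym(1)] by (simp only: pq')
  have N: "q < num_vertices G" "q' < num_vertices G"
    using cmax_less[OF t i] cmax_less[OF t k(1)] by (simp_all only: pq pq')
  have r: "cmap G i = merge p q" "cmap G k = merge p' q'" by (simp_all only: cmap_def pq pq')
  have ne: "edges (contract G i) ! after_del i k = relabel_edge (merge p q) (edges G ! k)"
    "edges (contract G k) ! after_del k i = relabel_edge (merge p' q') (edges G ! i)"
    using nth_edges_after_del(1)[OF ci k] nth_edges_after_del(1)[OF sym(1) i k(2)[symmetric]]
    by (simp_all only: r)
  have se: "(src_at G i = p \<and> tgt_at G i = q) \<or> (src_at G i = q \<and> tgt_at G i = p)"
    using pq by (auto simp: min_def max_def split: if_splits)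
  have sf: "(src_at G k = p' \<and> tgt_at G k = q') \<or> (src_at G k = q' \<and> tgt_at G k = p')"
    using pq' by (auto simp: min_def max_def split: if_splits)
  note gi = good_contract[OF g ci] and gk = good_contract[OF g sym(1)]
  note sg = contraction_sign_eq[OF g ci] contraction_sign_eq[OF gi cik]
    contraction_sign_eq[OF g sym(1)] contraction_sign_eq[OF gk sym(2)]
  note ed = edeg_contract[OF ci k] edeg_contract[OF sym(1) i k(2)[symmetric]]
    edeg_sum_contract[OF ci] edeg_sum_contract[OF sym(1)]
    edeg_after_contract[OF ci k] edeg_after_contract[OF sym(1) i k(2)[symmetric]]
  have vq: "vdeg G q = - (edeg G i + 1)" "vdeg G q' = - (edeg G k + 1)"
    using vdeg_cmax[OF g ci] vdeg_cmax[OF g sym(1)] by (simp_all only: pq pq')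
  have nv: "num_vertices (contract G i) = num_vertices G - 1" "num_vertices (contract G k) = num_vertices G - 1"
    using num_vertices_contract[OF ci t] num_vertices_contract[OF sym(1) t] .
  consider (1) "q < q'" | (2) "q = q'" "p < p'" using ord by (auto simp: pq pq')
  hence main: "merge (cmin (contract G i) (after_del i k)) (cmax (contract G i) (after_del i k)) (merge p q v) =
      merge (cmin (contract G k) (after_del k i)) (cmax (contract G k) (after_del k i)) (merge p' q' v) \<and>
    odd (csign_exp G i + csign_exp (contract G i) (after_del i k) -
      (csign_exp G k + csign_exp (contract G k) (after_del k i)))"
  proof cases
    case 1
    have r1: "merge p q q' = q' - 1" "merge p q p' < q' - 1" using 1 lt lt' by (auto simp: merge_def)
    have r2: "merge p' q' p = p" "merge p' q' q = q" using 1 lt by (auto simp: merge_def)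
    have mm: "cmin (contract G i) (after_del i k) = merge p q p'" "cmax (contract G i) (after_del i k) = q' - 1"
      "cmin (contract G k) (after_del k i) = p" "cmax (contract G k) (after_del k i) = q"
      unfolding ne using se sf r1 r2 lt by auto
    have fl: "src (edges (contract G i) ! after_del i k) < tgt (edges (contract G i) ! after_del i k) \<longleftrightarrow>
        src_at G k < tgt_at G k"
      "src (edges (contract G k) ! after_del k i) < tgt (edges (contract G k) ! after_del k i) \<longleftrightarrow>
        src_at G i < tgt_at G i" unfolding ne using se sf r1 r2 lt lt' by auto
    have va: "vdeg_after (contract G i) (q' - 1) = vdeg_after G q'"
      "vdeg_after (contract G k) q = vdeg_after G q - vdeg G q'"
    proof -
      have q1: "\<not> q' - 1 < q" "Suc (q' - 1) = q'" "q' - 1 < num_vertices G - 1" "q < num_vertices G - 1"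
        using 1 N by auto
      show "vdeg_after (contract G i) (q' - 1) = vdeg_after G q'"
        using vdeg_after_contract[OF g ci, of "q' - 1"] q1(1,3) unfolding nv pq q1(2) by simp
      show "vdeg_after (contract G k) q = vdeg_after G q - vdeg G q'"
        using vdeg_after_contract[OF g sym(1), of q] q1(4) 1 unfolding nv pq' by simp
    qed
    have "merge (merge p q p') (q' - 1) (merge p q v) = merge p q (merge p' q' v)"
      using 1 lt lt' by (auto simp: merge_def)
    moreover have "odd (csign_exp G i + csign_exp (contract G i) (after_del i k) -
      (csign_exp G k + csign_exp (contract G k) (after_del k i)))"
      unfolding csign_exp_def mm fl va ed pq pq' vq using k(2) by auto
    ultimately show ?thesis unfolding mm by blast
  next
    case 2
    have r1: "merge p q q' = p" "merge p q p' = p'" using 2 lt' by (auto simp: merge_def)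
    have r2: "merge p' q' p = p" "merge p' q' q = p'" using 2 lt by (auto simp: merge_def)
    have mm: "cmin (contract G i) (after_del i k) = p" "cmax (contract G i) (after_del i k) = p'"
      "cmin (contract G k) (after_del k i) = p" "cmax (contract G k) (after_del k i) = p'"
      unfolding ne using se sf r1 r2 2 by auto
    have fl: "src (edges (contract G i) ! after_del i k) < tgt (edges (contract G i) ! after_del i k) \<longleftrightarrow>
        \<not> src_at G k < tgt_at G k"
      "src (edges (contract G k) ! after_del k i) < tgt (edges (contract G k) ! after_del k i) \<longleftrightarrow>
        src_at G i < tgt_at G i" unfolding ne using se sf r1 r2 2 lt lt' by auto
    have va: "vdeg_after (contract G i) p' = vdeg_after G p' - vdeg G q"
      "vdeg_after (contract G k) p' = vdeg_after G p' - vdeg G q"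
      using vdeg_after_contract[OF g ci, of p'] vdeg_after_contract[OF g sym(1), of p'] 2 lt' N
      by (simp_all add: nv pq pq')
    have eq: "edeg G k = edeg G i" using vq 2 by simp
    have "merge p p' (merge p q v) = merge p p' (merge p' q' v)" using 2 lt lt' by (auto simp: merge_def)
    moreover have "odd (csign_exp G i + csign_exp (contract G i) (after_del i k) -
      (csign_exp G k + csign_exp (contract G k) (after_del k i)))"
      unfolding csign_exp_def mm fl va ed pq pq' vq eq 2(1)[symmetric] using k(2) by auto
    ultimately show ?thesis unfolding mm by blast
  qed
  thus "cmap (contract G i) (after_del i k) (cmap G i v) = cmap (contract G k) (after_del k i) (cmap G k v)"
    unfolding r by (simp only: cmap_def)
  from main show "csign G i * csign (contract G i) (after_del i k) =
      - (csign G k * csign (contract G k) (after_del k i))"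
    unfolding sg sgn_pow_mult by (auto simp: sgn_pow_if)
qed

text \<open>The doubly contracted graphs agree as labeled graphs, not merely up to orientation: the
  edge lists by \<open>del_at_del_at\<close>, the vertex kinds because both are determined by the
  fibres of the same composite map.\<close>

lemma contract_contract:
  assumes g: "good G" and ci: "contractible b G i" and cik: "contractible b (contract G i) (after_del i k)"
    and k: "k < num_edges G" "k \<noteq> i"
  shows "cmap (contract G i) (after_del i k) (cmap G i v) = cmap (contract G k) (after_del k i) (cmap G k v)"
    and "csign G i * csign (contract G i) (after_del i k) =
      - (csign G k * csign (contract G k) (after_del k i))"
    and "contract (contract G i) (after_del i k) = contract (contract G k) (after_del k i)"
proof -
  note sym = contractible_contract_sym[OF g ci cik k]
  note i = contractible_less[OF ci]
  have "cmin G i \<noteq> cmin G k \<or> cmax G i \<noteq> cmax G k"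
    using sym(3) unfolding ends_min_max by metis
  then consider "cmax G i < cmax G k \<or> cmax G i = cmax G k \<and> cmin G i < cmin G k"
    | "cmax G k < cmax G i \<or> cmax G k = cmax G i \<and> cmin G k < cmin G i" by linarith
  hence both: "cmap (contract G i) (after_del i k) (cmap G i v) = cmap (contract G k) (after_del k i) (cmap G k v)
    \<and> csign G i * csign (contract G i) (after_del i k) =
      - (csign G k * csign (contract G k) (after_del k i))" for v
  proof cases
    case 1
    show ?thesis using contract_contract_ordered[OF assms 1] by blast
  next
    case 2
    show ?thesis using contract_contract_ordered[OF g sym(1,2) i k(2)[symmetric] 2] by simp
  qed
  thus m: "cmap (contract G i) (after_del i k) (cmap G i v) = cmap (contract G k) (after_del k i) (cmap G k v)"
    and "csign G i * csign (contract G i) (after_del i k) =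
      - (csign G k * csign (contract G k) (after_del k i))" for v by blast+
  note gi = good_contract[OF g ci] and gk = good_contract[OF g sym(1)]
  let ?A = "contract (contract G i) (after_del i k)" and ?B = "contract (contract G k) (after_del k i)"
  have nv: "num_vertices ?A = num_vertices G - 2" "num_vertices ?B = num_vertices G - 2"
    using num_vertices_contract[OF cik good_typed[OF gi]] num_vertices_contract[OF ci good_typed[OF g]]
      num_vertices_contract[OF sym(2) good_typed[OF gk]] num_vertices_contract[OF sym(1) good_typed[OF g]]
    by simp_all
  have fib: "(vkind C u = ExtBlack \<longleftrightarrow> (\<exists>w<num_vertices G. R w = u \<and> vkind G w = ExtBlack)) \<and>
      (vkind C u \<noteq> ExtBlack \<longrightarrow> (\<forall>w<num_vertices G. R w = u \<longrightarrow> vkind C u = vkind G w))"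
    if c: "contractible b G x" "contractible b (contract G x) y" and C: "C = contract (contract G x) y"
      and R: "\<And>w. R w = cmap (contract G x) y (cmap G x w)" and u: "u < num_vertices C" for x y u C R
  proof -
    note gx = good_contract[OF g c(1)]
    obtain u1 where u1: "u1 < num_vertices (contract G x)" "cmap (contract G x) y u1 = u"
      using cmap_surj[OF gx c(2)] u C by blast
    have 1: "vkind C u = ExtBlack \<longleftrightarrow> (\<exists>w<num_vertices (contract G x). cmap (contract G x) y w = u \<and> vkind (contract G x) w = ExtBlack)"
      using contract_kind_fibre(1)[OF gx c(2) u1(1)] u1(2) C by simp
    have 2: "\<exists>w'<num_vertices G. cmap G x w' = w \<and> vkind G w' = ExtBlack"
      if ww: "w < num_vertices (contract G x)" "vkind (contract G x) w = ExtBlack" for w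
    proof -
      obtain w' where w': "w' < num_vertices G" "cmap G x w' = w" using cmap_surj[OF g c(1) ww(1)] by blast
      show ?thesis using contract_kind_fibre(1)[OF g c(1) w'(1)] w'(2) ww(2) by simp
    qed
    have 3: "vkinds (contract G x) ! cmap G x w = ExtBlack" "cmap G x w < num_vertices (contract G x)"
      if "w < num_vertices G" "vkind G w = ExtBlack" for w
      using contract_kind_fibre(1)[OF g c(1) that(1)] that cmap_less[OF g c(1) that(1)] by auto
    show ?thesis
    proof (intro conjI impI allI)
      show "vkind C u = ExtBlack \<longleftrightarrow> (\<exists>w<num_vertices G. R w = u \<and> vkind G w = ExtBlack)"
      proof
        assume "vkind C u = ExtBlack"
        then obtain w where "w < num_vertices (contract G x)" "cmap (contract G x) y w = u" "vkind (contract G x) w = ExtBlack"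
          using 1 by blast
        thus "\<exists>w<num_vertices G. R w = u \<and> vkind G w = ExtBlack" using 2[of w] R by auto
      next
        assume "\<exists>w<num_vertices G. R w = u \<and> vkind G w = ExtBlack"
        thus "vkind C u = ExtBlack" using 1 3 R by auto
      qed
      fix w assume ne: "vkind C u \<noteq> ExtBlack" and w: "w < num_vertices G" "R w = u"
      have w1: "cmap G x w < num_vertices (contract G x)" "cmap (contract G x) y (cmap G x w) = u"
        using cmap_less[OF g c(1) w(1)] w(2) R by auto
      have "vkind C u = vkinds (contract G x) ! cmap G x w"
        using contract_kind_fibre(2)[OF gx c(2) w1(1)] w1(2) ne C by simp
      moreover have "vkinds (contract G x) ! cmap G x w = vkind G w"
        using contract_kind_fibre(2)[OF g c(1) w(1)] calculation ne by simp
      ultimately show "vkind C u = vkind G w" by simp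
    qed
  qed
  have "vkinds ?A = vkinds ?B"
  proof (rule nth_equalityI)
    show "num_vertices ?A = num_vertices ?B" by (simp add: nv)
    fix u assume u: "u < num_vertices ?A"
    define R where "R w = cmap (contract G i) (after_del i k) (cmap G i w)" for w
    obtain u1 where u1: "u1 < num_vertices (contract G i)" "cmap (contract G i) (after_del i k) u1 = u"
      using cmap_surj[OF gi cik u] by blast
    obtain w where w: "w < num_vertices G" "cmap G i w = u1" using cmap_surj[OF g ci u1(1)] by blast
    hence Rw: "R w = u" by (simp add: R_def u1)
    have fA: "(vkind ?A u = ExtBlack \<longleftrightarrow> (\<exists>w<num_vertices G. R w = u \<and> vkind G w = ExtBlack)) \<and>
      (vkind ?A u \<noteq> ExtBlack \<longrightarrow> (\<forall>w<num_vertices G. R w = u \<longrightarrow> vkind ?A u = vkind G w))"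
      using fib[OF ci cik refl R_def u] .
    have fB: "(vkind ?B u = ExtBlack \<longleftrightarrow> (\<exists>w<num_vertices G. R w = u \<and> vkind G w = ExtBlack)) \<and>
      (vkind ?B u \<noteq> ExtBlack \<longrightarrow> (\<forall>w<num_vertices G. R w = u \<longrightarrow> vkind ?B u = vkind G w))"
    proof -
      have Rk: "R w = cmap (contract G k) (after_del k i) (cmap G k w)" for w by (simp only: R_def m)
      have "u < num_vertices ?B" using u nv by simp
      from fib[OF sym(1,2) refl Rk this] show ?thesis .
    qed
    show "vkind ?A u = vkind ?B u"
    proof (cases "vkind ?A u = ExtBlack")
      case True
      hence "vkind ?B u = ExtBlack" unfolding fA[THEN conjunct1] fB[THEN conjunct1] .
      with True show ?thesis by simp
    next
      case False
      hence B: "vkind ?B u \<noteq> ExtBlack" unfolding fA[THEN conjunct1] fB[THEN conjunct1] .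
      show ?thesis
        using fA[THEN conjunct2, rule_format, OF False w(1) Rw] fB[THEN conjunct2, rule_format, OF B w(1) Rw]
        by simp
    qed
  qed
  moreover have "edges ?A = edges ?B"
  proof -
    have "edges ?A = map (relabel_edge (\<lambda>v. cmap (contract G i) (after_del i k) (cmap G i v)))
        (del_at (after_del i k) (del_at i (edges G)))"
      unfolding edges_contract[OF cik] edges_contract[OF ci] by (simp add: map_del_at relabel_edge_comp comp_def)
    also have "\<dots> = map (relabel_edge (\<lambda>v. cmap (contract G k) (after_del k i) (cmap G k v)))
        (del_at (after_del k i) (del_at k (edges G)))"
      using del_at_del_at[OF i k(1) k(2)[symmetric]] by (simp add: m)
    also have "\<dots> = edges ?B"
      unfolding edges_contract[OF sym(2)] edges_contract[OF sym(1)] by (simp add: map_del_at relabel_edge_comp comp_def)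
    finally show ?thesis .
  qed
  ultimately show "?A = ?B" by (rule lgraph.expand[OF conjI])
qed

lemma pm_eq_neg_imp_zero: "x = - x \<Longrightarrow> x = (0 :: 'a \<Rightarrow>\<^sub>0 rat)"
proof -
  assume "x = - x"
  hence "lookup x g = - lookup x g" for g by (metis lookup_uminus)
  thus "x = 0" by (intro poly_mapping_eqI) (simp add: equal_neg_zero)
qed

text \<open>The terms for \<open>(i, k)\<close> and \<open>(k, i)\<close> are negatives of each
  other, so the sum equals its own negative. It vanishes on the nose, without relations.\<close>

lemma ddiff_ddiff:
  assumes "good (fst X)"
  shows "lin (ddiff b) (ddiff b X) = 0"
proof -
  obtain G ms where X: "X = (G, ms)" by force
  with assms have g: "good G" by simp
  define A where "A = {(i, k). contractible b G i \<and> k < num_edges G \<and> k \<noteq> i \<and> contractible b (contract G i) (after_del i k)}"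
  define T where "T i k = scale_rat (csign G i)
    (cterm (contract G i, map (cmap G i) ms) (after_del i k))" for i k
  have finA: "finite A"
    by (rule finite_subset[of _ "{..<num_edges G} \<times> {..<num_edges G}"]) (auto simp: A_def contractible_def)
  have one: "(\<Sum>l\<in>contractions b (contract G i). f l) =
      (\<Sum>k | k < num_edges G \<and> k \<noteq> i \<and> contractible b (contract G i) (after_del i k). f (after_del i k))"
    if c: "contractible b G i" for i and f :: "nat \<Rightarrow> dgraph \<Rightarrow>\<^sub>0 rat"
  proof (rule sum.reindex_bij_witness[of _ "after_del i" "\<lambda>l. if l < i then l else Suc l"])
    fix l assume "l \<in> contractions b (contract G i)"
    hence l: "contractible b (contract G i) l" by (simp add: contractions_def)
    hence "l < num_edges G - 1" using contractible_less[OF l] num_edges_contract[OF c] by simp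
    with l show "(if l < i then l else Suc l) \<in> {k. k < num_edges G \<and> k \<noteq> i \<and> contractible b (contract G i) (after_del i k)}"
      by (auto simp: after_del_def)
  qed (auto simp: after_del_def contractions_def)
  have "lin (ddiff b) (ddiff b X) = (\<Sum>i\<in>contractions b G. scale_rat (csign G i)
      (ddiff b (contract G i, map (cmap G i) ms)))"
    unfolding ddiff_def[of b X] by (simp add: lin_sum cterm_def X)
  also have "\<dots> = (\<Sum>i\<in>contractions b G. \<Sum>k | k < num_edges G \<and> k \<noteq> i \<and> contractible b (contract G i) (after_del i k). T i k)"
  proof (rule sum.cong[OF refl])
    fix i assume "i \<in> contractions b G"
    hence c: "contractible b G i" by (simp add: contractions_def)
    show "scale_rat (csign G i) (ddiff b (contract G i, map (cmap G i) ms)) =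
        (\<Sum>k | k < num_edges G \<and> k \<noteq> i \<and> contractible b (contract G i) (after_del i k). T i k)"
      by (simp only: ddiff_def fst_conv one[OF c] rv.scale_sum_right T_def)
  qed
  also have "\<dots> = (\<Sum>(i, k)\<in>A. T i k)"
  proof -
    have "A = Sigma (contractions b G)
        (\<lambda>i. {k. k < num_edges G \<and> k \<noteq> i \<and> contractible b (contract G i) (after_del i k)})"
      by (auto simp: A_def contractions_def)
    thus ?thesis by (simp only:) (rule sum.Sigma, auto)
  qed
  finally have d: "lin (ddiff b) (ddiff b X) = (\<Sum>(i, k)\<in>A. T i k)" .
  have "(\<Sum>(i, k)\<in>A. T i k) = (\<Sum>(i, k)\<in>A. T k i)"
    by (rule sum.reindex_bij_witness[of _ prod.swap prod.swap])
      (auto simp: A_def dest: contractible_less contractible_contract_sym[OF g])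
  also have "\<dots> = (\<Sum>(i, k)\<in>A. - T i k)"
  proof (rule sum.cong[OF refl], clarify)
    fix i k assume "(i, k) \<in> A"
    hence ik: "contractible b G i" "contractible b (contract G i) (after_del i k)" "k < num_edges G" "k \<noteq> i"
      by (auto simp: A_def)
    note cc = contract_contract[OF g ik]
    show "T k i = - T i k" unfolding T_def cterm_def
      using cc(2) by (simp add: cc(1,3)[symmetric] comp_def flip: single_uminus)
  qed
  also have "\<dots> = - (\<Sum>(i, k)\<in>A. T i k)" by (simp add: split_def sum_negf)
  finally show ?thesis unfolding d by (rule pm_eq_neg_imp_zero)
qed

section \<open>Blowing up a vertex\<close>

fun int_kind :: "edge_kind \<Rightarrow> vertex_kind"
  where "int_kind Dashed = White" | "int_kind Solid = IntBlack"

text \<open>The last positions at which an internal vertex, respectively an edge, of a given kind can be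
  inserted.\<close>

definition vpos :: "edge_kind \<Rightarrow> lgraph \<Rightarrow> nat"
  where "vpos K G = (if K = Dashed then num_vertices G else black_count G)"

definition epos :: "edge_kind \<Rightarrow> lgraph \<Rightarrow> nat"
  where "epos K G = (if K = Dashed then num_edges G else solid_count G)"

definition shift :: "nat \<Rightarrow> nat \<Rightarrow> nat"
  where "shift b v = (if v < b then v else Suc v)"

definition blow_edge :: "edge_kind \<Rightarrow> nat \<Rightarrow> nat set \<Rightarrow> nat \<Rightarrow> edge \<Rightarrow> edge"
  where "blow_edge K a T b e = Edge (ekind e)
    (if ekind e = K \<and> src e = a \<and> tgt e \<notin> T then b else shift b (src e))
    (if ekind e = K \<and> tgt e = a \<and> src e \<notin> T then b else shift b (tgt e))"

text \<open>The vertex \<open>a\<close> is joined by a new edge of kind \<open>K\<close> to a new internal vertex, to which all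
  half-edges of kind \<open>K\<close> at \<open>a\<close> are moved whose other end is not in \<open>T\<close>.\<close>

definition blow :: "edge_kind \<Rightarrow> nat \<Rightarrow> nat set \<Rightarrow> lgraph \<Rightarrow> lgraph"
  where "blow K a T G = LGraph (ins_at (vpos K G) (int_kind K) (vkinds G))
    (ins_at (epos K G) (Edge K a (vpos K G)) (map (blow_edge K a T (vpos K G)) (edges G)))"

text \<open>Two moved half-edges and the new edge make the new vertex at least trivalent. An
  internal \<open>a\<close> has to retain two half-edges for the same reason.\<close>

definition blow_ok :: "edge_kind \<Rightarrow> nat \<Rightarrow> nat set \<Rightarrow> lgraph \<Rightarrow> bool"
  where "blow_ok K a T G \<longleftrightarrow> a < num_vertices G \<and> out_count K T a (edges G) \<ge> 2 \<and>
    (vkind G a = ExtBlack \<or> vkind G a = int_kind K \<and> in_count K T a (edges G) \<ge> 2)"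

lemma int_kind_simps [simp]: "int_kind K \<noteq> ExtBlack" "ExtBlack \<noteq> int_kind K" "int_kind K = White \<longleftrightarrow> K = Dashed"
  "int_kind K = IntBlack \<longleftrightarrow> K = Solid" by (cases K; simp)+

lemma vpos_le: "vpos K G \<le> num_vertices G" using black_count_le[of G] by (simp add: vpos_def)

lemma epos_le: "epos K G \<le> num_edges G" using solid_count_le[of G] by (simp add: epos_def)

lemma blow_edge_simps [simp]: "ekind (blow_edge K a T b e) = ekind e" by (simp add: blow_edge_def)

lemma shift_less_iff [simp]: "shift b v < shift b w \<longleftrightarrow> v < w" "shift b v = shift b w \<longleftrightarrow> v = w"
  "shift b v \<noteq> b" "b \<noteq> shift b v" by (auto simp: shift_def)

lemma shift_less: "v < N \<Longrightarrow> shift b v < Suc N" by (auto simp: shift_def)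

lemma shift_id: "v < b \<Longrightarrow> shift b v = v" by (simp add: shift_def)

lemma num_vertices_blow [simp]: "num_vertices (blow K a T G) = Suc (num_vertices G)" by (simp add: blow_def)

lemma num_edges_blow [simp]: "num_edges (blow K a T G) = Suc (num_edges G)" by (simp add: blow_def)

lemma nth_vkinds_blow:
  "vkinds (blow K a T G) ! vpos K G = int_kind K"
  "v < num_vertices G \<Longrightarrow> vkinds (blow K a T G) ! shift (vpos K G) v = vkind G v"
  using vpos_le[of K G] by (auto simp: blow_def nth_ins_at shift_def)

lemma nth_edges_blow:
  "edges (blow K a T G) ! epos K G = Edge K a (vpos K G)"
  "l < num_edges G \<Longrightarrow> edges (blow K a T G) ! shift (epos K G) l = blow_edge K a T (vpos K G) (edges G ! l)"
  using epos_le[of K G] by (auto simp: blow_def nth_ins_at shift_def)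

lemma shift_cases:
  assumes "u < Suc N" "b \<le> N"
  obtains "u = b" | v where "v < N" "u = shift b v"
proof (cases "u = b")
  case False
  thus ?thesis using assms that(2)[of u] that(2)[of "u - 1"] by (cases "u < b") (auto simp: shift_def)
qed

lemma blow_ok_less:
  assumes "good G" "blow_ok K a T G"
  shows "a < vpos K G"
proof (cases K)
  case Solid
  hence "vkind G a \<noteq> White" "a < num_vertices G" using assms(2) by (auto simp: blow_ok_def)
  thus ?thesis using assms(1) Solid by (auto simp: good_iff well_labeled_iff vpos_def)
qed (use assms in "simp add: vpos_def blow_ok_def")

lemma half_weight_blow_edge:
  assumes "a < b"
  shows "half_weight K' (\<lambda>_. True) b (blow_edge K a T b e) = (if K' = K then half_weight K (\<lambda>x. x \<notin> T) a e else 0)"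
    and "half_weight K' (\<lambda>_. True) a (blow_edge K a T b e) =
      (if K' = K then half_weight K (\<lambda>x. x \<in> T) a e else half_weight K' (\<lambda>_. True) a e)"
    and "v \<noteq> a \<Longrightarrow> half_weight K' (\<lambda>_. True) (shift b v) (blow_edge K a T b e) = half_weight K' (\<lambda>_. True) v e"
  using assms shift_id[of a b] by (auto simp: half_weight_def blow_edge_def shift_def split: if_splits)

lemma valence_blow:
  assumes "a < vpos K G"
  shows "valence K' (vpos K G) (edges (blow K a T G)) =
      (if K' = K then Suc (out_count K T a (edges G)) else 0)"
    and "valence K' a (edges (blow K a T G)) =
      (if K' = K then Suc (in_count K T a (edges G)) else valence K' a (edges G))"
    and "v \<noteq> a \<Longrightarrow> valence K' (shift (vpos K G) v) (edges (blow K a T G)) = valence K' v (edges G)"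
proof -
  have e: "edges (blow K a T G) = ins_at (epos K G) (Edge K a (vpos K G)) (map (blow_edge K a T (vpos K G)) (edges G))"
    by (simp add: blow_def)
  have sh: "shift (vpos K G) v = a \<longleftrightarrow> v = a" for v using assms by (auto simp: shift_def)
  have m: "half_count K' (\<lambda>_. True) v (map (blow_edge K a T (vpos K G)) (edges G)) =
      sum_list (map (\<lambda>e. half_weight K' (\<lambda>_. True) v (blow_edge K a T (vpos K G) e)) (edges G))" for v
    by (simp add: half_count_def comp_def)
  have le: "epos K G \<le> length (map (blow_edge K a T (vpos K G)) (edges G))" by (simp add: epos_le)
  have wE: "half_weight K' (\<lambda>_. True) (vpos K G) (Edge K a (vpos K G)) = of_bool (K' = K)"
    "half_weight K' (\<lambda>_. True) a (Edge K a (vpos K G)) = of_bool (K' = K)"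
    "v \<noteq> a \<Longrightarrow> half_weight K' (\<lambda>_. True) (shift (vpos K G) v) (Edge K a (vpos K G)) = 0" for v
    using assms sh by (auto simp: half_weight_def)
  show "valence K' (vpos K G) (edges (blow K a T G)) =
      (if K' = K then Suc (out_count K T a (edges G)) else 0)"
    unfolding e half_count_ins_at[OF le] m half_weight_blow_edge[OF assms] by (simp add: half_count_def wE)
  show "valence K' a (edges (blow K a T G)) =
      (if K' = K then Suc (in_count K T a (edges G)) else valence K' a (edges G))"
    unfolding e half_count_ins_at[OF le] m half_weight_blow_edge[OF assms] by (simp add: half_count_def wE)
  show "valence K' (shift (vpos K G) v) (edges (blow K a T G)) = valence K' v (edges G)" if "v \<noteq> a"
    unfolding e half_count_ins_at[OF le] m half_weight_blow_edge(3)[OF assms that]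
    using that by (simp add: half_count_def wE)
qed

text \<open>Insertion takes place at the end of the black vertices and solid edges, or at the very
  end of the lists, so the order conditions persist. Valences change only at \<open>a\<close> and at
  the new vertex, where \<open>blow_ok\<close> controls them.\<close>

lemma good_blow:
  assumes g: "good G" and ok: "blow_ok K a T G"
  shows "good (blow K a T G)"
proof -
  let ?H = "blow K a T G" and ?b = "vpos K G" and ?c = "epos K G" and ?N = "num_vertices G"
  let ?f = "blow_edge K a T ?b"
  have ab: "a < ?b" by (rule blow_ok_less[OF g ok])
  note bN = vpos_le[of K G] and cM = epos_le[of K G]
  have wl: "well_labeled G" and con: "connected_graph G"
    and vok: "\<And>v. v < ?N \<Longrightarrow> vertex_ok (vkind G v) (valence Dashed v (edges G)) (valence Solid v (edges G))"
    using g by (auto simp: good_iff)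
  have setH: "set (edges ?H) = insert (Edge K a ?b) (?f ` set (edges G))" using cM by (simp add: blow_def)
  have bpos: "vkind G v \<noteq> White \<longleftrightarrow> v < black_count G" if "v < ?N" for v
    using wl that by (auto simp: well_labeled_iff)
  have epos': "kind_at G l = Solid \<longleftrightarrow> l < solid_count G" if "l < num_edges G" for l
    using wl that by (auto simp: well_labeled_iff)
  have "well_labeled ?H" unfolding well_labeled_def
  proof (intro conjI ballI allI impI)
    fix e assume "e \<in> set (edges ?H)"
    thus "src e < num_vertices ?H" "tgt e < num_vertices ?H" using wl ab bN unfolding setH well_labeled_def
      by (auto simp: blow_edge_def shift_less)
  next
    fix v w assume vw: "v < w \<and> w < num_vertices ?H \<and> vkind ?H v = White"
    hence N: "v < Suc ?N" "w < Suc ?N" by auto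
    from N(2) bN show "vkind ?H w = White"
    proof (cases rule: shift_cases)
      case 1
      show ?thesis
      proof (cases K)
        case Solid
        from N(1) bN consider "v = ?b" | v' where "v' < ?N" "v = shift ?b v'" by (rule shift_cases)
        thus ?thesis
        proof cases
          case 1 thus ?thesis using vw \<open>w = ?b\<close> by simp
        next
          case (2 v')
          hence "vkind G v' = White" using vw by (simp add: nth_vkinds_blow)
          hence "\<not> v' < ?b" using bpos[OF 2(1)] Solid by (simp add: vpos_def)
          thus ?thesis using vw 1 2 by (simp add: shift_def)
        qed
      qed (use 1 in "simp add: nth_vkinds_blow")
    next
      case (2 w')
      from N(1) bN consider "v = ?b" | v' where "v' < ?N" "v = shift ?b v'" by (rule shift_cases)
      thus ?thesis
      proof cases
        case 1
        hence "\<not> w' < ?b" "K = Dashed" using vw 2 by (auto simp: shift_def nth_vkinds_blow)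
        thus ?thesis using 2 by (simp add: vpos_def)
      next
        case (2 v')
        hence "vkind G v' = White" "v' < w'" using vw \<open>w = shift ?b w'\<close> by (auto simp: nth_vkinds_blow)
        hence "vkind G w' = White" using wl \<open>w' < ?N\<close> unfolding well_labeled_def by blast
        thus ?thesis using \<open>w = shift ?b w'\<close> \<open>w' < ?N\<close> by (simp add: nth_vkinds_blow)
      qed
    qed
  next
    fix i k assume ik: "i < k \<and> k < num_edges ?H \<and> kind_at ?H i = Dashed"
    hence N: "i < Suc (num_edges G)" "k < Suc (num_edges G)" by auto
    from N(2) cM show "kind_at ?H k = Dashed"
    proof (cases rule: shift_cases)
      case 1
      show ?thesis
      proof (cases K)
        case Solid
        from N(1) cM consider "i = ?c" | v' where "v' < num_edges G" "i = shift ?c v'" by (rule shift_cases)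
        thus ?thesis
        proof cases
          case 1 thus ?thesis using ik \<open>k = ?c\<close> by simp
        next
          case (2 v')
          hence "kind_at G v' = Dashed" using ik by (simp add: nth_edges_blow)
          hence "\<not> v' < ?c" using epos'[OF 2(1)] Solid by (simp add: epos_def)
          thus ?thesis using ik 1 2 by (simp add: shift_def)
        qed
      qed (use 1 in "simp add: nth_edges_blow")
    next
      case (2 w')
      from N(1) cM consider "i = ?c" | v' where "v' < num_edges G" "i = shift ?c v'" by (rule shift_cases)
      thus ?thesis
      proof cases
        case 1
        hence "\<not> w' < ?c" "K = Dashed" using ik 2 by (auto simp: shift_def nth_edges_blow)
        thus ?thesis using 2 by (simp add: epos_def)
      next
        case (2 v')
        hence "kind_at G v' = Dashed" "v' < w'" using ik \<open>k = shift ?c w'\<close> by (auto simp: nth_edges_blow)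
        hence "kind_at G w' = Dashed" using wl \<open>w' < num_edges G\<close> unfolding well_labeled_def by blast
        thus ?thesis using \<open>k = shift ?c w'\<close> \<open>w' < num_edges G\<close> by (simp add: nth_edges_blow)
      qed
    qed
  qed
  moreover have "connected_graph ?H"
  proof -
    have new: "reachable ?H a ?b" using reachable_edge[of "Edge K a ?b" ?H] by (simp add: setH)
    \<comment> \<open>A moved half-edge ends at the new vertex, which the new edge joins to
      \<open>a\<close>, so no connection is lost.\<close>
    have move: "reachable ?H (shift ?b x) (if P then ?b else shift ?b x)" if "P \<longrightarrow> x = a" for P x
      using that new ab by (auto simp: shift_id)
    have sh: "reachable ?H (shift ?b v) (shift ?b w)" if "reachable G v w" for v w using that
    proof (rule reachable_map[rotated])
      fix e assume "e \<in> set (edges G)"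
      hence "?f e \<in> set (edges ?H)" by (simp add: setH)
      from reachable_edge[OF this]
      have "reachable ?H (if ekind e = K \<and> src e = a \<and> tgt e \<notin> T then ?b else shift ?b (src e))
          (if ekind e = K \<and> tgt e = a \<and> src e \<notin> T then ?b else shift ?b (tgt e))"
        by (simp add: blow_edge_def)
      moreover have "reachable ?H (shift ?b (src e)) (if ekind e = K \<and> src e = a \<and> tgt e \<notin> T then ?b else shift ?b (src e))"
        by (rule move) simp
      moreover have "reachable ?H (if ekind e = K \<and> tgt e = a \<and> src e \<notin> T then ?b else shift ?b (tgt e)) (shift ?b (tgt e))"
        by (rule reachable_sym, rule move) simp
      ultimately show "reachable ?H (shift ?b (src e)) (shift ?b (tgt e))" using reachable_trans by blast
    qed
    have "reachable ?H a u" if "u < Suc ?N" for u using that bN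
    proof (cases rule: shift_cases)
      case (2 v)
      have "reachable G a v" using con ok 2 by (auto simp: connected_graph_def blow_ok_def)
      from sh[OF this] show ?thesis using 2 ab by (simp add: shift_id)
    qed (use new in simp)
    thus ?thesis unfolding connected_graph_def by (auto intro: reachable_trans[OF reachable_sym])
  qed
  moreover have "ExtBlack \<in> set (vkinds ?H)" using g bN by (simp add: good_iff blow_def)
  moreover have "vertex_ok (vkind ?H u) (valence Dashed u (edges ?H)) (valence Solid u (edges ?H))"
    if "u < Suc ?N" for u using that bN
  proof (cases rule: shift_cases)
    case 1
    thus ?thesis
      using ok valence_blow(1)[OF ab, where K' = Dashed and T = T] valence_blow(1)[OF ab, where K' = Solid and T = T]
        nth_vkinds_blow(1)[of K a T G] by (cases K) (simp_all add: blow_ok_def)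
  next
    case (2 v)
    show ?thesis
    proof (cases "v = a")
      case False
      thus ?thesis using 2 vok[of v] by (simp add: nth_vkinds_blow valence_blow(3)[OF ab])
    next
      case True
      hence u: "u = a" "vkind ?H a = vkind G a" using 2 ab nth_vkinds_blow(2)[of a G K a T] by (auto simp: shift_id)
      show ?thesis using vok[of a] ok valence_blow(2)[OF ab, where K' = Dashed and T = T]
          valence_blow(2)[OF ab, where K' = Solid and T = T] unfolding u
        by (cases K; cases "vkind G a") (auto simp: blow_ok_def)
    qed
  qed
  ultimately show ?thesis by (simp add: good_iff)
qed

lemma contractible_blow:
  assumes "good G" "blow_ok K a T G"
  shows "contractible b (blow K a T G) (epos K G)" unfolding contractible_def
proof (intro conjI disjI1)
  show "epos K G < num_edges (blow K a T G)" using epos_le[of K G] by simp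
  show "src (edges (blow K a T G) ! epos K G) \<noteq> tgt (edges (blow K a T G) ! epos K G)"
    using blow_ok_less[OF assms] by (simp add: nth_edges_blow)
  show "\<exists>v\<in>ends (edges (blow K a T G) ! epos K G). vkind (blow K a T G) v \<noteq> ExtBlack"
    by (intro bexI[of _ "vpos K G"]) (simp_all add: nth_edges_blow nth_vkinds_blow ends_def)
qed

lemma cmap_blow:
  assumes "good G" "blow_ok K a T G"
  shows "cmap (blow K a T G) (epos K G) (shift (vpos K G) v) = v"
    and "cmap (blow K a T G) (epos K G) (vpos K G) = a"
  using blow_ok_less[OF assms] by (auto simp: cmap_def nth_edges_blow merge_def shift_def)

lemma contract_blow:
  assumes "good G" "blow_ok K a T G"
  shows "contract (blow K a T G) (epos K G) = G"
proof -
  let ?H = "blow K a T G" and ?b = "vpos K G" and ?c = "epos K G"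
  have ab: "a < ?b" by (rule blow_ok_less[OF assms])
  have mm: "cmin ?H ?c = a" "cmax ?H ?c = ?b" using ab by (auto simp: nth_edges_blow)
  have "vkind ?H a = vkind G a"
    using nth_vkinds_blow(2)[of a G K a T] ab assms(2) by (simp add: shift_id blow_ok_def)
  hence "(vkinds ?H)[a := merged_kind (vkind ?H a) (vkind ?H ?b)] = vkinds ?H"
  proof -
    assume va: "vkind ?H a = vkind G a"
    have "merged_kind (vkind ?H a) (vkind ?H ?b) = vkind ?H a"
      by (simp add: merged_kind_def nth_vkinds_blow)
    thus ?thesis by simp
  qed
  hence v: "vkinds (contract ?H ?c) = vkinds G"
    using ab vpos_le[of K G] by (simp add: contract_eq mm nth_edges_blow) (simp add: blow_def)
  have "relabel_edge (cmap ?H ?c) (blow_edge K a T ?b e) = e" for e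
    using cmap_blow[OF assms] by (auto simp: blow_edge_def relabel_edge_def intro: edge.expand)
  hence "edges (contract ?H ?c) = edges G"
    unfolding edges_contract[OF contractible_blow[OF assms, of False]]
    using epos_le[of K G] by (simp add: blow_def[of K a T G] map_idI)
  with v show ?thesis by (simp add: lgraph.expand)
qed

text \<open>The new edge and vertex come last of their kind, so what follows them is counted by the
  dashed edges and the white vertices. Only numbers invariant under relabeling enter, and this is
  what makes the homotopy respect the orientation relations.\<close>

lemma contraction_sign_blow:
  assumes "good G" "blow_ok K a T G"
  shows "csign (blow K a T G) (epos K G) = sgn_pow
    (edeg_sum G + (if K = Solid then j * n * int (num_vertices G - black_count G)
      + (j - 1) * (n - 1) * int (num_edges G - solid_count G) else 0))"
proof -
  let ?H = "blow K a T G" and ?b = "vpos K G" and ?c = "epos K G"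
  have ab: "a < ?b" by (rule blow_ok_less[OF assms])
  have gH: "good ?H" by (rule good_blow[OF assms])
  have wl: "well_labeled G" using assms(1) by (simp add: good_iff)
  have ed: "edeg ?H ?c = kdeg K" by (simp add: edeg_def nth_edges_blow)
  have es: "edeg_sum ?H = edeg_sum G + kdeg K"
    using edeg_sum_contract[OF contractible_blow[OF assms, of False]] contract_blow[OF assms] ed by simp
  have va: "vdeg_after ?H ?b = (if K = Solid then - n * int (num_vertices G - black_count G) else 0)"
  proof (cases K)
    case Dashed
    moreover have "{num_vertices G<..<Suc (num_vertices G)} = {}" by auto
    ultimately show ?thesis by (simp add: vdeg_after_def vpos_def)
  next
    case Solid
    have "vdeg ?H w = - n" if w: "w \<in> {?b<..<num_vertices ?H}" for w
    proof -
      have "w < Suc (num_vertices G)" using w by simp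
      from this vpos_le[of K G] obtain v where v: "v < num_vertices G" "w = shift ?b v"
      proof (cases rule: shift_cases)
        case 1 with w show ?thesis by simp
      next
        case (2 v) thus ?thesis by (rule that)
      qed
      hence "\<not> v < ?b" using w by (auto simp: shift_def)
      hence "vkind G v = White" using wl v Solid by (auto simp: well_labeled_iff vpos_def)
      thus ?thesis using v by (simp add: vdeg_def nth_vkinds_blow)
    qed
    thus ?thesis using Solid black_count_le[of G] by (simp add: vdeg_after_def vpos_def)
  qed
  have ea: "edeg_after ?H ?c = (if K = Solid then (n - 1) * int (num_edges G - solid_count G) else 0)"
  proof (cases K)
    case Dashed
    moreover have "{num_edges G<..<Suc (num_edges G)} = {}" by auto
    ultimately show ?thesis by (simp add: edeg_after_def epos_def)
  next
    case Solid
    have "edeg ?H m = n - 1" if w: "m \<in> {?c<..<num_edges ?H}" for m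
    proof -
      have "m < Suc (num_edges G)" using w by simp
      from this epos_le[of K G] obtain l where l: "l < num_edges G" "m = shift ?c l"
      proof (cases rule: shift_cases)
        case 1 with w show ?thesis by simp
      next
        case (2 l) thus ?thesis by (rule that)
      qed
      hence "\<not> l < ?c" using w by (auto simp: shift_def)
      hence "kind_at G l \<noteq> Solid" using wl l Solid by (auto simp: well_labeled_iff epos_def)
      thus ?thesis using l by (cases "kind_at G l") (auto simp: edeg_def nth_edges_blow)
    qed
    thus ?thesis using Solid solid_count_le[of G] by (simp add: edeg_after_def epos_def mult.commute)
  qed
  have mx: "cmax ?H ?c = ?b" using ab by (auto simp: nth_edges_blow)
  show ?thesis unfolding contraction_sign_eq[OF gH contractible_blow[OF assms, of False]]
    unfolding csign_exp_def mx unfolding es ed va ea nth_edges_blow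
    using ab by (cases K; intro sgn_pow_eqI) auto
qed

section \<open>Compatibility of blow-ups with relabeling\<close>

lemma swap_adjacent_ins_at:
  assumes "Suc i < length xs" "c \<le> length xs" "c \<noteq> Suc i"
  shows "swap_adjacent (shift c i) (ins_at c x xs) = ins_at c x (swap_adjacent i xs)"
proof (rule nth_equalityI)
  fix m assume "m < length (swap_adjacent (shift c i) (ins_at c x xs))"
  hence m: "m < Suc (length xs)" by simp
  have s: "shift c (Suc i) = Suc (shift c i)" using assms by (auto simp: shift_def)
  have "Suc (shift c i) < Suc (length xs)" using assms s by (metis shift_less)
  hence L: "swap_adjacent (shift c i) (ins_at c x xs) ! m = ins_at c x xs ! transpose (shift c i) (shift c (Suc i)) m"
    using m by (simp add: nth_swap_adjacent s)
  have n: "ins_at c x ys ! c = x" "k < length ys \<Longrightarrow> ins_at c x ys ! shift c k = ys ! k" if "c \<le> length ys" for ys :: "'a list" and k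
    using that by (auto simp: nth_ins_at shift_def)
  from m assms(2) show "swap_adjacent (shift c i) (ins_at c x xs) ! m = ins_at c x (swap_adjacent i xs) ! m"
  proof (cases rule: shift_cases)
    case 1
    thus ?thesis unfolding L using assms by (simp add: n)
  next
    case (2 k)
    have "transpose (shift c i) (shift c (Suc i)) m = shift c (transpose i (Suc i) k)"
      unfolding 2 by (auto simp: transpose_def)
    thus ?thesis unfolding L using 2 assms by (simp add: n nth_swap_adjacent transpose_Suc_less)
  qed
qed (use assms in simp)

lemma ins_at_list_update:
  assumes "i < length xs" "c \<le> length xs"
  shows "(ins_at c x xs)[shift c i := y] = ins_at c x (xs[i := y])"
  using assms by (intro nth_equalityI) (auto simp: nth_ins_at nth_list_update shift_def split: if_splits)

lemma filter_length_mset_cong: "mset xs = mset ys \<Longrightarrow> length (filter P xs) = length (filter P ys)"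
  by (metis mset_filter size_mset)

lemma rstep_counts:
  assumes "rstep G H vp ep s"
  shows "black_count H = black_count G" "solid_count H = solid_count G"
proof -
  have "mset (map ekind (edges H)) = mset (map ekind (edges G)) \<and> mset (vkinds H) = mset (vkinds G)"
    using assms
  proof cases
    case (edges i)
    thus ?thesis by (simp add: swap_edges_def)
  next
    case (vertices v)
    thus ?thesis by (simp add: swap_vertices_def comp_def)
  next
    case (reverse i)
    hence "map ekind (edges H) = map ekind (edges G)"
      by (simp add: reverse_edge_def map_update list_update_same_conv)
    moreover have "vkinds H = vkinds G" using reverse by (simp add: reverse_edge_def)
    ultimately show ?thesis by simp
  qed
  moreover have "solid_count G = length (filter (\<lambda>k. k = Solid) (map ekind (edges G)))" for G
    by (simp add: solid_count_def filter_map comp_def)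
  ultimately show "black_count H = black_count G" "solid_count H = solid_count G"
    unfolding black_count_def by (metis filter_length_mset_cong)+
qed

lemma rstep_positions:
  assumes "rstep G H vp ep s"
  shows "vpos K H = vpos K G" "epos K H = epos K G"
  using rstep_counts[OF assms] rstep_num[OF assms] by (simp_all add: vpos_def epos_def)

lemma half_weight_flip: "half_weight K P v (flip_edge e) = half_weight K P v e"
  by (auto simp: half_weight_def flip_edge_def)

lemma half_count_rstep:
  assumes "rstep G H vp ep s" "\<And>x. P' (vp x) = P x"
  shows "half_count K P' (vp a) (edges H) = half_count K P a (edges G)" using assms(1)
proof cases
  case (edges i)
  hence "P' = P" using assms(2) by auto
  with edges show ?thesis by (auto simp: swap_edges_def intro: half_count_mset_cong)
next
  case (vertices v)
  have "half_weight K P a e = half_weight K P' (vp a) (relabel_edge vp e)" for e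
    using rstep_bij(1)[OF assms(1)] by (auto simp: half_weight_def assms(2) bij_def inj_eq)
  hence "half_count K P a (edges G) = half_count K P' (vp a) (map (relabel_edge vp) (edges G))"
    by (rule half_count_cong)
  thus ?thesis using vertices by (simp add: swap_vertices_def)
next
  case (reverse i)
  hence "P' = P" using assms(2) by auto
  moreover have "map (half_weight K P a) (edges H) = map (half_weight K P a) (edges G)"
    using reverse half_weight_flip[of K P a "edges G ! i"]
    by (simp add: reverse_edge_def map_update flip_edge_def list_update_same_conv)
  ultimately show ?thesis using reverse by (simp add: half_count_def)
qed

lemma blow_ok_rstep:
  assumes "rstep G H vp ep s"
  shows "blow_ok K (vp a) (vp ` T) H \<longleftrightarrow> blow_ok K a T G"
proof -
  have inj: "inj vp" using rstep_bij(1)[OF assms] by (rule bij_is_inj)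
  have "out_count K (vp ` T) (vp a) (edges H) = out_count K T a (edges G)"
    "in_count K (vp ` T) (vp a) (edges H) = in_count K T a (edges G)"
    by (rule half_count_rstep[OF assms]; simp add: inj_image_mem_iff[OF inj])+
  thus ?thesis using nth_vkinds_rstep[OF assms, of a] rstep_bij(2)[OF assms, of a] rstep_num[OF assms]
    by (cases "a < num_vertices G") (simp_all add: blow_ok_def)
qed

lemma blow_rstep:
  assumes g: "good G" "good H" and st: "rstep G H vp ep s" and ok: "blow_ok K a T G"
  shows "\<exists>vp' ep'. rstep (blow K a T G) (blow K (vp a) (vp ` T) H) vp' ep' s \<and>
    (\<forall>v. vp' (shift (vpos K G) v) = shift (vpos K H) (vp v))"
proof -
  let ?b = "vpos K G" and ?c = "epos K G"
  note pos = rstep_positions[OF st, of K]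
  note cM = epos_le[of K G] and bN = vpos_le[of K G]
  have ab: "a < ?b" by (rule blow_ok_less[OF g(1) ok])
  have okH: "blow_ok K (vp a) (vp ` T) H" using ok blow_ok_rstep[OF st] by blast
  have ab': "vp a < ?b" using blow_ok_less[OF g(2) okH] pos by simp
  have wl: "well_labeled G" "well_labeled H" using g by (auto simp: good_iff)
  show ?thesis using st
  proof cases
    case (edges i)
    have "ekind (edges G ! Suc i) = Solid \<longleftrightarrow> Suc i < solid_count G"
      using wl(1) edges(5) by (auto simp: well_labeled_iff)
    moreover have "kind_at H i = Solid \<longleftrightarrow> i < solid_count G"
      using wl(2) edges(5) rstep_counts[OF st] rstep_num[OF st] by (auto simp: well_labeled_iff)
    moreover have "edges H ! i = edges G ! Suc i"
      using edges by (simp add: swap_edges_def nth_swap_adjacent)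
    \<comment> \<open>An insertion point between the two swapped edges would mean that a solid edge
      is exchanged with a dashed one, which would spoil the order of \<open>H\<close>. The same
      reasoning applies to vertices further below.\<close>
    ultimately have ne: "?c \<noteq> Suc i" using edges(5) by (auto simp: epos_def)
    hence s: "shift ?c (Suc i) = Suc (shift ?c i)" by (auto simp: shift_def)
    have len: "Suc (shift ?c i) < num_edges (blow K a T G)"
      using edges(5) shift_less[of "Suc i" "num_edges G" ?c] by (simp add: s)
    have "swap_edges (shift ?c i) (blow K a T G) = blow K (vp a) (vp ` T) H"
      using swap_adjacent_ins_at[of i "map (blow_edge K a T ?b) (edges G)" ?c] edges(5) cM ne
      unfolding swap_edges_def[of "shift ?c i"] blow_def pos
      by (simp add: edges(1,2) swap_edges_def map_swap_adjacent)
    moreover have "s = sgn_pow (edeg (blow K a T G) (shift ?c i) * edeg (blow K a T G) (Suc (shift ?c i)))"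
      using edges(5) nth_edges_blow(2)[of i G K a T] nth_edges_blow(2)[of "Suc i" G K a T]
      by (simp add: edges(4) edeg_def s)
    ultimately show ?thesis using rstep.edges[OF len] edges(2) pos by auto
  next
    case (reverse i)
    have len: "shift ?c i < num_edges (blow K a T G)"
      using reverse(5) shift_less[of i "num_edges G" ?c] by simp
    have fl: "blow_edge K a T ?b (flip_edge e) = flip_edge (blow_edge K a T ?b e)" for e
      by (auto simp: blow_edge_def flip_edge_def)
    have "reverse_edge (shift ?c i) (blow K a T G) = blow K (vp a) (vp ` T) H"
      using ins_at_list_update[of i "map (blow_edge K a T ?b) (edges G)" ?c] reverse(5) cM
        nth_edges_blow(2)[of i G K a T] fl[of "edges G ! i"]
      unfolding reverse_edge_def[of "shift ?c i"] blow_def[of K "vp a"] pos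
      by (simp add: reverse(1,2) reverse_edge_def map_update flip_edge_def) (simp add: blow_def)
    moreover have "s = sgn_pow (edeg (blow K a T G) (shift ?c i) + 1)"
      using reverse(5) nth_edges_blow(2)[of i G K a T] by (simp add: reverse(4) edeg_def)
    ultimately show ?thesis using rstep.reverse[OF len] reverse(2) pos by auto
  next
    case (vertices v)
    let ?T = "transpose v (Suc v)"
    have "vkinds G ! Suc v \<noteq> White \<longleftrightarrow> Suc v < black_count G"
      using wl(1) vertices(5) by (auto simp: well_labeled_iff)
    moreover have "vkind H v \<noteq> White \<longleftrightarrow> v < black_count G"
      using wl(2) vertices(5) rstep_counts[OF st] rstep_num[OF st] by (auto simp: well_labeled_iff)
    moreover have "vkind H v = vkinds G ! Suc v"
      using vertices by (simp add: swap_vertices_def nth_swap_adjacent)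
    ultimately have ne: "?b \<noteq> Suc v" using vertices(5) by (auto simp: vpos_def)
    hence s: "shift ?b (Suc v) = Suc (shift ?b v)" by (auto simp: shift_def)
    have len: "Suc (shift ?b v) < num_vertices (blow K a T G)"
      using vertices(5) shift_less[of "Suc v" "num_vertices G" ?b] by (simp add: s)
    define R where "R = transpose (shift ?b v) (Suc (shift ?b v))"
    have R: "R (shift ?b x) = shift ?b (?T x)" for x
      unfolding R_def s[symmetric] by (auto simp: transpose_def)
    have Rb: "R ?b = ?b" unfolding R_def s[symmetric] by (auto simp: transpose_def)
    have Ra: "R a = ?T a" using R[of a] ab ab' by (simp add: shift_id vertices(2))
    have inj: "?T x \<in> ?T ` T \<longleftrightarrow> x \<in> T" "?T x = ?T y \<longleftrightarrow> x = y" for x y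
      using bij_is_inj[OF transpose_Suc_bij[of v]] by (simp_all add: inj_image_mem_iff inj_eq)
    have "blow_edge K (?T a) (?T ` T) ?b (relabel_edge ?T e) = relabel_edge R (blow_edge K a T ?b e)" for e
      by (simp add: blow_edge_def relabel_edge_def inj R Rb)
    moreover have "Edge K (?T a) ?b = relabel_edge R (Edge K a ?b)" by (simp add: relabel_edge_def Ra Rb)
    ultimately have "swap_vertices (shift ?b v) (blow K a T G) = blow K (vp a) (vp ` T) H"
      using swap_adjacent_ins_at[of v "vkinds G" ?b] vertices(5) bN ne
      unfolding swap_vertices_def[of "shift ?b v"] blow_def pos R_def[symmetric]
      by (simp add: vertices(1,2) swap_vertices_def map_ins_at comp_def)
    moreover have "s = sgn_pow (vdeg (blow K a T G) (shift ?b v) * vdeg (blow K a T G) (Suc (shift ?b v)))"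
      using vertices(5) nth_vkinds_blow(2)[of v G K a T] nth_vkinds_blow(2)[of "Suc v" G K a T]
      by (simp add: vertices(4) vdeg_def s)
    ultimately show ?thesis using rstep.vertices[OF len] vertices(2) pos R unfolding R_def by auto
  qed
qed

text \<open>The homotopy: blow up the last marked vertex \<open>a\<close>, the other marked vertices being ignored.\<close>

definition hop_ok :: "edge_kind \<Rightarrow> dgraph \<Rightarrow> bool"
  where "hop_ok K X \<longleftrightarrow> snd X \<noteq> [] \<and> last (snd X) < num_vertices (fst X) \<and>
    vkinds (fst X) ! last (snd X) = ExtBlack \<and>
    half_count K (\<lambda>x. x \<notin> set (butlast (snd X))) (last (snd X)) (edges (fst X)) \<ge> 2"

definition blow_marked :: "edge_kind \<Rightarrow> dgraph \<Rightarrow> dgraph"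
  where "blow_marked K X = (blow K (last (snd X)) (set (butlast (snd X))) (fst X),
    map (shift (vpos K (fst X))) (snd X))"

text \<open>The coefficient is the sign with which contracting the new edge returns the graph. As
  signs square to one, this term of the differential of the blow-up contributes exactly the original
  graph.\<close>

definition hop :: "edge_kind \<Rightarrow> dgraph \<Rightarrow> (dgraph \<Rightarrow>\<^sub>0 rat)"
  where "hop K X = (if hop_ok K X then single (blow_marked K X)
    (csign (fst (blow_marked K X)) (epos K (fst X))) else 0)"

lemma hop_ok_blow_ok: "hop_ok K X \<Longrightarrow> blow_ok K (last (snd X)) (set (butlast (snd X))) (fst X)"
  by (simp add: hop_ok_def blow_ok_def)

lemma good_blow_marked: "good (fst X) \<Longrightarrow> hop_ok K X \<Longrightarrow> good (fst (blow_marked K X))"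
  using good_blow[OF _ hop_ok_blow_ok] by (simp add: blow_marked_def)

lemma last_butlast_map:
  "ms \<noteq> [] \<Longrightarrow> last (map f ms) = f (last ms)" "set (butlast (map f ms)) = f ` set (butlast ms)"
  by (simp_all add: last_map map_butlast[symmetric])

lemma hop_ok_rstep:
  assumes "rstep G H vp ep s"
  shows "hop_ok K (H, map vp ms) \<longleftrightarrow> hop_ok K (G, ms)"
proof (cases "ms = []")
  case False
  have inj: "inj vp" using rstep_bij(1)[OF assms] by (rule bij_is_inj)
  show ?thesis
  proof -
    have hc: "out_count K (vp ` set (butlast ms)) (vp (last ms)) (edges H) =
        out_count K (set (butlast ms)) (last ms) (edges G)"
      by (rule half_count_rstep[OF assms]) (simp add: inj_image_mem_iff[OF inj])
    show ?thesis
      using False nth_vkinds_rstep[OF assms, of "last ms"] rstep_bij(2)[OF assms, of "last ms"] rstep_num[OF assms]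
      by (cases "last ms < num_vertices G") (simp_all add: hop_ok_def last_butlast_map hc)
  qed
qed (simp add: hop_ok_def)

lemma edeg_sum_rstep:
  assumes "rstep G H vp ep s"
  shows "edeg_sum H = edeg_sum G"
proof -
  have "edeg_sum H = (\<Sum>l<num_edges G. edeg H (ep l))" unfolding edeg_sum_def rstep_num[OF assms]
  proof (rule sum.reindex_bij_betw[symmetric])
    have "inj_on ep {..<num_edges G}"
      using bij_is_inj[OF rstep_bij(3)[OF assms]] by (rule inj_on_subset) simp
    moreover have "ep ` {..<num_edges G} \<subseteq> {..<num_edges G}" using rstep_bij(4)[OF assms] by auto
    ultimately show "bij_betw ep {..<num_edges G} {..<num_edges G}"
      using endo_inj_surj[of "{..<num_edges G}" ep] by (simp add: bij_betw_def)
  qed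
  thus ?thesis by (simp add: edeg_sum_def edeg_def nth_edges_rstep'(1)[OF assms])
qed

lemma hop_relations:
  assumes "r \<in> dec_relations"
  shows "lin (hop K) r \<in> rv.span (dec_relations)"
proof -
  obtain G H vp ep s ms where r: "r = bv (H, map vp ms) - single (G, ms) s"
    and g: "good G" "good H" "rstep G H vp ep s" using assms by (auto simp: dec_relations_def)
  show ?thesis
  proof (cases "hop_ok K (G, ms)")
    case False
    thus ?thesis using hop_ok_rstep[OF g(3)] by (simp add: r lin_diff hop_def rv.span_zero)
  next
    case True
    hence okH: "hop_ok K (H, map vp ms)" using hop_ok_rstep[OF g(3)] by blast
    have ne: "ms \<noteq> []" using True by (simp add: hop_ok_def)
    let ?a = "last ms" and ?T = "set (butlast ms)"
    have ok: "blow_ok K ?a ?T G" "blow_ok K (vp ?a) (vp ` ?T) H"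
      using hop_ok_blow_ok[OF True] hop_ok_blow_ok[OF okH] ne by (simp_all add: last_butlast_map)
    obtain vp' ep' where st: "rstep (blow K ?a ?T G) (blow K (vp ?a) (vp ` ?T) H) vp' ep' s"
      and sh: "\<And>v. vp' (shift (vpos K G) v) = shift (vpos K H) (vp v)"
      using blow_rstep[OF g ok(1)] by blast
    define c where "c = csign (blow K ?a ?T G) (epos K G)"
    have c: "csign (blow K (vp ?a) (vp ` ?T) H) (epos K H) = c"
      unfolding c_def contraction_sign_blow[OF g(1) ok(1)] contraction_sign_blow[OF g(2) ok(2)]
      by (simp add: edeg_sum_rstep[OF g(3)] rstep_num[OF g(3)] rstep_counts[OF g(3)])
    have "bv (blow K (vp ?a) (vp ` ?T) H, map vp' (map (shift (vpos K G)) ms)) -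
        single (blow K ?a ?T G, map (shift (vpos K G)) ms) s \<in> dec_relations"
      unfolding dec_relations_def using st good_blow[OF g(1) ok(1)] good_blow[OF g(2) ok(2)] by blast
    from rv.span_scale[OF rv.span_base[OF this], of c]
    show ?thesis using True okH ne c
      by (simp add: r lin_diff hop_def blow_marked_def last_butlast_map rv.scale_right_diff_distrib sh comp_def
          c_def mult.commute)
  qed
qed

lemma length_filter_del_at:
  assumes "i < length xs"
  shows "length (filter P xs) = (if P (xs ! i) then 1 else 0) + length (filter P (del_at i xs))"
  using arg_cong[OF id_take_nth_drop[OF assms], of "\<lambda>xs. length (filter P xs)"] by (simp add: del_at_def)

lemma merge_image_iff:
  assumes "p < q" "p \<notin> T" "q \<notin> T"
  shows "merge p q x \<in> merge p q ` T \<longleftrightarrow> x \<in> T"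
  unfolding image_iff merge_eq_iff[OF assms(1)] using assms(2,3) by (auto simp: doubleton_eq_iff)

lemma half_count_contract:
  assumes "contractible b G l"
  shows "v \<notin> ends_at G l \<Longrightarrow>
      half_count K P (cmap G l v) (edges (contract G l)) = half_count K (\<lambda>x. P (cmap G l x)) v (del_at l (edges G))"
    and "ends_at G l = {v, w} \<Longrightarrow>
      half_count K P (cmap G l v) (edges (contract G l)) =
        half_count K (\<lambda>x. P (cmap G l x)) v (del_at l (edges G)) + half_count K (\<lambda>x. P (cmap G l x)) w (del_at l (edges G))"
proof -
  obtain p q where pq: "cmin G l = p" "cmax G l = q" by blast
  have lt: "p < q" using cmin_less_cmax[OF assms] by (simp only: pq)
  have ends: "ends_at G l = {p, q}" by (simp only: ends_min_max pq)
  have r: "cmap G l = merge p q" by (simp only: cmap_def pq)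
  have eq: "cmap G l x = cmap G l v \<longleftrightarrow> x = v \<or> {x, v} = {p, q}" for x v
    unfolding r by (rule merge_eq_iff[OF lt])
  have comp: "half_count K P u (edges (contract G l)) =
      sum_list (map (\<lambda>e. half_weight K P u (relabel_edge (cmap G l) e)) (del_at l (edges G)))" for u
    by (simp add: half_count_def edges_contract[OF assms] comp_def)
  show "half_count K P (cmap G l v) (edges (contract G l)) = half_count K (\<lambda>x. P (cmap G l x)) v (del_at l (edges G))"
    if "v \<notin> ends_at G l"
  proof -
    have "cmap G l x = cmap G l v \<longleftrightarrow> x = v" for x
      using that unfolding eq ends by (auto simp: doubleton_eq_iff)
    hence "half_weight K P (cmap G l v) (relabel_edge (cmap G l) e) = half_weight K (\<lambda>x. P (cmap G l x)) v e" for e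
      by (simp add: half_weight_def)
    thus ?thesis unfolding comp by (simp add: half_count_def)
  qed
  show "half_count K P (cmap G l v) (edges (contract G l)) =
        half_count K (\<lambda>x. P (cmap G l x)) v (del_at l (edges G)) + half_count K (\<lambda>x. P (cmap G l x)) w (del_at l (edges G))"
    if "ends_at G l = {v, w}"
  proof -
    have "v \<noteq> w" using that lt unfolding ends by (auto simp: doubleton_eq_iff)
    moreover have "cmap G l x = cmap G l v \<longleftrightarrow> x = v \<or> x = w" for x
      using that unfolding eq ends by (auto simp: doubleton_eq_iff)
    ultimately have "half_weight K P (cmap G l v) (relabel_edge (cmap G l) e) =
        half_weight K (\<lambda>x. P (cmap G l x)) v e + half_weight K (\<lambda>x. P (cmap G l x)) w e" for e
      by (auto simp: half_weight_def)
    thus ?thesis unfolding comp by (simp add: half_count_def sum_list_addf)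
  qed
qed

section \<open>Relabelings preserve admissible connected graphs\<close>

lemma well_labeled_cong:
  assumes "well_labeled G" "map ekind (edges H) = map ekind (edges G)"
    "map (\<lambda>k. k = White) (vkinds H) = map (\<lambda>k. k = White) (vkinds G)"
    "\<And>e. e \<in> set (edges H) \<Longrightarrow> src e < num_vertices H \<and> tgt e < num_vertices H"
  shows "well_labeled H"
proof -
  have len: "num_edges H = num_edges G" "num_vertices H = num_vertices G"
    using assms(2,3) by (metis length_map)+
  have k: "kind_at H l = kind_at G l" if "l < num_edges G" for l
    using arg_cong[OF assms(2), of "\<lambda>xs. xs ! l"] that len by simp
  have v: "vkind H v = White \<longleftrightarrow> vkind G v = White" if "v < num_vertices G" for v
    using arg_cong[OF assms(3), of "\<lambda>xs. xs ! v"] that len by simp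
  have A: "vkind G w = White" if "u < w" "w < num_vertices G" "vkind G u = White" for u w
    using assms(1) that unfolding well_labeled_def by blast
  have B: "kind_at G i' = Dashed" if "i < i'" "i' < num_edges G" "kind_at G i = Dashed" for i i'
    using assms(1) that unfolding well_labeled_def by blast
  show ?thesis unfolding well_labeled_def
  proof (intro conjI ballI allI impI)
    fix u w assume "u < w \<and> w < num_vertices H \<and> vkind H u = White"
    thus "vkind H w = White" using A[of u w] v[of u] v[of w] len by simp
  next
    fix i k assume "i < k \<and> k < num_edges H \<and> kind_at H i = Dashed"
    thus "kind_at H k = Dashed" using B[of i k] k[of i] k[of k] len by simp
  qed (use assms(4) in auto)
qed

lemma rstep_edges_bounded:
  assumes "rstep G H vp ep s" "well_labeled G" "e \<in> set (edges H)"
  shows "src e < num_vertices H \<and> tgt e < num_vertices H"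
proof -
  obtain l' where l': "l' < num_edges G" "e = edges H ! l'"
    using assms(3) rstep_num[OF assms(1)] by (metis in_set_conv_nth)
  obtain l where l: "l' = ep l" using rstep_bij(3)[OF assms(1)] by (metis bij_pointE)
  hence lG: "l < num_edges G" using l' rstep_bij(4)[OF assms(1)] by simp
  hence "edges G ! l \<in> set (edges G)" by simp
  hence "src_at G l < num_vertices G" "tgt_at G l < num_vertices G"
    using assms(2) by (auto simp: well_labeled_def)
  thus ?thesis unfolding l'(2) l using nth_edges_rstep[OF assms(1) lG]
    by (elim disjE) (simp_all add: flip_edge_def rstep_bij(2)[OF assms(1)] rstep_num[OF assms(1)])
qed

text \<open>Everything but the order of the label is invariant under isomorphism.
  \<open>well_labeled H\<close> is a hypothesis because a swap across the border between black and
  white vertices, or solid and dashed edges, destroys it.\<close>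

lemma good_rstep:
  assumes g: "good G" and st: "rstep G H vp ep s" and wl: "well_labeled H"
  shows "good H"
proof -
  note num = rstep_num[OF st] and bij = rstep_bij[OF st]
  have pre: "\<exists>v<num_vertices G. u = vp v" if "u < num_vertices H" for u
    using bij(1,2) that num by (metis bij_pointE)
  have "reachable H (vp (src e)) (vp (tgt e))" if e: "e \<in> set (edges G)" for e
  proof -
    obtain l where l: "l < num_edges G" "e = edges G ! l" using e by (metis in_set_conv_nth)
    hence "edges H ! ep l \<in> set (edges H)" using bij(4) num by simp
    from reachable_edge[OF this] nth_edges_rstep[OF st l(1)] show ?thesis
      by (auto simp: l(2) flip_edge_def intro: reachable_sym)
  qed
  hence re: "reachable H (vp v) (vp w)" if "reachable G v w" for v w
    using reachable_map[of G H vp v w] that by blast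
  have "connected_graph H" unfolding connected_graph_def
  proof (intro conjI allI impI)
    show "0 < num_vertices H" using g num by (simp add: good_iff connected_graph_def)
    fix v w assume "v < num_vertices H" "w < num_vertices H"
    then obtain v' w' where "v' < num_vertices G" "w' < num_vertices G" "v = vp v'" "w = vp w'"
      using pre by blast
    thus "reachable H v w" using re g by (auto simp: good_iff connected_graph_def)
  qed
  moreover have "ExtBlack \<in> set (vkinds H)"
  proof -
    obtain v where v: "v < num_vertices G" "vkind G v = ExtBlack"
      using g by (auto simp: good_iff in_set_conv_nth)
    have 1: "vkinds H ! vp v = ExtBlack" using nth_vkinds_rstep[OF st v(1)] v(2) by simp
    have 2: "vp v < num_vertices H" unfolding num(1) bij(2) by (rule v(1))
    from nth_mem[OF 2] show ?thesis unfolding 1 .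
  qed
  moreover have "vertex_ok (vkind H u) (valence Dashed u (edges H)) (valence Solid u (edges H))"
    if u: "u < num_vertices H" for u
  proof -
    obtain v where v: "v < num_vertices G" "u = vp v" using pre[OF u] by blast
    have hv: "valence K u (edges H) = valence K v (edges G)" for K
      unfolding v(2) by (rule half_count_rstep[OF st]) simp
    have kv: "vkind H u = vkind G v" unfolding v(2) by (rule nth_vkinds_rstep[OF st v(1)])
    show ?thesis unfolding hv kv using g v(1) unfolding good_iff by blast
  qed
  ultimately show ?thesis using wl by (simp add: good_iff)
qed

lemma good_reverse_edge:
  assumes "good G" "i < num_edges G"
  shows "good (reverse_edge i G)"
proof (rule good_rstep[OF assms(1) rstep.reverse[OF assms(2)]])
  have wl: "well_labeled G" using assms(1) by (simp add: good_iff)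
  show "well_labeled (reverse_edge i G)" by (rule well_labeled_cong[OF wl])
      (use rstep_edges_bounded[OF rstep.reverse[OF assms(2)] wl] assms(2) in
        \<open>auto simp: reverse_edge_def map_update list_update_same_conv\<close>)
qed

lemma good_swap_edges:
  assumes "good G" "Suc i < num_edges G" "kind_at G i = ekind (edges G ! Suc i)"
  shows "good (swap_edges i G)"
proof (rule good_rstep[OF assms(1) rstep.edges[OF assms(2)]])
  have wl: "well_labeled G" using assms(1) by (simp add: good_iff)
  show "well_labeled (swap_edges i G)"
  proof (rule well_labeled_cong[OF wl])
    show "map ekind (edges (swap_edges i G)) = map ekind (edges G)"
      using assms(2,3) by (intro nth_equalityI) (auto simp: swap_edges_def nth_swap_adjacent transpose_def)
  qed (use rstep_edges_bounded[OF rstep.edges[OF assms(2)] wl] in "auto simp: swap_edges_def")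
qed

lemma good_swap_vertices:
  assumes "good G" "Suc v < num_vertices G" "vkind G v = White \<longleftrightarrow> vkinds G ! Suc v = White"
  shows "good (swap_vertices v G)"
proof (rule good_rstep[OF assms(1) rstep.vertices[OF assms(2)]])
  have wl: "well_labeled G" using assms(1) by (simp add: good_iff)
  show "well_labeled (swap_vertices v G)"
  proof (rule well_labeled_cong[OF wl])
    show "map (\<lambda>k. k = White) (vkinds (swap_vertices v G)) = map (\<lambda>k. k = White) (vkinds G)"
      using assms(2,3) by (intro nth_equalityI) (auto simp: swap_vertices_def nth_swap_adjacent transpose_def)
    show "map ekind (edges (swap_vertices v G)) = map ekind (edges G)"
      by (simp add: swap_vertices_def comp_def)
  qed (use rstep_edges_bounded[OF rstep.vertices[OF assms(2)] wl] in auto)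
qed

section \<open>Contraction of a univalent external vertex\<close>

text \<open>Up to neighbours in \<open>T\<close>, the vertex \<open>a\<close> sees nothing along
  \<open>K\<close> but the internal vertex \<open>w\<close>, and \<open>w\<close> sees nothing of
  \<open>T\<close>. Up to orientation these are the graphs obtained by blowing up \<open>a\<close>:
  contracting \<open>l\<close> and blowing up again recovers them.\<close>

definition leaf_edge :: "edge_kind \<Rightarrow> lgraph \<Rightarrow> nat \<Rightarrow> nat \<Rightarrow> nat \<Rightarrow> nat set \<Rightarrow> bool"
  where "leaf_edge K G l a w T \<longleftrightarrow> l < num_edges G \<and> kind_at G l = K \<and> ends_at G l = {a, w} \<and>
    a \<noteq> w \<and> vkind G a = ExtBlack \<and> vkind G w = int_kind K \<and> a \<notin> T \<and> w \<notin> T \<and>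
    out_count K T a (edges G) = 1 \<and> in_count K T w (edges G) = 0"

lemma leaf_edge_contractible:
  assumes "leaf_edge K G l a w T"
  shows "contractible b G l"
proof -
  have "src_at G l \<noteq> tgt_at G l" using assms by (auto simp: leaf_edge_def ends_def doubleton_eq_iff)
  thus ?thesis using assms by (auto simp: leaf_edge_def contractible_def)
qed

lemma leaf_edge_rstep:
  assumes "good G" "rstep G H vp ep s" "leaf_edge K G l a w T"
  shows "leaf_edge K H (ep l) (vp a) (vp w) (vp ` T)"
proof -
  have l: "l < num_edges G" using assms(3) by (simp add: leaf_edge_def)
  have inj: "inj vp" using rstep_bij(1)[OF assms(2)] by (rule bij_is_inj)
  have N: "a < num_vertices G" "w < num_vertices G"
    using ends_bounded[OF good_typed[OF assms(1)] l] assms(3) by (auto simp: leaf_edge_def)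
  have hc: "out_count K (vp ` T) (vp a) (edges H) = out_count K T a (edges G)"
    "in_count K (vp ` T) (vp w) (edges H) = in_count K T w (edges G)"
    by (rule half_count_rstep[OF assms(2)]; simp add: inj_image_mem_iff[OF inj])+
  show ?thesis using assms(3) N rstep_num[OF assms(2)] rstep_bij(4)[OF assms(2)]
    by (simp add: leaf_edge_def hc nth_edges_rstep'[OF assms(2) l] nth_vkinds_rstep[OF assms(2)]
        inj_image_mem_iff[OF inj] inj_eq[OF inj])
qed

text \<open>The vertex \<open>w\<close> has at least three half-edges, all leading outside
  \<open>T\<close>. Two of them remain after the loss of \<open>l\<close>, and they pass to the
  merged vertex.\<close>

lemma leaf_edge_hop_ok:
  assumes g: "good G" and le: "leaf_edge K G l a w T" and T: "set ts = T"
  shows "hop_ok K (contract G l, map (cmap G l) (ts @ [a]))"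
proof -
  note c = leaf_edge_contractible[OF le, of False]
  have l: "l < num_edges G" and ends: "ends_at G l = {a, w}" and kd: "kind_at G l = K"
    and aw: "a \<noteq> w" "a \<notin> T" "w \<notin> T" and va: "vkind G a = ExtBlack" and vw: "vkind G w = int_kind K"
    and sc: "out_count K T a (edges G) = 1" and sw: "in_count K T w (edges G) = 0"
    using le by (auto simp: leaf_edge_def)
  have N: "a < num_vertices G" "w < num_vertices G" using ends_bounded[OF good_typed[OF g] l] ends by auto
  obtain p q where pq: "cmin G l = p" "cmax G l = q" by blast
  have lt: "p < q" using cmin_less_cmax[OF c] by (simp only: pq)
  have pqa: "{p, q} = {a, w}" using ends by (simp only: ends_min_max pq)
  have r: "cmap G l = merge p q" by (simp only: cmap_def pq)
  have mem: "cmap G l x \<in> cmap G l ` T \<longleftrightarrow> x \<in> T" for x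
  proof -
    have "p \<notin> T" "q \<notin> T" using aw pqa by (auto simp: doubleton_eq_iff)
    thus ?thesis unfolding r by (rule merge_image_iff[OF lt])
  qed
  have v3: "valence K w (edges G) \<ge> 3" using g N(2) vw by (cases K) (fastforce simp: good_iff)+
  have "valence K w (edges G) = in_count K T w (edges G) + out_count K T w (edges G)"
    unfolding half_count_def sum_list_addf[symmetric]
    by (rule arg_cong[of _ _ sum_list]) (auto simp: half_weight_def)
  hence "out_count K T w (edges G) \<ge> 3" using v3 sw by simp
  moreover have "half_weight K (\<lambda>x. x \<notin> T) w (edges G ! l) \<le> 1"
    using aw ends by (auto simp: half_weight_def ends_def doubleton_eq_iff)
  ultimately have "out_count K T w (del_at l (edges G)) \<ge> 2"
    using half_count_del_at[OF l, of K "\<lambda>x. x \<notin> T" w] by simp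
  hence "out_count K (cmap G l ` T) (cmap G l a) (edges (contract G l)) \<ge> 2"
    unfolding half_count_contract(2)[OF c ends] mem by simp
  moreover have "vkinds (contract G l) ! cmap G l a = ExtBlack"
    using vkinds_contract_cmap[OF c good_typed[OF g] N(1)] va ends pqa
    unfolding pq by (auto simp: merged_kind_def doubleton_eq_iff)
  ultimately show ?thesis using cmap_less[OF g c N(1)] T by (simp add: hop_ok_def)
qed

text \<open>When \<open>w\<close> and \<open>l\<close> already occupy the positions where a blow-up
  would insert them and \<open>l\<close> points away from \<open>a\<close>, blowing up the
  contraction reproduces \<open>G\<close> literally, and the coefficient is the square of a
  sign.\<close>

lemma cterm_leaf_normal:
  assumes g: "good G" and le: "leaf_edge K G l a w T" and T: "set ts = T"
    and last: "Suc w = vpos K G" "Suc l = epos K G" and src: "src_at G l = a"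
  shows "lin (hop K) (cterm (G, ts @ [a]) l) = bv (G, ts @ [a])"
proof -
  note c = leaf_edge_contractible[OF le, of False]
  note hok = leaf_edge_hop_ok[OF g le T]
  have l: "l < num_edges G" and ends: "ends_at G l = {a, w}" and kd: "kind_at G l = K"
    and aw: "a \<noteq> w" "a \<notin> T" "w \<notin> T" and va: "vkind G a = ExtBlack" and vw: "vkind G w = int_kind K"
    and sc: "out_count K T a (edges G) = 1" and sw: "in_count K T w (edges G) = 0"
    using le by (auto simp: leaf_edge_def)
  have tgt: "tgt_at G l = w" using ends src aw by (auto simp: ends_def doubleton_eq_iff)
  have el: "edges G ! l = Edge K a w" using src tgt kd by (metis edge.collapse)
  have t: "typed G" and wl: "well_labeled G" using good_typed[OF g] g by (auto simp: good_iff)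
  have N: "a < num_vertices G" "w < num_vertices G" using ends_bounded[OF t l] ends by auto
  have alw: "a < w"
  proof (cases K)
    case Dashed
    thus ?thesis using last N aw by (simp add: vpos_def)
  next
    case Solid
    have "a < black_count G" using wl N va by (auto simp: well_labeled_iff)
    thus ?thesis using last aw Solid by (simp add: vpos_def)
  qed
  have mm: "cmin G l = a" "cmax G l = w" using src tgt alw by auto
  have r: "cmap G l = merge a w" by (simp only: cmap_def mm)
  let ?C = "contract G l"
  have vC: "vkinds ?C = del_at w (vkinds G)"
  proof -
    have "merged_kind (vkind G a) (vkind G w) = vkind G a" by (simp add: merged_kind_def va)
    thus ?thesis using contract_eq[of G l] src tgt aw mm by simp
  qed
  have eC: "edges ?C = map (relabel_edge (merge a w)) (del_at l (edges G))"
    using edges_contract[OF c] by (simp only: r)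
  have "vpos K ?C = w \<and> epos K ?C = l"
  proof (cases K)
    case Dashed
    thus ?thesis
      using last num_vertices_contract[OF c t] num_edges_contract[OF c] unfolding vpos_def epos_def
      by (metis diff_Suc_1)
  next
    case Solid
    have "black_count G = Suc (black_count ?C)"
      using length_filter_del_at[OF N(2), of "\<lambda>k. k \<noteq> White"] vw Solid by (simp add: black_count_def vC)
    moreover have "solid_count G = Suc (solid_count ?C)"
      using length_filter_del_at[OF l, of "\<lambda>e. ekind e = Solid"] kd Solid
      by (simp add: solid_count_def eC filter_map comp_def)
    ultimately show ?thesis using last Solid by (simp add: vpos_def epos_def)
  qed
  hence pos: "vpos K ?C = w" "epos K ?C = l" by auto
  let ?T' = "merge a w ` T"
  have mem: "merge a w x \<in> ?T' \<longleftrightarrow> x \<in> T" for x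
    by (rule merge_image_iff[OF alw]) (use aw in blast)+
  have "half_weight K (\<lambda>x. x \<notin> T) a (edges G ! l) = 1"
    using aw by (simp add: el half_weight_def)
  hence "out_count K T a (del_at l (edges G)) = 0"
    using half_count_del_at[OF l, of K "\<lambda>x. x \<notin> T" a] sc by simp
  \<comment> \<open>Apart from \<open>l\<close>, the half-edges of kind \<open>K\<close> at
    \<open>a\<close> lead into \<open>T\<close>, those at \<open>w\<close> lead outside, and all
    edges at \<open>w\<close> are of kind \<open>K\<close>. Hence the opposite end tells which of
    the two merged vertices a half-edge came from.\<close>
  hence z1: "(src e = a \<longrightarrow> tgt e \<in> T) \<and> (tgt e = a \<longrightarrow> src e \<in> T)"
    if "e \<in> set (del_at l (edges G))" "ekind e = K" for e using that by (simp add: half_count_zero_iff)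
  have z2: "(src e = w \<longrightarrow> tgt e \<notin> T) \<and> (tgt e = w \<longrightarrow> src e \<notin> T)"
    if "e \<in> set (edges G)" "ekind e = K" for e using that sw by (simp add: half_count_zero_iff)
  have z3: "ekind e = K" if "e \<in> set (edges G)" "w \<in> ends e" for e
  proof -
    have "(ekind e = Solid \<longrightarrow> vkind G w \<noteq> White) \<and> (ekind e = Dashed \<longrightarrow> vkind G w \<noteq> IntBlack)"
      using t that unfolding typed_def by blast
    thus ?thesis using vw by (cases K; cases "ekind e") auto
  qed
  have mw: "merge a w x = a \<longleftrightarrow> x = a \<or> x = w" for x
    using merge_eq_iff[OF alw, of x a] alw by (auto simp: doubleton_eq_iff)
  have sm: "x \<noteq> w \<Longrightarrow> shift w (merge a w x) = x" for x
    using alw by (auto simp: shift_def merge_def)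
  have "blow_edge K a ?T' w (relabel_edge (merge a w) e) = e" if e: "e \<in> set (del_at l (edges G))" for e
  proof -
    have eG: "e \<in> set (edges G)" using e set_del_at_subset[of l "edges G"] by blast
    have A: "(if ekind e = K \<and> merge a w (src e) = a \<and> merge a w (tgt e) \<notin> ?T' then w else shift w (merge a w (src e))) = src e"
      using z1[OF e] z2[OF eG] z3[OF eG] sm[of "src e"] unfolding mem mw by (auto simp: ends_def)
    have B: "(if ekind e = K \<and> merge a w (tgt e) = a \<and> merge a w (src e) \<notin> ?T' then w else shift w (merge a w (tgt e))) = tgt e"
      using z1[OF e] z2[OF eG] z3[OF eG] sm[of "tgt e"] unfolding mem mw by (auto simp: ends_def)
    show ?thesis unfolding blow_edge_def relabel_edge_simps A B by simp
  qed
  hence "map (blow_edge K a ?T' w) (edges ?C) = del_at l (edges G)" unfolding eC by (simp add: map_idI)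
  hence bl: "blow K a ?T' ?C = G" using ins_del_at[OF N(2)] ins_del_at[OF l] unfolding blow_def pos
    by (simp add: vC vw el)
  have ca: "cmap G l a = a" using alw by (simp add: r)
  have sh: "map (shift w) (map (cmap G l) (ts @ [a])) = ts @ [a]" unfolding r map_map
  proof (rule map_idI)
    fix x assume "x \<in> set (ts @ [a])"
    hence "x \<noteq> w" using aw T by auto
    thus "(shift w \<circ> merge a w) x = x" using sm by simp
  qed
  have bm: "blow_marked K (?C, map (cmap G l) (ts @ [a])) = (G, ts @ [a])"
    using bl sh T ca unfolding r by (simp add: blow_marked_def pos)
  show ?thesis using hok bm by (simp add: cterm_def hop_def pos contraction_sign_eq[OF g c])
qed

text \<open>Both sides are multiplied by \<open>s\<close> under the relabeling, modulo relations,
  and \<open>s\<close> is its own inverse. So the claim may be checked after any elementary change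
  of the label.\<close>

lemma leaf_step:
  assumes g: "good G" "good H" and st: "rstep G H vp ep s" and le: "leaf_edge K G l a w T"
    and claim: "lin (hop K) (cterm (H, map vp ms) (ep l)) - bv (H, map vp ms) \<in> rv.span (dec_relations)"
  shows "lin (hop K) (cterm (G, ms) l) - bv (G, ms) \<in> rv.span (dec_relations)"
proof -
  let ?R = "rv.span (dec_relations)"
  have "bv (H, map vp ms) - single (G, ms) s \<in> dec_relations"
    unfolding dec_relations_def using g st by blast
  hence 1: "bv (H, map vp ms) - scale_rat s (bv (G, ms)) \<in> ?R" by (simp add: rv.span_base)
  have "cterm (H, map vp ms) (ep l) - scale_rat s (cterm (G, ms) l) \<in> ?R"
    by (rule cterm_rstep[OF g st leaf_edge_contractible[OF le, of False]])
  hence "lin (hop K) (cterm (H, map vp ms) (ep l) - scale_rat s (cterm (G, ms) l)) \<in> ?R"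
    using lin_span_image[of "dec_relations" "hop K" "dec_relations"] hop_relations by blast
  hence 2: "lin (hop K) (cterm (H, map vp ms) (ep l))
      - scale_rat s (lin (hop K) (cterm (G, ms) l)) \<in> ?R" by (simp only: lin_diff lin_scale)
  let ?x = "lin (hop K) (cterm (G, ms) l)" and ?y = "lin (hop K) (cterm (H, map vp ms) (ep l))"
  have "scale_rat s (?x - bv (G, ms)) = (?y - bv (H, map vp ms)) + (bv (H, map vp ms) - scale_rat s (bv (G, ms)))
      - (?y - scale_rat s ?x)" unfolding rv.scale_right_diff_distrib by simp
  also have "\<dots> \<in> ?R" by (intro rv.span_add rv.span_diff claim 1 2)
  finally have "scale_rat s (scale_rat s (?x - bv (G, ms))) \<in> ?R" by (rule rv.span_scale)
  thus ?thesis using rstep_sign[OF st] by simp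
qed

text \<open>By changing the label one may assume that the edge and its internal end come last.\<close>

theorem cterm_leaf:
  assumes "good G" "leaf_edge K G l a w T" "set ts = T"
  shows "lin (hop K) (cterm (G, ts @ [a]) l) - bv (G, ts @ [a]) \<in> rv.span (dec_relations)"
proof -
  have *: "lin (hop K) (cterm (G, ts @ [a]) l) - bv (G, ts @ [a]) \<in> rv.span (dec_relations)"
    if "good G" "leaf_edge K G l a w T" "set ts = T" "src_at G l = a"
      "(vpos K G - w) + (epos K G - l) = m" for m G l a w ts T using that
  \<comment> \<open>Up to a constant, \<open>m\<close> is the number of neighbour swaps that bring
    \<open>w\<close> and \<open>l\<close> to the last positions of their kind.\<close>
  proof (induction m arbitrary: G l a w ts T rule: less_induct)
    case (less m)
    note g = less.prems(1) and le = less.prems(2) and T = less.prems(3) and src = less.prems(4) and m = less.prems(5)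
    have l: "l < num_edges G" and ends: "ends_at G l = {a, w}" and kd: "kind_at G l = K"
      and vw: "vkind G w = int_kind K" using le by (auto simp: leaf_edge_def)
    have wl: "well_labeled G" using g by (auto simp: good_iff)
    have N: "a < num_vertices G" "w < num_vertices G" using ends_bounded[OF good_typed[OF g] l] ends by auto
    have lw: "w < vpos K G" "l < epos K G"
      using wl l N kd vw by (cases K; auto simp: vpos_def epos_def well_labeled_iff)+
    consider "Suc w < vpos K G" | "Suc l < epos K G" | "Suc w = vpos K G" "Suc l = epos K G"
      using lw by linarith
    thus ?case
    proof cases
      case 1
      hence w1: "Suc w < num_vertices G" using vpos_le[of K G] by simp
      have "vkind G w = White \<longleftrightarrow> vkinds G ! Suc w = White"
      proof -
        have "vkind G w \<noteq> White \<longleftrightarrow> w < black_count G" "vkinds G ! Suc w \<noteq> White \<longleftrightarrow> Suc w < black_count G"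
          using wl N w1 by (auto simp: well_labeled_iff)
        thus ?thesis using 1 vw by (cases K) (auto simp: vpos_def)
      qed
      hence gH: "good (swap_vertices w G)" by (rule good_swap_vertices[OF g w1])
      note st = rstep.vertices[OF w1]
      show ?thesis
      proof (rule leaf_step[OF g gH st le])
        let ?H = "swap_vertices w G" and ?T = "transpose w (Suc w)"
        have lH: "leaf_edge K ?H l (?T a) (Suc w) (?T ` T)" using leaf_edge_rstep[OF g st le] by simp
        have sH: "src_at ?H l = ?T a" using l src by (simp add: swap_vertices_def)
        have "lin (hop K) (cterm (?H, map ?T ts @ [?T a]) l) - bv (?H, map ?T ts @ [?T a]) \<in> rv.span (dec_relations)"
        proof (rule less.IH[OF _ gH lH _ sH refl])
          show "vpos K ?H - Suc w + (epos K ?H - l) < m" using rstep_positions[OF st, of K] 1 m by simp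
        qed (use T in simp)
        thus "lin (hop K) (cterm (?H, map ?T (ts @ [a])) (id l)) - bv (?H, map ?T (ts @ [a])) \<in> rv.span (dec_relations)"
          by simp
      qed
    next
      case 2
      hence l1: "Suc l < num_edges G" using epos_le[of K G] by simp
      have "kind_at G l = ekind (edges G ! Suc l)"
      proof -
        have "kind_at G l = Solid \<longleftrightarrow> l < solid_count G" "ekind (edges G ! Suc l) = Solid \<longleftrightarrow> Suc l < solid_count G"
          using wl l l1 by (auto simp: well_labeled_iff)
        thus ?thesis using 2 kd by (cases K; cases "ekind (edges G ! Suc l)") (auto simp: epos_def)
      qed
      hence gH: "good (swap_edges l G)" by (rule good_swap_edges[OF g l1])
      note st = rstep.edges[OF l1]
      show ?thesis
      proof (rule leaf_step[OF g gH st le])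
        let ?H = "swap_edges l G"
        have lH: "leaf_edge K ?H (Suc l) a w T" using leaf_edge_rstep[OF g st le] by simp
        have sH: "src (edges ?H ! Suc l) = a" using l1 src by (simp add: swap_edges_def nth_swap_adjacent)
        have "lin (hop K) (cterm (?H, ts @ [a]) (Suc l)) - bv (?H, ts @ [a]) \<in> rv.span (dec_relations)"
        proof (rule less.IH[OF _ gH lH T sH refl])
          show "vpos K ?H - w + (epos K ?H - Suc l) < m" using rstep_positions[OF st, of K] 2 m by simp
        qed
        thus "lin (hop K) (cterm (?H, map id (ts @ [a])) (transpose l (Suc l) l))
            - bv (?H, map id (ts @ [a])) \<in> rv.span (dec_relations)" by simp
      qed
    next
      case 3
      show ?thesis unfolding cterm_leaf_normal[OF g le T 3 src] by (simp add: rv.span_zero)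
    qed
  qed
  have l: "l < num_edges G" and ends: "ends_at G l = {a, w}" using assms(2) by (auto simp: leaf_edge_def)
  then consider "src_at G l = a" | "tgt_at G l = a" by (auto simp: ends_def doubleton_eq_iff)
  thus ?thesis
  proof cases
    case 1
    show ?thesis by (rule *[OF assms 1 refl])
  next
    case 2
    note st = rstep.reverse[OF l]
    have gH: "good (reverse_edge l G)" by (rule good_reverse_edge[OF assms(1) l])
    show ?thesis
    proof (rule leaf_step[OF assms(1) gH st assms(2)])
      let ?H = "reverse_edge l G"
      have lH: "leaf_edge K ?H l a w T" using leaf_edge_rstep[OF assms(1) st assms(2)] by simp
      have sH: "src_at ?H l = a" using l 2 by (simp add: reverse_edge_def)
      show "lin (hop K) (cterm (?H, map id (ts @ [a])) (id l)) - bv (?H, map id (ts @ [a])) \<in> rv.span (dec_relations)"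
        using *[OF gH lH assms(3) sH refl] by simp
    qed
  qed
qed

section \<open>Pruned vertices\<close>

definition inner_count :: "edge_kind \<Rightarrow> lgraph \<Rightarrow> nat \<Rightarrow> nat"
  where "inner_count K G v = half_count K (\<lambda>x. vkind G x \<noteq> ExtBlack) v (edges G)"

text \<open>The final state of a marked vertex: there is no second free half-edge, so the blow-up
  does not apply, and no internal vertex is adjacent along \<open>K\<close>.\<close>

definition pruned :: "edge_kind \<Rightarrow> lgraph \<Rightarrow> nat \<Rightarrow> nat set \<Rightarrow> bool"
  where "pruned K G v T \<longleftrightarrow> out_count K T v (edges G) \<le> 1 \<and> inner_count K G v = 0"

text \<open>The part of being pruned that concerns internal neighbours, for all earlier marks. It
  guarantees that contracted edges of kind \<open>K\<close> stay away from \<open>T\<close>.\<close>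

definition clean :: "edge_kind \<Rightarrow> lgraph \<Rightarrow> nat set \<Rightarrow> bool"
  where "clean K G T \<longleftrightarrow> (\<forall>t\<in>T. t < num_vertices G \<and> vkind G t = ExtBlack \<and> inner_count K G t = 0)"

text \<open>\<open>stage f N (G, ms)\<close>: the first \<open>f K\<close> marked vertices are leaves of kind \<open>K\<close> (or isolated) once
  the preceding marked vertices are ignored.\<close>

definition stage :: "(edge_kind \<Rightarrow> nat) \<Rightarrow> nat \<Rightarrow> dgraph \<Rightarrow> bool"
  where "stage f N X \<longleftrightarrow> good (fst X) \<and> distinct (snd X) \<and>
    (\<forall>v\<in>set (snd X). v < num_vertices (fst X) \<and> vkind (fst X) v = ExtBlack) \<and>
    card {v. v < num_vertices (fst X) \<and> vkind (fst X) v = ExtBlack} = N \<and>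
    (\<forall>K i. i < f K \<and> i < length (snd X) \<longrightarrow> pruned K (fst X) (snd X ! i) (set (take i (snd X))))"

definition has_internal :: "lgraph \<Rightarrow> bool"
  where "has_internal G \<longleftrightarrow> (\<exists>v<num_vertices G. vkind G v \<noteq> ExtBlack)"

lemma half_count_add_not:
  "half_count K (\<lambda>_. True) v es = half_count K P v es + half_count K (\<lambda>x. \<not> P x) v es"
  unfolding half_count_def sum_list_addf[symmetric]
  by (rule arg_cong[of _ _ sum_list]) (auto simp: half_weight_def)

lemma half_count_pos_iff:
  "half_count K P v es > 0 \<longleftrightarrow> (\<exists>l<length es. \<exists>w. ekind (es ! l) = K \<and> ends (es ! l) = {v, w} \<and> P w)"
proof
  assume "half_count K P v es > 0"
  then obtain e where e: "e \<in> set es" "ekind e = K" "src e = v \<and> P (tgt e) \<or> tgt e = v \<and> P (src e)"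
    using half_count_zero_iff[of K P v es] by auto
  then obtain l where "l < length es" "es ! l = e" by (metis in_set_conv_nth)
  with e(2,3) show "\<exists>l<length es. \<exists>w. ekind (es ! l) = K \<and> ends (es ! l) = {v, w} \<and> P w"
    by (intro exI[of _ l]) (auto simp: ends_def insert_commute)
next
  assume "\<exists>l<length es. \<exists>w. ekind (es ! l) = K \<and> ends (es ! l) = {v, w} \<and> P w"
  then obtain l w where l: "l < length es" "ekind (es ! l) = K" "ends (es ! l) = {v, w}" "P w" by blast
  hence "half_weight K P v (es ! l) > 0" by (auto simp: half_weight_def ends_def doubleton_eq_iff)
  thus "half_count K P v es > 0" using half_count_del_at[OF l(1), of K P v] by simp
qed

lemma half_count_two_edges:
  assumes "l < length es" "m < length es" "l \<noteq> m" "ekind (es ! l) = K" "ekind (es ! m) = K"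
    "ends (es ! l) = {v, w}" "ends (es ! m) = {v, u}" "P w" "P u"
  shows "half_count K P v es \<ge> 2"
proof -
  have "half_weight K P v (es ! l) \<ge> 1" "half_weight K P v (es ! m) \<ge> 1"
    using assms by (auto simp: half_weight_def ends_def doubleton_eq_iff)
  moreover have "half_count K P v (del_at l es) \<ge> half_weight K P v (es ! m)"
  proof -
    let ?m = "if m < l then m else m - 1"
    have m: "?m < length (del_at l es)" "del_at l es ! ?m = es ! m"
      using assms(1-3) by (auto simp: nth_del_at)
    show ?thesis using half_count_del_at[OF m(1), of K P v] m(2) by simp
  qed
  ultimately show ?thesis using half_count_del_at[OF assms(1), of K P v] by simp
qed

section \<open>Marked vertices under contraction\<close>

lemma edge_kind_internal:
  assumes "good G" "l < num_edges G" "v \<in> ends_at G l" "vkind G v \<noteq> ExtBlack"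
  shows "vkind G v = int_kind (kind_at G l)"
proof -
  have "edges G ! l \<in> set (edges G)" using assms(2) by simp
  hence "(kind_at G l = Solid \<longrightarrow> vkind G v \<noteq> White) \<and> (kind_at G l = Dashed \<longrightarrow> vkind G v \<noteq> IntBlack)"
    using good_typed[OF assms(1)] assms(3) unfolding typed_def by blast
  thus ?thesis using assms(4) by (cases "kind_at G l"; cases "vkind G v") auto
qed

lemma contractible_False_internal:
  assumes "contractible False G l"
  shows "\<exists>v\<in>ends_at G l. vkind G v \<noteq> ExtBlack"
  using assms by (simp add: contractible_def)

lemma inner_count_contractible:
  assumes "good G" "contractible False G l" "v \<in> ends_at G l" "vkind G v = ExtBlack"
    "inner_count K G v = 0"
  shows "kind_at G l \<noteq> K"
proof
  assume k: "kind_at G l = K"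
  obtain u where u: "u \<in> ends_at G l" "vkind G u \<noteq> ExtBlack"
    using contractible_False_internal[OF assms(2)] by blast
  hence "ends_at G l = {v, u}" using assms(3,4) by (auto simp: ends_def)
  hence "inner_count K G v > 0"
    unfolding inner_count_def half_count_pos_iff using k u contractible_less[OF assms(2)] by blast
  thus False using assms(5) by simp
qed

lemma clean_disjoint:
  assumes "good G" "contractible False G l" "clean K G T" "kind_at G l = K"
  shows "ends_at G l \<inter> T = {}"
  using inner_count_contractible[OF assms(1,2)] assms(3,4) unfolding clean_def by blast

text \<open>Seen from its other end, such a half-edge would lead from a vertex of \<open>T\<close>
  to an internal one.\<close>

lemma clean_internal_zero:
  assumes "clean K G T" "vkind G w \<noteq> ExtBlack"
  shows "in_count K T w (edges G) = 0"
proof (rule ccontr)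
  assume "in_count K T w (edges G) \<noteq> 0"
  then obtain l t where l: "l < num_edges G" "kind_at G l = K" "ends_at G l = {w, t}" "t \<in> T"
    using half_count_pos_iff[of K "\<lambda>x. x \<in> T" w "edges G"] by auto
  hence "inner_count K G t > 0"
    unfolding inner_count_def half_count_pos_iff using assms(2) by (metis insert_commute)
  thus False using assms(1) l(4) by (simp add: clean_def)
qed

lemma leaf_edgeI:
  assumes "good G" "clean K G T" "l < num_edges G" "kind_at G l = K" "ends_at G l = {a, w}"
    "vkind G a = ExtBlack" "vkind G w \<noteq> ExtBlack" "a \<notin> T" "out_count K T a (edges G) = 1"
  shows "leaf_edge K G l a w T"
proof -
  have "vkind G w = int_kind K" using edge_kind_internal[OF assms(1,3), of w] assms(4,5,7) by simp
  moreover have "w \<notin> T" using assms(2,7) by (auto simp: clean_def)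
  ultimately show ?thesis using assms clean_internal_zero[OF assms(2,7)] unfolding leaf_edge_def by auto
qed

text \<open>If \<open>v\<close> is an end of \<open>l\<close>, then \<open>l\<close> is not of kind
  \<open>K\<close>, and its internal end has no half-edges of kind \<open>K\<close> at all; merging
  with it adds nothing to the count.\<close>

lemma half_count_contract_same:
  assumes g: "good G" and c: "contractible False G l" and v: "vkind G v = ExtBlack"
    and nv: "v \<notin> ends_at G l \<or> kind_at G l \<noteq> K"
    and P: "\<And>m x. \<lbrakk>m < num_edges G; m \<noteq> l; kind_at G m = K; x \<in> ends_at G m\<rbrakk> \<Longrightarrow> P' (cmap G l x) \<longleftrightarrow> P x"
  shows "half_count K P' (cmap G l v) (edges (contract G l)) = half_count K P v (edges G)"
proof -
  note l = contractible_less[OF c]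
  have P: "P' (cmap G l x) \<longleftrightarrow> P x" if e: "e \<in> set (del_at l (edges G))" "ekind e = K" "x \<in> ends e" for e x
  proof -
    obtain k where k: "k < num_edges G - 1" "e = del_at l (edges G) ! k"
      using e(1) l by (auto simp: in_set_conv_nth)
    define k' where "k' = (if k < l then k else Suc k)"
    have "e = edges G ! k'" using l k by (simp add: nth_del_at k'_def)
    moreover have "k' < num_edges G" "k' \<noteq> l" using k(1) by (auto simp: k'_def)
    ultimately show ?thesis using P[of k' x] e(2,3) by blast
  qed
  have eq: "half_count K (\<lambda>x. P' (cmap G l x)) v (del_at l (edges G)) = half_count K P v (del_at l (edges G))" for v
    unfolding half_count_def
    by (intro arg_cong[of _ _ sum_list] map_cong refl) (use P in "auto simp: half_weight_def ends_def")
  show ?thesis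
  proof (cases "v \<in> ends_at G l")
    case False
    hence "half_weight K P v (edges G ! l) = 0" by (auto simp: half_weight_def ends_def)
    thus ?thesis unfolding half_count_contract(1)[OF c False] eq half_count_del_at[OF l, of K P v] by simp
  next
    case True
    hence k: "kind_at G l \<noteq> K" using nv by blast
    obtain u where u: "u \<in> ends_at G l" "vkind G u \<noteq> ExtBlack"
      using contractible_False_internal[OF c] by blast
    hence ends: "ends_at G l = {v, u}" using True v by (auto simp: ends_def)
    have "half_count K P u (edges G) = 0"
    proof (rule ccontr)
      assume "half_count K P u (edges G) \<noteq> 0"
      then obtain m w where m: "m < num_edges G" "kind_at G m = K" "ends_at G m = {u, w}"
        using half_count_pos_iff[of K P u "edges G"] by auto
      have "int_kind K = int_kind (kind_at G l)"
        using edge_kind_internal[OF g m(1), of u] edge_kind_internal[OF g l, of u] m u by simp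
      thus False using k by (cases K; cases "kind_at G l") auto
    qed
    moreover have "half_weight K P x (edges G ! l) = 0" for x using k by (simp add: half_weight_def)
    ultimately show ?thesis unfolding half_count_contract(2)[OF c ends] eq
      using half_count_del_at[OF l, of K P v] half_count_del_at[OF l, of K P u] by simp
  qed
qed

text \<open>An edge \<open>l\<close> of kind \<open>K\<close> avoids \<open>T\<close> altogether.
  One of the other kind may merge a vertex of \<open>T\<close> with an internal vertex, but that
  internal vertex is no end of an edge of kind \<open>K\<close>, so the confusion is invisible along
  \<open>K\<close>.\<close>

lemma cmap_image_iff:
  assumes g: "good G" and c: "contractible False G l" and T: "\<forall>t\<in>T. vkind G t = ExtBlack"
    and d: "kind_at G l = K \<Longrightarrow> ends_at G l \<inter> T = {}"
    and m: "m < num_edges G" "kind_at G m = K" "x \<in> ends_at G m"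
  shows "cmap G l x \<in> cmap G l ` T \<longleftrightarrow> x \<in> T"
proof -
  obtain p q where pq: "cmin G l = p" "cmax G l = q" by blast
  have lt: "p < q" using cmin_less_cmax[OF c] by (simp only: pq)
  have ends: "ends_at G l = {p, q}" by (simp only: ends_min_max pq)
  have r: "cmap G l = merge p q" by (simp only: cmap_def pq)
  show ?thesis
  proof (cases "kind_at G l = K")
    case True
    hence "p \<notin> T" "q \<notin> T" using d ends by auto
    thus ?thesis unfolding r by (rule merge_image_iff[OF lt])
  next
    case False
    note l = contractible_less[OF c]
    have xi: "vkind G x = ExtBlack" if "x \<in> {p, q}"
    proof (rule ccontr)
      assume ne: "vkind G x \<noteq> ExtBlack"
      have "int_kind K = int_kind (kind_at G l)"
        using edge_kind_internal[OF g m(1,3) ne] edge_kind_internal[OF g l _ ne] that ends m(2) by simp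
      thus False using False by (cases K; cases "kind_at G l") auto
    qed
    obtain u where u: "u \<in> {p, q}" "vkind G u \<noteq> ExtBlack"
      using contractible_False_internal[OF c] ends by auto
    show ?thesis
    proof
      assume "cmap G l x \<in> cmap G l ` T"
      then obtain t where t: "t \<in> T" "merge p q x = merge p q t" by (auto simp: r)
      hence "x = t \<or> {x, t} = {p, q}" using merge_eq_iff[OF lt] by blast
      thus "x \<in> T"
      proof
        assume xt: "{x, t} = {p, q}"
        hence "u = x \<or> u = t" using u by blast
        thus ?thesis using u(2) xi xt T t(1) by auto
      qed (use t in simp)
    qed auto
  qed
qed

lemma vkinds_contract_ext:
  assumes "good G" "contractible b G l" "v < num_vertices G" "vkind G v = ExtBlack"
  shows "vkinds (contract G l) ! cmap G l v = ExtBlack"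
  using contract_kind_fibre(1)[OF assms(1-3)] assms(3,4) by blast

lemma vkinds_contract_int:
  assumes "good G" "contractible b G l" "v < num_vertices G" "vkinds (contract G l) ! cmap G l v \<noteq> ExtBlack"
  shows "vkind G v \<noteq> ExtBlack" using vkinds_contract_ext[OF assms(1-3)] assms(4) by blast

lemma inner_count_contract:
  assumes g: "good G" and c: "contractible False G l" and v: "vkind G v = ExtBlack" and i: "inner_count K G v = 0"
  shows "inner_count K (contract G l) (cmap G l v) = 0"
proof -
  have "inner_count K (contract G l) (cmap G l v) = half_count K (\<lambda>x. vkinds (contract G l) ! cmap G l x \<noteq> ExtBlack) v (edges G)"
    unfolding inner_count_def
    by (rule half_count_contract_same[OF g c v]) (use inner_count_contractible[OF g c _ v i] in auto)
  also have "\<dots> = 0"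
  proof (rule ccontr)
    assume "half_count K (\<lambda>x. vkinds (contract G l) ! cmap G l x \<noteq> ExtBlack) v (edges G) \<noteq> 0"
    then obtain m w where m: "m < num_edges G" "kind_at G m = K" "ends_at G m = {v, w}"
      "vkinds (contract G l) ! cmap G l w \<noteq> ExtBlack"
      using half_count_pos_iff[of K "\<lambda>x. vkinds (contract G l) ! cmap G l x \<noteq> ExtBlack" v "edges G"] by auto
    hence "w < num_vertices G" using ends_bounded[OF good_typed[OF g] m(1)] by auto
    hence "vkind G w \<noteq> ExtBlack" using vkinds_contract_int[OF g c] m(4) by blast
    hence "inner_count K G v > 0" unfolding inner_count_def half_count_pos_iff using m(1-3) by blast
    thus False using i by simp
  qed
  finally show ?thesis .
qed

lemma clean_contract:
  assumes "good G" "contractible False G l" "clean K G T"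
  shows "clean K (contract G l) (cmap G l ` T)"
  using assms(3) inner_count_contract[OF assms(1,2)] vkinds_contract_ext[OF assms(1,2)] cmap_less[OF assms(1,2)]
  by (auto simp: clean_def)

lemma half_count_contract_notin:
  assumes g: "good G" and c: "contractible False G l" and T: "clean K G T" and v: "vkind G v = ExtBlack"
    and nv: "v \<notin> ends_at G l \<or> kind_at G l \<noteq> K"
  shows "out_count K (cmap G l ` T) (cmap G l v) (edges (contract G l)) = out_count K T v (edges G)"
proof (rule half_count_contract_same[OF g c v nv])
  fix m x assume "m < num_edges G" "kind_at G m = K" "x \<in> ends_at G m"
  thus "cmap G l x \<notin> cmap G l ` T \<longleftrightarrow> x \<notin> T"
    using cmap_image_iff[OF g c, of T K m x] clean_disjoint[OF g c T] T by (auto simp: clean_def)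
qed

lemma pruned_contract:
  assumes "good G" "contractible False G l" "clean K G T" "vkind G v = ExtBlack" "pruned K G v T"
  shows "pruned K (contract G l) (cmap G l v) (cmap G l ` T)"
proof -
  have "v \<notin> ends_at G l \<or> kind_at G l \<noteq> K"
    using inner_count_contractible[OF assms(1,2) _ assms(4)] assms(5) by (auto simp: pruned_def)
  thus ?thesis using half_count_contract_notin[OF assms(1-4)] inner_count_contract[OF assms(1,2,4)] assms(5)
    by (auto simp: pruned_def)
qed

text \<open>The contracted edge cannot be another edge of kind \<open>K\<close> at \<open>a\<close>,
  since the single free half-edge of \<open>a\<close> belongs to \<open>m\<close>. Whether
  \<open>w\<close> is absorbed by an external vertex decides between the pruned and the leaf
  state.\<close>

lemma leaf_edge_contract:
  assumes g: "good G" and c: "contractible False G l" and T: "clean K G T" and le: "leaf_edge K G m a w T" and ml: "m \<noteq> l"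
  shows "out_count K (cmap G l ` T) (cmap G l a) (edges (contract G l)) = 1"
    and "if vkinds (contract G l) ! cmap G l w = ExtBlack then pruned K (contract G l) (cmap G l a) (cmap G l ` T)
      else leaf_edge K (contract G l) (after_del l m) (cmap G l a) (cmap G l w) (cmap G l ` T)"
proof -
  note l = contractible_less[OF c]
  have m: "m < num_edges G" and ends: "ends_at G m = {a, w}" and kd: "kind_at G m = K"
    and aw: "a \<noteq> w" "a \<notin> T" "w \<notin> T" and va: "vkind G a = ExtBlack" and vw: "vkind G w = int_kind K"
    and sc: "out_count K T a (edges G) = 1" using le by (auto simp: leaf_edge_def)
  have N: "a < num_vertices G" "w < num_vertices G" using ends_bounded[OF good_typed[OF g] m] ends by auto
  have na: "a \<notin> ends_at G l \<or> kind_at G l \<noteq> K"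
  proof (rule ccontr)
    assume "\<not> ?thesis"
    hence al: "a \<in> ends_at G l" and kl: "kind_at G l = K" by auto
    obtain u where u: "u \<in> ends_at G l" "vkind G u \<noteq> ExtBlack"
      using contractible_False_internal[OF c] by blast
    have "u \<noteq> a" using u(2) va by blast
    hence "ends_at G l = {a, u}" using al u(1) by (auto simp: ends_def)
    moreover have "u \<notin> T" using T u(2) unfolding clean_def by blast
    ultimately have "out_count K T a (edges G) \<ge> 2"
      by (intro half_count_two_edges[OF m l ml kd kl ends] aw(3))
    thus False using sc by simp
  qed
  show sc': "out_count K (cmap G l ` T) (cmap G l a) (edges (contract G l)) = 1"
    using half_count_contract_notin[OF g c T va na] sc by simp
  let ?C = "contract G l"
  note nm = nth_edges_after_del[OF c m ml]
  have vaC: "vkinds ?C ! cmap G l a = ExtBlack" by (rule vkinds_contract_ext[OF g c N(1) va])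
  have endsC: "ends (edges ?C ! after_del l m) = {cmap G l a, cmap G l w}"
    using ends unfolding nm(1) ends_def relabel_edge_simps by (metis image_empty image_insert)
  have kC: "ekind (edges ?C ! after_del l m) = K" by (simp add: nm(1) kd)
  have aT: "cmap G l a \<notin> cmap G l ` T"
    using cmap_image_iff[OF g c, of T K m a] clean_disjoint[OF g c T] T m kd ends aw by (auto simp: clean_def)
  show "if vkinds ?C ! cmap G l w = ExtBlack then pruned K ?C (cmap G l a) (cmap G l ` T)
      else leaf_edge K ?C (after_del l m) (cmap G l a) (cmap G l w) (cmap G l ` T)"
  proof (cases "vkinds ?C ! cmap G l w = ExtBlack")
    case False
    thus ?thesis
      using leaf_edgeI[OF good_contract[OF g c] clean_contract[OF g c T] nm(2) kC endsC vaC False aT sc'] by simp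
  next
    case True
    have "inner_count K ?C (cmap G l a) = 0"
    proof (rule ccontr)
      assume "inner_count K ?C (cmap G l a) \<noteq> 0"
      then obtain k x where k: "k < num_edges ?C" "kind_at ?C k = K" "ends_at ?C k = {cmap G l a, x}"
          "vkind ?C x \<noteq> ExtBlack"
        using half_count_pos_iff[of K "\<lambda>x. vkind ?C x \<noteq> ExtBlack" "cmap G l a" "edges ?C"] by (auto simp: inner_count_def)
      have "k \<noteq> after_del l m" using k endsC True vaC by (auto simp: doubleton_eq_iff)
      moreover have "x \<notin> cmap G l ` T" using k(4) clean_contract[OF g c T] by (auto simp: clean_def)
      moreover have "cmap G l w \<notin> cmap G l ` T"
        using cmap_image_iff[OF g c, of T K m w] clean_disjoint[OF g c T] T m kd ends aw by (auto simp: clean_def)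
      ultimately have "out_count K (cmap G l ` T) (cmap G l a) (edges ?C) \<ge> 2"
        by (intro half_count_two_edges[OF k(1) nm(2) _ k(2) kC k(3) endsC])
      thus False using sc' by simp
    qed
    thus ?thesis using True sc' by (simp add: pruned_def)
  qed
qed

abbreviation ext_vertices :: "lgraph \<Rightarrow> nat set"
  where "ext_vertices G \<equiv> {v. v < num_vertices G \<and> vkind G v = ExtBlack}"

text \<open>The contracted edge has an internal end, so no two external vertices are identified.
  Hence marks stay distinct, and averages over external vertices pass through contractions.\<close>

lemma bij_ext_vertices_contract:
  assumes g: "good G" and c: "contractible False G l"
  shows "bij_betw (cmap G l) (ext_vertices G) (ext_vertices (contract G l))" unfolding bij_betw_def
proof
  obtain p q where pq: "cmin G l = p" "cmax G l = q" by blast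
  have lt: "p < q" using cmin_less_cmax[OF c] by (simp only: pq)
  have ends: "ends_at G l = {p, q}" by (simp only: ends_min_max pq)
  have r: "cmap G l = merge p q" by (simp only: cmap_def pq)
  have "\<not> (vkind G p = ExtBlack \<and> vkind G q = ExtBlack)"
    using contractible_False_internal[OF c] ends by auto
  thus "inj_on (cmap G l) (ext_vertices G)"
    unfolding inj_on_def r merge_eq_iff[OF lt] by (auto simp: doubleton_eq_iff)
  show "cmap G l ` ext_vertices G = ext_vertices (contract G l)"
  proof
    show "cmap G l ` ext_vertices G \<subseteq> ext_vertices (contract G l)"
      using vkinds_contract_ext[OF g c] cmap_less[OF g c] by auto
    show "ext_vertices (contract G l) \<subseteq> cmap G l ` ext_vertices G"
    proof
      fix u assume u: "u \<in> ext_vertices (contract G l)"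
      then obtain v where v: "v < num_vertices G" "cmap G l v = u" using cmap_surj[OF g c] by blast
      obtain w where "w < num_vertices G" "cmap G l w = u" "vkind G w = ExtBlack"
        using contract_kind_fibre(1)[OF g c v(1)] u v(2) by auto
      thus "u \<in> cmap G l ` ext_vertices G" by (intro image_eqI[of _ _ w]) auto
    qed
  qed
qed

lemma stage_clean:
  assumes "stage f N X" "i \<le> f K" "i \<le> length (snd X)"
  shows "clean K (fst X) (set (take i (snd X)))" unfolding clean_def
proof
  fix t assume "t \<in> set (take i (snd X))"
  then obtain m where m: "m < i" "t = snd X ! m" using assms(3) by (auto simp: in_set_conv_nth)
  hence "m < f K" "m < length (snd X)" using assms(2,3) by auto
  thus "t < num_vertices (fst X) \<and> vkind (fst X) t = ExtBlack \<and> inner_count K (fst X) t = 0"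
    using assms(1) m unfolding stage_def pruned_def by auto
qed

lemma stage_contract:
  assumes st: "stage f N (G, ms)" and c: "contractible False G l"
  shows "stage f N (contract G l, map (cmap G l) ms)"
proof -
  have g: "good G" and d: "distinct ms" and ext: "set ms \<subseteq> ext_vertices G" and card: "card (ext_vertices G) = N"
    and pr: "\<And>K i. i < f K \<Longrightarrow> i < length ms \<Longrightarrow> pruned K G (ms ! i) (set (take i ms))"
    using st by (auto simp: stage_def)
  note bij = bij_ext_vertices_contract[OF g c]
  have "distinct (map (cmap G l) ms)"
    using d ext bij by (auto simp: distinct_map bij_betw_def intro: inj_on_subset)
  moreover have "pruned K (contract G l) (map (cmap G l) ms ! i) (set (take i (map (cmap G l) ms)))"
    if "i < f K" "i < length ms" for K i
  proof -
    have "clean K G (set (take i ms))" using stage_clean[OF st, of i K] that by simp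
    moreover have "vkind G (ms ! i) = ExtBlack" using ext that(2) nth_mem[of i ms] by blast
    ultimately show ?thesis using pruned_contract[OF g c _ _ pr[OF that]] that by (simp add: take_map)
  qed
  moreover have "card (ext_vertices (contract G l)) = N" using bij_betw_same_card[OF bij] card by simp
  ultimately show ?thesis using good_contract[OF g c] ext vkinds_contract_ext[OF g c] cmap_less[OF g c]
    unfolding stage_def by auto
qed

section \<open>Marked vertices under blow-up\<close>

lemma half_count_blow_same:
  assumes g: "good G" and ok: "blow_ok K a T G" and v: "K' \<noteq> K \<or> v \<noteq> a \<and> v \<in> T"
    and P: "\<And>x. x < num_vertices G \<Longrightarrow> P' (shift (vpos K G) x) \<longleftrightarrow> P x"
  shows "half_count K' P' (shift (vpos K G) v) (edges (blow K a T G)) = half_count K' P v (edges G)"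
proof -
  have ab: "a < vpos K G" by (rule blow_ok_less[OF g ok])
  have le: "epos K G \<le> length (map (blow_edge K a T (vpos K G)) (edges G))" by (simp add: epos_le)
  have "half_weight K' P v e = half_weight K' P' (shift (vpos K G) v) (blow_edge K a T (vpos K G) e)"
    if e: "e \<in> set (edges G)" for e
  proof -
    have "src e < num_vertices G" "tgt e < num_vertices G"
      using g e by (auto simp: good_iff well_labeled_def)
    thus ?thesis using v P by (auto simp: half_weight_def blow_edge_def)
  qed
  hence "half_count K' P v (edges G) = half_count K' P' (shift (vpos K G) v) (map (blow_edge K a T (vpos K G)) (edges G))"
    by (rule half_count_cong)
  moreover have "half_weight K' P' (shift (vpos K G) v) (Edge K a (vpos K G)) = 0"
  proof (cases "K' = K")
    case True
    hence "shift (vpos K G) v \<noteq> a" using v ab by (auto simp: shift_def)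
    thus ?thesis by (auto simp: half_weight_def)
  qed (simp add: half_weight_def)
  moreover have "edges (blow K a T G) = ins_at (epos K G) (Edge K a (vpos K G)) (map (blow_edge K a T (vpos K G)) (edges G))"
    by (simp add: blow_def)
  ultimately show ?thesis using half_count_ins_at[OF le] by simp
qed

lemma inner_count_blow_same:
  assumes "good G" "blow_ok K a T G" "K' \<noteq> K \<or> v \<noteq> a \<and> v \<in> T"
  shows "inner_count K' (blow K a T G) (shift (vpos K G) v) = inner_count K' G v"
  unfolding inner_count_def by (rule half_count_blow_same[OF assms]) (simp add: nth_vkinds_blow)

lemma clean_blow:
  assumes "good G" "blow_ok K a T G" "a \<notin> T" "clean K G T"
  shows "clean K (blow K a T G) (shift (vpos K G) ` T)"
proof -
  have "inner_count K (blow K a T G) (shift (vpos K G) t) = 0" if "t \<in> T" for t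
    using inner_count_blow_same[OF assms(1,2), of K t] that assms(3,4) by (auto simp: clean_def)
  thus ?thesis using assms(4) by (auto simp: clean_def nth_vkinds_blow shift_less)
qed

lemma leaf_edge_blow:
  assumes g: "good G" and ok: "blow_ok K a T G" and a: "a \<notin> T" "vkind G a = ExtBlack" and T: "clean K G T"
  shows "leaf_edge K (blow K a T G) (epos K G) a (vpos K G) (shift (vpos K G) ` T)"
proof (rule leaf_edgeI[OF good_blow[OF g ok] clean_blow[OF g ok a(1) T]])
  let ?b = "vpos K G" and ?B = "blow K a T G"
  have ab: "a < ?b" by (rule blow_ok_less[OF g ok])
  have aN: "a < num_vertices G" using ok by (simp add: blow_ok_def)
  show "epos K G < num_edges ?B" using epos_le[of K G] by simp
  show "ekind (edges ?B ! epos K G) = K" "ends (edges ?B ! epos K G) = {a, ?b}" "vkind ?B ?b \<noteq> ExtBlack"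
    by (simp_all add: nth_edges_blow ends_def nth_vkinds_blow)
  show "vkind ?B a = ExtBlack" using nth_vkinds_blow(2)[OF aN, of K a T] ab a(2) by (simp add: shift_id)
  have aT: "shift ?b a \<notin> shift ?b ` T" using a(1) by auto
  thus "a \<notin> shift ?b ` T" using ab by (simp add: shift_id)
  have bT: "?b \<notin> shift ?b ` T" by auto
  have sa: "shift ?b x = a \<longleftrightarrow> x = a" for x using ab by (auto simp: shift_def)
  have "half_weight K (\<lambda>x. x \<notin> shift ?b ` T) a (blow_edge K a T ?b e) = 0" for e
    using ab a(1) by (auto simp: half_weight_def blow_edge_def sa)
  moreover have "half_weight K (\<lambda>x. x \<notin> shift ?b ` T) a (Edge K a ?b) = 1"
    using ab bT by (auto simp: half_weight_def)
  ultimately show "out_count K (shift ?b ` T) a (edges ?B) = 1"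
    using epos_le[of K G] unfolding blow_def by (simp add: half_count_ins_at) (simp add: half_count_def comp_def)
qed

lemma ext_vertices_blow: "ext_vertices (blow K a T G) = shift (vpos K G) ` ext_vertices G"
proof
  show "ext_vertices (blow K a T G) \<subseteq> shift (vpos K G) ` ext_vertices G"
  proof
    fix u assume u: "u \<in> ext_vertices (blow K a T G)"
    hence "u < Suc (num_vertices G)" by simp
    from this vpos_le[of K G] show "u \<in> shift (vpos K G) ` ext_vertices G"
      by (cases rule: shift_cases) (use u in "auto simp: nth_vkinds_blow")
  qed
qed (auto simp: nth_vkinds_blow shift_less)

text \<open>Since \<open>f K = length ts\<close>, nothing is demanded of \<open>a\<close> along
  \<open>K\<close>, and it is only there that the blow-up changes \<open>a\<close>. Along the other
  kind, and at the earlier marks, all counts stay the same.\<close>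

lemma stage_blow:
  assumes st: "stage f N (G, ts @ [a])" and f: "f K = length ts" and ok: "blow_ok K a (set ts) G"
  shows "stage f N (blow K a (set ts) G, map (shift (vpos K G)) (ts @ [a]))"
proof -
  let ?ms = "ts @ [a]" and ?b = "vpos K G"
  have g: "good G" and d: "distinct ?ms" and ext: "set ?ms \<subseteq> ext_vertices G" and card: "card (ext_vertices G) = N"
    and pr: "\<And>K i. i < f K \<Longrightarrow> i < length ?ms \<Longrightarrow> pruned K G (?ms ! i) (set (take i ?ms))"
    using st by (auto simp: stage_def)
  have inj: "inj (shift ?b)" by (simp add: inj_def)
  have "pruned K' (blow K a (set ts) G) (map (shift ?b) ?ms ! i) (set (take i (map (shift ?b) ?ms)))"
    if i: "i < f K'" "i < length ?ms" for K' i
  proof -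
    let ?v = "?ms ! i" and ?T = "set (take i ?ms)"
    have v: "K' \<noteq> K \<or> ?v \<noteq> a \<and> ?v \<in> set ts"
    proof (cases "K' = K")
      case True
      hence "i < length ts" using i f by simp
      hence "?v \<in> set ts" by (simp add: nth_append)
      thus ?thesis using d by auto
    qed simp
    have "out_count K' (shift ?b ` ?T) (shift ?b ?v) (edges (blow K a (set ts) G)) = out_count K' ?T ?v (edges G)"
      by (rule half_count_blow_same[OF g ok v]) (simp add: inj_image_mem_iff[OF inj])
    thus ?thesis using pr[OF i] inner_count_blow_same[OF g ok v] i(2)
      by (simp add: pruned_def nth_map[of i ?ms] take_map del: map_append)
  qed
  moreover have "card (ext_vertices (blow K a (set ts) G)) = N"
    unfolding ext_vertices_blow using card card_image[OF inj_on_subset[OF inj subset_UNIV]] by simp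
  moreover have "distinct (map (shift ?b) ?ms)"
    using d by (simp add: distinct_map inj_on_subset[OF inj subset_UNIV] inj_image_mem_iff[OF inj])
  ultimately show ?thesis using good_blow[OF g ok] ext unfolding stage_def
    by (auto simp: nth_vkinds_blow shift_less)
qed

section \<open>The homotopy formula at the last marked vertex\<close>

lemma marked_cases:
  assumes st: "stage f N (G, ts @ [a])" and f: "f K = length ts"
  obtains "hop_ok K (G, ts @ [a])"
    | "\<not> hop_ok K (G, ts @ [a])" "pruned K G a (set ts)"
    | l w where "\<not> hop_ok K (G, ts @ [a])" "leaf_edge K G l a w (set ts)"
proof -
  have g: "good G" and a: "a < num_vertices G" "vkind G a = ExtBlack" "a \<notin> set ts"
    using st by (auto simp: stage_def)
  have T: "clean K G (set ts)" using stage_clean[OF st, of "length ts" K] f by simp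
  have hop: "hop_ok K (G, ts @ [a]) \<longleftrightarrow> out_count K (set ts) a (edges G) \<ge> 2"
    using a by (simp add: hop_ok_def)
  show thesis
  proof (cases "hop_ok K (G, ts @ [a])")
    case False
    hence sc: "out_count K (set ts) a (edges G) \<le> 1" by (simp add: hop)
    show thesis
    proof (cases "inner_count K G a = 0")
      case True
      thus thesis using that(2) False sc by (simp add: pruned_def)
    next
      case ne: False
      then obtain l w where l: "l < num_edges G" "kind_at G l = K" "ends_at G l = {a, w}" "vkind G w \<noteq> ExtBlack"
        using half_count_pos_iff[of K "\<lambda>x. vkind G x \<noteq> ExtBlack" a "edges G"] by (auto simp: inner_count_def)
      have "w \<notin> set ts" using T l(4) by (auto simp: clean_def)
      hence "out_count K (set ts) a (edges G) > 0" unfolding half_count_pos_iff using l by blast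
      hence "out_count K (set ts) a (edges G) = 1" using sc by simp
      thus thesis using that(3)[OF False leaf_edgeI[OF g T l(1-3) a(2) l(4) a(3)]] by blast
    qed
  qed (rule that(1))
qed

lemma hop_zero_if_count_le_1:
  "out_count K (set ts) a (edges G) \<le> 1 \<Longrightarrow> hop K (G, ts @ [a]) = 0"
  by (simp add: hop_def hop_ok_def)

lemma lin_hop_cterm_zero:
  assumes "out_count K (cmap G l ` set ts) (cmap G l a) (edges (contract G l)) \<le> 1"
  shows "lin (hop K) (cterm (G, ts @ [a]) l) = 0"
  using assms hop_zero_if_count_le_1[of K "map (cmap G l) ts" "cmap G l a" "contract G l"]
  by (simp add: cterm_def)

definition stage_set :: "(edge_kind \<Rightarrow> nat) \<Rightarrow> nat \<Rightarrow> nat \<Rightarrow> dgraph set"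
  where "stage_set f N k = {X. stage f N X \<and> length (snd X) = k \<and> has_internal (fst X)}"

lemma stage_prune_last:
  assumes "stage f N (G, ts @ [a])" "f K = length ts" "pruned K G a (set ts)"
  shows "stage (f(K := Suc (length ts))) N (G, ts @ [a])"
proof -
  have "pruned K G ((ts @ [a]) ! i) (set (take i (ts @ [a])))" if "i < Suc (length ts)" for i
  proof (cases "i = length ts")
    case False
    hence "i < f K" using that assms(2) by simp
    thus ?thesis using assms(1) that by (auto simp: stage_def)
  qed (use assms(3) in simp)
  thus ?thesis using assms(1) by (auto simp: stage_def)
qed

definition stratum :: "nat \<Rightarrow> nat \<Rightarrow> lgraph set"
  where "stratum N m = {G. good G \<and> card (ext_vertices G) = N \<and> num_vertices G = N + m}"

lemma good_stratum: "G \<in> stratum N m \<Longrightarrow> good G" by (simp add: stratum_def)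

lemma has_internal_iff: "has_internal G \<longleftrightarrow> card (ext_vertices G) < num_vertices G"
proof
  assume "has_internal G"
  hence "ext_vertices G \<subset> {..<num_vertices G}" by (auto simp: has_internal_def)
  thus "card (ext_vertices G) < num_vertices G" using psubset_card_mono[of "{..<num_vertices G}"] by simp
next
  assume "card (ext_vertices G) < num_vertices G"
  hence "ext_vertices G \<noteq> {..<num_vertices G}" by (intro notI) simp
  thus "has_internal G" by (auto simp: has_internal_def)
qed

lemma card_ext_le: "card (ext_vertices G) \<le> num_vertices G"
  using card_mono[of "{..<num_vertices G}" "ext_vertices G"] by auto

lemma stratum_contract:
  assumes "G \<in> stratum N m" "contractible False G l"
  shows "contract G l \<in> stratum N (m - 1)" "m > 0"
proof -
  have g: "good G" using assms(1) by (rule good_stratum)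
  have c: "card (ext_vertices (contract G l)) = N"
    using bij_betw_same_card[OF bij_ext_vertices_contract[OF g assms(2)]] assms(1) by (simp add: stratum_def)
  have "num_vertices (contract G l) = N + m - 1"
    using num_vertices_contract[OF assms(2) good_typed[OF g]] assms(1) by (simp add: stratum_def)
  moreover obtain v where "v \<in> ends_at G l" "vkind G v \<noteq> ExtBlack"
    using contractible_False_internal[OF assms(2)] by blast
  hence "has_internal G"
    using ends_bounded[OF good_typed[OF g] contractible_less[OF assms(2)]] by (auto simp: has_internal_def)
  thus "m > 0" using assms(1) by (auto simp: stratum_def has_internal_iff)
  ultimately show "contract G l \<in> stratum N (m - 1)"
    using good_contract[OF g assms(2)] c by (auto simp: stratum_def)
qed

lemma stratum_blow:
  assumes "G \<in> stratum N m" "blow_ok K a T G"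
  shows "blow K a T G \<in> stratum N (Suc m)"
proof -
  have "card (ext_vertices (blow K a T G)) = card (ext_vertices G)"
    unfolding ext_vertices_blow by (simp add: card_image inj_on_def)
  moreover have "good G" "card (ext_vertices G) = N" "num_vertices G = N + m"
    using assms(1) unfolding stratum_def by blast+
  ultimately show ?thesis
    using good_blow[of G K a T] assms(2) unfolding stratum_def mem_Collect_eq by (metis num_vertices_blow add_Suc_right)
qed

theorem prune_homotopy:
  assumes X: "X \<in> stage_set f N (Suc k)" and f: "f K = k"
  shows "\<exists>y. keys y \<subseteq> stage_set (f(K := Suc k)) N (Suc k) \<and>
    bv X - lin (hop K) (ddiff False X) - lin (ddiff False) (hop K X) - y \<in> rv.span (dec_relations)"
proof -
  let ?R = "rv.span (dec_relations)"
  obtain G ms where GX: "X = (G, ms)" by force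
  obtain ts a where ms: "ms = ts @ [a]" and k: "length ts = k"
    using X GX by (auto simp: stage_set_def length_Suc_conv_rev)
  have st: "stage f N (G, ts @ [a])" and hi: "has_internal G" using X by (auto simp: stage_set_def GX ms)
  have fk: "f K = length ts" using f k by simp
  have g: "good G" and a: "a < num_vertices G" "vkind G a = ExtBlack" "a \<notin> set ts"
    using st by (auto simp: stage_def)
  have T: "clean K G (set ts)" using stage_clean[OF st, of "length ts" K] fk by simp
  note X_eq = GX ms
  from st fk show ?thesis
  proof (cases rule: marked_cases)
    case 2
    \<comment> \<open>Contractions keep \<open>a\<close> pruned, so the homotopy vanishes on every
      term of the differential as well as on \<open>X\<close>; \<open>X\<close> itself serves as the
      remainder.\<close>
    have "lin (hop K) (cterm (G, ts @ [a]) l) = 0" if "contractible False G l" for l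
      using pruned_contract[OF g that T a(2) 2(2)] by (intro lin_hop_cterm_zero) (simp add: pruned_def)
    hence "lin (hop K) (ddiff False X) = 0" by (simp add: X_eq ddiff_def lin_sum contractions_def)
    moreover have "hop K X = 0" using 2(1) by (simp add: X_eq hop_def)
    moreover have "X \<in> stage_set (f(K := Suc k)) N (Suc k)"
      using stage_prune_last[OF st fk 2(2)] k hi by (simp add: stage_set_def X_eq)
    ultimately show ?thesis by (intro exI[of _ "bv X"]) (simp add: rv.span_zero)
  next
    case (3 l w)
    have c: "contractible False G l" by (rule leaf_edge_contractible[OF 3(2)])
    \<comment> \<open>Contracting any edge other than \<open>l\<close> leaves \<open>a\<close> with
      one free half-edge, where the homotopy vanishes. The term of \<open>l\<close> returns
      \<open>X\<close> by \<open>cterm_leaf\<close>, so the remainder is zero.\<close>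
    have z: "lin (hop K) (cterm (G, ts @ [a]) m) = 0" if "contractible False G m" "m \<noteq> l" for m
      using leaf_edge_contract(1)[OF g that(1) T 3(2)] that(2) by (intro lin_hop_cterm_zero) auto
    have "lin (hop K) (ddiff False X) = (\<Sum>m\<in>contractions False G. lin (hop K) (cterm (G, ts @ [a]) m))"
      by (simp add: X_eq ddiff_def lin_sum)
    also have "\<dots> = lin (hop K) (cterm (G, ts @ [a]) l)"
      by (subst sum.remove[of _ l]) (use c z in "auto simp: contractions_def finite_contractions[unfolded contractions_def]")
    finally have "lin (hop K) (ddiff False X) - bv X \<in> ?R"
      using cterm_leaf[OF g 3(2) refl] by (simp add: X_eq)
    from rv.span_neg[OF this] show ?thesis using 3(1) by (intro exI[of _ 0]) (simp add: X_eq hop_def)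
  next
    case 1
    let ?B = "blow K a (set ts) G" and ?c = "epos K G" and ?b = "vpos K G"
    let ?T = "shift ?b ` set ts" and ?ms' = "map (shift ?b) ts @ [a]"
    define \<beta> where "\<beta> = csign ?B ?c"
    have ok: "blow_ok K a (set ts) G" using hop_ok_blow_ok[OF 1] by simp
    have ab: "a < ?b" by (rule blow_ok_less[OF g ok])
    have sa: "shift ?b a = a" using ab by (simp add: shift_id)
    have gB: "good ?B" by (rule good_blow[OF g ok])
    have cB: "contractible False ?B ?c" by (rule contractible_blow[OF g ok])
    have CB: "contract ?B ?c = G" by (rule contract_blow[OF g ok])
    have TB: "clean K ?B ?T" by (rule clean_blow[OF g ok a(3) T])
    have leB: "leaf_edge K ?B ?c a ?b ?T" by (rule leaf_edge_blow[OF g ok a(3,2) T])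
    have stB: "stage f N (?B, ?ms')" using stage_blow[OF st fk ok] by (simp add: sa)
    have \<beta>2: "\<beta> * \<beta> = 1" unfolding \<beta>_def contraction_sign_eq[OF gB cB] by simp
    have hX: "hop K X = single (?B, ?ms') \<beta>"
      using 1 by (simp add: X_eq hop_def blow_marked_def \<beta>_def sa)
    have cm: "map (cmap ?B ?c) ?ms' = ts @ [a]"
      using cmap_blow(1)[OF g ok] cmap_blow(1)[OF g ok, of a] by (simp add: sa comp_def)
    have cc: "cterm (?B, ?ms') ?c = single X \<beta>" using cm by (simp add: cterm_def CB \<beta>_def X_eq)
    let ?s = "shift ?c"
    have ad: "after_del ?c (?s l) = l" for l by (auto simp: after_del_def shift_def)
    have sl: "?s l \<noteq> ?c" "l < num_edges G \<Longrightarrow> ?s l < num_edges ?B" for l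
      by (simp_all add: shift_less)
    define L where "L = {l'. contractible False ?B l' \<and> l' \<noteq> ?c}"
    \<comment> \<open>The new vertex stays internal. These terms correspond to the contractions of
      \<open>G\<close> and cancel against the homotopy applied to the differential. In the other
      terms the new vertex is absorbed by an external one, which leaves \<open>a\<close> pruned;
      they form the remainder \<open>y\<close>.\<close>
    define good_l where "good_l l' \<longleftrightarrow> vkinds (contract ?B l') ! cmap ?B l' ?b \<noteq> ExtBlack" for l'
    have L_pruned: "pruned K (contract ?B l') (cmap ?B l' a) (cmap ?B l' ` ?T)" if "l' \<in> L" "\<not> good_l l'" for l'
      using leaf_edge_contract(2)[OF gB _ TB leB, of l'] that unfolding L_def good_l_def by auto
    have L_leaf: "leaf_edge K (contract ?B l') (after_del l' ?c) (cmap ?B l' a) (cmap ?B l' ?b) (cmap ?B l' ` ?T)"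
      if "l' \<in> L" "good_l l'" for l'
      using leaf_edge_contract(2)[OF gB _ TB leB, of l'] that unfolding L_def good_l_def by auto
    have cN: "?c < num_edges ?B" by (rule contractible_less[OF cB])
    have set_eq: "{l' \<in> L. good_l l'} = ?s ` contractions False G"
    proof
      show "{l' \<in> L. good_l l'} \<subseteq> ?s ` contractions False G"
      proof
        fix l' assume l': "l' \<in> {l' \<in> L. good_l l'}"
        hence c': "contractible False ?B l'" "?c \<noteq> l'" and
          cl: "contractible False (contract ?B l') (after_del l' ?c)"
          using leaf_edge_contractible[OF L_leaf] by (auto simp: L_def)
        have "contractible False G (after_del ?c l')"
          using contractible_contract_sym(2)[OF gB c'(1) cl cN c'(2)] CB by simp
        moreover have "l' = ?s (after_del ?c l')" using c'(2) by (auto simp: after_del_def shift_def)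
        ultimately show "l' \<in> ?s ` contractions False G" by (auto simp: contractions_def)
      qed
      show "?s ` contractions False G \<subseteq> {l' \<in> L. good_l l'}"
      proof
        fix l' assume "l' \<in> ?s ` contractions False G"
        then obtain l where l: "contractible False G l" "l' = ?s l" by (auto simp: contractions_def)
        have "contractible False (contract ?B ?c) (after_del ?c (?s l))" unfolding CB ad by (rule l(1))
        note sym = contractible_contract_sym[OF gB cB this sl(2)[OF contractible_less[OF l(1)]] sl(1)]
        have L: "l' \<in> L" using sym(1) sl l by (simp add: L_def)
        have "good_l l'"
        proof (rule ccontr)
          assume ng: "\<not> good_l l'"
          have "ends (edges (contract ?B l') ! after_del l' ?c) = {cmap ?B l' a, cmap ?B l' ?b}"
            using nth_edges_after_del(1)[OF sym(1) cN sl(1)[symmetric]] l(2)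
            by (simp add: nth_edges_blow ends_def)
          moreover have "vkinds (contract ?B l') ! cmap ?B l' a = ExtBlack"
            using vkinds_contract_ext[OF gB sym(1), of a] leB a(1) l(2) by (simp add: leaf_edge_def)
          ultimately show False
            using contractible_False_internal[OF sym(2)] ng l(2) by (auto simp: good_l_def)
        qed
        with L show "l' \<in> {l' \<in> L. good_l l'}" by simp
      qed
    qed
    have finL: "finite L"
      by (rule finite_subset[OF _ finite_contractions[of False ?B]]) (auto simp: L_def contractions_def)
    let ?t = "cterm (?B, ?ms')"
    have "ddiff False (?B, ?ms') = ?t ?c + (\<Sum>l'\<in>L. ?t l')"
    proof -
      have "contractions False ?B = insert ?c L" using cB by (auto simp: L_def contractions_def)
      moreover have "?c \<notin> L" by (simp add: L_def)
      ultimately show ?thesis using finL by (simp add: ddiff_def)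
    qed
    also have "(\<Sum>l'\<in>L. ?t l') = (\<Sum>l'\<in>{l' \<in> L. good_l l'}. ?t l') + (\<Sum>l'\<in>{l' \<in> L. \<not> good_l l'}. ?t l')"
      using finL sum.union_disjoint[of "{l' \<in> L. good_l l'}" "{l' \<in> L. \<not> good_l l'}" ?t]
      by (simp add: Int_def Un_def conj_disj_distribL[symmetric])
    also have "(\<Sum>l'\<in>{l' \<in> L. good_l l'}. ?t l') = (\<Sum>l\<in>contractions False G. ?t (?s l))"
      unfolding set_eq by (subst sum.reindex) (auto simp: inj_on_def)
    finally have dB: "lin (ddiff False) (hop K X) = bv X +
        (\<Sum>l\<in>contractions False G. scale_rat \<beta> (?t (?s l))) + scale_rat \<beta> (\<Sum>l'\<in>{l' \<in> L. \<not> good_l l'}. ?t l')"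
      by (simp add: hX cc rv.scale_right_distrib rv.scale_sum_right \<beta>2)
    \<comment> \<open>After contraction along \<open>?s l\<close>, the blow-up still has the new
      edge as a leaf edge, and contracting it gives \<open>contract G l\<close>. So
      \<open>cterm_leaf\<close> identifies the two terms up to sign, and the sign is opposite
      because contractions anticommute.\<close>
    have canc: "lin (hop K) (cterm (G, ts @ [a]) l) + scale_rat \<beta> (?t (?s l)) \<in> ?R" if "l \<in> contractions False G" for l
    proof -
      have c: "contractible False G l" using that by (simp add: contractions_def)
      have lL: "?s l \<in> L" "good_l (?s l)" using set_eq that by auto
      have cl: "contractible False ?B (?s l)" using lL by (simp add: L_def)
      let ?C = "contract ?B (?s l)" and ?m = "after_del (?s l) ?c"
      note le = L_leaf[OF lL]
      have gC: "good ?C" by (rule good_contract[OF gB cl])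
      have cG: "contractible False (contract ?B ?c) (after_del ?c (?s l))" unfolding CB ad by (rule c)
      note ct = contract_contract[OF gB cB cG sl(2)[OF contractible_less[OF c]] sl(1), unfolded CB ad]
      have mk: "map (cmap ?C ?m) (map (cmap ?B (?s l)) ?ms') = map (cmap G l) (ts @ [a])"
        using ct(1) unfolding cm[symmetric] by (simp only: map_map comp_def)
      let ?g = "csign ?C ?m"
      have "cterm (?C, map (cmap ?B (?s l)) ?ms') ?m =
          scale_rat ?g (bv (contract G l, map (cmap G l) (ts @ [a])))"
        using mk ct(3) by (simp add: cterm_def del: map_append map_map)
      moreover have "lin (hop K) (cterm (?C, map (cmap ?B (?s l)) ?ms') ?m) - bv (?C, map (cmap ?B (?s l)) ?ms') \<in> ?R"
        using cterm_leaf[OF gC le, of "map (cmap ?B (?s l)) (map (shift ?b) ts)"] by (simp add: image_image)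
      ultimately have 1: "scale_rat ?g (lin (hop K) (bv (contract G l, map (cmap G l) (ts @ [a]))))
          - bv (?C, map (cmap ?B (?s l)) ?ms') \<in> ?R" by (simp only: lin_scale)
      have g2: "?g * ?g = 1"
        unfolding contraction_sign_eq[OF gC leaf_edge_contractible[OF le, of False]] by simp
      have sg: "\<beta> * csign G l = - (csign ?B (?s l) * ?g)" using ct(2) by (simp add: \<beta>_def)
      have "csign G l = - (\<beta> * csign ?B (?s l)) * ?g"
        using arg_cong[OF sg, of "(*) \<beta>"] \<beta>2 by (simp add: mult.assoc[symmetric])
      hence "lin (hop K) (cterm (G, ts @ [a]) l) + scale_rat \<beta> (?t (?s l)) =
          scale_rat (- (\<beta> * csign ?B (?s l)))
            (scale_rat ?g (lin (hop K) (bv (contract G l, map (cmap G l) (ts @ [a])))) - bv (?C, map (cmap ?B (?s l)) ?ms'))"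
        by (simp add: cterm_def rv.scale_right_diff_distrib flip: single_uminus)
      thus ?thesis by (simp only: rv.span_scale[OF 1])
    qed
    define y where "y = - scale_rat \<beta> (\<Sum>l'\<in>{l' \<in> L. \<not> good_l l'}. ?t l')"
    have "lin (hop K) (ddiff False X) = (\<Sum>l\<in>contractions False G. lin (hop K) (cterm (G, ts @ [a]) l))"
      by (simp add: X_eq ddiff_def lin_sum)
    hence "bv X - lin (hop K) (ddiff False X) - lin (ddiff False) (hop K X) - y =
        - (\<Sum>l\<in>contractions False G. lin (hop K) (cterm (G, ts @ [a]) l) + scale_rat \<beta> (?t (?s l)))"
      by (simp add: dB y_def sum.distrib)
    also have "\<dots> \<in> ?R" using canc by (intro rv.span_neg rv.span_sum)
    finally have rel: "bv X - lin (hop K) (ddiff False X) - lin (ddiff False) (hop K X) - y \<in> ?R" .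
    have "(contract ?B l', map (cmap ?B l') ?ms') \<in> stage_set (f(K := Suc k)) N (Suc k)"
      if l': "l' \<in> L" "\<not> good_l l'" for l'
    proof -
      have cl: "contractible False ?B l'" using l' by (simp add: L_def)
      have "stage f N (contract ?B l', map (cmap ?B l') (map (shift ?b) ts) @ [cmap ?B l' a])"
        using stage_contract[OF stB cl] by simp
      moreover have "pruned K (contract ?B l') (cmap ?B l' a) (set (map (cmap ?B l') (map (shift ?b) ts)))"
        using L_pruned[OF l'] by (simp add: image_image)
      ultimately have "stage (f(K := Suc k)) N (contract ?B l', map (cmap ?B l') ?ms')"
        using stage_prune_last[of f N "contract ?B l'" "map (cmap ?B l') (map (shift ?b) ts)" "cmap ?B l' a" K] fk k by simp
      moreover have "has_internal (contract ?B l')"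
      proof -
        have "num_vertices G > card (ext_vertices G)" using hi by (simp add: has_internal_iff)
        hence "G \<in> stratum (card (ext_vertices G)) (Suc (num_vertices G - Suc (card (ext_vertices G))))"
          using g by (simp add: stratum_def)
        from stratum_contract(1)[OF stratum_blow[OF this ok] cl] show ?thesis
          unfolding stratum_def mem_Collect_eq has_internal_iff by linarith
      qed
      ultimately show ?thesis using k by (simp add: stage_set_def)
    qed
    hence "keys y \<subseteq> stage_set (f(K := Suc k)) N (Suc k)"
    proof -
      assume *: "\<And>l'. l' \<in> L \<Longrightarrow> \<not> good_l l' \<Longrightarrow> (contract ?B l', map (cmap ?B l') ?ms') \<in> stage_set (f(K := Suc k)) N (Suc k)"
      have "keys (\<Sum>l'\<in>{l' \<in> L. \<not> good_l l'}. ?t l') \<subseteq> stage_set (f(K := Suc k)) N (Suc k)"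
        by (rule order_trans[OF keys_sum_subset]) (use * in "auto simp: cterm_def split: if_splits")
      thus ?thesis
        using keys_scale_subset[of \<beta> "\<Sum>l'\<in>{l' \<in> L. \<not> good_l l'}. ?t l'"] by (simp add: y_def)
    qed
    with rel show ?thesis by blast
  qed
qed

section \<open>Exactness at the graphs with internal vertices\<close>

definition dec_double_loop :: "(dgraph \<Rightarrow>\<^sub>0 rat) set"
  where "dec_double_loop = {bv (G, ms) | G ms. good G \<and> has_double_or_loop G}"

text \<open>The flag \<open>dl\<close> says whether graphs with double edges or loops are set to
  zero.\<close>

definition dec_rels :: "bool \<Rightarrow> (dgraph \<Rightarrow>\<^sub>0 rat) set"
  where "dec_rels dl = dec_relations \<union> (if dl then dec_double_loop else {})"

abbreviation dspan :: "bool \<Rightarrow> (dgraph \<Rightarrow>\<^sub>0 rat) set" where "dspan dl \<equiv> rv.span (dec_rels dl)"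

lemma span_dec_rels: "x \<in> rv.span (dec_relations) \<Longrightarrow> x \<in> dspan dl"
  using rv.span_mono[of "dec_relations" "dec_rels dl"] by (auto simp: dec_rels_def)

lemma double_loopI:
  assumes "i < num_edges G" "m < num_edges G" "i \<noteq> m" "kind_at G i = kind_at G m"
    "ends_at G i = ends_at G m"
  shows "has_double_or_loop G" unfolding has_double_or_loop_def in_double_edge_def using assms by metis

text \<open>A pair of parallel edges stays parallel or becomes two loops, unless one member is
  contracted, and then the other becomes a loop.\<close>

lemma double_loop_contract:
  assumes "has_double_or_loop G" "contractible b G l"
  shows "has_double_or_loop (contract G l)"
proof -
  note l = contractible_less[OF assms(2)]
  have loop: "has_double_or_loop (contract G l)"
    if "i < num_edges G" "i \<noteq> l" "cmap G l (src_at G i) = cmap G l (tgt_at G i)" for i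
    using nth_edges_after_del[OF assms(2) that(1,2)] that(3)
    unfolding has_double_or_loop_def is_loop_def by auto
  obtain i where i: "i < num_edges G" "is_loop G i \<or> in_double_edge G i"
    using assms(1) by (auto simp: has_double_or_loop_def)
  from i(2) show ?thesis
  proof
    assume "is_loop G i"
    thus ?thesis using loop[OF i(1)] assms(2) by (auto simp: is_loop_def contractible_def)
  next
    assume "in_double_edge G i"
    then obtain m where m: "m < num_edges G" "m \<noteq> i" "kind_at G m = kind_at G i"
      "ends_at G m = ends_at G i" by (auto simp: in_double_edge_def)
    have same: "cmap G l (src_at G k) = cmap G l (tgt_at G k)" if "ends_at G k = ends_at G l" for k
      using that cmap_ends[OF assms(2)] by (auto simp: ends_def doubleton_eq_iff)
    consider "l = i" | "l = m" | "l \<noteq> i" "l \<noteq> m" by blast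
    thus ?thesis
    proof cases
      case 1 thus ?thesis using loop[OF m(1)] same m by blast
    next
      case 2 thus ?thesis using loop[OF i(1)] same m by metis
    next
      case 3
      note ni = nth_edges_after_del[OF assms(2) i(1) 3(1)[symmetric]]
      note nm = nth_edges_after_del[OF assms(2) m(1) 3(2)[symmetric]]
      have "after_del l i \<noteq> after_del l m" using 3 m(2) by (auto simp: after_del_def)
      moreover have "ends (relabel_edge (cmap G l) e) = cmap G l ` ends e" for e by (simp add: ends_def)
      ultimately show ?thesis using double_loopI[OF ni(2) nm(2)] ni(1) nm(1) m by simp
    qed
  qed
qed

text \<open>Whether an end of an edge is moved depends only on the kind and the two ends of the
  edge, so parallel edges remain parallel, and loops remain loops.\<close>

lemma double_loop_blow:
  assumes "has_double_or_loop G"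
  shows "has_double_or_loop (blow K a T G)"
proof -
  let ?b = "vpos K G" and ?c = "epos K G" and ?B = "blow K a T G"
  obtain i where i: "i < num_edges G" "is_loop G i \<or> in_double_edge G i"
    using assms by (auto simp: has_double_or_loop_def)
  from i(2) show ?thesis
  proof
    assume "is_loop G i"
    hence "is_loop ?B (shift ?c i)" by (auto simp: is_loop_def nth_edges_blow(2)[OF i(1)] blow_edge_def)
    thus ?thesis
      unfolding has_double_or_loop_def using shift_less[OF i(1), of ?c] by (intro exI[of _ "shift ?c i"]) simp
  next
    assume "in_double_edge G i"
    then obtain m where m: "m < num_edges G" "m \<noteq> i" "kind_at G m = kind_at G i"
      "ends_at G m = ends_at G i" by (auto simp: in_double_edge_def)
    have "ends (blow_edge K a T ?b (edges G ! m)) = ends (blow_edge K a T ?b (edges G ! i))"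
    proof -
      have "src_at G m = src_at G i \<and> tgt_at G m = tgt_at G i \<or>
          src_at G m = tgt_at G i \<and> tgt_at G m = src_at G i"
        using m(4) by (auto simp: ends_def doubleton_eq_iff)
      thus ?thesis
        by (elim disjE conjE) (simp_all only: ends_def blow_edge_def m(3) edge.sel insert_commute)
    qed
    thus ?thesis
      using double_loopI[of "shift ?c m" ?B "shift ?c i"] shift_less[OF i(1), of ?c] shift_less[OF m(1), of ?c] m
      by (simp add: nth_edges_blow(2)[OF i(1)] nth_edges_blow(2)[OF m(1)])
  qed
qed

lemma ddiff_dec_rels:
  assumes "x \<in> dspan dl"
  shows "lin (ddiff b) x \<in> dspan dl"
proof (rule lin_span_image[OF _ assms])
  fix r assume "r \<in> dec_rels dl"
  then consider "r \<in> dec_relations" | G ms where "dl" "r = bv (G, ms)" "good G" "has_double_or_loop G"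
    by (auto simp: dec_rels_def dec_double_loop_def split: if_splits)
  thus "lin (ddiff b) r \<in> dspan dl"
  proof cases
    case 1
    thus ?thesis using ddiff_relations span_dec_rels by blast
  next
    case 2
    have "cterm (G, ms) l \<in> dspan dl" if "l \<in> contractions b G" for l
    proof -
      have c: "contractible b G l" using that by (simp add: contractions_def)
      have "bv (contract G l, map (cmap G l) ms) \<in> dec_rels dl"
        using 2 good_contract[OF 2(3) c] double_loop_contract[OF 2(4) c]
        by (auto simp: dec_rels_def dec_double_loop_def)
      from rv.span_scale[OF rv.span_base[OF this], of "csign G l"]
      show ?thesis by (simp add: cterm_def)
    qed
    thus ?thesis by (simp add: 2 ddiff_def rv.span_sum)
  qed
qed

lemma hop_dec_rels:
  assumes "x \<in> dspan dl"
  shows "lin (hop K) x \<in> dspan dl"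
proof (rule lin_span_image[OF _ assms])
  fix r assume "r \<in> dec_rels dl"
  then consider "r \<in> dec_relations" | G ms where "dl" "r = bv (G, ms)" "good G" "has_double_or_loop G"
    by (auto simp: dec_rels_def dec_double_loop_def split: if_splits)
  thus "lin (hop K) r \<in> dspan dl"
  proof cases
    case 1
    thus ?thesis using hop_relations span_dec_rels by blast
  next
    case 2
    show ?thesis
    proof (cases "hop_ok K (G, ms)")
      case True
      have "bv (blow_marked K (G, ms)) \<in> dec_rels dl"
        using 2 good_blow_marked[OF _ True] double_loop_blow[OF 2(4)]
        by (auto simp: dec_rels_def dec_double_loop_def blow_marked_def)
      from rv.span_scale[OF rv.span_base[OF this]] True show ?thesis by (simp add: 2 hop_def)
    qed (simp add: 2 hop_def rv.span_zero)
  qed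
qed

section \<open>Adding and removing a mark\<close>

definition drop_mark :: "dgraph \<Rightarrow> (dgraph \<Rightarrow>\<^sub>0 rat)"
  where "drop_mark X = bv (fst X, butlast (snd X))"

text \<open>Averaging over the vertex to be marked makes this a section of \<open>drop_mark\<close> which commutes with
  contractions and relabelings.\<close>

definition add_mark :: "dgraph \<Rightarrow> (dgraph \<Rightarrow>\<^sub>0 rat)"
  where "add_mark X = scale_rat (1 / of_nat (card (ext_vertices (fst X) - set (snd X))))
    (\<Sum>a\<in>ext_vertices (fst X) - set (snd X). bv (fst X, snd X @ [a]))"

lemma drop_mark_dec_rels:
  assumes "x \<in> dspan dl"
  shows "lin drop_mark x \<in> dspan dl"
proof (rule lin_span_image[OF _ assms])
  fix r assume "r \<in> dec_rels dl"
  then consider G H vp ep s ms where "r = bv (H, map vp ms) - single (G, ms) s"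
      "good G" "good H" "rstep G H vp ep s"
    | G ms where "dl" "r = bv (G, ms)" "good G" "has_double_or_loop G"
    by (auto simp: dec_rels_def dec_relations_def dec_double_loop_def split: if_splits)
  thus "lin drop_mark r \<in> dspan dl"
  proof cases
    case (1 G H vp ep s ms)
    have "bv (H, map vp (butlast ms)) - single (G, butlast ms) s \<in> dec_rels dl"
      unfolding dec_rels_def dec_relations_def using 1 by blast
    thus ?thesis using rv.span_base by (simp add: 1(1) lin_diff drop_mark_def map_butlast)
  next
    case (2 G ms)
    hence "lin drop_mark r \<in> dec_rels dl" by (auto simp: drop_mark_def dec_rels_def dec_double_loop_def)
    thus ?thesis by (rule rv.span_base)
  qed
qed

lemma ext_vertices_rstep:
  assumes "rstep G H vp ep s"
  shows "ext_vertices H - set (map vp ms) = vp ` (ext_vertices G - set ms)"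
proof -
  have inj: "inj vp" using rstep_bij(1)[OF assms] by (rule bij_is_inj)
  have iff: "vp v \<in> ext_vertices H - set (map vp ms) \<longleftrightarrow> v \<in> ext_vertices G - set ms" for v
    using nth_vkinds_rstep[OF assms, of v] rstep_bij(2)[OF assms, of v] rstep_num[OF assms]
    by (cases "v < num_vertices G") (simp_all add: inj_image_mem_iff[OF inj])
  show ?thesis
  proof (intro equalityI subsetI)
    fix u assume u: "u \<in> ext_vertices H - set (map vp ms)"
    obtain v where v: "u = vp v" using rstep_bij(1)[OF assms] by (metis bij_pointE)
    with u show "u \<in> vp ` (ext_vertices G - set ms)" unfolding v iff by blast
  next
    fix u assume "u \<in> vp ` (ext_vertices G - set ms)"
    then obtain v where "u = vp v" "v \<in> ext_vertices G - set ms" by (rule imageE)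
    thus "u \<in> ext_vertices H - set (map vp ms)" using iff by simp
  qed
qed

lemma add_mark_dec_rels:
  assumes "x \<in> dspan dl"
  shows "lin add_mark x \<in> dspan dl"
proof (rule lin_span_image[OF _ assms])
  fix r assume "r \<in> dec_rels dl"
  then consider G H vp ep s ms where "r = bv (H, map vp ms) - single (G, ms) s"
      "good G" "good H" "rstep G H vp ep s"
    | G ms where "dl" "r = bv (G, ms)" "good G" "has_double_or_loop G"
    by (auto simp: dec_rels_def dec_relations_def dec_double_loop_def split: if_splits)
  thus "lin add_mark r \<in> dspan dl"
  proof cases
    case (1 G H vp ep s ms)
    let ?A = "ext_vertices G - set ms"
    have inj: "inj_on vp ?A" using bij_is_inj[OF rstep_bij(1)[OF 1(4)]] by (rule inj_on_subset) simp
    have "add_mark (H, map vp ms) = scale_rat (1 / of_nat (card ?A)) (\<Sum>a\<in>?A. bv (H, map vp (ms @ [a])))"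
      unfolding add_mark_def fst_conv snd_conv ext_vertices_rstep[OF 1(4)]
      by (simp add: card_image[OF inj] sum.reindex[OF inj])
    hence "lin add_mark r = scale_rat (1 / of_nat (card ?A))
        (\<Sum>a\<in>?A. bv (H, map vp (ms @ [a])) - single (G, ms @ [a]) s)"
      by (simp add: 1(1) lin_diff add_mark_def sum_subtractf rv.scale_right_diff_distrib rv.scale_sum_right mult.commute)
    moreover have "bv (H, map vp (ms @ [a])) - single (G, ms @ [a]) s \<in> dec_rels dl" for a
      unfolding dec_rels_def dec_relations_def using 1 by blast
    ultimately show ?thesis by (simp only:) (intro rv.span_scale rv.span_sum rv.span_base)
  next
    case (2 G ms)
    have "bv (G, ms @ [a]) \<in> dec_rels dl" for a using 2 by (auto simp: dec_rels_def dec_double_loop_def)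
    thus ?thesis unfolding 2(2) lin_single add_mark_def fst_conv snd_conv
      by (intro rv.span_scale rv.span_sum rv.span_base)
  qed
qed

lemma drop_mark_ddiff: "lin drop_mark (lin (ddiff b) x) = lin (ddiff b) (lin drop_mark x)"
proof -
  have "lin drop_mark (ddiff b X) = lin (ddiff b) (drop_mark X)" for X
    by (simp add: ddiff_def drop_mark_def lin_sum cterm_def map_butlast)
  thus ?thesis by (simp only: lin_lin)
qed

text \<open>Each contraction maps the unmarked external vertices bijectively onto those of the
  contracted graph, so it carries one average to the other, with the same weights.\<close>

lemma add_mark_ddiff:
  assumes "\<And>X. X \<in> keys x \<Longrightarrow> good (fst X) \<and> set (snd X) \<subseteq> ext_vertices (fst X)"
  shows "lin add_mark (lin (ddiff False) x) = lin (ddiff False) (lin add_mark x)" unfolding lin_lin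
proof (rule lin_cong)
  fix X assume "X \<in> keys x"
  obtain G ms where X: "X = (G, ms)" by force
  have g: "good G" and ms: "set ms \<subseteq> ext_vertices G"
    using assms[OF \<open>X \<in> keys x\<close>] by (auto simp: X)
  let ?A = "ext_vertices G - set ms"
  have l: "lin add_mark (cterm X l) = scale_rat (1 / of_nat (card ?A)) (\<Sum>a\<in>?A. cterm (G, ms @ [a]) l)"
    if "l \<in> contractions False G" for l
  proof -
    have c: "contractible False G l" using that by (simp add: contractions_def)
    note bij = bij_ext_vertices_contract[OF g c]
    have inj: "inj_on (cmap G l) (ext_vertices G)" using bij by (simp add: bij_betw_def)
    hence inj': "inj_on (cmap G l) ?A" by (rule inj_on_subset) auto
    have "ext_vertices (contract G l) - cmap G l ` set ms = cmap G l ` ?A"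
      using bij inj_on_image_set_diff[OF inj, of "ext_vertices G" "set ms"] ms by (auto simp: bij_betw_def)
    thus ?thesis
      by (simp add: X cterm_def add_mark_def card_image[OF inj'] sum.reindex[OF inj'] rv.scale_sum_right mult.commute)
  qed
  have "lin add_mark (ddiff False X) = (\<Sum>l\<in>contractions False G. scale_rat (1 / of_nat (card ?A)) (\<Sum>a\<in>?A. cterm (G, ms @ [a]) l))"
    using l by (simp add: ddiff_def lin_sum X)
  also have "\<dots> = scale_rat (1 / of_nat (card ?A)) (\<Sum>a\<in>?A. \<Sum>l\<in>contractions False G. cterm (G, ms @ [a]) l)"
    by (subst sum.swap) (simp add: rv.scale_sum_right)
  also have "\<dots> = lin (ddiff False) (add_mark X)"
    by (simp add: X add_mark_def lin_scale lin_sum ddiff_def)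
  finally show "lin add_mark (ddiff False X) = lin (ddiff False) (add_mark X)" .
qed

lemma drop_add_mark:
  assumes "\<And>X. X \<in> keys x \<Longrightarrow> ext_vertices (fst X) - set (snd X) \<noteq> {}"
  shows "lin drop_mark (lin add_mark x) = x"
proof -
  have "lin drop_mark (lin add_mark x) = lin bv x" unfolding lin_lin
  proof (rule lin_cong)
    fix X assume "X \<in> keys x"
    hence "card (ext_vertices (fst X) - set (snd X)) \<noteq> 0" using assms by simp
    thus "lin drop_mark (add_mark X) = bv X"
      by (simp add: add_mark_def lin_scale lin_sum drop_mark_def flip: sum_constant_scale)
        (simp add: poly_mapping_eq_iff fun_eq_iff lookup_sum lookup_single when_def)
  qed
  thus ?thesis by simp
qed

text \<open>If all external vertices are pruned, no internal vertex is adjacent to an external one, so by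
  connectedness there are no internal vertices.\<close>

lemma stage_set_empty:
  assumes "N \<le> k"
  shows "stage_set (\<lambda>_. k) N k = {}"
proof (rule ccontr)
  assume "stage_set (\<lambda>_. k) N k \<noteq> {}"
  then obtain G ms where X: "stage (\<lambda>_. k) N (G, ms)" "length ms = k" "has_internal G"
    by (auto simp: stage_set_def)
  have g: "good G" and d: "distinct ms" and ext: "set ms \<subseteq> ext_vertices G" and card: "card (ext_vertices G) = N"
    and pr: "\<And>K i. i < k \<Longrightarrow> pruned K G (ms ! i) (set (take i ms))"
    using X by (auto simp: stage_def)
  have "card (set ms) \<ge> card (ext_vertices G)" using distinct_card[OF d] X(2) card assms by simp
  hence all: "set ms = ext_vertices G" using ext by (intro card_seteq) auto
  have zero: "inner_count K G v = 0" if "v < num_vertices G" "vkind G v = ExtBlack" for K v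
  proof -
    have "v \<in> set ms" using all that by blast
    then obtain i where "i < k" "v = ms ! i" using X(2) by (auto simp: in_set_conv_nth)
    thus ?thesis using pr by (simp add: pruned_def)
  qed
  obtain u where u: "u < num_vertices G" "vkind G u \<noteq> ExtBlack" using X(3) by (auto simp: has_internal_def)
  obtain v where v: "v < num_vertices G" "vkind G v = ExtBlack"
    using g by (auto simp: good_iff in_set_conv_nth)
  have "reachable G u v" using g u v by (auto simp: good_iff connected_graph_def)
  hence "vkind G v \<noteq> ExtBlack" unfolding reachable_def
  proof (induction rule: rtrancl_induct)
    case (step y z)
    then obtain l where l: "l < num_edges G" "ends_at G l = {z, y}"
      by (auto simp: in_set_conv_nth insert_commute)
    have "z < num_vertices G" using ends_bounded[OF good_typed[OF g] l(1)] l(2) by simp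
    moreover have "inner_count (kind_at G l) G z > 0"
      unfolding inner_count_def half_count_pos_iff using l step.IH by blast
    ultimately show ?case using zero by fastforce
  qed (rule u(2))
  thus False using v(2) by simp
qed

text \<open>The linear extension of \<open>prune_homotopy\<close>: the homotopy of the differential
  of \<open>x\<close> is a relation and drops out, and the remainder is again a cycle modulo
  relations because the differential squares to zero.\<close>

lemma prune_step:
  assumes x: "keys x \<subseteq> stage_set f N (Suc k)" and f: "f K = k"
    and dx: "lin (ddiff False) x \<in> dspan dl"
  obtains y where "keys y \<subseteq> stage_set (f(K := Suc k)) N (Suc k)"
    "lin (ddiff False) y \<in> dspan dl"
    "x - lin (ddiff False) (lin (hop K) x) - y \<in> dspan dl"
proof -
  let ?R = "dspan dl" and ?d = "ddiff False" and ?h = "hop K"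
  have "\<forall>X. \<exists>y. X \<in> stage_set f N (Suc k) \<longrightarrow> keys y \<subseteq> stage_set (f(K := Suc k)) N (Suc k) \<and>
    bv X - lin ?h (?d X) - lin ?d (?h X) - y \<in> rv.span (dec_relations)"
    using prune_homotopy[where f = f and K = K and k = k, OF _ f] by blast
  then obtain Y where "\<forall>X. X \<in> stage_set f N (Suc k) \<longrightarrow> keys (Y X) \<subseteq> stage_set (f(K := Suc k)) N (Suc k) \<and>
    bv X - lin ?h (?d X) - lin ?d (?h X) - Y X \<in> rv.span (dec_relations)" by (rule choice[THEN exE])
  hence Y: "keys (Y X) \<subseteq> stage_set (f(K := Suc k)) N (Suc k)"
    "bv X - lin ?h (?d X) - lin ?d (?h X) - Y X \<in> ?R" if "X \<in> keys x" for X
    using that x span_dec_rels by blast+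
  define y where "y = lin Y x"
  have ky: "keys y \<subseteq> stage_set (f(K := Suc k)) N (Suc k)"
    unfolding y_def using keys_lin_subset[of Y x] Y(1) by blast
  have "lin (\<lambda>X. bv X - lin ?h (?d X) - lin ?d (?h X) - Y X) x \<in> ?R"
    by (rule lin_in_span) (rule Y(2))
  hence 1: "x - lin ?h (lin ?d x) - lin ?d (lin ?h x) - y \<in> ?R"
    by (simp add: lin_fun_diff lin_lin y_def)
  from rv.span_add[OF this hop_dec_rels[OF dx, of K]]
  have 2: "x - lin ?d (lin ?h x) - y \<in> ?R" by (simp add: algebra_simps)
  have gh: "good (fst X)" if X: "X \<in> keys (lin ?h x)" for X
  proof -
    obtain Z where Z: "Z \<in> keys x" "X \<in> keys (?h Z)" using X keys_lin_subset[of ?h x] by blast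
    hence "good (fst Z)" using x by (auto simp: stage_set_def stage_def)
    thus ?thesis using Z(2) good_blow_marked[of Z K] by (auto simp: hop_def split: if_splits)
  qed
  have dd: "lin ?d (lin ?d (lin ?h x)) = 0"
    unfolding lin_lin[of ?d ?d] using gh ddiff_ddiff by (simp add: linear_extension_def)
  have "lin ?d x - (lin ?d (x - lin ?d (lin ?h x) - y)) \<in> ?R"
    by (rule rv.span_diff[OF dx ddiff_dec_rels[OF 2]])
  hence "lin ?d y \<in> ?R" by (simp add: lin_diff dd)
  with ky 2 that show thesis by blast
qed

definition internal_set :: "nat \<Rightarrow> dgraph set"
  where "internal_set N = {X. good (fst X) \<and> card (ext_vertices (fst X)) = N \<and> has_internal (fst X)}"

lemma keys_hop_internal:
  assumes "keys x \<subseteq> internal_set N"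
  shows "keys (lin (hop K) x) \<subseteq> internal_set N"
proof
  fix X assume "X \<in> keys (lin (hop K) x)"
  then obtain Z where Z: "Z \<in> keys x" "X \<in> keys (hop K Z)"
    using keys_lin_subset[of "hop K" x] by blast
  hence ok: "hop_ok K Z" and X: "X = blow_marked K Z" by (auto simp: hop_def split: if_splits)
  have Zi: "Z \<in> internal_set N" using assms Z(1) by blast
  have inj: "inj (shift b)" for b by (simp add: inj_def)
  have "vkinds (fst X) ! vpos K (fst Z) \<noteq> ExtBlack" "vpos K (fst Z) < num_vertices (fst X)"
    using vpos_le[of K "fst Z"] by (simp_all add: X blow_marked_def nth_vkinds_blow)
  hence hi: "has_internal (fst X)" unfolding has_internal_def by blast
  show "X \<in> internal_set N"
  proof -
    have "card (ext_vertices (blow K a T G)) = card (ext_vertices G)" for a T G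
      unfolding ext_vertices_blow by (rule card_image[OF inj_on_subset[OF inj subset_UNIV]])
    hence "card (ext_vertices (fst X)) = N"
      using Zi by (simp only: internal_set_def X blow_marked_def fst_conv mem_Collect_eq)
    thus ?thesis using good_blow_marked[OF _ ok] Zi hi by (simp only: internal_set_def X mem_Collect_eq)
  qed
qed

lemma stage_set_internal: "stage_set f N k \<subseteq> internal_set N"
  by (auto simp: stage_set_def internal_set_def stage_def)

lemma keys_drop_internal:
  assumes "keys x \<subseteq> internal_set N"
  shows "keys (lin drop_mark x) \<subseteq> internal_set N"
  using keys_lin_subset[of drop_mark x] assms by (fastforce simp: drop_mark_def internal_set_def)

text \<open>Induction on the number of unmarked external vertices. The mark added by averaging is
  needed only until the next primitive has been found: \<open>drop_mark\<close> commutes with the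
  differential and turns the averaged cycle back into \<open>x\<close>.\<close>

lemma acyclic_marked:
  assumes "keys x \<subseteq> stage_set (\<lambda>_. k) N k" "lin (ddiff False) x \<in> dspan dl"
  shows "\<exists>y. keys y \<subseteq> internal_set N \<and> x - lin (ddiff False) y \<in> dspan dl"
  using assms
proof (induction "N - k" arbitrary: k x)
  case 0
  hence "keys x = {}" using stage_set_empty[of N k] by simp
  thus ?case by (intro exI[of _ 0]) (simp add: rv.span_zero)
next
  case (Suc m)
  let ?R = "dspan dl" and ?d = "ddiff False"
  have kN: "k < N" using Suc.hyps(2) by simp
  have x: "good (fst X) \<and> set (snd X) \<subseteq> ext_vertices (fst X) \<and> ext_vertices (fst X) - set (snd X) \<noteq> {}"
    if X: "X \<in> keys x" for X
  proof -
    have st: "stage (\<lambda>_. k) N X" "length (snd X) = k" using X Suc.prems(1) by (auto simp: stage_set_def)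
    have "card (set (snd X)) = k" using st by (simp add: stage_def distinct_card)
    moreover have "card (ext_vertices (fst X)) = N" using st by (simp add: stage_def)
    ultimately have "\<not> ext_vertices (fst X) \<subseteq> set (snd X)"
      using kN card_mono[of "set (snd X)" "ext_vertices (fst X)"] by auto
    thus ?thesis using st by (auto simp: stage_def)
  qed
  define X0 where "X0 = lin add_mark x"
  have k0: "keys X0 \<subseteq> stage_set (\<lambda>_. k) N (Suc k)"
  proof
    fix Y assume "Y \<in> keys X0"
    then obtain X where X: "X \<in> keys x" "Y \<in> keys (add_mark X)"
      using keys_lin_subset[of add_mark x] unfolding X0_def by blast
    have "keys (add_mark X) \<subseteq> (\<lambda>a. (fst X, snd X @ [a])) ` (ext_vertices (fst X) - set (snd X))"
      unfolding add_mark_def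
      by (rule order_trans[OF keys_scale_subset], rule order_trans[OF keys_sum_subset]) auto
    then obtain a where a: "a \<in> ext_vertices (fst X) - set (snd X)" "Y = (fst X, snd X @ [a])"
      using X(2) by blast
    have st: "stage (\<lambda>_. k) N X" "length (snd X) = k" "has_internal (fst X)"
      using X(1) Suc.prems(1) by (auto simp: stage_set_def)
    have "pruned K (fst Y) (snd Y ! i) (set (take i (snd Y)))" if "i < k" for K i
      using st that by (simp add: a stage_def nth_append)
    thus "Y \<in> stage_set (\<lambda>_. k) N (Suc k)" using st a by (auto simp: stage_set_def stage_def)
  qed
  have d0: "lin ?d X0 \<in> ?R"
    unfolding X0_def using add_mark_ddiff[of x] x add_mark_dec_rels[OF Suc.prems(2)] by simp
  \<comment> \<open>Pruning along one kind preserves what has been achieved along the other. This is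
    why \<open>stage\<close> records the progress for each kind separately.\<close>
  obtain Y1 where Y1: "keys Y1 \<subseteq> stage_set ((\<lambda>_. k)(Dashed := Suc k)) N (Suc k)"
    "lin ?d Y1 \<in> ?R" "X0 - lin ?d (lin (hop Dashed) X0) - Y1 \<in> ?R"
    by (rule prune_step[OF k0 _ d0]) auto
  have s: "((\<lambda>_. k)(Dashed := Suc k)) Solid = k" by simp
  obtain Y2 where Y2: "keys Y2 \<subseteq> stage_set (((\<lambda>_. k)(Dashed := Suc k))(Solid := Suc k)) N (Suc k)"
    "lin ?d Y2 \<in> ?R" "Y1 - lin ?d (lin (hop Solid) Y1) - Y2 \<in> ?R"
    by (rule prune_step[OF Y1(1) s Y1(2)])
  have f: "((\<lambda>_. k)(Dashed := Suc k))(Solid := Suc k) = (\<lambda>_. Suc k)"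
  proof
    fix K show "(((\<lambda>_. k)(Dashed := Suc k))(Solid := Suc k)) K = Suc k" by (cases K) auto
  qed
  have "m = N - Suc k" using Suc.hyps(2) by simp
  from Suc.hyps(1)[OF this Y2(1)[unfolded f] Y2(2)]
  obtain y2 where y2: "keys y2 \<subseteq> internal_set N" "Y2 - lin ?d y2 \<in> ?R" by blast
  define z where "z = lin (hop Dashed) X0 + lin (hop Solid) Y1 + y2"
  have "X0 - lin ?d z = (X0 - lin ?d (lin (hop Dashed) X0) - Y1) +
      (Y1 - lin ?d (lin (hop Solid) Y1) - Y2) + (Y2 - lin ?d y2)" by (simp add: z_def lin_add)
  also have "\<dots> \<in> ?R" by (intro rv.span_add Y1(3) Y2(3) y2(2))
  finally have "lin drop_mark (X0 - lin ?d z) \<in> ?R" by (rule drop_mark_dec_rels)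
  moreover have "lin drop_mark X0 = x" unfolding X0_def by (rule drop_add_mark) (use x in blast)
  ultimately have "x - lin ?d (lin drop_mark z) \<in> ?R" by (simp add: lin_diff drop_mark_ddiff)
  moreover have "keys z \<subseteq> internal_set N"
  proof -
    have "keys X0 \<subseteq> internal_set N" "keys Y1 \<subseteq> internal_set N"
      using k0 Y1(1) stage_set_internal by blast+
    thus ?thesis unfolding z_def using keys_hop_internal y2(1) keys_add by (meson Un_least order_trans)
  qed
  ultimately show ?case using keys_drop_internal by blast
qed

section \<open>The differential on graphs\<close>

definition udiff :: "bool \<Rightarrow> lgraph \<Rightarrow> (lgraph \<Rightarrow>\<^sub>0 rat)"
  where "udiff b G = (\<Sum>l\<in>contractions b G. cvec G l)"

definition urels :: "bool \<Rightarrow> (lgraph \<Rightarrow>\<^sub>0 rat) set"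
  where "urels dl = orient_rel {G. good G} \<union>
    (if dl then double_loop_relations {G. good G} else {})"

abbreviation uspan :: "bool \<Rightarrow> (lgraph \<Rightarrow>\<^sub>0 rat) set" where "uspan dl \<equiv> rv.span (urels dl)"

text \<open>Statements on bare graphs are deduced from those on marked graphs by attaching the empty
  list and forgetting it again: both maps commute with the differentials and respect the relations,
  and their composite is the identity.\<close>

definition unmarked :: "lgraph \<Rightarrow> (dgraph \<Rightarrow>\<^sub>0 rat)"
  where "unmarked G = bv (G, [])"

definition forget :: "dgraph \<Rightarrow> (lgraph \<Rightarrow>\<^sub>0 rat)"
  where "forget X = bv (fst X)"

lemma forget_unmarked: "lin forget (lin unmarked x) = x" by (simp add: lin_lin unmarked_def forget_def)

lemma forget_ddiff: "lin forget (lin (ddiff b) x) = lin (udiff b) (lin forget x)"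
proof -
  have "lin forget (ddiff b X) = lin (udiff b) (forget X)" for X
    by (simp add: ddiff_def udiff_def forget_def lin_sum cterm_def)
  thus ?thesis by (simp only: lin_lin)
qed

lemma unmarked_udiff: "lin unmarked (lin (udiff b) x) = lin (ddiff b) (lin unmarked x)"
proof -
  have "lin unmarked (udiff b G) = lin (ddiff b) (unmarked G)" for G
    by (simp add: ddiff_def udiff_def unmarked_def lin_sum cterm_def)
  thus ?thesis by (simp only: lin_lin)
qed

lemma unmarked_rels:
  assumes "x \<in> uspan dl"
  shows "lin unmarked x \<in> dspan dl"
proof (rule lin_span_image[OF _ assms])
  fix r assume "r \<in> urels dl"
  then consider G H s where "r = bv H - single G s" "good G" "good H" "relab G H s"
    | G where "dl" "r = bv G" "good G" "has_double_or_loop G"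
    by (auto simp: urels_def orientation_relations_def double_loop_relations_def split: if_splits)
  hence "lin unmarked r \<in> dec_rels dl"
  proof cases
    case (1 G H s)
    obtain vp ep where st: "rstep G H vp ep s" using 1(4) relabeling_iff by blast
    have "bv (H, map vp []) - single (G, []) s \<in> dec_rels dl"
      unfolding dec_rels_def dec_relations_def using 1 st by blast
    thus ?thesis by (simp add: 1(1) lin_diff unmarked_def)
  next
    case (2 G)
    thus ?thesis by (auto simp: unmarked_def dec_rels_def dec_double_loop_def)
  qed
  thus "lin unmarked r \<in> dspan dl" by (rule rv.span_base)
qed

lemma forget_rels:
  assumes "x \<in> dspan dl"
  shows "lin forget x \<in> uspan dl"
proof (rule lin_span_image[OF _ assms])
  fix r assume "r \<in> dec_rels dl"
  then consider G H vp ep s ms where "r = bv (H, map vp ms) - single (G, ms) s"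
      "good G" "good H" "rstep G H vp ep s"
    | G ms where "dl" "r = bv (G, ms)" "good G" "has_double_or_loop G"
    by (auto simp: dec_rels_def dec_relations_def dec_double_loop_def split: if_splits)
  hence "lin forget r \<in> urels dl"
  proof cases
    case (1 G H vp ep s ms)
    hence "bv H - single G s \<in> orient_rel {G. good G}"
      unfolding orientation_relations_def using relabeling_iff by blast
    thus ?thesis by (simp add: 1(1) lin_diff forget_def urels_def)
  next
    case (2 G ms)
    thus ?thesis by (auto simp: forget_def urels_def double_loop_relations_def)
  qed
  thus "lin forget r \<in> uspan dl" by (rule rv.span_base)
qed

lemma udiff_rels:
  assumes "x \<in> uspan dl"
  shows "lin (udiff b) x \<in> uspan dl"
proof -
  have "lin forget (lin (ddiff b) (lin unmarked x)) \<in> uspan dl"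
    by (intro forget_rels ddiff_dec_rels unmarked_rels assms)
  thus ?thesis by (simp add: forget_ddiff forget_unmarked)
qed

lemma udiff_udiff:
  assumes "\<And>G. G \<in> keys x \<Longrightarrow> good G"
  shows "lin (udiff b) (lin (udiff b) x) = 0"
proof -
  have "lin (udiff b) (udiff b G) = 0" if "good G" for G
  proof -
    have "lin (udiff b) (udiff b G) = lin forget (lin (ddiff b) (ddiff b (G, [])))"
      unfolding forget_ddiff using forget_ddiff[of b "bv (G, [])"] by (simp add: forget_def)
    thus ?thesis using ddiff_ddiff[of "(G, [])" b] that by simp
  qed
  thus ?thesis unfolding lin_lin using assms by (simp add: linear_extension_def)
qed

lemma urels_mono: "x \<in> uspan False \<Longrightarrow> x \<in> uspan dl"
  using rv.span_mono[of "urels False" "urels dl"] by (auto simp: urels_def)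

definition internal_graphs :: "nat \<Rightarrow> lgraph set"
  where "internal_graphs N = {G. good G \<and> card (ext_vertices G) = N \<and> has_internal G}"

theorem acyclic_internal:
  assumes "keys x \<subseteq> internal_graphs N" "lin (udiff False) x \<in> uspan dl"
  shows "\<exists>y. keys y \<subseteq> internal_graphs N \<and> x - lin (udiff False) y \<in> uspan dl"
proof -
  have "keys (lin unmarked x) \<subseteq> stage_set (\<lambda>_. 0) N 0"
  proof
    fix X assume "X \<in> keys (lin unmarked x)"
    then obtain G where "G \<in> keys x" "X = (G, [])"
      using keys_lin_subset[of unmarked x] by (auto simp: unmarked_def)
    thus "X \<in> stage_set (\<lambda>_. 0) N 0"
      using assms(1) by (auto simp: stage_set_def stage_def internal_graphs_def)
  qed
  moreover have "lin (ddiff False) (lin unmarked x) \<in> dspan dl"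
    unfolding unmarked_udiff[symmetric] by (rule unmarked_rels[OF assms(2)])
  ultimately obtain y where y: "keys y \<subseteq> internal_set N"
    "lin unmarked x - lin (ddiff False) y \<in> dspan dl" using acyclic_marked by blast
  have "x - lin (udiff False) (lin forget y) \<in> uspan dl"
    using forget_rels[OF y(2)] by (simp add: lin_diff forget_unmarked forget_ddiff)
  moreover have "keys (lin forget y) \<subseteq> internal_graphs N"
    using keys_lin_subset[of forget y] y(1) by (fastforce simp: forget_def internal_set_def internal_graphs_def)
  ultimately show ?thesis by blast
qed

section \<open>Arnold relations as coboundaries\<close>

definition chordal :: "lgraph \<Rightarrow> bool"
  where "chordal G \<longleftrightarrow> good G \<and> \<not> has_internal G"

lemma chordal_kinds: "chordal G \<Longrightarrow> v < num_vertices G \<Longrightarrow> vkind G v = ExtBlack"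
  by (auto simp: chordal_def has_internal_def)

lemma chordal_vpos: "chordal G \<Longrightarrow> vpos K G = num_vertices G"
proof -
  assume c: "chordal G"
  hence "filter (\<lambda>k. k \<noteq> White) (vkinds G) = vkinds G"
    by (intro filter_True) (auto simp: in_set_conv_nth chordal_kinds)
  thus ?thesis by (simp add: vpos_def black_count_def)
qed

lemma chordal_blow_edge:
  assumes "chordal G" "l < num_edges G" "\<And>x. kind_at G l = K \<Longrightarrow> ends_at G l = {a, x} \<Longrightarrow> x \<in> T"
  shows "blow_edge K a T (vpos K G) (edges G ! l) = edges G ! l"
proof -
  have N: "src_at G l < num_vertices G" "tgt_at G l < num_vertices G"
    using assms(1,2) by (auto simp: chordal_def good_iff well_labeled_def)
  show ?thesis using assms(3)[of "tgt_at G l"] assms(3)[of "src_at G l"] N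
    by (cases "edges G ! l") (auto simp: blow_edge_def chordal_vpos[OF assms(1)] shift_def ends_def insert_commute)
qed

text \<open>The new vertex is the only internal one, so an edge is contractible precisely if it ends
  there and is not a loop. These are the new edge and the moved edges that were not loops at
  \<open>a\<close>.\<close>

lemma contractions_chordal_blow:
  assumes c: "chordal G" and ok: "blow_ok K a T G" and a: "a \<notin> T"
  shows "contractions False (blow K a T G) = insert (epos K G) (shift (epos K G) `
    {l. l < num_edges G \<and> kind_at G l = K \<and> (\<exists>x. ends_at G l = {a, x} \<and> x \<noteq> a \<and> x \<notin> T)})"
    (is "_ = insert ?c (shift ?c ` ?A)")
proof -
  have g: "good G" using c by (simp add: chordal_def)
  let ?B = "blow K a T G" and ?b = "vpos K G"
  have ab: "a < ?b" by (rule blow_ok_less[OF g ok])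
  have int: "vkind ?B v \<noteq> ExtBlack \<longleftrightarrow> v = ?b" if "v < Suc (num_vertices G)" for v
    using that vpos_le[of K G] by (cases rule: shift_cases) (auto simp: nth_vkinds_blow chordal_kinds[OF c])
  have iff: "contractible False ?B (shift ?c l) \<longleftrightarrow> l \<in> ?A" if l: "l < num_edges G" for l
  proof -
    let ?e = "edges G ! l"
    have N: "src ?e < num_vertices G" "tgt ?e < num_vertices G"
      using g l by (auto simp: good_iff well_labeled_def)
    note ne = nth_edges_blow(2)[OF l, of K a T]
    have "contractible False ?B (shift ?c l) \<longleftrightarrow> src (blow_edge K a T ?b ?e) \<noteq> tgt (blow_edge K a T ?b ?e) \<and>
        ?b \<in> ends (blow_edge K a T ?b ?e)"
    proof -
      have "src (blow_edge K a T ?b ?e) < Suc (num_vertices G)" "tgt (blow_edge K a T ?b ?e) < Suc (num_vertices G)"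
        using N vpos_le[of K G] by (auto simp: blow_edge_def shift_less)
      thus ?thesis using shift_less[OF l, of ?c] unfolding contractible_def ne ends_def by (auto simp: int)
    qed
    also have "\<dots> \<longleftrightarrow> ekind ?e = K \<and> (src ?e = a \<and> tgt ?e \<notin> T \<and> tgt ?e \<noteq> a \<or> tgt ?e = a \<and> src ?e \<notin> T \<and> src ?e \<noteq> a)"
      using a by (auto simp: blow_edge_def ends_def)
    also have "\<dots> \<longleftrightarrow> l \<in> ?A" using l by (auto simp: ends_def doubleton_eq_iff)
    finally show ?thesis .
  qed
  show ?thesis
  proof (intro equalityI subsetI)
    fix m assume "m \<in> contractions False ?B"
    hence m: "contractible False ?B m" by (simp add: contractions_def)
    hence "m < Suc (num_edges G)" using contractible_less[OF m] by simp
    from this epos_le[of K G] show "m \<in> insert ?c (shift ?c ` ?A)"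
    proof (cases rule: shift_cases)
      case (2 l)
      thus ?thesis using iff[OF 2(1)] m by blast
    qed simp
  next
    fix m assume "m \<in> insert ?c (shift ?c ` ?A)"
    thus "m \<in> contractions False ?B"
      using iff contractible_blow[OF g ok, of False] by (auto simp: contractions_def)
  qed
qed

text \<open>The sign is kept as an exponent so that composites are added up and finally compared
  modulo two by \<open>reorient_cong\<close>.\<close>

definition reorient :: "lgraph \<Rightarrow> lgraph \<Rightarrow> int \<Rightarrow> bool"
  where "reorient X Y e \<longleftrightarrow> good X \<and> good Y \<and>
    bv X - single Y (sgn_pow e) \<in> uspan False"

lemma reorient_cong: "reorient X Y e \<Longrightarrow> even (e - f) \<Longrightarrow> reorient X Y f"
  using sgn_pow_eqI[of e f] by (simp add: reorient_def)

lemma reorient_refl: "good X \<Longrightarrow> even e \<Longrightarrow> reorient X X e"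
  by (simp add: reorient_def sgn_pow_if rv.span_zero)

lemma reorient_scale:
  assumes "reorient X Y e"
  shows "single X c - single Y (c * sgn_pow e) \<in> uspan False"
  using rv.span_scale[of _ "urels False" c] assms
  by (metis (no_types, lifting) mult.right_neutral reorient_def rv.scale_right_diff_distrib scale_single)

lemma reorient_trans:
  assumes "reorient X Y e" "reorient Y Z f"
  shows "reorient X Z (e + f)" using rv.span_add[OF _ reorient_scale[OF assms(2), of "sgn_pow e"]] assms
  by (fastforce simp: reorient_def sgn_pow_mult)

lemma reorient_sym:
  assumes "reorient X Y e"
  shows "reorient Y X e"
  using rv.span_neg[OF reorient_scale[OF assms, of "sgn_pow e"]] assms by (simp add: reorient_def)

lemma reorient_rstep:
  assumes "good G" "good H" "rstep G H vp ep (sgn_pow e)"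
  shows "reorient H G e"
proof -
  have "bv H - single G (sgn_pow e) \<in> urels False"
    using assms relabeling_iff[of G H "sgn_pow e"] unfolding urels_def orientation_relations_def by auto
  thus ?thesis using assms rv.span_base by (auto simp: reorient_def)
qed

lemma reorient_reverse:
  assumes "good G" "i < num_edges G"
  shows "reorient (reverse_edge i G) G (edeg G i + 1)"
  by (rule reorient_rstep[OF assms(1) good_reverse_edge[OF assms] rstep.reverse[OF assms(2)]])

lemma reorient_swap:
  assumes "good G" "Suc i < num_edges G" "kind_at G i = ekind (edges G ! Suc i)"
  shows "reorient (swap_edges i G) G (edeg G i)"
proof (rule reorient_cong)
  show "reorient (swap_edges i G) G (edeg G i * edeg G (Suc i))"
    by (rule reorient_rstep[OF assms(1) good_swap_edges[OF assms] rstep.edges[OF assms(2)]])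
  show "even (edeg G i * edeg G (Suc i) - edeg G i)" using assms(3) by (simp add: edeg_def)
qed

lemma reorient_transpose:
  assumes "s < t" "t < length es" "\<And>m. s < m \<Longrightarrow> m < t \<Longrightarrow> ekind (es ! m) = K"
    "ekind e = K" "ekind f = K" "good (LGraph vs (es[s := e, t := f]))"
  shows "reorient (LGraph vs (es[s := f, t := e])) (LGraph vs (es[s := e, t := f])) (kdeg K)" using assms
proof (induction "t - s" arbitrary: t f e es)
  case 0
  thus ?case by simp
next
  case (Suc k)
  let ?d = "kdeg K"
  show ?case
  proof (cases "t = Suc s")
    case True
    have "swap_edges s (LGraph vs (es[s := e, t := f])) = LGraph vs (es[s := f, t := e])"
      using Suc.prems(2) unfolding True swap_edges_def swap_adjacent_def lgraph.inject lgraph.sel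
      by (intro conjI nth_equalityI) (auto simp: nth_list_update)
    thus ?thesis using reorient_swap[OF Suc.prems(6), of s] Suc.prems True by (simp add: edeg_def)
  next
    case False
    then obtain u where u: "t = Suc u" "s < u" using Suc.prems(1) by (cases t) auto
    define g where "g = es ! u"
    have g: "ekind g = K" unfolding g_def by (rule Suc.prems(3)) (use u in auto)
    have sw: "swap_edges u (LGraph vs (es[s := x, u := a, t := b])) = LGraph vs (es[s := x, u := b, t := a])" for x a b
      using Suc.prems(2) u unfolding swap_edges_def swap_adjacent_def u(1) lgraph.inject lgraph.sel
      by (intro conjI nth_equalityI) (auto simp: nth_list_update)
    have e1: "es[s := e, t := f] = es[s := e, u := g, t := f]" "es[s := f, t := e] = es[s := f, u := g, t := e]"
      using Suc.prems(2) u unfolding g_def u(1) by (auto intro!: nth_equalityI simp: nth_list_update)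
    have st: "reorient (LGraph vs (es[s := x, u := b, t := a])) (LGraph vs (es[s := x, u := a, t := b])) ?d"
      if "ekind a = K" "ekind b = K" "good (LGraph vs (es[s := x, u := a, t := b]))" for x a b
      using reorient_swap[OF that(3), of u] that Suc.prems(2) u unfolding sw by (simp add: edeg_def)
    have r1: "reorient (LGraph vs (es[s := e, u := f, t := g])) (LGraph vs (es[s := e, u := g, t := f])) ?d"
      by (rule st) (use Suc.prems g e1 in auto)
    have c: "es[s := x, u := y, t := g] = es[t := g, s := x, u := y]" for x y
      using Suc.prems(2) u unfolding u(1) by (auto intro!: nth_equalityI simp: nth_list_update)
    have r2: "reorient (LGraph vs (es[t := g, s := f, u := e])) (LGraph vs (es[t := g, s := e, u := f])) ?d"
    proof (rule Suc.hyps(1))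
      show "good (LGraph vs (es[t := g, s := e, u := f]))" using r1 unfolding reorient_def c by blast
    qed (use Suc.prems Suc.hyps(2) u in auto)
    have r3: "reorient (LGraph vs (es[s := f, u := g, t := e])) (LGraph vs (es[s := f, u := e, t := g])) ?d"
    proof (rule st)
      show "good (LGraph vs (es[s := f, u := e, t := g]))" using r2 unfolding reorient_def c by blast
    qed (use Suc.prems g in auto)
    show ?thesis unfolding e1
      by (rule reorient_cong[OF reorient_trans[OF r3 reorient_trans[OF r2[folded c] r1]]]) simp
  qed
qed

text \<open>After the deletion \<open>e\<close> sits at position \<open>c - 1\<close>, and it moves
  left past \<open>c - 1 - s\<close> edges of its own kind to reach position
  \<open>s\<close>.\<close>

lemma reorient_rotate:
  assumes "s < c" "c \<le> length xs" "\<And>m. s < m \<Longrightarrow> m < c \<Longrightarrow> ekind (xs ! m) = K"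
    "ekind e = K" "good (LGraph vs (del_at s (ins_at c e xs)))"
  shows "reorient (LGraph vs (del_at s (ins_at c e xs))) (LGraph vs (xs[s := e]))
    (kdeg K * int (c - 1 - s))" using assms
proof (induction "c - s" arbitrary: c)
  case 0
  thus ?case by simp
next
  case (Suc k)
  show ?case
  proof (cases "c = Suc s")
    case True
    have "del_at s (ins_at c e xs) = xs[s := e]" using Suc.prems(2) unfolding True
      by (intro nth_equalityI) (auto simp: nth_del_at nth_ins_at nth_list_update)
    thus ?thesis using True Suc.prems(5) by (simp add: reorient_refl)
  next
    case False
    then obtain u where u: "c = Suc u" "s < u" using Suc.prems(1) by (cases c) auto
    let ?A = "LGraph vs (del_at s (ins_at c e xs))" and ?B = "LGraph vs (del_at s (ins_at u e xs))"
    have len: "Suc u \<le> length xs" using Suc.prems(2) u by simp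
    have sw: "swap_edges (u - 1) ?A = ?B" using u len unfolding swap_edges_def u(1)
      by (auto intro!: nth_equalityI simp: nth_swap_adjacent nth_del_at nth_ins_at transpose_def)
    have n: "edges ?A ! (u - 1) = xs ! u" "edges ?A ! u = e"
      using u len by (auto simp: nth_del_at nth_ins_at)
    have r: "reorient ?B ?A (kdeg K)"
      using reorient_swap[OF Suc.prems(5), of "u - 1"] u len n Suc.prems(3)[of u] Suc.prems(4) unfolding sw
      by (simp add: edeg_def)
    have "reorient ?B (LGraph vs (xs[s := e])) (kdeg K * int (u - 1 - s))"
      by (rule Suc.hyps(1)) (use Suc.prems Suc.hyps(2) u r in "auto simp: reorient_def")
    from reorient_trans[OF reorient_sym[OF r] this] show ?thesis
      by (rule reorient_cong) (use u in "auto simp: algebra_simps")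
  qed
qed


lemma epos_kinds:
  assumes "good G" "l < num_edges G" "kind_at G l = K"
  shows "l < epos K G" "l \<le> m \<Longrightarrow> m < epos K G \<Longrightarrow> kind_at G m = K"
proof -
  have iff: "kind_at G m = Solid \<longleftrightarrow> m < solid_count G" if "m < num_edges G" for m
    using assms(1) that by (simp add: good_iff well_labeled_iff)
  show "l < epos K G" using assms(2,3) iff[of l] by (cases K) (auto simp: epos_def)
  thus "kind_at G m = K" if "l \<le> m" "m < epos K G"
    using assms(2,3) iff[of l] iff[of m] that epos_le[of K G]
    by (cases K; cases "kind_at G m") (auto simp: epos_def)
qed

text \<open>Contracting the moved edge \<open>p\<close> merges the new vertex into \<open>x\<close>:
  the other moved half-edges now hang at \<open>x\<close> instead of \<open>a\<close>, and the new
  edge, now running from \<open>a\<close> to \<open>x\<close>, takes over the role of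
  \<open>p\<close>. It sits at the insertion point and is rotated to position \<open>p\<close>,
  which explains the exponents.\<close>

lemma contract_chordal_blow:
  assumes c: "chordal G" and ok: "blow_ok K a T G" and a: "a \<notin> T"
    and p: "p < num_edges G" "kind_at G p = K" "ends_at G p = {a, x}" "x \<noteq> a" "x \<notin> T"
  defines "B \<equiv> blow K a T G" and "d \<equiv> kdeg K"
  shows "csign B p = csign B (epos K G) *
      sgn_pow (d * int (epos K G - p) + (if src_at G p = a then d + 1 else 0))"
    and "reorient (contract B p) (LGraph (vkinds G) ((map (\<lambda>e. relabel_edge (\<lambda>v. if v = num_vertices G then x else v)
      (blow_edge K a T (num_vertices G) e)) (edges G))[p := Edge K a x])) (d * int (epos K G - 1 - p))"
proof -
  let ?N = "num_vertices G" and ?c = "epos K G"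
  have g: "good G" using c by (simp add: chordal_def)
  have gB: "good B" unfolding B_def by (rule good_blow[OF g ok])
  have b: "vpos K G = ?N" by (rule chordal_vpos[OF c])
  have aN: "a < ?N" using ok by (simp add: blow_ok_def)
  have xN: "x < ?N" using g p by (auto simp: good_iff well_labeled_def ends_def doubleton_eq_iff)
  have pc: "p < ?c" by (rule epos_kinds(1)[OF g p(1,2)])
  have sp: "shift ?c p = p" by (rule shift_id[OF pc])
  have ep: "edges B ! p = (if src_at G p = a then Edge K ?N x else Edge K x ?N)"
    using nth_edges_blow(2)[OF p(1), of K a T] p xN aN a unfolding B_def sp b
    by (auto simp: blow_edge_def ends_def doubleton_eq_iff shift_def)
  have con: "contractible False B p"
  proof -
    have "p \<in> contractions False B"
      unfolding B_def contractions_chordal_blow[OF c ok a] using p sp by (auto intro!: image_eqI[of _ _ p])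
    thus ?thesis by (simp add: contractions_def)
  qed
  have conc: "contractible False B ?c" unfolding B_def by (rule contractible_blow[OF g ok])
  have ec: "edges B ! ?c = Edge K a ?N" unfolding B_def nth_edges_blow(1) by (simp add: b)
  have mm: "cmin B p = x" "cmax B p = ?N" "cmax B ?c = ?N" using ep ec xN aN by auto
  \<comment> \<open>Edges of one kind are contiguous, so everything from \<open>p\<close> to the
    insertion point has kind \<open>K\<close>; this makes the degrees between the two positions
    computable.\<close>
  have kinds: "kind_at B m = K" if "p \<le> m" "m \<le> ?c" for m
  proof (cases "m = ?c")
    case False
    hence "m < ?c" using that by simp
    thus ?thesis using nth_edges_blow(2)[of m G K a T] epos_kinds(2)[OF g p(1,2) that(1)] epos_le[of K G]
      by (simp add: B_def shift_id)
  qed (simp add: ec)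
  have ed: "edeg B p = d" "edeg B ?c = d" using kinds pc by (auto simp: edeg_def d_def)
  have after: "edeg_after B p = d * int (?c - p) + edeg_after B ?c"
  proof -
    have "{p<..<num_edges B} = {p<..?c} \<union> {?c<..<num_edges B}"
      using pc epos_le[of K G] by (auto simp: B_def)
    hence "edeg_after B p = (\<Sum>m\<in>{p<..?c}. edeg B m) + edeg_after B ?c"
      unfolding edeg_after_def by (simp add: sum.union_disjoint ivl_disj_int)
    moreover have "(\<Sum>m\<in>{p<..?c}. edeg B m) = (\<Sum>m\<in>{p<..?c}. d)"
      by (rule sum.cong) (auto simp: kinds edeg_def d_def)
    ultimately show ?thesis by simp
  qed
  show "csign B p = csign B ?c *
      sgn_pow (d * int (?c - p) + (if src_at G p = a then d + 1 else 0))"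
    unfolding contraction_sign_eq[OF gB con] contraction_sign_eq[OF gB conc] sgn_pow_mult
    by (rule sgn_pow_eqI) (use xN aN in "auto simp: csign_exp_def ed after mm ep ec")
  let ?r = "\<lambda>v. if v = ?N then x else v"
  let ?es = "map (\<lambda>e. relabel_edge ?r (blow_edge K a T ?N e)) (edges G)"
  have vk: "vkinds (contract B p) = vkinds G"
  proof -
    have "vkind B x = ExtBlack" "vkind G x = ExtBlack"
      using nth_vkinds_blow(2)[OF xN, of K a T] chordal_kinds[OF c xN] xN by (simp_all add: B_def b shift_id)
    hence "vkinds (contract B p) = del_at ?N ((vkinds B)[x := ExtBlack])"
      using contract_eq[of B p] con by (simp add: contractible_def mm merged_kind_def)
    also have "\<dots> = vkinds G" using xN \<open>vkind G x = ExtBlack\<close> unfolding B_def blow_def b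
      by (intro nth_equalityI) (auto simp: nth_del_at nth_ins_at nth_list_update)
    finally show ?thesis .
  qed
  have "edges (contract B p) = del_at p (map (relabel_edge (cmap B p)) (edges B))"
    by (simp add: edges_contract[OF con] map_del_at)
  also have "map (relabel_edge (cmap B p)) (edges B) = map (relabel_edge ?r) (edges B)"
  proof (rule map_cong[OF refl])
    fix e assume "e \<in> set (edges B)"
    hence "src e < Suc ?N" "tgt e < Suc ?N" using gB by (auto simp: good_iff well_labeled_def B_def)
    thus "relabel_edge (cmap B p) e = relabel_edge ?r e"
      by (intro relabel_edge_cong) (auto simp: cmap_def mm merge_def)
  qed
  also have "\<dots> = ins_at ?c (Edge K a x) ?es"
    using aN by (simp add: B_def blow_def b map_ins_at relabel_edge_def comp_def)
  finally have eq: "contract B p = LGraph (vkinds G) (del_at p (ins_at ?c (Edge K a x) ?es))"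
    using vk by (cases "contract B p") simp
  show "reorient (contract B p) (LGraph (vkinds G) (?es[p := Edge K a x])) (d * int (?c - 1 - p))"
    unfolding eq d_def
  proof (rule reorient_rotate[OF pc])
    show "?c \<le> length ?es" using epos_le[of K G] by simp
    show "ekind (?es ! m) = K" if "p < m" "m < ?c" for m
      using epos_kinds(2)[OF g p(1,2), of m] that epos_le[of K G] by simp
    show "good (LGraph (vkinds G) (del_at p (ins_at ?c (Edge K a x) ?es)))"
      using good_contract[OF gB con] unfolding eq .
  qed simp
qed

lemma reorient_transpose':
  assumes "s \<noteq> t" "s < length es" "t < length es" "ekind e = K" "ekind f = K"
    "good (LGraph vs (es[s := e, t := f]))"
  shows "reorient (LGraph vs (es[s := f, t := e])) (LGraph vs (es[s := e, t := f])) (kdeg K)"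
proof -
  have k: "ekind (es ! m) = K" if "min s t < m" "m < max s t" for m
  proof -
    have "ekind (edges (LGraph vs (es[s := e, t := f])) ! m) = K"
    proof (rule epos_kinds(2)[OF assms(6)])
      show "min s t < num_edges (LGraph vs (es[s := e, t := f]))" "min s t \<le> m" using assms that by auto
      show "ekind (edges (LGraph vs (es[s := e, t := f])) ! min s t) = K"
        using assms by (auto simp: min_def nth_list_update)
      have "max s t < epos K (LGraph vs (es[s := e, t := f]))"
        by (rule epos_kinds(1)[OF assms(6)]) (use assms in "auto simp: max_def nth_list_update")
      thus "m < epos K (LGraph vs (es[s := e, t := f]))" using that by linarith
    qed
    thus ?thesis using that assms by (simp add: nth_list_update split: if_splits)
  qed
  show ?thesis
  proof (cases "s < t")
    case True
    thus ?thesis by (intro reorient_transpose) (use assms k in auto)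
  next
    case False
    hence "t < s" using assms(1) by simp
    moreover have sw: "es[s := x, t := y] = es[t := y, s := x]" for x y
      using assms(1) by (rule list_update_swap)
    ultimately show ?thesis unfolding sw by (intro reorient_transpose) (use assms k sw in auto)
  qed
qed

lemma reorient_flip:
  assumes "s < length es" "good (LGraph vs (es[s := Edge K x y]))"
  shows "reorient (LGraph vs (es[s := Edge K y x])) (LGraph vs (es[s := Edge K x y])) (kdeg K + 1)"
  using reorient_reverse[OF assms(2), of s] assms(1) by (simp add: reverse_edge_def edeg_def)

text \<open>Blowing up \<open>i\<close> along its edges to \<open>h\<close> and \<open>l\<close> gives a trivalent vertex, whose three contractions are the
  three terms of the Arnold relation.\<close>

lemma udiff_arnold:
  fixes vs es s t K h i l T
  defines "G1 \<equiv> LGraph vs (es[s := Edge K h i, t := Edge K i l])"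
    and "G2 \<equiv> LGraph vs (es[s := Edge K i l, t := Edge K l h])"
    and "G3 \<equiv> LGraph vs (es[t := Edge K h i, s := Edge K l h])"
  assumes c: "chordal G1" and d: "distinct [h, i, l]" and st: "s \<noteq> t" "s < length es" "t < length es"
    and T: "h \<notin> T" "i \<notin> T" "l \<notin> T"
    and others: "\<And>m x. \<lbrakk>m < length es; m \<noteq> s; m \<noteq> t; ekind (es ! m) = K; ends (es ! m) = {i, x}\<rbrakk> \<Longrightarrow> x \<in> T"
  shows "blow_ok K i T G1" "good G2" "good G3"
    and "udiff False (blow K i T G1) -
      scale_rat (csign (blow K i T G1) (epos K G1)) (bv G1 + bv G2 + bv G3) \<in> uspan False"
proof -
  let ?B = "blow K i T G1" and ?c = "epos K G1" and ?N = "num_vertices G1" and ?d = "kdeg K"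
  have g: "good G1" using c by (simp add: chordal_def)
  have len: "num_edges G1 = length es" "vkinds G1 = vs" by (simp_all add: G1_def)
  have es: "edges G1 ! s = Edge K h i" "edges G1 ! t = Edge K i l"
    "m \<noteq> s \<Longrightarrow> m \<noteq> t \<Longrightarrow> edges G1 ! m = es ! m" for m
    using st by (auto simp: G1_def nth_list_update)
  have N: "h < ?N" "i < ?N" "l < ?N"
  proof -
    have "src_at G1 m < ?N \<and> tgt_at G1 m < ?N" if "m < length es" for m
      using g that by (auto simp: good_iff well_labeled_def len)
    from this[OF st(2)] this[OF st(3)] show "h < ?N" "i < ?N" "l < ?N" by (simp_all add: es)
  qed
  show ok: "blow_ok K i T G1" unfolding blow_ok_def
  proof (intro conjI disjI1)
    show "out_count K T i (edges G1) \<ge> 2"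
      by (rule half_count_two_edges[where l=s and m=t and w=h and u=l]) (use st T in "auto simp: len es ends_def")
  qed (use N chordal_kinds[OF c] in auto)
  define r where "r x e = relabel_edge (\<lambda>v. if v = ?N then x else v) (blow_edge K i T ?N e)" for x :: nat and e
  have r_other: "r x (es ! m) = es ! m" if "m < length es" "m \<noteq> s" "m \<noteq> t" for x m
  proof -
    have "blow_edge K i T ?N (edges G1 ! m) = edges G1 ! m"
      using chordal_blow_edge[OF c, of m K i T] others[of m] that es(3) chordal_vpos[OF c] by (simp add: len)
    moreover have "src_at G1 m < ?N" "tgt_at G1 m < ?N"
      using g that by (auto simp: good_iff well_labeled_def len)
    ultimately show ?thesis
      using es(3)[OF that(2,3)] unfolding r_def by (cases "es ! m") (auto simp: relabel_edge_def)
  qed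
  have r_st: "r x (Edge K h i) = Edge K h x" "r x (Edge K i l) = Edge K x l" for x
    using N T d by (auto simp: r_def blow_edge_def relabel_edge_def shift_def)
  have list: "(map (r x) (edges G1))[p := e] = es[s := Edge K h x, t := Edge K x l, p := e]" for p x e
  proof -
    have "map (r x) (edges G1) ! m = es[s := Edge K h x, t := Edge K x l] ! m" if "m < length es" for m
      using st that by (cases "m = s"; cases "m = t") (auto simp: len es r_st r_other)
    hence "map (r x) (edges G1) = es[s := Edge K h x, t := Edge K x l]"
      by (intro nth_equalityI) (auto simp: len)
    thus ?thesis by simp
  qed
  have s: "ends_at G1 s = {i, h}" "h \<noteq> i" "src_at G1 s \<noteq> i" and t: "ends_at G1 t = {i, l}" "l \<noteq> i" "src_at G1 t = i"
    using d by (auto simp: es ends_def)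
  have kst: "kind_at G1 s = K" "kind_at G1 t = K" by (simp_all add: es)
  have sle: "s < num_edges G1" and tle: "t < num_edges G1" using st len by auto
  note cs = contract_chordal_blow[OF c ok T(2) sle kst(1) s(1,2) T(1), folded r_def, unfolded list len]
    and ct = contract_chordal_blow[OF c ok T(2) tle kst(2) t(1,2) T(3), folded r_def, unfolded list len]
  have sc: "s < ?c" "t < ?c" using epos_kinds(1)[OF g sle kst(1)] epos_kinds(1)[OF g tle kst(2)] .
  \<comment> \<open>Two flips and one exchange turn the contraction of \<open>s\<close> into
    \<open>G3\<close>. The flips cancel modulo two, so the exponent matches the sign difference of
    the two contractions exactly.\<close>
  have rs: "reorient (contract ?B s) G3 (?d * int (?c - s))"
  proof -
    let ?Y = "LGraph vs (es[s := Edge K h h, t := Edge K h l, s := Edge K i h])"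
    have e: "es[s := Edge K h h, t := Edge K h l, s := Edge K i h] = es[t := Edge K h l, s := Edge K i h]"
      using st(1) by (simp add: list_update_swap)
    have a: "reorient (contract ?B s) (LGraph vs (es[t := Edge K h l, s := Edge K i h])) (?d * int (?c - 1 - s))"
      using cs(2) unfolding e .
    hence b: "reorient (LGraph vs (es[t := Edge K h l, s := Edge K h i])) (LGraph vs (es[t := Edge K h l, s := Edge K i h])) (?d + 1)"
      using st by (intro reorient_flip) (auto simp: reorient_def)
    have sw: "es[t := x, s := y] = es[s := y, t := x]" for x y using st(1) by (simp add: list_update_swap)
    have b2: "reorient (LGraph vs (es[s := Edge K h i, t := Edge K l h])) (LGraph vs (es[s := Edge K h i, t := Edge K h l])) (?d + 1)"
      using st b by (intro reorient_flip) (auto simp: reorient_def sw)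
    hence c': "reorient (LGraph vs (es[s := Edge K l h, t := Edge K h i])) (LGraph vs (es[s := Edge K h i, t := Edge K l h])) ?d"
      using st by (intro reorient_transpose') (auto simp: reorient_def)
    have "reorient (LGraph vs (es[s := Edge K l h, t := Edge K h i])) (contract ?B s) (?d + (?d + 1 + (?d + 1 + ?d * int (?c - 1 - s))))"
      by (rule reorient_trans[OF c' reorient_trans[OF b2 reorient_trans[OF b[unfolded sw] reorient_sym[OF a[unfolded sw]]]]])
    hence "reorient (contract ?B s) G3 (?d + (?d + 1 + (?d + 1 + ?d * int (?c - 1 - s))))"
      unfolding G3_def sw by (rule reorient_sym)
    thus ?thesis by (rule reorient_cong) (use sc in "auto simp: of_nat_diff algebra_simps")
  qed
  \<comment> \<open>Here one flip and one exchange are needed. The surplus \<open>?d + 1\<close> is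
    compensated by the orientation term in the contraction sign, since \<open>t\<close> starts at
    \<open>i\<close> while \<open>s\<close> does not.\<close>
  have rt: "reorient (contract ?B t) G2 (?d * int (?c - t) + ?d + 1)"
  proof -
    have a: "reorient (contract ?B t) (LGraph vs (es[s := Edge K h l, t := Edge K i l])) (?d * int (?c - 1 - t))"
      using ct(2) by simp
    have sw: "es[s := x, t := y] = es[t := y, s := x]" for x y using st(1) by (simp add: list_update_swap)
    have b: "reorient (LGraph vs (es[s := Edge K l h, t := Edge K i l])) (LGraph vs (es[s := Edge K h l, t := Edge K i l])) (?d + 1)"
      using st a unfolding sw by (intro reorient_flip) (auto simp: reorient_def)
    hence c': "reorient (LGraph vs (es[s := Edge K i l, t := Edge K l h])) (LGraph vs (es[s := Edge K l h, t := Edge K i l])) ?d"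
      using st by (intro reorient_transpose') (auto simp: reorient_def)
    have "reorient (contract ?B t) G2 (?d + (?d + 1 + ?d * int (?c - 1 - t)))"
      unfolding G2_def by (rule reorient_sym[OF reorient_trans[OF c' reorient_trans[OF b reorient_sym[OF a]]]])
    thus ?thesis by (rule reorient_cong) (use sc in "auto simp: of_nat_diff algebra_simps")
  qed
  show "good G2" "good G3" using rs rt by (auto simp: reorient_def)
  have set: "contractions False ?B = {?c, s, t}"
  proof -
    have "{m. m < num_edges G1 \<and> kind_at G1 m = K \<and> (\<exists>x. ends_at G1 m = {i, x} \<and> x \<noteq> i \<and> x \<notin> T)} = {s, t}"
      (is "?L = _")
    proof
      have "m = s \<or> m = t" if "m < num_edges G1" "kind_at G1 m = K" "ends_at G1 m = {i, x}" "x \<notin> T" for m x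
        using others[of m x] that es(3)[of m] by (cases "m = s"; cases "m = t") (auto simp: len)
      thus "?L \<subseteq> {s, t}" by blast
      show "{s, t} \<subseteq> ?L" using sle tle kst s(1,2) t(1,2) T by blast
    qed
    thus ?thesis unfolding contractions_chordal_blow[OF c ok T(2)] using sc by (auto simp: shift_id)
  qed
  let ?\<beta> = "csign ?B ?c"
  have "udiff False ?B = single G1 ?\<beta> +
      cvec ?B s + cvec ?B t" using sc st(1) contract_blow[OF g ok] by (simp add: udiff_def set)
  moreover have "cvec ?B s - single G3 ?\<beta> \<in> uspan False"
    using reorient_scale[OF rs, of "csign ?B s"] s by (simp add: cs(1) mult.assoc)
  moreover have "cvec ?B t - single G2 ?\<beta> \<in> uspan False"
    using reorient_scale[OF rt, of "csign ?B t"] t by (simp add: ct(1) mult.assoc add.assoc)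
  ultimately show "udiff False ?B - scale_rat ?\<beta> (bv G1 + bv G2 + bv G3) \<in> uspan False"
    using rv.span_add by (fastforce simp: rv.scale_right_distrib algebra_simps)
qed

section \<open>The chord relations are the coboundaries of internal graphs\<close>

lemma stratum_zero: "G \<in> stratum N 0 \<longleftrightarrow> chordal G \<and> card (ext_vertices G) = N"
  using card_ext_le[of G] by (auto simp: stratum_def chordal_def has_internal_iff)

lemma stratum_Suc: "G \<in> stratum N (Suc m) \<Longrightarrow> G \<in> internal_graphs N"
  by (auto simp: stratum_def internal_graphs_def has_internal_iff)

lemma keys_cvec: "keys (\<Sum>l\<in>A. cvec G l) \<subseteq> contract G ` A"
  using keys_sum_subset[of "cvec G" A] by (fastforce split: if_splits)

lemma keys_udiff: "keys (udiff b G) \<subseteq> contract G ` contractions b G"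
  unfolding udiff_def by (rule keys_cvec)

text \<open>The relations of \<open>HH\<close> over an arbitrary set of generators, so that they can
  be cut down by degree or by the number of external vertices.\<close>

definition hrels :: "lgraph set \<Rightarrow> (lgraph \<Rightarrow>\<^sub>0 rat) set"
  where "hrels S = orient_rel S \<union> double_loop_relations S \<union> arnold_relations S"

definition coboundary :: "nat \<Rightarrow> (lgraph \<Rightarrow>\<^sub>0 rat) \<Rightarrow> bool"
  where "coboundary N x \<longleftrightarrow> (\<exists>y. keys y \<subseteq> internal_graphs N \<and>
    x - lin (udiff False) y \<in> uspan False)"

lemma coboundary_rels: "x \<in> uspan False \<Longrightarrow> coboundary N x"
  unfolding coboundary_def by (intro exI[of _ 0]) simp

lemma coboundary_add: "coboundary N x \<Longrightarrow> coboundary N y \<Longrightarrow> coboundary N (x + y)"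
  unfolding coboundary_def
proof (elim exE conjE)
  fix u v assume a: "keys u \<subseteq> internal_graphs N" "keys v \<subseteq> internal_graphs N"
    "x - lin (udiff False) u \<in> uspan False" "y - lin (udiff False) v \<in> uspan False"
  show "\<exists>w. keys w \<subseteq> internal_graphs N \<and> x + y - lin (udiff False) w \<in> uspan False"
    using rv.span_add[OF a(3,4)] a(1,2) keys_add[of u v]
    by (intro exI[of _ "u + v"]) (auto simp: lin_add algebra_simps)
qed

lemma coboundary_scale: "coboundary N x \<Longrightarrow> coboundary N (scale_rat c x)"
  unfolding coboundary_def
proof (elim exE conjE)
  fix u assume a: "keys u \<subseteq> internal_graphs N" "x - lin (udiff False) u \<in> uspan False"
  show "\<exists>w. keys w \<subseteq> internal_graphs N \<and> scale_rat c x - lin (udiff False) w \<in> uspan False"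
    using rv.span_scale[OF a(2), of c] a(1) keys_scale_subset[of c u]
    by (intro exI[of _ "scale_rat c u"]) (auto simp: lin_scale rv.scale_right_diff_distrib)
qed

lemma coboundary_lin:
  assumes "\<And>g. g \<in> keys x \<Longrightarrow> coboundary N (F g)"
  shows "coboundary N (lin F x)"
proof -
  have "coboundary N (\<Sum>g\<in>A. scale_rat (lookup x g) (F g))"
    if "finite A" "A \<subseteq> keys x" for A using that
  proof (induction A)
    case empty
    thus ?case by (simp add: coboundary_rels rv.span_zero)
  next
    case (insert a A)
    thus ?case by (simp add: coboundary_add coboundary_scale assms)
  qed
  thus ?thesis by (simp add: linear_extension_def)
qed

lemma coboundary_span:
  assumes "x \<in> rv.span R" "\<And>r. r \<in> R \<Longrightarrow> coboundary N r"
  shows "coboundary N x" using assms(1) by (induction rule: rv.span_induct_alt)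
    (auto simp: coboundary_rels rv.span_zero coboundary_add coboundary_scale assms(2))

section \<open>Loops, double edges and Arnold sums are coboundaries\<close>

lemma coboundary_udiff:
  "B \<in> internal_graphs N \<Longrightarrow> coboundary N (udiff False B)"
  unfolding coboundary_def by (intro exI[of _ "bv B"]) (simp add: rv.span_zero)

lemma coboundary_cong:
  "coboundary N x \<Longrightarrow> y - x \<in> uspan False \<Longrightarrow> coboundary N y"
  using coboundary_add[OF _ coboundary_rels, of N x "y - x"] by simp

text \<open>The graph \<open>x\<close> enters with a sign as coefficient, hence invertibly; if the
  boundary of the blow-up differs from that term by a coboundary, \<open>x\<close> is a coboundary
  too.\<close>

lemma coboundary_blow:
  assumes "G \<in> stratum N 0" "blow_ok K a T G"
    and "coboundary N (udiff False (blow K a T G) - single x (csign (blow K a T G) (epos K G)))"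
  shows "coboundary N (bv x)"
proof -
  let ?\<beta> = "csign (blow K a T G) (epos K G)"
  have "coboundary N (udiff False (blow K a T G))"
    by (rule coboundary_udiff[OF stratum_Suc[OF stratum_blow[OF assms(1,2)]]])
  from coboundary_add[OF this coboundary_scale[OF assms(3), of "-1"]]
  have "coboundary N (single x ?\<beta>)" by (simp add: rv.scale_right_diff_distrib single_uminus)
  moreover have "?\<beta> * ?\<beta> = 1"
    by (simp add: contraction_sign_blow[OF good_stratum[OF assms(1)] assms(2)])
  ultimately show ?thesis using coboundary_scale[of N _ ?\<beta>] by (metis scale_single)
qed

lemma coboundary_loop:
  assumes G: "G \<in> stratum N 0" and l: "l < num_edges G" "is_loop G l"
  shows "coboundary N (bv G)"
proof -
  define a where "a = src_at G l"
  define K where "K = kind_at G l"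
  \<comment> \<open>With this \<open>T\<close> exactly the loops of kind \<open>K\<close> at
    \<open>a\<close> are moved, with both half-edges. The new edge is then the only contractible
    one, so the boundary of the blow-up is \<open>G\<close> up to sign.\<close>
  define T where "T = {..<num_vertices G} - {a}"
  have c: "chordal G" using G by (simp add: stratum_zero)
  have g: "good G" by (rule good_stratum[OF G])
  have e: "edges G ! l = Edge K a a" using l(2) by (cases "edges G ! l") (auto simp: is_loop_def a_def K_def)
  have a: "a < num_vertices G" using g l(1) by (auto simp: good_iff well_labeled_def a_def)
  have ok: "blow_ok K a T G"
    using a chordal_kinds[OF c a] l(1) by (simp add: blow_ok_def half_count_del_at[of l] e half_weight_def T_def)
  have x: "x < num_vertices G" if "m < num_edges G" "ends_at G m = {a, x}" for m x
    using ends_bounded[OF good_typed[OF g] that(1), of x] that(2) by simp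
  have "contractions False (blow K a T G) = {epos K G}"
    using contractions_chordal_blow[OF c ok] x by (auto simp: T_def)
  hence "udiff False (blow K a T G) = single G (csign (blow K a T G) (epos K G))"
    by (simp add: udiff_def contract_blow[OF g ok])
  thus ?thesis by (intro coboundary_blow[OF G ok]) (simp add: coboundary_rels rv.span_zero)
qed

lemma double_loop_cases:
  assumes "has_double_or_loop G"
  obtains l where "l < num_edges G" "is_loop G l"
  | l m a x where "l < num_edges G" "m < num_edges G" "l \<noteq> m" "kind_at G m = kind_at G l"
      "ends_at G l = {a, x}" "ends_at G m = {a, x}" "a \<noteq> x"
proof -
  obtain l where l: "l < num_edges G" "is_loop G l \<or> in_double_edge G l"
    using assms by (auto simp: has_double_or_loop_def)
  show thesis
  proof (cases "is_loop G l")
    case False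
    then obtain m where "m < num_edges G" "m \<noteq> l" "kind_at G m = kind_at G l"
      "ends_at G m = ends_at G l" using l(2) by (auto simp: in_double_edge_def)
    moreover have "ends_at G l = {src_at G l, tgt_at G l}" "src_at G l \<noteq> tgt_at G l"
      using False by (auto simp: ends_def is_loop_def)
    ultimately show thesis using that(2)[of l m] l(1) by metis
  qed (use that l in blast)
qed

lemma coboundary_double_loop:
  assumes G: "G \<in> stratum N 0" and dl: "has_double_or_loop G"
  shows "coboundary N (bv G)" using dl
proof (cases rule: double_loop_cases)
  case (1 l)
  thus ?thesis by (rule coboundary_loop[OF G])
next
  case (2 l m a x)
  define K where "K = kind_at G l"
  \<comment> \<open>Only loops at \<open>a\<close> and edges between \<open>a\<close> and
    \<open>x\<close> are moved. Contracting one of the parallel edges turns another into a loop, so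
    all terms except that of the new edge are covered by \<open>coboundary_loop\<close>.\<close>
  define T where "T = {..<num_vertices G} - {a, x}"
  let ?B = "blow K a T G" and ?c = "epos K G" and ?N = "num_vertices G"
  have c: "chordal G" using G by (simp add: stratum_zero)
  have g: "good G" by (rule good_stratum[OF G])
  have ax: "a < ?N" "x < ?N" using ends_bounded[OF good_typed[OF g] 2(1)] 2(5) by auto
  have "out_count K T a (edges G) \<ge> 2"
    by (rule half_count_two_edges[where l=l and m=m and w=x and u=x]) (use 2 in "auto simp: K_def T_def")
  hence ok: "blow_ok K a T G" using ax chordal_kinds[OF c] by (simp add: blow_ok_def)
  have aT: "a \<notin> T" by (simp add: T_def)
  have gB: "good ?B" by (rule good_blow[OF g ok])
  have eB: "ends (edges ?B ! shift ?c p) = {?N, x}"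
    if "p < num_edges G" "kind_at G p = K" "ends_at G p = {a, x}" for p
    unfolding nth_edges_blow(2)[OF that(1)] chordal_vpos[OF c]
    using that(2,3) ax 2(7) by (auto simp: blow_edge_def ends_def doubleton_eq_iff T_def shift_def)
  have "coboundary N (udiff False ?B - single G (csign ?B ?c))"
  proof -
    let ?x = "\<Sum>p\<in>contractions False ?B - {?c}. cvec ?B p"
    have "?c \<in> contractions False ?B" by (simp add: contractions_def contractible_blow[OF g ok])
    hence eq: "udiff False ?B - single G (csign ?B ?c) = ?x"
      unfolding udiff_def by (simp add: sum.remove[of _ ?c] contract_blow[OF g ok])
    have "coboundary N (bv H)" if H: "H \<in> keys ?x" for H
    proof -
      obtain p where p: "p \<in> contractions False ?B" "p \<noteq> ?c" "H = contract ?B p"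
        using H keys_cvec[of ?B "contractions False ?B - {?c}"] by blast
      have con: "contractible False ?B p" using p(1) by (simp add: contractions_def)
      obtain q z where q: "p = shift ?c q" "q < num_edges G" "kind_at G q = K" "ends_at G q = {a, z}" "z \<noteq> a" "z \<notin> T"
        using p(1,2) contractions_chordal_blow[OF c ok aT] by blast
      have "z < ?N" using ends_bounded[OF good_typed[OF g] q(2)] q(4) by simp
      hence z: "z = x" using q(5,6) by (simp add: T_def)
      obtain r where r: "r \<noteq> q" "r < num_edges G" "kind_at G r = K" "ends_at G r = {a, x}"
        using 2 K_def by metis
      have rp: "shift ?c r \<noteq> p" "shift ?c r < num_edges ?B"
        using q(1) r(1) shift_less[OF r(2)] by simp_all
      have e: "ends_at ?B p = {?N, x}" "ends (edges ?B ! shift ?c r) = {?N, x}"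
        unfolding q(1) using eB q r z by simp_all
      have "cmap ?B p ?N = cmap ?B p x"
        using cmap_ends[OF con] e(1) by (auto simp: ends_def doubleton_eq_iff)
      hence "is_loop H (after_del p (shift ?c r))" using nth_edges_after_del(1)[OF con rp(2,1)] e(2) p(3)
        by (auto simp: is_loop_def ends_def doubleton_eq_iff)
      moreover have "after_del p (shift ?c r) < num_edges H"
        using nth_edges_after_del(2)[OF con rp(2,1)] p(3) by simp
      moreover have "H \<in> stratum N 0"
        using stratum_contract(1)[OF stratum_blow[OF G ok] con] p(3) by simp
      ultimately show ?thesis by (intro coboundary_loop)
    qed
    hence "coboundary N (lin bv ?x)" by (rule coboundary_lin)
    thus ?thesis unfolding eq by simp
  qed
  thus ?thesis by (rule coboundary_blow[OF G ok])
qed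

lemma coboundary_arnold:
  fixes vs es s t K h i l
  defines "G1 \<equiv> LGraph vs (es[s := Edge K h i, t := Edge K i l])"
    and "G2 \<equiv> LGraph vs (es[s := Edge K i l, t := Edge K l h])"
    and "G3 \<equiv> LGraph vs (es[t := Edge K h i, s := Edge K l h])"
  assumes G: "G1 \<in> stratum N 0" and d: "distinct [h, i, l]" and st: "s \<noteq> t" "s < length es" "t < length es"
    and dl: "\<not> has_double_or_loop G1"
  shows "coboundary N (bv G1 + bv G2 + bv G3)"
proof -
  \<comment> \<open>In the absence of loops and double edges, \<open>s\<close> and \<open>t\<close>
    are the only edges of kind \<open>K\<close> at \<open>i\<close> whose other end lies outside
    \<open>T\<close>.\<close>
  define T where "T = {..<num_vertices G1} - {h, i, l}"
  have c: "chordal G1" using G by (simp add: stratum_zero)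
  have g: "good G1" by (rule good_stratum[OF G])
  have T: "h \<notin> T" "i \<notin> T" "l \<notin> T" by (simp_all add: T_def)
  have e: "edges G1 ! s = Edge K h i" "edges G1 ! t = Edge K i l" "num_edges G1 = length es"
    "m \<noteq> s \<Longrightarrow> m \<noteq> t \<Longrightarrow> edges G1 ! m = es ! m" for m
    using st by (auto simp: G1_def nth_list_update)
  have others: "x \<in> T" if m: "m < length es" "m \<noteq> s" "m \<noteq> t" "ekind (es ! m) = K" "ends (es ! m) = {i, x}" for m x
  proof -
    have em: "ends_at G1 m = {i, x}" "kind_at G1 m = K" using m by (simp_all add: e)
    have "x < num_vertices G1" using ends_bounded[OF good_typed[OF g], of m x] em m(1) by (simp add: e)
    moreover have "x \<noteq> i"
      using em dl m(1) by (auto simp: e(3) has_double_or_loop_def is_loop_def ends_def)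
    moreover have "x \<noteq> h" using double_loopI[of m G1 s] em dl m st by (auto simp: e ends_def)
    moreover have "x \<noteq> l" using double_loopI[of m G1 t] em dl m st by (auto simp: e ends_def)
    ultimately show ?thesis by (simp add: T_def)
  qed
  note ar = udiff_arnold[OF c[unfolded G1_def] d st T others, folded G1_def G2_def G3_def]
  let ?B = "blow K i T G1"
  let ?\<beta> = "csign ?B (epos K G1)"
  have "coboundary N (udiff False ?B)"
    by (rule coboundary_udiff[OF stratum_Suc[OF stratum_blow[OF G ar(1)]]])
  hence "coboundary N (scale_rat ?\<beta> (bv G1 + bv G2 + bv G3))"
    by (rule coboundary_cong) (use rv.span_neg[OF ar(4)] in simp)
  from coboundary_scale[OF this, of ?\<beta>] show ?thesis by (simp add: contraction_sign_blow[OF g ar(1)])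
qed

text \<open>\<open>coboundary_arnold\<close> needs its first graph to be free of loops and double
  edges. The Arnold sum is invariant under cyclic rotation of \<open>h\<close>, \<open>i\<close>,
  \<open>l\<close>, so any of the three graphs may come first; if none qualifies, each term is a
  coboundary by itself.\<close>

lemma coboundary_hrels:
  assumes "r \<in> hrels (stratum N 0)"
  shows "coboundary N r"
proof -
  consider "r \<in> orient_rel (stratum N 0)" | "r \<in> double_loop_relations (stratum N 0)"
    | "r \<in> arnold_relations (stratum N 0)" using assms by (auto simp: hrels_def)
  thus ?thesis
  proof cases
    case 1
    hence "r \<in> urels False"  unfolding urels_def orientation_relations_def using good_stratum by blast
    thus ?thesis by (intro coboundary_rels rv.span_base)
  next
    case 2
    thus ?thesis by (auto simp: double_loop_relations_def coboundary_double_loop)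
  next
    case 3
    then obtain vs es a b K h i l where d: "distinct [h, i, l]" "a \<noteq> b" "a < length es" "b < length es"
      and r: "r = bv (LGraph vs (es[a := Edge K h i, b := Edge K i l])) +
        bv (LGraph vs (es[a := Edge K i l, b := Edge K l h])) +
        bv (LGraph vs (es[b := Edge K h i, a := Edge K l h]))"
      and S: "LGraph vs (es[a := Edge K h i, b := Edge K i l]) \<in> stratum N 0"
        "LGraph vs (es[a := Edge K i l, b := Edge K l h]) \<in> stratum N 0"
        "LGraph vs (es[b := Edge K h i, a := Edge K l h]) \<in> stratum N 0"
      unfolding arnold_relations_def by blast
    have sw: "es[b := x, a := y] = es[a := y, b := x]" for x y using d(2) by (simp add: list_update_swap)
    note S' = S[unfolded sw]
    show ?thesis
    proof (cases "has_double_or_loop (LGraph vs (es[a := Edge K h i, b := Edge K i l]))")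
      case False
      thus ?thesis unfolding r by (intro coboundary_arnold[OF S(1) d])
    next
      case dl1: True
      show ?thesis
      proof (cases "has_double_or_loop (LGraph vs (es[a := Edge K i l, b := Edge K l h]))")
        case False
        have "coboundary N (bv (LGraph vs (es[a := Edge K i l, b := Edge K l h])) +
          bv (LGraph vs (es[a := Edge K l h, b := Edge K h i])) + bv (LGraph vs (es[b := Edge K i l, a := Edge K h i])))"
          by (rule coboundary_arnold[OF S(2) _ d(2-4) False]) (use d(1) in auto)
        thus ?thesis unfolding r sw by (simp add: add_ac)
      next
        case dl2: True
        show ?thesis
        proof (cases "has_double_or_loop (LGraph vs (es[a := Edge K l h, b := Edge K h i]))")
          case False
          have "coboundary N (bv (LGraph vs (es[a := Edge K l h, b := Edge K h i])) +
            bv (LGraph vs (es[a := Edge K h i, b := Edge K i l])) + bv (LGraph vs (es[b := Edge K l h, a := Edge K i l])))"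
            by (rule coboundary_arnold[OF S'(3) _ d(2-4) False]) (use d(1) in auto)
          thus ?thesis unfolding r sw by (simp add: add_ac)
        next
          case True
          thus ?thesis unfolding r sw by (intro coboundary_add coboundary_double_loop dl1 dl2 S')
        qed
      qed
    qed
  qed
qed

section \<open>Boundaries of graphs with one internal vertex\<close>

lemma stratum_one:
  assumes "G \<in> stratum N (Suc 0)"
  obtains y where "y < num_vertices G" "vkind G y \<noteq> ExtBlack" "\<forall>v<num_vertices G. v \<noteq> y \<longrightarrow> vkind G v = ExtBlack"
proof -
  have "card ({..<num_vertices G} - ext_vertices G) = 1"
    using assms by (subst card_Diff_subset) (auto simp: stratum_def)
  then obtain y where "{..<num_vertices G} - ext_vertices G = {y}" by (rule card_1_singletonE)
  thus thesis using that[of y] by blast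
qed

text \<open>Without loops an edge has at most one half-edge at \<open>v\<close>.\<close>

lemma valence_card:
  assumes "\<not> has_double_or_loop G"
  shows "valence K v (edges G) = card {l. l < num_edges G \<and> kind_at G l = K \<and> v \<in> ends_at G l}"
proof -
  let ?A = "{l. l < num_edges G \<and> kind_at G l = K \<and> src_at G l = v}"
    and ?B = "{l. l < num_edges G \<and> kind_at G l = K \<and> tgt_at G l = v}"
  have "?A \<inter> ?B = {}" using assms by (auto simp: has_double_or_loop_def is_loop_def)
  hence "card ?A + card ?B = card (?A \<union> ?B)" by (simp add: card_Un_disjoint)
  also have "?A \<union> ?B = {l. l < num_edges G \<and> kind_at G l = K \<and> v \<in> ends_at G l}"
    by (auto simp: ends_def)
  finally show ?thesis by (simp add: half_edges_def flip: half_edges_eq)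
qed

definition chord_span :: "nat \<Rightarrow> (lgraph \<Rightarrow>\<^sub>0 rat) set"
  where "chord_span N = rv.span (urels False \<union> hrels (stratum N 0))"

lemma chord_span_urels: "x \<in> uspan False \<Longrightarrow> x \<in> chord_span N"
  unfolding chord_span_def by (rule rv.span_mono[THEN subsetD]) auto

lemma chord_span_add: "x \<in> chord_span N \<Longrightarrow> y \<in> chord_span N \<Longrightarrow> x + y \<in> chord_span N"
  unfolding chord_span_def by (rule rv.span_add)

lemma chord_span_scale: "x \<in> chord_span N \<Longrightarrow> scale_rat c x \<in> chord_span N"
  unfolding chord_span_def by (rule rv.span_scale)

lemma chord_span_cong:
  assumes "x - scale_rat c y \<in> uspan False" "y \<in> chord_span N"
  shows "x \<in> chord_span N"
  using chord_span_add[OF chord_span_urels[OF assms(1)] chord_span_scale[OF assms(2), of c]] by simp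

lemma chord_span_udiff:
  assumes "\<And>l. contractible False G l \<Longrightarrow> has_double_or_loop (contract G l)" "G \<in> stratum N (Suc 0)"
  shows "udiff False G \<in> chord_span N" unfolding udiff_def chord_span_def
proof (rule rv.span_sum)
  fix l assume "l \<in> contractions False G"
  hence "contractible False G l" by (simp add: contractions_def)
  hence "bv (contract G l) \<in> hrels (stratum N 0)"
    using stratum_contract(1)[OF assms(2)] assms(1) by (auto simp: hrels_def double_loop_relations_def)
  hence "scale_rat (csign G l) (bv (contract G l)) \<in> rv.span (urels False \<union> hrels (stratum N 0))"
    by (intro rv.span_scale rv.span_base) simp
  thus "cvec G l \<in> rv.span (urels False \<union> hrels (stratum N 0))" by simp
qed

text \<open>The blow-up has two internal vertices, both of smaller valence than \<open>y\<close>; that the square of the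
  differential vanishes on it expresses the boundary of \<open>G\<close> by boundaries known by induction.\<close>

lemma star_split:
  assumes G: "G \<in> stratum N (Suc 0)" and y: "y < num_vertices G" "vkind G y = int_kind K"
    "\<And>v. v < num_vertices G \<Longrightarrow> v \<noteq> y \<Longrightarrow> vkind G v = ExtBlack"
    and dl: "\<not> has_double_or_loop G"
    and T: "out_count K T y (edges G) \<ge> 2" "in_count K T y (edges G) \<ge> 2"
    and IH: "\<And>H v. \<lbrakk>H \<in> stratum N (Suc 0); v < num_vertices H; vkind H v = int_kind K;
      valence K v (edges H) < valence K y (edges G)\<rbrakk> \<Longrightarrow> udiff False H \<in> chord_span N"
  shows "udiff False G \<in> chord_span N"
proof -
  let ?B = "blow K y T G" and ?c = "epos K G" and ?b = "vpos K G"
  let ?\<beta> = "csign ?B ?c"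
  let ?x = "\<Sum>p\<in>contractions False ?B - {?c}. cvec ?B p"
  have g: "good G" by (rule good_stratum[OF G])
  have ok: "blow_ok K y T G" using y T by (simp add: blow_ok_def)
  have gB: "good ?B" by (rule good_blow[OF g ok])
  have yb: "y < ?b" by (rule blow_ok_less[OF g ok])
  have B: "?B \<in> stratum N (Suc (Suc 0))" by (rule stratum_blow[OF G ok])
  have val: "valence K y (edges ?B) < valence K y (edges G)" "valence K ?b (edges ?B) < valence K y (edges G)"
    using T half_count_add_not[of K y "edges G" "\<lambda>x. x \<in> T"] by (simp_all add: valence_blow[OF yb])
  have kind: "vkind ?B y = int_kind K" "vkind ?B ?b = int_kind K"
    using nth_vkinds_blow(2)[OF y(1), of K y T] y(2) shift_id[OF yb] by (simp_all add: nth_vkinds_blow(1))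
  have int: "v = y \<or> v = ?b" if "v < num_vertices ?B" "vkind ?B v \<noteq> ExtBlack" for v
    using that(1)[unfolded num_vertices_blow] vpos_le[of K G]
  proof (cases rule: shift_cases)
    case (2 w)
    thus ?thesis using that(2) y(3)[OF 2(1)] shift_id[OF yb] by (cases "w = y") (auto simp: nth_vkinds_blow(2))
  qed simp
  have x: "lin (udiff False) ?x \<in> chord_span N" unfolding lin_sum chord_span_def
  proof (rule rv.span_sum)
    fix p assume p: "p \<in> contractions False ?B - {?c}"
    hence con: "contractible False ?B p" by (simp add: contractions_def)
    \<comment> \<open>A further edge between the two internal vertices would come from a loop at
      \<open>y\<close>. Hence every other contraction leaves one of the two, called
      \<open>w\<close>, untouched, and its valence is smaller than that of \<open>y\<close> in
      \<open>G\<close>.\<close>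
    have not_both: "\<not> (y \<in> ends_at ?B p \<and> ?b \<in> ends_at ?B p)"
    proof
      assume e: "y \<in> ends_at ?B p \<and> ?b \<in> ends_at ?B p"
      have "p < Suc (num_edges G)" using contractible_less[OF con] by simp
      from this epos_le[of K G] show False
      proof (cases rule: shift_cases)
        case (2 m)
        have s: "y = shift ?b v \<longleftrightarrow> v = y" for v using shift_id[OF yb] by (metis shift_less_iff(2))
        have "is_loop G m" using e y(1) yb unfolding 2(2) nth_edges_blow(2)[OF 2(1)]
          by (auto simp: is_loop_def blow_edge_def ends_def s split: if_splits)
        thus False using dl 2(1) by (auto simp: has_double_or_loop_def)
      qed (use p in simp)
    qed
    obtain w where w: "w \<in> {y, ?b}" "w \<notin> ends_at ?B p" using not_both by blast
    have wB: "w < num_vertices ?B" using w(1) y(1) yb vpos_le[of K G] by auto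
    have "udiff False (contract ?B p) \<in> chord_span N"
    proof (rule IH)
      show "contract ?B p \<in> stratum N (Suc 0)" using stratum_contract(1)[OF B con] by simp
      show "cmap ?B p w < num_vertices (contract ?B p)" by (rule cmap_less[OF gB con wB])
      show "vkinds (contract ?B p) ! cmap ?B p w = int_kind K"
        using vkinds_contract_cmap[OF con good_typed[OF gB] wB] w kind by auto
      have "valence K (cmap ?B p w) (edges (contract ?B p)) = valence K w (del_at p (edges ?B))"
        by (rule half_count_contract(1)[OF con w(2)])
      also have "\<dots> \<le> valence K w (edges ?B)"
        using contractible_less[OF con] by (simp add: half_count_del_at[of p])
      also have "\<dots> < valence K y (edges G)" using w(1) val by auto
      finally show "valence K (cmap ?B p w) (edges (contract ?B p)) < valence K y (edges G)" .
    qed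
    thus "lin (udiff False) (cvec ?B p) \<in>
        rv.span (urels False \<union> hrels (stratum N 0))"
      unfolding lin_single chord_span_def by (rule rv.span_scale)
  qed
  have "?c \<in> contractions False ?B" by (simp add: contractions_def contractible_blow[OF g ok])
  hence "udiff False ?B = single G ?\<beta> + ?x"
    unfolding udiff_def by (simp add: sum.remove[of _ ?c] contract_blow[OF g ok])
  moreover have "lin (udiff False) (udiff False ?B) = 0" using udiff_udiff[of "bv ?B" False] gB by simp
  ultimately have "scale_rat ?\<beta> (udiff False G) + lin (udiff False) ?x = 0" by (simp add: lin_add)
  hence "scale_rat ?\<beta> (udiff False G) = scale_rat (-1) (lin (udiff False) ?x)"
    by (simp add: add_eq_0_iff2)
  hence "scale_rat ?\<beta> (udiff False G) \<in> chord_span N"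
    using chord_span_scale[OF x, of "-1"] by simp
  from chord_span_scale[OF this, of ?\<beta>] show ?thesis by (simp add: contraction_sign_blow[OF g ok])
qed

lemma reorient_udiff:
  assumes "reorient X Y e"
  shows "udiff b X - scale_rat (sgn_pow e) (udiff b Y) \<in> uspan False"
  using udiff_rels[of _ False b] assms by (force simp: reorient_def lin_diff)

lemma reorient_blow_flip:
  assumes "good G" "blow_ok K a T G" "s < num_edges G" "kind_at G s = K'" "ends_at G s = {u, v}"
  defines "H \<equiv> LGraph (vkinds G) ((edges G)[s := Edge K' u v])"
  shows "(\<exists>e. reorient H G e) \<and> (\<exists>e. reorient (blow K a T H) (blow K a T G) e) \<and> blow_ok K a T H"
proof -
  have gB: "good (blow K a T G)" by (rule good_blow[OF assms(1,2)])
  consider "H = G" | "H = reverse_edge s G" using assms(3-5) unfolding H_def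
    by (cases "edges G ! s"; cases G) (auto simp: ends_def doubleton_eq_iff reverse_edge_def list_update_same_conv)
  thus ?thesis
  proof cases
    case 1
    thus ?thesis using reorient_refl[OF gB, of 0] reorient_refl[OF assms(1), of 0] assms(2) by auto
  next
    case 2
    note st = rstep.reverse[OF assms(3)]
    have g: "good (reverse_edge s G)" by (rule good_reverse_edge[OF assms(1,3)])
    have ok: "blow_ok K a T (reverse_edge s G)" using blow_ok_rstep[OF st, of K a T] assms(2) by simp
    obtain vp ep where "rstep (blow K a T G) (blow K a T (reverse_edge s G)) vp ep (sgn_pow (edeg G s + 1))"
      using blow_rstep[OF assms(1) g st assms(2)] by auto
    from reorient_rstep[OF gB good_blow[OF g ok] this] show ?thesis
      unfolding 2 using reorient_reverse[OF assms(1,3)] ok by blast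
  qed
qed

lemma arnold_relationsI:
  assumes "distinct [h, i, l]" "a \<noteq> b" "a < length es" "b < length es"
    "LGraph vs (es[a := Edge K h i, b := Edge K i l]) \<in> S" "LGraph vs (es[a := Edge K i l, b := Edge K l h]) \<in> S"
    "LGraph vs (es[b := Edge K h i, a := Edge K l h]) \<in> S"
  shows "bv (LGraph vs (es[a := Edge K h i, b := Edge K i l])) + bv (LGraph vs (es[a := Edge K i l, b := Edge K l h])) +
    bv (LGraph vs (es[b := Edge K h i, a := Edge K l h])) \<in> arnold_relations S"
  unfolding arnold_relations_def by (rule CollectI, (rule exI)+, intro conjI, rule refl, (rule assms refl)+)

text \<open>\<open>udiff_arnold\<close> with the orientations of the two edges left open: flipping
  \<open>s\<close> or \<open>t\<close> changes both the graph and its blow-up only by a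
  sign.\<close>

lemma arnold_ends:
  assumes G: "G \<in> stratum N 0" and st: "s \<noteq> t" "s < num_edges G" "t < num_edges G"
    and k: "kind_at G s = K" "kind_at G t = K" "ends_at G s = {h, i}" "ends_at G t = {i, l}"
    and d: "distinct [h, i, l]" and T: "h \<notin> T" "i \<notin> T" "l \<notin> T"
    and others: "\<And>m x. \<lbrakk>m < num_edges G; m \<noteq> s; m \<noteq> t; kind_at G m = K; ends_at G m = {i, x}\<rbrakk> \<Longrightarrow> x \<in> T"
  shows "udiff False (blow K i T G) \<in> chord_span N"
proof -
  let ?G' = "LGraph (vkinds G) ((edges G)[s := Edge K h i])"
  let ?H = "LGraph (vkinds G) ((edges G)[s := Edge K h i, t := Edge K i l])"
  have g: "good G" by (rule good_stratum[OF G])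
  have c: "chordal G" using G by (simp add: stratum_zero)
  have "out_count K T i (edges G) \<ge> 2"
    by (rule half_count_two_edges[OF st(2,3,1) k(1,2) _ k(4), of h]) (use k T in auto)
  moreover have i: "i < num_vertices G" using ends_bounded[OF good_typed[OF g] st(2), of i] k(3) by simp
  ultimately have ok: "blow_ok K i T G" using chordal_kinds[OF c i] by (simp add: blow_ok_def)
  note f = reorient_blow_flip[OF g ok st(2) k(1,3)]
  obtain e1 e1' where e1: "reorient ?G' G e1" "reorient (blow K i T ?G') (blow K i T G) e1'"
    using f by blast
  have g': "good ?G'" using e1(1) by (simp add: reorient_def)
  have t: "t < num_edges ?G'" "ekind (edges ?G' ! t) = K" "ends (edges ?G' ! t) = {i, l}" using st k by simp_all
  note f' = reorient_blow_flip[OF g' _ t, simplified, where T=T]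
  obtain e2 e2' where e2: "reorient ?H ?G' e2" "reorient (blow K i T ?H) (blow K i T ?G') e2'"
    using f'[where K=K and a=i] f by blast
  have e: "reorient (blow K i T G) (blow K i T ?H) (e2' + e1')"
    by (rule reorient_sym[OF reorient_trans[OF e2(2) e1(2)]])
  have gH: "good ?H" using e2(1) by (simp add: reorient_def)
  have S: "LGraph (vkinds G) es \<in> stratum N 0" if "good (LGraph (vkinds G) es)" for es
    using that G unfolding stratum_def mem_Collect_eq lgraph.sel by blast
  have cH: "chordal ?H" using S[OF gH] by (simp add: stratum_zero)
  note ar = udiff_arnold[OF cH d st T others]
  let ?\<beta> = "csign (blow K i T ?H) (epos K ?H)"
  let ?r = "bv ?H + bv (LGraph (vkinds G) ((edges G)[s := Edge K i l, t := Edge K l h])) +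
    bv (LGraph (vkinds G) ((edges G)[t := Edge K h i, s := Edge K l h]))"
  have "?r \<in> arnold_relations (stratum N 0)"
    by (rule arnold_relationsI[OF d st S[OF gH] S[OF ar(2)] S[OF ar(3)]])
  hence "?r \<in> chord_span N" unfolding chord_span_def by (intro rv.span_base) (simp add: hrels_def)
  from chord_span_cong[OF ar(4) this]
  have "udiff False (blow K i T ?H) \<in> chord_span N" .
  thus ?thesis by (rule chord_span_cong[OF reorient_udiff[OF e]])
qed

text \<open>\<open>cterm_leaf\<close> with the marks forgotten. Finiteness of \<open>T\<close>
  serves to list it as marks.\<close>

lemma bv_leaf:
  assumes "good G" "leaf_edge K G l a w T" "finite T"
  shows "\<exists>c. bv G - single (blow K (cmap G l a) (cmap G l ` T) (contract G l)) c \<in> uspan False"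
proof -
  obtain ts where ts: "set ts = T" using finite_list[OF assms(3)] by blast
  let ?Y = "(contract G l, map (cmap G l) (ts @ [a]))"
  have "lin (hop K) (cterm (G, ts @ [a]) l) - bv (G, ts @ [a]) \<in> dspan False"
    using cterm_leaf[OF assms(1,2) ts] by (simp add: dec_rels_def)
  from rv.span_neg[OF forget_rels[OF this]]
  have "bv G - lin forget (lin (hop K) (cterm (G, ts @ [a]) l)) \<in> uspan False"
    by (simp add: lin_diff forget_def)
  moreover have "\<exists>c. lin forget (lin (hop K) (cterm (G, ts @ [a]) l)) =
      single (blow K (cmap G l a) (cmap G l ` T) (contract G l)) c"
    using leaf_edge_hop_ok[OF assms(1,2) ts] ts
    by (auto simp: cterm_def hop_def blow_marked_def forget_def butlast_append)
  ultimately show ?thesis by auto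
qed

text \<open>If the contraction of some edge at \<open>y\<close> has no double edge, then \<open>G\<close> is a blow-up of it.\<close>

lemma star_three:
  assumes G: "G \<in> stratum N (Suc 0)" and y: "y < num_vertices G" "vkind G y = int_kind K"
    "\<And>v. v < num_vertices G \<Longrightarrow> v \<noteq> y \<Longrightarrow> vkind G v = ExtBlack"
    and dl: "\<not> has_double_or_loop G" and v3: "valence K y (edges G) = 3"
  shows "udiff False G \<in> chord_span N"
proof (cases "\<forall>l. contractible False G l \<longrightarrow> has_double_or_loop (contract G l)")
  case True
  thus ?thesis using G by (intro chord_span_udiff) auto
next
  case False
  then obtain l where con: "contractible False G l" and dlc: "\<not> has_double_or_loop (contract G l)" by blast
  let ?A = "{m. m < num_edges G \<and> kind_at G m = K \<and> y \<in> ends_at G m}"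
  let ?C = "contract G l" and ?f = "cmap G l"
  have g: "good G" by (rule good_stratum[OF G])
  have t: "typed G" by (rule good_typed[OF g])
  have lA: "l \<in> ?A"
  proof -
    obtain v where v: "v \<in> ends_at G l" "vkind G v \<noteq> ExtBlack"
      using contractible_False_internal[OF con] by blast
    have "v < num_vertices G" by (rule ends_bounded[OF t contractible_less[OF con] v(1)])
    hence "v = y" using y(3) v(2) by blast
    thus ?thesis
      using edge_kind_internal[OF g contractible_less[OF con] v] v(1) contractible_less[OF con] y(2)
      by (cases K; cases "kind_at G l") auto
  qed
  have "card ?A = 3" using v3 valence_card[OF dl, of K y] by simp
  hence "card (?A - {l}) = 2" using lA by simp
  then obtain l2 l3 where l23: "?A - {l} = {l2, l3}" "l2 \<noteq> l3" by (auto simp: card_2_iff)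
  have m: "l2 < num_edges G" "l3 < num_edges G" "kind_at G l2 = K" "kind_at G l3 = K"
    "l2 \<noteq> l" "l3 \<noteq> l" using l23(1) by auto
  have l: "l < num_edges G" "kind_at G l = K" using lA by auto
  have loop: "src_at G m \<noteq> tgt_at G m" if "m < num_edges G" for m
    using dl that by (auto simp: has_double_or_loop_def is_loop_def)
  have ex: "\<exists>u. ends_at G m = {u, y} \<and> u \<noteq> y" if "m \<in> ?A" for m
  proof -
    have "m < num_edges G" "y = src_at G m \<or> y = tgt_at G m" using that by (auto simp: ends_def)
    thus ?thesis using loop[of m] unfolding ends_def by (metis insert_commute)
  qed
  obtain a where a: "ends_at G l = {a, y}" "a \<noteq> y" using ex[OF lA] by blast
  obtain h where h: "ends_at G l2 = {h, y}" "h \<noteq> y" using ex[of l2] l23(1) by blast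
  obtain x where x: "ends_at G l3 = {x, y}" "x \<noteq> y" using ex[of l3] l23(1) by blast
  have dd: "ends_at G m \<noteq> ends_at G m'"
    if "m < num_edges G" "m' < num_edges G" "m \<noteq> m'" "kind_at G m = K" "kind_at G m' = K" for m m'
    using double_loopI[of m G m'] dl that by auto
  have dist: "a \<noteq> h" "a \<noteq> x" "h \<noteq> x"
    using dd[OF l(1) m(1)] dd[OF l(1) m(2)] dd[OF m(1,2)] l m l23(2) a(1) h(1) x(1) by auto
  have bnd: "a < num_vertices G" "h < num_vertices G" "x < num_vertices G"
    using ends_bounded[OF t l(1)] ends_bounded[OF t m(1)] ends_bounded[OF t m(2)] a(1) h(1) x(1) by auto
  have fay: "?f a = ?f y" using cmap_ends[OF con] a(1) by (auto simp: ends_def doubleton_eq_iff)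
  have finj: "?f u = ?f v \<longleftrightarrow> u = v \<or> {u, v} = {a, y}" for u v
    using merge_eq_iff[OF cmin_less_cmax[OF con], of u v] a(1) ends_min_max[of G l] by (simp add: cmap_def)
  \<comment> \<open>Outside \<open>T\<close> there remain only \<open>y\<close> and its three
    neighbours. An edge of kind \<open>K\<close> from \<open>a\<close> to \<open>h\<close> or
    \<open>x\<close> would become parallel to \<open>l2\<close> or \<open>l3\<close> in the
    contraction, which has no double edge; so \<open>l\<close> is the only free half-edge of
    \<open>a\<close>.\<close>
  define T where "T = ext_vertices G - {a, h, x}"
  have dlC: "False" if "m < num_edges G" "m' < num_edges G" "m \<noteq> l" "m' \<noteq> l" "m \<noteq> m'"
      "kind_at G m = kind_at G m'" "?f ` ends_at G m = ?f ` ends_at G m'" for m m'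
  proof -
    note e = nth_edges_after_del[OF con that(1,3)] nth_edges_after_del[OF con that(2,4)]
    have im: "ends (relabel_edge ?f e) = ?f ` ends e" for e by (simp add: ends_def)
    have "after_del l m \<noteq> after_del l m'" using that(3-5) by (auto simp: after_del_def split: if_splits)
    thus False using double_loopI[OF e(2,4)] dlc that(6,7) e(1,3) by (simp add: im)
  qed
  have loopC: "?f (src_at G m) \<noteq> ?f (tgt_at G m)" if "m < num_edges G" "m \<noteq> l" for m
  proof
    assume "?f (src_at G m) = ?f (tgt_at G m)"
    hence "is_loop ?C (after_del l m)" unfolding is_loop_def nth_edges_after_del(1)[OF con that] by simp
    thus False using dlc nth_edges_after_del(2)[OF con that] unfolding has_double_or_loop_def by blast
  qed
  have leaf: "leaf_edge K G l a y T" unfolding leaf_edge_def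
  proof (intro conjI)
    show "out_count K T a (edges G) = 1"
    proof -
      have "out_count K T a (del_at l (edges G)) = 0"
      proof (rule ccontr)
        assume "out_count K T a (del_at l (edges G)) \<noteq> 0"
        then obtain m' u where m': "m' < length (del_at l (edges G))" "ekind (del_at l (edges G) ! m') = K"
          "ends (del_at l (edges G) ! m') = {a, u}" "u \<notin> T"
          unfolding neq0_conv half_count_pos_iff by blast
        define m where "m = (if m' < l then m' else Suc m')"
        have mm: "m < num_edges G" "m \<noteq> l" "edges G ! m = del_at l (edges G) ! m'"
          using m'(1) l(1) by (auto simp: m_def nth_del_at)
        note e = m'(2,3)[folded mm(3)]
        have "u < num_vertices G" using ends_bounded[OF t mm(1), of u] e by simp
        hence "u = a \<or> u = y \<or> u = h \<or> u = x" using m'(4) y(3)[of u] by (auto simp: T_def)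
        then consider "u = a" | "u = y" | "u = h" | "u = x" by blast
        thus False
        proof cases
          case 1 thus False using e(2) loop[OF mm(1)] by (auto simp: ends_def)
        next
          case 2 thus False using dd[OF mm(1) l(1) mm(2)] e l a by simp
        next
          case 3
          have "m \<noteq> l2" using e(2) h 3 dist a by (auto simp: doubleton_eq_iff)
          thus False using dlC[OF mm(1) m(1) mm(2) m(5)] e m 3 h fay by (simp add: insert_commute)
        next
          case 4
          have "m \<noteq> l3" using e(2) x 4 dist a by (auto simp: doubleton_eq_iff)
          thus False using dlC[OF mm(1) m(2) mm(2) m(6)] e m 4 x fay by (simp add: insert_commute)
        qed
      qed
      moreover have "half_weight K (\<lambda>x. x \<notin> T) a (edges G ! l) = 1"
        using l(2) a y(2) by (auto simp: half_weight_def ends_def doubleton_eq_iff T_def)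
      ultimately show ?thesis using half_count_del_at[OF l(1), of K "\<lambda>x. x \<notin> T" a] by simp
    qed
    show "in_count K T y (edges G) = 0"
    proof (rule ccontr)
      assume "in_count K T y (edges G) \<noteq> 0"
      then obtain m' u where m': "m' < num_edges G" "kind_at G m' = K" "ends_at G m' = {y, u}" "u \<in> T"
        unfolding neq0_conv half_count_pos_iff by blast
      hence "m' \<in> {l, l2, l3}" using l23(1) lA by blast
      thus False using m'(3,4) a h x by (auto simp: T_def doubleton_eq_iff)
    qed
  qed (use l a y bnd in "auto simp: T_def")
  obtain c where c: "bv G - single (blow K (?f a) (?f ` T) ?C) c \<in> uspan False"
    using bv_leaf[OF g leaf] by (auto simp: T_def)
  have "udiff False G - scale_rat c (udiff False (blow K (?f a) (?f ` T) ?C)) \<in> uspan False"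
    using udiff_rels[OF c, of False] by (simp add: lin_diff)
  moreover have "udiff False (blow K (?f a) (?f ` T) ?C) \<in> chord_span N"
  proof (rule arnold_ends)
    show "?C \<in> stratum N 0" using stratum_contract(1)[OF G con] by simp
    note e2 = nth_edges_after_del[OF con m(1,5)] and e3 = nth_edges_after_del[OF con m(2,6)]
    show "after_del l l2 \<noteq> after_del l l3" using m l23(2) by (auto simp: after_del_def split: if_splits)
    show "after_del l l2 < num_edges ?C" "after_del l l3 < num_edges ?C" by (fact e2 e3)+
    show "ekind (edges ?C ! after_del l l2) = K" "ekind (edges ?C ! after_del l l3) = K"
      unfolding e2(1) e3(1) using m by simp_all
    have im: "ends (relabel_edge ?f e) = ?f ` ends e" for e by (simp add: ends_def)
    show "ends (edges ?C ! after_del l l2) = {?f h, ?f a}" "ends (edges ?C ! after_del l l3) = {?f a, ?f x}"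
      unfolding e2(1) e3(1) im h(1) x(1) fay by auto
    show "distinct [?f h, ?f a, ?f x]" using dist h(2) x(2) by (auto simp: finj doubleton_eq_iff)
    have T: "?f v \<notin> ?f ` T" if "v \<in> {a, h, x}" for v
    proof
      assume "?f v \<in> ?f ` T"
      then obtain u where u: "u \<in> T" "?f v = ?f u" by blast
      have "u \<noteq> y" "u \<notin> {a, h, x}" using u(1) y(2) by (auto simp: T_def)
      thus False using u(2) that h(2) x(2) unfolding finj by (auto simp: doubleton_eq_iff)
    qed
    show "?f h \<notin> ?f ` T" "?f a \<notin> ?f ` T" "?f x \<notin> ?f ` T" using T by blast+
    fix m' z assume m': "m' < num_edges ?C" "m' \<noteq> after_del l l2" "m' \<noteq> after_del l l3" "kind_at ?C m' = K"
      "ends_at ?C m' = {?f a, z}"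
    define m where "m = (if m' < l then m' else Suc m')"
    have mm: "m < num_edges G" "m \<noteq> l" "after_del l m = m'"
      using m'(1) l(1) by (auto simp: m_def after_del_def num_edges_contract[OF con])
    note e = nth_edges_after_del(1)[OF con mm(1,2), unfolded mm(3)]
    have k: "kind_at G m = K" "?f ` ends_at G m = {?f a, z}" using m'(4,5) unfolding e im by simp_all
    have "m \<noteq> l2" "m \<noteq> l3" using m'(2,3) mm(3) by auto
    have "z < num_vertices ?C" using ends_bounded[OF good_typed[OF good_contract[OF g con]] m'(1), of z] m'(5) by simp
    then obtain v where v: "v < num_vertices G" "?f v = z" using cmap_surj[OF g con] by blast
    have "z \<noteq> ?f a" using loopC[OF mm(1,2)] k(2) by (auto simp: ends_def)
    moreover have "z \<noteq> ?f h"
    proof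
      assume "z = ?f h"
      thus False
        using dlC[OF mm(1) \<open>l2 < num_edges G\<close> mm(2) \<open>l2 \<noteq> l\<close> \<open>m \<noteq> l2\<close>] k \<open>kind_at G l2 = K\<close> h(1) fay
        by (simp add: insert_commute)
    qed
    moreover have "z \<noteq> ?f x"
    proof
      assume "z = ?f x"
      thus False
        using dlC[OF mm(1) \<open>l3 < num_edges G\<close> mm(2) \<open>l3 \<noteq> l\<close> \<open>m \<noteq> l3\<close>] k \<open>kind_at G l3 = K\<close> x(1) fay
        by (simp add: insert_commute)
    qed
    ultimately have "v \<in> T" using v y(3)[OF v(1)] fay by (auto simp: T_def)
    thus "z \<in> ?f ` T" using v(2) by blast
  qed
  ultimately show ?thesis by (rule chord_span_cong)
qed

lemma star_span:
  assumes "G \<in> stratum N (Suc 0)"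
  shows "udiff False G \<in> chord_span N"
proof -
  have main: "udiff False G \<in> chord_span N"
    if "G \<in> stratum N (Suc 0)" "y < num_vertices G" "vkind G y = int_kind K" for G y K using that
  proof (induction "valence K y (edges G)" arbitrary: G y rule: less_induct)
    case less
    note G = less.prems(1)
    have g: "good G" by (rule good_stratum[OF G])
    have y: "vkind G v = ExtBlack" if "v < num_vertices G" "v \<noteq> y" for v
    proof -
      obtain z where "z < num_vertices G" "vkind G z \<noteq> ExtBlack"
        "\<forall>v<num_vertices G. v \<noteq> z \<longrightarrow> vkind G v = ExtBlack" using stratum_one[OF G] .
      thus ?thesis using that less.prems(2,3) by (metis int_kind_simps(2))
    qed
    show ?case
    proof (cases "has_double_or_loop G")
      case True
      thus ?thesis using G by (intro chord_span_udiff double_loop_contract)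
    next
      case dl: False
      let ?A = "{l. l < num_edges G \<and> kind_at G l = K \<and> y \<in> ends_at G l}"
      have v: "valence K y (edges G) \<ge> 3" "valence K y (edges G) = card ?A"
      proof -
        have "vertex_ok (vkind G y) (valence Dashed y (edges G)) (valence Solid y (edges G))"
          using g less.prems(2) by (simp add: good_iff)
        thus "valence K y (edges G) \<ge> 3" unfolding less.prems(3) by (cases K) simp_all
      qed (rule valence_card[OF dl])
      show ?thesis
      proof (cases "valence K y (edges G) = 3")
        case True
        from star_three[OF G less.prems(2,3) y dl this] show ?thesis .
      next
        case False
        hence c4: "card ?A \<ge> 4" using v by simp
        then obtain B where B: "B \<subseteq> ?A" "card B = 2" using obtain_subset_with_card_n[of 2 ?A] by auto
        hence "card (?A - B) \<ge> 2" using c4 by (subst card_Diff_subset) (auto intro: finite_subset)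
        then obtain C where C: "C \<subseteq> ?A - B" "card C = 2" using obtain_subset_with_card_n[of 2 "?A - B"] by auto
        obtain l1 l2 where l12: "B = {l1, l2}" "l1 \<noteq> l2" using B(2) by (auto simp: card_2_iff)
        obtain l3 l4 where l34: "C = {l3, l4}" "l3 \<noteq> l4" using C(2) by (auto simp: card_2_iff)
        have lA: "l1 \<in> ?A" "l2 \<in> ?A" "l3 \<in> ?A" "l4 \<in> ?A" using B(1) C(1) l12(1) l34(1) by blast+
        have ne: "l3 \<noteq> l1" "l3 \<noteq> l2" "l4 \<noteq> l1" "l4 \<noteq> l2" using C(1) l12(1) l34(1) by blast+
        have ex: "\<exists>u. ends_at G m = {y, u}" if "m \<in> ?A" for m
          using that by (auto simp: ends_def)
        obtain u1 u2 u3 u4 where u: "ends_at G l1 = {y, u1}" "ends_at G l2 = {y, u2}"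
            "ends_at G l3 = {y, u3}" "ends_at G l4 = {y, u4}"
          using ex[OF lA(1)] ex[OF lA(2)] ex[OF lA(3)] ex[OF lA(4)] by blast
        have dd: "w \<noteq> w'" if "m \<in> ?A" "m' \<in> ?A" "m \<noteq> m'" "ends_at G m = {y, w}" "ends_at G m' = {y, w'}" for m m' w w'
          using double_loopI[of m G m'] dl that by auto
        have d: "u3 \<noteq> u1" "u3 \<noteq> u2" "u4 \<noteq> u1" "u4 \<noteq> u2"
          using dd[OF lA(3,1) ne(1) u(3,1)] dd[OF lA(3,2) ne(2) u(3,2)] dd[OF lA(4,1) ne(3) u(4,1)] dd[OF lA(4,2) ne(4) u(4,2)] .
        \<comment> \<open>The first two edges lead outside \<open>?T\<close>. The other two lead
          into it, because without double edges their ends differ from \<open>u1\<close> and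
          \<open>u2\<close>. So both halves have at least two edges, as \<open>star_split\<close>
          demands.\<close>
        let ?T = "UNIV - {u1, u2}"
        have k: "kind_at G l1 = K" "kind_at G l2 = K" "kind_at G l3 = K" "kind_at G l4 = K"
          and b: "l1 < num_edges G" "l2 < num_edges G" "l3 < num_edges G" "l4 < num_edges G" using lA by auto
        show ?thesis
        proof (rule star_split[OF G less.prems(2,3) y dl])
          show "2 \<le> out_count K ?T y (edges G)"
            by (rule half_count_two_edges[OF b(1,2) l12(2) k(1,2) u(1,2)]) auto
          show "2 \<le> in_count K ?T y (edges G)"
            by (rule half_count_two_edges[OF b(3,4) l34(2) k(3,4) u(3,4)]) (use d in auto)
        qed (use less.hyps in auto)
      qed
    qed
  qed
  obtain y where y: "y < num_vertices G" "vkind G y \<noteq> ExtBlack" using stratum_one[OF assms] by blast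
  have "vkind G y = int_kind Solid \<or> vkind G y = int_kind Dashed" using y(2) by (cases "vkind G y") auto
  thus ?thesis using main[OF assms y(1)] by blast
qed

text \<open>Every relation lies either entirely inside or entirely outside \<open>P\<close>, so
  projecting to \<open>P\<close> sends it to itself or to zero. A combination of relations can thus
  be replaced by one that involves only graphs with \<open>P\<close>.\<close>

lemma restrict_orientation:
  assumes "\<And>G H s. good G \<Longrightarrow> good H \<Longrightarrow> relab G H s \<Longrightarrow> P G \<longleftrightarrow> P H"
    and "\<And>r. r \<in> R \<Longrightarrow> (\<forall>g\<in>keys r. P g) \<or> (\<forall>g\<in>keys r. \<not> P g)"
    and "x \<in> rv.span (orient_rel {G. good G} \<union> R)"
  shows "restrict_to P x \<in> rv.span (orient_rel {G. good G \<and> P G} \<union> {r \<in> R. \<forall>g\<in>keys r. P g})"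
    (is "_ \<in> rv.span ?W") unfolding restrict_to_def
proof (rule lin_span_image[OF _ assms(3)])
  fix r assume "r \<in> orient_rel {G. good G} \<union> R"
  then consider G H s where "r = bv H - single G s" "good G" "good H" "relab G H s" | "r \<in> R"
    by (auto simp: orientation_relations_def)
  thus "lin (\<lambda>g. if P g then bv g else 0) r \<in> rv.span ?W"
  proof cases
    case (1 G H s)
    thus ?thesis using assms(1)[OF 1(2-4)] rv.span_base[of r ?W] rv.span_zero[of ?W]
      by (cases "P G") (auto simp: lin_diff orientation_relations_def)
  next
    case 2
    show ?thesis using assms(2)[OF 2]
    proof
      assume P: "\<forall>g\<in>keys r. P g"
      thus ?thesis using restrict_to_id[of r P] rv.span_base[of r ?W] 2 by (simp add: restrict_to_def)
    next
      assume "\<forall>g\<in>keys r. \<not> P g"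
      thus ?thesis using restrict_to_zero[of r P] rv.span_zero[of ?W] by (simp add: restrict_to_def)
    qed
  qed
qed

lemma relabeling_counts:
  assumes "relab G H s"
  shows "num_vertices H = num_vertices G" "card (ext_vertices H) = card (ext_vertices G)"
proof -
  obtain vp ep where st: "rstep G H vp ep s" using assms relabeling_iff by blast
  show "num_vertices H = num_vertices G" by (rule rstep_num(1)[OF st])
  have "ext_vertices H = vp ` ext_vertices G" using ext_vertices_rstep[OF st, of "[]"] by simp
  thus "card (ext_vertices H) = card (ext_vertices G)"
    using rstep_bij(1)[OF st] by (simp add: card_image inj_on_def bij_def)
qed

lemma keys_hrels:
  assumes "r \<in> hrels S"
  shows "keys r \<subseteq> S"
proof -
  consider G H s where "r = bv H - single G s" "G \<in> S" "H \<in> S" | G where "r = bv G" "G \<in> S"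
    | G H L where "r = bv G + bv H + bv L" "G \<in> S" "H \<in> S" "L \<in> S"
    using assms unfolding hrels_def orientation_relations_def double_loop_relations_def arnold_relations_def by blast
  thus ?thesis
  proof cases
    case (1 G H s)
    thus ?thesis using keys_diff_subset[of "bv H" "single G s"] by (auto split: if_splits)
  next
    case (3 G H L)
    thus ?thesis using keys_add[of "bv G + bv H" "bv L"] keys_add[of "bv G" "bv H"] by auto
  qed simp
qed

lemma chord_span_hrels:
  assumes "x \<in> chord_span N" "keys x \<subseteq> stratum N 0"
  shows "x \<in> rv.span (hrels (stratum N 0))"
proof -
  have "restrict_to (\<lambda>G. G \<in> stratum N 0) x \<in> rv.span (orient_rel {G. good G \<and> G \<in> stratum N 0} \<union>
      {r \<in> hrels (stratum N 0). \<forall>g\<in>keys r. g \<in> stratum N 0})"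
  proof (rule restrict_orientation)
    show "G \<in> stratum N 0 \<longleftrightarrow> H \<in> stratum N 0" if "good G" "good H" "relab G H s" for G H s
      using relabeling_counts[OF that(3)] that(1,2) unfolding stratum_def mem_Collect_eq by metis
    show "(\<forall>g\<in>keys r. g \<in> stratum N 0) \<or> (\<forall>g\<in>keys r. g \<notin> stratum N 0)"
      if "r \<in> hrels (stratum N 0)" for r using keys_hrels[OF that] by blast
  qed (use assms(1) in "simp add: chord_span_def urels_def")
  also have "restrict_to (\<lambda>G. G \<in> stratum N 0) x = x" using assms(2) by (intro restrict_to_id) auto
  finally show ?thesis
    by (rule rv.span_mono[THEN subsetD, rotated]) (auto simp: hrels_def orientation_relations_def)
qed

lemma star_hrels:
  assumes "G \<in> stratum N (Suc 0)"
  shows "udiff False G \<in> rv.span (hrels (stratum N 0))"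
proof (rule chord_span_hrels[OF star_span[OF assms]])
  show "keys (udiff False G) \<subseteq> stratum N 0"
    using keys_udiff[of False G] stratum_contract(1)[OF assms] by (auto simp: contractions_def)
qed

section \<open>The projections are quasi-isomorphisms\<close>

text \<open>What becomes zero in \<open>HH\<close>, in all degrees at once.\<close>

definition chord_null :: "(lgraph \<Rightarrow>\<^sub>0 rat) set"
  where "chord_null = rv.span (hrels {G. chordal G})"

text \<open>The three graphs of an Arnold relation differ only in the ends of two edges, so a
  quantity \<open>f\<close> that depends only on the kinds of vertices and edges is constant on
  them. It is applied to the degree and to the number of external vertices.\<close>

lemma hrels_homogeneous:
  assumes "r \<in> hrels S" "\<And>G H s. relab G H s \<Longrightarrow> f H = f G"
    and "\<And>vs es es'. map ekind es = map ekind es' \<Longrightarrow> f (LGraph vs es) = f (LGraph vs es')"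
  shows "\<exists>c. r \<in> hrels {G \<in> S. f G = c}"
proof -
  consider G H s where "r = bv H - single G s" "G \<in> S" "H \<in> S" "relab G H s"
    | G where "r = bv G" "G \<in> S" "has_double_or_loop G" | "r \<in> arnold_relations S"
    using assms(1) unfolding hrels_def orientation_relations_def double_loop_relations_def by blast
  thus ?thesis
  proof cases
    case (1 G H s)
    hence "r \<in> orient_rel {G' \<in> S. f G' = f G}"
      using assms(2)[OF 1(4)] unfolding orientation_relations_def by blast
    thus ?thesis by (auto simp: hrels_def)
  next
    case (2 G)
    hence "r \<in> double_loop_relations {G' \<in> S. f G' = f G}" unfolding double_loop_relations_def by blast
    thus ?thesis by (auto simp: hrels_def)
  next
    case 3
    then obtain vs es a b K h i l where d: "distinct [h, i, l]" "a \<noteq> b" "a < length es" "b < length es"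
      and r: "r = bv (LGraph vs (es[a := Edge K h i, b := Edge K i l])) +
        bv (LGraph vs (es[a := Edge K i l, b := Edge K l h])) +
        bv (LGraph vs (es[b := Edge K h i, a := Edge K l h]))"
      and S: "LGraph vs (es[a := Edge K h i, b := Edge K i l]) \<in> S"
        "LGraph vs (es[a := Edge K i l, b := Edge K l h]) \<in> S"
        "LGraph vs (es[b := Edge K h i, a := Edge K l h]) \<in> S" unfolding arnold_relations_def by blast
    define c where "c = f (LGraph vs (es[a := Edge K h i, b := Edge K i l]))"
    have "f (LGraph vs (es[a := Edge K i l, b := Edge K l h])) = c" "f (LGraph vs (es[b := Edge K h i, a := Edge K l h])) = c"
      unfolding c_def by (rule assms(3); simp add: map_update list_update_swap[OF d(2)])+
    hence "r \<in> arnold_relations {G' \<in> S. f G' = c}"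
      unfolding r using S c_def by (intro arnold_relationsI[OF d]) simp_all
    thus ?thesis by (auto simp: hrels_def)
  qed
qed

lemma hrels_mono: "S \<subseteq> S' \<Longrightarrow> hrels S \<subseteq> hrels S'"
  unfolding hrels_def orientation_relations_def double_loop_relations_def arnold_relations_def by blast

lemma stratum_chord_null: "x \<in> rv.span (hrels (stratum N 0)) \<Longrightarrow> x \<in> chord_null"
  unfolding chord_null_def
  by (rule rv.span_mono[OF hrels_mono, THEN subsetD, rotated]) (auto simp: stratum_zero)

lemma restrict_hrels:
  assumes "x \<in> rv.span (hrels S)" "\<And>G H s. relab G H s \<Longrightarrow> f H = f G"
    and "\<And>vs es es'. map ekind es = map ekind es' \<Longrightarrow> f (LGraph vs es) = f (LGraph vs es')"
  shows "restrict_to (\<lambda>G. Q (f G)) x \<in> rv.span (hrels {G \<in> S. Q (f G)})"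
  unfolding restrict_to_def
proof (rule lin_span_image[OF _ assms(1)])
  fix r assume r: "r \<in> hrels S"
  have "\<exists>c. r \<in> hrels {G \<in> S. f G = c}" by (rule hrels_homogeneous[OF r]; erule assms(2,3))
  then obtain c where c: "r \<in> hrels {G \<in> S. f G = c}" ..
  have "restrict_to (\<lambda>G. Q (f G)) r \<in> rv.span (hrels {G \<in> S. Q (f G)})"
  proof (cases "Q c")
    case True
    hence "r \<in> hrels {G \<in> S. Q (f G)}" by (intro hrels_mono[THEN subsetD, OF _ c]) auto
    moreover have "restrict_to (\<lambda>G. Q (f G)) r = r" using keys_hrels[OF c] True by (intro restrict_to_id) auto
    ultimately show ?thesis by (simp add: rv.span_base)
  next
    case False
    hence "restrict_to (\<lambda>G. Q (f G)) r = 0" using keys_hrels[OF c] by (intro restrict_to_zero) auto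
    thus ?thesis by (simp add: rv.span_zero)
  qed
  thus "lin (\<lambda>G. if Q (f G) then bv G else 0) r \<in> rv.span (hrels {G \<in> S. Q (f G)})"
    by (simp add: restrict_to_def)
qed

abbreviation num_ext :: "lgraph \<Rightarrow> nat"
  where "num_ext G \<equiv> card (ext_vertices G)"

lemma keys_urels:
  assumes "x \<in> uspan dl"
  shows "keys x \<subseteq> {G. good G}"
proof (rule keys_span_subset[OF keys_hrels])
  show "r \<in> hrels {G. good G}" if "r \<in> urels dl" for r
    using that by (auto simp: urels_def hrels_def split: if_splits)
qed (rule assms)

lemma restrict_urels:
  assumes "x \<in> uspan dl" "\<And>G H s. good G \<Longrightarrow> good H \<Longrightarrow> relab G H s \<Longrightarrow> P G \<longleftrightarrow> P H"
  shows "restrict_to P x \<in> rv.span (orient_rel {G. good G \<and> P G} \<union>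
    (if dl then double_loop_relations {G. good G \<and> P G} else {}))"
proof -
  have "restrict_to P x \<in> rv.span (orient_rel {G. good G \<and> P G} \<union>
      {r \<in> if dl then double_loop_relations {G. good G} else {}. \<forall>g\<in>keys r. P g})"
    by (rule restrict_orientation)
      (use assms in "auto simp: urels_def double_loop_relations_def split: if_splits")
  thus ?thesis by (rule rv.span_mono[THEN subsetD, rotated]) (auto simp: double_loop_relations_def)
qed

lemma restrict_urels':
  assumes "x \<in> uspan dl" "\<And>G H s. good G \<Longrightarrow> good H \<Longrightarrow> relab G H s \<Longrightarrow> P G \<longleftrightarrow> P H"
  shows "restrict_to P x \<in> uspan dl" using restrict_urels[OF assms]
  by (rule rv.span_mono[THEN subsetD, rotated])
    (auto simp: urels_def orientation_relations_def double_loop_relations_def)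

lemma relabeling_chordal: "good G \<Longrightarrow> good H \<Longrightarrow> relab G H s \<Longrightarrow> chordal G \<longleftrightarrow> chordal H"
  using relabeling_counts[of G H s] by (simp add: chordal_def has_internal_iff)

lemma chordal_urels:
  assumes "x \<in> uspan dl"
  shows "restrict_to chordal x \<in> chord_null"
  using restrict_urels[OF assms relabeling_chordal] unfolding chord_null_def
  by (rule rv.span_mono[THEN subsetD, rotated])
    (auto simp: hrels_def orientation_relations_def double_loop_relations_def)

section \<open>Contractions between external vertices and the chord relations\<close>

lemma num_ext_contract:
  assumes "good G" "contractible True G l" "\<not> contractible False G l"
  shows "num_ext (contract G l) < num_ext G" "has_internal (contract G l) \<longleftrightarrow> has_internal G"
proof -
  let ?p = "cmin G l" and ?q = "cmax G l"
  have l: "l < num_edges G" "ends_at G l = {?p, ?q}" using contractible_less[OF assms(2)] ends_min_max by auto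
  have t: "typed G" by (rule good_typed[OF assms(1)])
  have pq: "?p < ?q" "?q < num_vertices G" using cmin_less_cmax[OF assms(2)] cmax_less[OF t l(1)] by auto
  have e: "vkind G ?p = ExtBlack" "vkind G ?q = ExtBlack"
    using assms(2,3) l(2) unfolding contractible_def by auto
  have "(vkinds G)[?p := ExtBlack] = vkinds G" using e(1) by (metis list_update_id)
  hence vk: "vkinds (contract G l) = del_at ?q (vkinds G)"
    using contract_eq[of G l] assms(2) e by (simp only: contractible_def merged_kind_def) simp
  have count: "num_ext H = length (filter (\<lambda>k. k = ExtBlack) (vkinds H))" for H
    by (simp add: length_filter_conv_card)
  have "length (filter (\<lambda>k. k = ExtBlack) (vkinds G)) = Suc (length (filter (\<lambda>k. k = ExtBlack) (vkinds (contract G l))))"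
    using length_filter_del_at[of ?q "vkinds G"] pq e unfolding vk by simp
  moreover have "Suc (num_vertices (contract G l)) = num_vertices G"
    using num_vertices_contract[OF assms(2) t] pq(2) by linarith
  ultimately show "num_ext (contract G l) < num_ext G" "has_internal (contract G l) \<longleftrightarrow> has_internal G"
    unfolding has_internal_iff count by auto
qed

lemma contractions_mono: "contractions False G \<subseteq> contractions True G"
  by (auto simp: contractions_def contractible_def)

text \<open>The contractions of solid edges between two external vertices. They lower the number of
  external vertices and keep the internal ones, so \<open>udiff False\<close> is the leading part of
  the differential for the filtration by external vertices.\<close>

definition ext_diff :: "lgraph \<Rightarrow> (lgraph \<Rightarrow>\<^sub>0 rat)"
  where "ext_diff G = udiff True G - udiff False G"

lemma keys_ext_diff:
  assumes "good G" "H \<in> keys (ext_diff G)"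
  shows "good H" "num_ext H < num_ext G" "has_internal H \<longleftrightarrow> has_internal G"
proof -
  have "ext_diff G = (\<Sum>l\<in>contractions True G - contractions False G. cvec G l)"
    unfolding ext_diff_def udiff_def by (simp add: sum_diff[OF _ contractions_mono])
  then obtain l where "contractible True G l" "\<not> contractible False G l" "H = contract G l"
    using assms(2) keys_cvec[of G "contractions True G - contractions False G"] by (auto simp: contractions_def)
  thus "good H" "num_ext H < num_ext G" "has_internal H \<longleftrightarrow> has_internal G"
    using good_contract[OF assms(1)] num_ext_contract[OF assms(1)] by blast+
qed

lemma keys_udiff_good:
  assumes "good G" "H \<in> keys (udiff b G)"
  shows "good H" "gdeg H = gdeg G + 1"
proof -
  obtain l where "contractible b G l" "H = contract G l"
    using keys_udiff assms(2) by (fastforce simp: contractions_def)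
  thus "good H" "gdeg H = gdeg G + 1" using good_contract graph_degree_contract assms(1) by blast+
qed

lemma keys_udiff_False:
  assumes "G \<in> stratum N m" "H \<in> keys (udiff False G)"
  shows "H \<in> stratum N (m - 1)"
proof -
  obtain l where "contractible False G l" "H = contract G l"
    using keys_udiff assms(2) by (fastforce simp: contractions_def)
  thus ?thesis using stratum_contract(1)[OF assms(1)] by simp
qed

lemma in_stratum: "good G \<Longrightarrow> G \<in> stratum (num_ext G) (num_vertices G - num_ext G)"
  using card_ext_le[of G] by (simp add: stratum_def)

text \<open>A chord graph can arise only from a graph with a single internal vertex, by a
  contraction that uses up this vertex; the corresponding part of the boundary is a chord relation
  by \<open>star_hrels\<close>. This is what makes the projection to \<open>HH\<close> compatible
  with the differentials.\<close>

lemma chordal_udiff_internal: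
  assumes "\<And>g. g \<in> keys x \<Longrightarrow> good g \<and> has_internal g"
  shows "restrict_to chordal (lin (udiff True) x) \<in> chord_null"
proof -
  have single: "restrict_to chordal (udiff True g) \<in> chord_null" if g: "good g" "has_internal g" for g
  proof -
    have "restrict_to chordal (udiff True g) = restrict_to chordal (ext_diff g + udiff False g)"
      by (simp add: ext_diff_def)
    also have "\<dots> = restrict_to chordal (udiff False g)"
      unfolding restrict_to_add using keys_ext_diff(3)[OF g(1)] g(2)
      by (subst restrict_to_zero) (auto simp: chordal_def)
    also have "\<dots> \<in> chord_null"
    proof (cases "num_vertices g - num_ext g = Suc 0")
      case True
      have s: "g \<in> stratum (num_ext g) (Suc 0)" using in_stratum[OF g(1)] True by simp
      have "restrict_to chordal (udiff False g) = udiff False g"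
        using keys_udiff_False[OF s] by (intro restrict_to_id) (auto simp: stratum_zero)
      thus ?thesis using stratum_chord_null[OF star_hrels[OF s]] by simp
    next
      case False
      have "\<not> chordal H" if "H \<in> keys (udiff False g)" for H
        using keys_udiff_False[OF in_stratum[OF g(1)] that] g(2) False
        by (auto simp: chordal_def has_internal_iff stratum_def)
      thus ?thesis by (simp add: restrict_to_zero chord_null_def rv.span_zero)
    qed
    finally show ?thesis .
  qed
  show ?thesis unfolding restrict_to_def lin_lin chord_null_def
    by (rule lin_in_span) (use assms single in "simp add: restrict_to_def chord_null_def")
qed


lemma chordal_contract:
  assumes "chordal G" "contractible True G l"
  shows "chordal (contract G l)"
proof -
  have g: "good G" using assms(1) by (simp add: chordal_def)
  have "\<not> contractible False G l"
    using stratum_contract(2)[of G "num_ext G" 0 l] assms(1) by (auto simp: stratum_zero)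
  thus ?thesis
    using num_ext_contract(2)[OF g assms(2)] good_contract[OF g assms(2)] assms(1) by (simp add: chordal_def)
qed

lemma chordal_udiff: "chordal g \<Longrightarrow> H \<in> keys (udiff True g) \<Longrightarrow> chordal H"
  using keys_udiff[of True g] chordal_contract[of g] by (auto simp: contractions_def)

lemma chordal_num_ext: "{G \<in> {G. chordal G}. num_ext G = N} = stratum N 0" using stratum_zero by blast

text \<open>Modulo orientation a chord relation is \<open>udiff False\<close> of an internal
  \<open>y\<close>. Since the full differential squares to zero, its boundary is, up to relations,
  minus the boundary of \<open>ext_diff\<close> of \<open>y\<close>, which is again internal, so
  \<open>chordal_udiff_internal\<close> applies.\<close>

lemma chord_null_udiff:
  assumes "x \<in> chord_null"
  shows "lin (udiff True) x \<in> chord_null" unfolding chord_null_def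
proof (rule lin_span_image[OF _ assms[unfolded chord_null_def]])
  fix r assume r: "r \<in> hrels {G. chordal G}"
  have "\<exists>N. r \<in> hrels {G \<in> {G. chordal G}. num_ext G = N}"
    by (rule hrels_homogeneous[OF r]) (erule relabeling_counts, simp)
  then obtain N where "r \<in> hrels (stratum N 0)" unfolding chordal_num_ext ..
  then obtain y where y: "keys y \<subseteq> internal_graphs N" "r - lin (udiff False) y \<in> uspan False"
    using coboundary_hrels unfolding coboundary_def by blast
  have yg: "good g \<and> has_internal g" if "g \<in> keys y" for g
    using y(1) that by (auto simp: internal_graphs_def)
  let ?u = "r - lin (udiff False) y" and ?e = "lin (ext_diff) y"
  have "lin (udiff False) y = lin (udiff True) y - ?e" by (simp add: ext_diff_def[abs_def] lin_fun_diff)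
  hence "lin (udiff True) r = lin (udiff True) ?u - lin (udiff True) ?e"
    using udiff_udiff[of y True] yg by (simp add: lin_diff)
  moreover have "restrict_to chordal (lin (udiff True) r) = lin (udiff True) r"
    using keys_lin_subset[of "udiff True" r] keys_hrels[OF r] chordal_udiff by (intro restrict_to_id) blast
  moreover have "restrict_to chordal (lin (udiff True) ?e) \<in> chord_null"
    using keys_lin_subset[of "ext_diff" y] yg keys_ext_diff by (intro chordal_udiff_internal) blast
  ultimately show "lin (udiff True) r \<in> rv.span (hrels {G. chordal G})"
    using rv.span_diff chordal_urels[OF udiff_rels[OF y(2)]] unfolding chord_null_def by (metis restrict_to_diff)
qed

section \<open>Acyclicity of the kernel of the projection\<close>

lemma restrict_to_commute: "restrict_to P (restrict_to Q x) = restrict_to Q (restrict_to P x)"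
  by (rule poly_mapping_eqI) (simp add: lookup_restrict_to)

text \<open>The terms of \<open>ext_diff\<close> have fewer than \<open>M\<close> external vertices,
  so only contractions that keep the external vertices contribute to the part with exactly
  \<open>M\<close>.\<close>

lemma restrict_num_ext:
  assumes "\<And>g. g \<in> keys z \<Longrightarrow> good g \<and> num_ext g \<le> M"
  shows "restrict_to (\<lambda>G. num_ext G = M) (lin (udiff True) z) =
    lin (udiff False) (restrict_to (\<lambda>G. num_ext G = M) z)"
proof -
  have "restrict_to (\<lambda>G. num_ext G = M) (udiff True g) = lin (udiff False) (if num_ext g = M then bv g else 0)"
    if g: "good g" "num_ext g \<le> M" for g
  proof -
    have "restrict_to (\<lambda>G. num_ext G = M) (udiff True g) =
        restrict_to (\<lambda>G. num_ext G = M) (ext_diff g) + restrict_to (\<lambda>G. num_ext G = M) (udiff False g)"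
      by (simp add: ext_diff_def flip: restrict_to_add)
    also have "restrict_to (\<lambda>G. num_ext G = M) (ext_diff g) = 0"
      using keys_ext_diff(2)[OF g(1)] g(2) by (intro restrict_to_zero) fastforce
    also have "restrict_to (\<lambda>G. num_ext G = M) (udiff False g) = (if num_ext g = M then udiff False g else 0)"
    proof -
      have "num_ext H = num_ext g" if "H \<in> keys (udiff False g)" for H
        using keys_udiff_False[OF in_stratum[OF g(1)] that] unfolding stratum_def by blast
      thus ?thesis by (auto intro: restrict_to_id restrict_to_zero)
    qed
    finally show ?thesis by simp
  qed
  thus ?thesis
    unfolding restrict_to_def lin_lin by (intro lin_cong) (use assms in "simp add: restrict_to_def")
qed

text \<open>On the part of \<open>x\<close> with the largest number of external vertices the differential is \<open>udiff False\<close>: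
  its chordal component is a coboundary of internal graphs, and the rest is treated by \<open>acyclic_internal\<close>.\<close>

lemma acyclic_bounded:
  assumes "\<And>g. g \<in> keys x \<Longrightarrow> good g \<and> num_ext g < M"
    and "restrict_to chordal x \<in> chord_null" "lin (udiff True) x \<in> uspan dl"
  shows "\<exists>y. keys y \<subseteq> {G. good G} \<and> restrict_to chordal y \<in> chord_null \<and>
    x - lin (udiff True) y \<in> uspan dl" using assms
proof (induction M arbitrary: x)
  case 0
  hence "keys x = {}" by blast
  thus ?case by (intro exI[of _ 0]) (simp add: restrict_to_def chord_null_def rv.span_zero)
next
  case (Suc M)
  let ?r = "restrict_to (\<lambda>G. num_ext G = M)" and ?c = "restrict_to chordal"
  let ?D = "lin (udiff True)" and ?DF = "lin (udiff False)" and ?U = "uspan dl"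
  have rel: "num_ext G = M \<longleftrightarrow> num_ext H = M" if "relab G H s" for G H s
    using relabeling_counts(2)[OF that] by simp
  have xM: "good g \<and> num_ext g \<le> M" if "g \<in> keys x" for g using Suc.prems(1)[OF that] by simp
  have cx: "restrict_to (\<lambda>G. Q (num_ext G)) z \<in> rv.span (hrels {G \<in> {G. chordal G}. Q (num_ext G)})"
    if "z \<in> chord_null" for Q z
    by (rule restrict_hrels[OF that[unfolded chord_null_def]]) (erule relabeling_counts, simp)
  have "?c (?r x) \<in> rv.span (hrels (stratum M 0))"
    using cx[OF Suc.prems(2), of "\<lambda>N. N = M"] unfolding chordal_num_ext restrict_to_commute[of chordal] .
  from coboundary_span[OF this coboundary_hrels] obtain y1
    where y1: "keys y1 \<subseteq> internal_graphs M" "?c (?r x) - ?DF y1 \<in> uspan False"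
    unfolding coboundary_def by blast
  have good1: "good g" if "g \<in> internal_graphs M" for g using that by (simp add: internal_graphs_def)
  \<comment> \<open>Removing the chordal part itself, rather than the boundary of \<open>y1\<close>,
    leaves only internal graphs, as \<open>acyclic_internal\<close> requires. The two differ by
    orientation relations.\<close>
  define x' where "x' = ?r x - ?c (?r x)"
  have "x' = restrict_to (\<lambda>g. \<not> chordal g) (?r x)"
    unfolding x'_def by (rule poly_mapping_eqI) (simp add: lookup_minus lookup_restrict_to)
  hence kx': "keys x' \<subseteq> internal_graphs M"
    using xM by (auto simp: keys_restrict_to internal_graphs_def chordal_def)
  have "?r (?D x) \<in> ?U" by (rule restrict_urels'[OF Suc.prems(3)]) (erule rel)
  hence "?DF (?r x) \<in> ?U" by (simp add: restrict_num_ext[OF xM])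
  moreover have "?DF (?c (?r x)) \<in> ?U"
    using urels_mono[OF udiff_rels[OF y1(2), of False]] y1(1) good1 udiff_udiff[of y1 False] by (force simp: lin_diff)
  ultimately have "?DF x' \<in> ?U" by (simp add: x'_def lin_diff rv.span_diff)
  then obtain y2 where y2: "keys y2 \<subseteq> internal_graphs M" "x' - ?DF y2 \<in> ?U"
    using acyclic_internal[OF kx'] by blast
  define y where "y = y1 + y2"
  have ky: "keys y \<subseteq> internal_graphs M" using y1(1) y2(1) keys_add[of y1 y2] by (auto simp: y_def)
  hence yM: "good g \<and> num_ext g \<le> M" "has_internal g" "num_ext g = M" if "g \<in> keys y" for g
    using that by (auto simp: internal_graphs_def)
  have DDy: "?D (?D y) = 0" using yM by (intro udiff_udiff) blast
  define x1 where "x1 = x - ?D y"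
  have "?r y = y" by (rule restrict_to_id) (rule yM(3))
  hence "?r (?D y) = ?DF y" using restrict_num_ext[OF yM(1)] by simp
  hence "?r x1 = (x' - ?DF y2) + (?c (?r x) - ?DF y1)"
    unfolding x1_def restrict_to_diff by (simp add: y_def lin_add x'_def)
  hence rx1: "?r x1 \<in> ?U" using rv.span_add[OF y2(2) urels_mono[OF y1(2)]] by simp
  \<comment> \<open>As \<open>?r x1\<close> is a combination of relations, dropping it costs
    nothing, and what remains has fewer than \<open>M\<close> external vertices.\<close>
  define x2 where "x2 = x1 - ?r x1"
  have x2: "x2 = restrict_to (\<lambda>G. num_ext G \<noteq> M) x1"
    unfolding x2_def by (rule poly_mapping_eqI) (simp add: lookup_minus lookup_restrict_to)
  have kx1: "good g \<and> num_ext g \<le> M" if "g \<in> keys x1" for g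
  proof -
    have "g \<in> keys x \<or> g \<in> keys (?D y)"
      using that keys_diff_subset[of x "?D y"] by (auto simp: x1_def)
    thus ?thesis
    proof
      assume "g \<in> keys (?D y)"
      then obtain h where h: "h \<in> keys y" "g \<in> keys (udiff True h)"
        using keys_lin_subset[of "udiff True" y] by blast
      have hg: "good h" "num_ext h \<le> M" using yM(1)[OF h(1)] by auto
      have "g \<in> keys (ext_diff h) \<or> g \<in> keys (udiff False h)"
        using h(2) keys_add[of "ext_diff h" "udiff False h"] by (auto simp: ext_diff_def)
      thus ?thesis using keys_ext_diff(1,2)[OF hg(1)] keys_udiff_False[OF in_stratum[OF hg(1)]] hg(2)
        by (fastforce simp: stratum_def)
    qed (rule xM)
  qed
  have "?c x1 \<in> chord_null" using rv.span_diff Suc.prems(2) chordal_udiff_internal[of y] yM(1,2)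
    unfolding x1_def restrict_to_diff chord_null_def by blast
  hence "?c x2 \<in> chord_null"
    using cx[of "?c x1" "\<lambda>N. N \<noteq> M"] rv.span_mono[OF hrels_mono[of "{G \<in> {G. chordal G}. num_ext G \<noteq> M}" "{G. chordal G}"]]
    unfolding x2 restrict_to_commute[of chordal] chord_null_def by blast
  moreover have "good g \<and> num_ext g < M" if "g \<in> keys x2" for g
    using that kx1[of g] by (auto simp: x2 keys_restrict_to)
  moreover have "?D x2 \<in> ?U"
    using rv.span_diff[OF Suc.prems(3) udiff_rels[OF rx1]] by (simp add: x2_def x1_def lin_diff DDy)
  ultimately obtain y3 where y3: "keys y3 \<subseteq> {G. good G}" "?c y3 \<in> chord_null" "x2 - ?D y3 \<in> ?U"
    using Suc.IH[of x2] by blast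
  show ?case
  proof (intro exI[of _ "y + y3"] conjI)
    show "keys (y + y3) \<subseteq> {G. good G}" using keys_add[of y y3] yM(1) y3(1) by blast
    have "?c y = 0" using yM(2) by (intro restrict_to_zero) (auto simp: chordal_def)
    thus "?c (y + y3) \<in> chord_null" using y3(2) by (simp add: restrict_to_add)
    have "x - ?D (y + y3) = ?r x1 + (x2 - ?D y3)" by (simp add: lin_add x2_def x1_def algebra_simps)
    thus "x - ?D (y + y3) \<in> ?U" using rv.span_add[OF rx1 y3(3)] by simp
  qed
qed

theorem acyclic_kernel:
  assumes "keys x \<subseteq> {G. good G}" "restrict_to chordal x \<in> chord_null"
    "lin (udiff True) x \<in> uspan dl"
  shows "\<exists>y. keys y \<subseteq> {G. good G} \<and> restrict_to chordal y \<in> chord_null \<and>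
    x - lin (udiff True) y \<in> uspan dl"
proof (rule acyclic_bounded[OF _ assms(2,3)])
  fix g assume "g \<in> keys x"
  thus "good g \<and> num_ext g < Suc (Max (num_ext ` keys x))"
    using assms(1) by (auto simp: less_Suc_eq_le)
qed

section \<open>Comparison with the differentials of the three complexes\<close>

definition boundary :: "bool \<Rightarrow> lgraph \<Rightarrow> (lgraph \<Rightarrow>\<^sub>0 rat)"
  where "boundary dl = (if dl then PGC_boundary n j else PGC'_boundary n j)"

definition rels :: "bool \<Rightarrow> int \<Rightarrow> (lgraph \<Rightarrow>\<^sub>0 rat) set"
  where "rels dl k = (if dl then PGC_relations n j k else PGC'_relations n j k)"

lemma plain_generators_iff: "G \<in> plain_gen k \<longleftrightarrow> good G \<and> gdeg G = k"
  by (auto simp: plain_generators_def good_def)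

lemma chord_graph_iff: "good G \<Longrightarrow> chord_graph G \<longleftrightarrow> chordal G"
  by (force simp: chord_graph_def good_def chordal_def has_internal_def in_set_conv_nth)

lemma chord_generators_iff: "G \<in> chord_gen k \<longleftrightarrow> chordal G \<and> gdeg G = k"
  using chord_graph_iff[of G] by (auto simp: chord_generators_def chordal_def good_def chord_graph_def)

lemma HH_relations_eq: "HH_rel k = hrels (chord_gen k)" by (simp add: HH_relations_def hrels_def)

text \<open>A non-external end of a dashed edge is white, so for dashed edges the condition on the
  ends says that the edge is not a chord; for solid edges it is void.\<close>

lemma contractible_True_iff:
  assumes "good G"
  shows "contractible True G l \<longleftrightarrow> l < num_edges G \<and> \<not> is_chord G l \<and> \<not> is_loop G l"
proof (cases "l < num_edges G")
  case l: True
  show ?thesis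
  proof (cases "kind_at G l")
    case Dashed
    have "vkind G v = White" if "v \<in> ends_at G l" "vkind G v \<noteq> ExtBlack" for v
      using edge_kind_internal[OF assms l that] Dashed by simp
    thus ?thesis using l Dashed unfolding contractible_def is_chord_def is_loop_def by fastforce
  qed (simp add: l contractible_def is_chord_def is_loop_def)
qed (simp add: contractible_def)

lemma multiple_edge_contract:
  assumes g: "good G" and c: "contractible True G l" and m: "in_double_edge G l \<or> in_multiple_edge G l"
  shows "has_double_or_loop (contract G l)"
proof -
  obtain m where m: "m < num_edges G" "m \<noteq> l" "ends_at G m = ends_at G l"
    using m by (auto simp: in_double_edge_def in_multiple_edge_def)
  hence "cmap G l (src_at G m) = cmap G l (tgt_at G m)"
    using cmap_ends[OF c] by (auto simp: ends_def doubleton_eq_iff)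
  hence "is_loop (contract G l) (after_del l m)"
    unfolding is_loop_def nth_edges_after_del(1)[OF c m(1,2)] by simp
  thus ?thesis using nth_edges_after_del(2)[OF c m(1,2)] unfolding has_double_or_loop_def by blast
qed

text \<open>Every contraction of \<open>udiff True\<close> that is omitted from
  \<open>PGC_boundary\<close> concerns a member of a double or multiple edge, and the other member
  becomes a loop. Modulo double edges and loops the omission is invisible, so
  \<open>udiff True\<close> serves both complexes.\<close>

lemma boundary_eq:
  assumes "good G"
  shows "\<exists>A\<subseteq>contractions True G. boundary dl G = (\<Sum>l\<in>A. cvec G l) \<and>
    (\<forall>l\<in>contractions True G - A. dl \<and> has_double_or_loop (contract G l))"
proof (cases dl)
  case True
  let ?A = "{i. i < num_edges G \<and> \<not> is_loop G i \<and> \<not> in_double_edge G i \<and> \<not> is_chord G i \<and> \<not> in_multiple_edge G i}"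
  show ?thesis
  proof (intro exI[of _ ?A] conjI ballI)
    show "?A \<subseteq> contractions True G" by (auto simp: contractions_def contractible_True_iff[OF assms])
    fix l assume "l \<in> contractions True G - ?A"
    thus "has_double_or_loop (contract G l)"
      using multiple_edge_contract[OF assms, of l] by (auto simp: contractions_def contractible_True_iff[OF assms])
  qed (simp_all add: True boundary_def PGC_boundary_def contraction_sum_def)
next
  case False
  have "contractions True G = {i. i < num_edges G \<and> \<not> is_chord G i \<and> \<not> is_loop G i}"
    by (simp add: contractions_def contractible_True_iff[OF assms])
  thus ?thesis
    by (intro exI[of _ "contractions True G"]) (simp_all add: boundary_def False PGC'_boundary_def contraction_sum_def)
qed

lemma keys_boundary:
  assumes "good G" "H \<in> keys (boundary dl G)"
  obtains l where "contractible True G l" "H = contract G l"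
proof -
  obtain A where "A \<subseteq> contractions True G" "boundary dl G = (\<Sum>l\<in>A. cvec G l)"
    using boundary_eq[OF assms(1)] by blast
  thus thesis using assms(2) keys_cvec[of G A] that by (auto simp: contractions_def)
qed

lemma keys_boundary_good: "good G \<Longrightarrow> keys (boundary dl G) \<subseteq> {G. good G}"
  by (auto elim!: keys_boundary[rotated] intro: good_contract)

lemma boundary_udiff:
  assumes "keys x \<subseteq> {G. good G}"
  shows "lin (boundary dl) x - lin (udiff True) x \<in> uspan dl"
proof (rule lin_diff_in_span)
  fix G assume "G \<in> keys x"
  hence g: "good G" using assms by blast
  obtain A where A: "A \<subseteq> contractions True G"
    "boundary dl G = (\<Sum>l\<in>A. cvec G l)"
    "\<forall>l\<in>contractions True G - A. dl \<and> has_double_or_loop (contract G l)"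
    using boundary_eq[OF g] by blast
  have "udiff True G - boundary dl G \<in> uspan dl"
    unfolding A(2) udiff_def sum_diff[OF finite_contractions A(1), symmetric]
  proof (rule rv.span_sum)
    fix l assume l: "l \<in> contractions True G - A"
    hence "bv (contract G l) \<in> urels dl"
      using A(3) good_contract[OF g] by (auto simp: urels_def double_loop_relations_def contractions_def)
    thus "cvec G l \<in> uspan dl"
      using rv.span_scale[OF rv.span_base, of _ "urels dl" "csign G l"] by fastforce
  qed
  from rv.span_neg[OF this] show "boundary dl G - udiff True G \<in> uspan dl" by simp
qed

lemma boundary_urels:
  assumes "x \<in> uspan dl"
  shows "lin (boundary dl) x \<in> uspan dl"
  using rv.span_add[OF boundary_udiff[OF keys_urels[OF assms]] udiff_rels[OF assms, of True]] by simp

lemma chordal_boundary: "chordal G \<Longrightarrow> H \<in> keys (boundary dl G) \<Longrightarrow> chordal H"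
  using keys_boundary[of G H dl] chordal_contract[of G] unfolding chordal_def by blast

lemma keys_lin_boundary:
  assumes "keys x \<subseteq> plain_gen k"
  shows "keys (lin (boundary dl) x) \<subseteq> plain_gen (k + 1)"
proof
  fix H assume "H \<in> keys (lin (boundary dl) x)"
  then obtain G where G: "G \<in> keys x" "H \<in> keys (boundary dl G)"
    using keys_lin_subset[of "boundary dl" x] by blast
  have g: "good G" "gdeg G = k" using assms G(1) by (auto simp: plain_generators_iff)
  obtain l where "contractible True G l" "H = contract G l" using keys_boundary[OF g(1) G(2)] .
  thus "H \<in> plain_gen (k + 1)"
    using g by (simp add: plain_generators_iff good_contract graph_degree_contract)
qed

lemma relabeling_degree: "relab G H s \<Longrightarrow> gdeg H = gdeg G"
proof (induction rule: relabeling.induct)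
  case (1 i)
  thus ?case
    by (simp add: graph_degree_def edge_degrees_def vertex_degrees_def swap_edges_def map_swap_adjacent flip: sum_mset_sum_list)
next
  case (2 v)
  thus ?case
    by (simp add: graph_degree_def edge_degrees_def vertex_degrees_def swap_vertices_def map_swap_adjacent comp_def flip: sum_mset_sum_list)
next
  case (3 i)
  have "(map (\<lambda>e. kdeg (ekind e)) (edges G))[i := kdeg (kind_at G i)] =
      map (\<lambda>e. kdeg (ekind e)) (edges G)" by (metis list_update_id map_update)
  thus ?case by (simp add: graph_degree_def edge_degrees_def vertex_degrees_def reverse_edge_def map_update)
qed

lemma graph_degree_cong:
  assumes "map ekind es = map ekind es'"
  shows "gdeg (LGraph vs es) = gdeg (LGraph vs es')"
proof -
  have "map (\<lambda>e. kdeg (ekind e)) xs = map (kdeg) (map ekind xs)" for xs by simp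
  thus ?thesis using assms by (simp only: graph_degree_def edge_degrees_def vertex_degrees_def lgraph.sel)
qed

lemma rels_subset: "rels dl k \<subseteq> urels dl"
  by (auto simp: rels_def PGC_relations_def PGC'_relations_def urels_def orientation_relations_def
      double_loop_relations_def plain_generators_iff)

lemma span_rels_iff:
  assumes "keys x \<subseteq> plain_gen k"
  shows "x \<in> rv.span (rels dl k) \<longleftrightarrow> x \<in> uspan dl"
proof
  assume x: "x \<in> uspan dl"
  have S: "{G. good G \<and> gdeg G = k} = plain_gen k" by (auto simp: plain_generators_iff)
  have "restrict_to (\<lambda>G. gdeg G = k) x \<in> rv.span (orient_rel {G. good G \<and> gdeg G = k} \<union>
      (if dl then double_loop_relations {G. good G \<and> gdeg G = k} else {}))"
    by (rule restrict_urels[OF x]) (simp add: relabeling_degree)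
  moreover have "restrict_to (\<lambda>G. gdeg G = k) x = x"
    using assms by (intro restrict_to_id) (auto simp: plain_generators_iff)
  ultimately show "x \<in> rv.span (rels dl k)"
    unfolding S by (simp add: rels_def PGC_relations_def PGC'_relations_def split: if_splits)
qed (use rv.span_mono[OF rels_subset] in blast)

lemma restrict_chord_null:
  assumes "x \<in> chord_null"
  shows "restrict_to (\<lambda>G. gdeg G = k) x \<in> rv.span (HH_rel k)"
proof -
  have "{G \<in> {G. chordal G}. gdeg G = k} = chord_gen k" by (auto simp: chord_generators_iff)
  moreover have "restrict_to (\<lambda>G. gdeg G = k) x \<in> rv.span (hrels {G \<in> {G. chordal G}. gdeg G = k})"
    by (rule restrict_hrels[where f="gdeg", OF assms[unfolded chord_null_def]])
      (erule relabeling_degree, erule graph_degree_cong)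
  ultimately show ?thesis by (simp add: HH_relations_eq)
qed

lemma span_HH_subset: "x \<in> rv.span (HH_rel k) \<Longrightarrow> x \<in> chord_null"
  unfolding chord_null_def HH_relations_eq
  by (rule rv.span_mono[OF hrels_mono, THEN subsetD, rotated]) (auto simp: chord_generators_iff)

lemma span_HH_iff:
  assumes "keys x \<subseteq> chord_gen k"
  shows "x \<in> rv.span (HH_rel k) \<longleftrightarrow> x \<in> chord_null"
proof -
  have "restrict_to (\<lambda>G. gdeg G = k) x = x"
    using assms by (intro restrict_to_id) (auto simp: chord_generators_iff)
  thus ?thesis using restrict_chord_null[of x k] span_HH_subset by metis
qed

lemma chord_null_add: "x \<in> chord_null \<Longrightarrow> y \<in> chord_null \<Longrightarrow> x + y \<in> chord_null"
  and chord_null_diff: "x \<in> chord_null \<Longrightarrow> y \<in> chord_null \<Longrightarrow> x - y \<in> chord_null"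
  unfolding chord_null_def by (rule rv.span_add rv.span_diff; assumption)+

text \<open>\<open>chord_part\<close> also discards chord graphs with double edges or loops, but
  these are relations of \<open>HH\<close>. Up to relations it is the restriction to chordal
  graphs.\<close>

lemma chord_part_diff:
  assumes "keys x \<subseteq> {G. good G}"
  shows "lin chord_part x - restrict_to chordal x \<in> chord_null" unfolding chord_null_def restrict_to_def
proof (rule lin_diff_in_span)
  fix G assume "G \<in> keys x"
  hence g: "good G" using assms by blast
  have "- bv G \<in> rv.span (hrels {G. chordal G})" if "chordal G" "has_double_or_loop G"
    using that by (intro rv.span_neg rv.span_base) (auto simp: hrels_def double_loop_relations_def)
  thus "chord_part G - (if chordal G then bv G else 0) \<in> rv.span (hrels {G. chordal G})"
    by (simp add: chord_part_def chord_graph_iff[OF g] rv.span_zero)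
qed

lemma chord_part_iff:
  "keys x \<subseteq> {G. good G} \<Longrightarrow> lin chord_part x \<in> chord_null \<longleftrightarrow> restrict_to chordal x \<in> chord_null"
  using span_cong chord_part_diff unfolding chord_null_def by blast

lemma keys_chord_part:
  assumes "keys x \<subseteq> plain_gen k"
  shows "keys (lin chord_part x) \<subseteq> chord_gen k"
proof
  fix G assume "G \<in> keys (lin chord_part x)"
  then obtain H where H: "H \<in> keys x" "G \<in> keys (chord_part H)"
    using keys_lin_subset[of chord_part x] by blast
  have "H \<in> plain_gen k" using H(1) assms by blast
  thus "G \<in> chord_gen k"
    using H(2) by (auto simp: chord_part_def chord_generators_iff plain_generators_iff chord_graph_iff split: if_splits)
qed

lemma restrict_degree:
  assumes "keys z \<subseteq> {G. good G}"
  shows "restrict_to (\<lambda>G. gdeg G = k + 1) (lin (udiff True) z) =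
    lin (udiff True) (restrict_to (\<lambda>G. gdeg G = k) z)"
proof -
  have "restrict_to (\<lambda>G. gdeg G = k + 1) (udiff True g) =
      lin (udiff True) (if gdeg g = k then bv g else 0)" if "good g" for g
    using keys_udiff_good(2)[OF that] by (auto intro!: restrict_to_id restrict_to_zero)
  thus ?thesis
    unfolding restrict_to_def lin_lin by (intro lin_cong) (use assms in "auto simp: restrict_to_def")
qed

text \<open>The primitive supplied by \<open>acyclic_kernel\<close> may have components in several
  degrees. As the differential has degree one, the component of degree \<open>k\<close> alone is a
  primitive.\<close>

lemma acyclic_degree:
  assumes "keys x \<subseteq> plain_gen (k + 1)" "restrict_to chordal x \<in> chord_null"
    "lin (boundary dl) x \<in> uspan dl"
  shows "\<exists>y. keys y \<subseteq> plain_gen k \<and> restrict_to chordal y \<in> chord_null \<and>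
    x - lin (boundary dl) y \<in> uspan dl"
proof -
  let ?D = "lin (udiff True)" and ?r = "\<lambda>k. restrict_to (\<lambda>G. gdeg G = k)"
  have kx: "keys x \<subseteq> {G. good G}" using assms(1) by (auto simp: plain_generators_iff)
  have "?D x \<in> uspan dl" using rv.span_diff[OF assms(3) boundary_udiff[OF kx]] by simp
  then obtain y where y: "keys y \<subseteq> {G. good G}" "restrict_to chordal y \<in> chord_null"
    "x - ?D y \<in> uspan dl" using acyclic_kernel[OF kx assms(2)] by blast
  have ky: "keys (?r k y) \<subseteq> plain_gen k"
    using y(1) by (auto simp: keys_restrict_to plain_generators_iff)
  have "?r (k + 1) (x - ?D y) \<in> uspan dl"
    by (rule restrict_urels'[OF y(3)]) (simp add: relabeling_degree)
  moreover have "?r (k + 1) x = x"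
    using assms(1) by (intro restrict_to_id) (auto simp: plain_generators_iff)
  ultimately have "x - ?D (?r k y) \<in> uspan dl" by (simp add: restrict_to_diff restrict_degree[OF y(1)])
  from rv.span_diff[OF this boundary_udiff[of "?r k y"]] ky
  have "x - lin (boundary dl) (?r k y) \<in> uspan dl" by (auto simp: plain_generators_iff subset_iff)
  moreover have "restrict_to chordal (?r k y) \<in> chord_null"
    unfolding restrict_to_commute[of chordal] by (rule span_HH_subset[OF restrict_chord_null[OF y(2)]])
  ultimately show ?thesis using ky by blast
qed

lemma boundary_boundary:
  assumes "good g"
  shows "lin (boundary dl) (boundary dl g) \<in> uspan dl"
proof -
  have B: "boundary dl g - udiff True g \<in> uspan dl" using boundary_udiff[of "bv g" dl] assms by simp
  have k: "keys (boundary dl g) \<subseteq> {G. good G}" by (rule keys_boundary_good[OF assms])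
  have "lin (udiff True) (udiff True g) = 0" using udiff_udiff[of "bv g" True] assms by simp
  hence "lin (udiff True) (boundary dl g) \<in> uspan dl"
    using udiff_rels[OF B, of True] by (simp add: lin_diff)
  from rv.span_add[OF boundary_udiff[OF k] this] show ?thesis by simp
qed

lemma chordal_keys_null:
  assumes "x \<in> uspan dl" "keys x \<subseteq> {G. chordal G}"
  shows "x \<in> chord_null"
  using chordal_urels[OF assms(1)] restrict_to_id[of x chordal] assms(2) by (metis mem_Collect_eq subsetD)

lemma keys_chordal_boundary:
  assumes "keys x \<subseteq> {G. chordal G}"
  shows "keys (lin (boundary dl) x) \<subseteq> {G. chordal G}"
    and "keys (lin (udiff True) x) \<subseteq> {G. chordal G}"
  using keys_lin_subset[of "boundary dl" x] keys_lin_subset[of "udiff True" x] assms chordal_boundary chordal_udiff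
  by blast+

lemma chordal_boundary_udiff:
  assumes "keys x \<subseteq> {G. chordal G}"
  shows "lin (boundary dl) x - lin (udiff True) x \<in> chord_null"
proof (rule chordal_keys_null[OF boundary_udiff])
  show "keys x \<subseteq> {G. good G}" using assms by (auto simp: chordal_def)
  show "keys (lin (boundary dl) x - lin (udiff True) x) \<subseteq> {G. chordal G}"
    by (rule subset_trans[OF keys_diff_subset Un_least[OF keys_chordal_boundary[OF assms]]])
qed

lemma boundary_chord_null:
  assumes "x \<in> chord_null"
  shows "lin (boundary dl) x \<in> chord_null"
proof -
  have "keys x \<subseteq> {G. chordal G}"
    using keys_span_subset[OF keys_hrels assms[unfolded chord_null_def]] by simp
  from chord_null_add[OF chordal_boundary_udiff[OF this] chord_null_udiff[OF assms]] show ?thesis by simp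
qed

lemma keys_rels:
  assumes "r \<in> rels dl k"
  shows "keys r \<subseteq> plain_gen k"
proof -
  have "r \<in> hrels (plain_gen k)"
    using assms by (auto simp: rels_def PGC_relations_def PGC'_relations_def hrels_def split: if_splits)
  thus ?thesis by (rule keys_hrels)
qed

lemma keys_HH_boundary:
  assumes "keys x \<subseteq> chord_gen k"
  shows "keys (lin (boundary dl) x) \<subseteq> chord_gen (k + 1)"
proof -
  have "keys x \<subseteq> plain_gen k" "keys x \<subseteq> {G. chordal G}"
    using assms by (auto simp: chord_generators_iff plain_generators_iff chordal_def)
  from keys_lin_boundary[OF this(1)] keys_chordal_boundary(1)[OF this(2)] show ?thesis
    by (force simp: chord_generators_iff plain_generators_iff)
qed

lemma chord_part_boundary:
  assumes "good g"
  shows "lin chord_part (boundary dl g) - lin (boundary dl') (chord_part g) \<in> chord_null"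
proof -
  let ?B = "boundary dl g" and ?c = "restrict_to chordal"
  have k: "keys ?B \<subseteq> {G. good G}" by (rule keys_boundary_good[OF assms])
  have "?c (?B - udiff True g) \<in> chord_null"
    using boundary_udiff[of "bv g" dl] assms by (intro chordal_urels) simp
  from chord_null_add[OF chord_part_diff[OF k] this]
  have 1: "lin chord_part ?B - ?c (udiff True g) \<in> chord_null" by (simp add: restrict_to_diff)
  show ?thesis
  proof (cases "chordal g")
    case True
    have 2: "?c (udiff True g) = udiff True g" by (rule restrict_to_id) (rule chordal_udiff[OF True])
    have 3: "boundary dl' g - udiff True g \<in> chord_null"
      using chordal_boundary_udiff[of "bv g" dl'] True by simp
    have "?c (bv g) = bv g" using True by (intro restrict_to_id) simp
    hence "lin (boundary dl') (chord_part g) - boundary dl' g \<in> chord_null"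
      using boundary_chord_null[OF chord_part_diff[of "bv g"], of dl'] assms by (simp add: lin_diff)
    from chord_null_diff[OF 1 chord_null_add[OF this 3]] show ?thesis by (simp add: 2)
  next
    case False
    have "?c (udiff True g) \<in> chord_null"
      using chordal_udiff_internal[of "bv g"] False assms by (simp add: chordal_def)
    from chord_null_add[OF 1 this] show ?thesis
      using False by (simp add: chord_part_def chord_graph_iff[OF assms])
  qed
qed

lemma keys_bv: "g \<in> A \<Longrightarrow> keys (bv g) \<subseteq> A" by simp

lemma plain_complex: "presented_complex (plain_gen) (rels dl) (boundary dl)" unfolding presented_complex_def
proof (intro allI conjI ballI)
  let ?B = "boundary dl"
  fix k
  show kR: "keys r \<subseteq> plain_gen k" if "r \<in> rels dl k" for r using that by (rule keys_rels)
  show D: "keys (?B g) \<subseteq> plain_gen (k + 1)" if "g \<in> plain_gen k" for g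
    using keys_lin_boundary[OF keys_bv[OF that]] by simp
  show "lin ?B r \<in> rv.span (rels dl (k + 1))" if "r \<in> rels dl k" for r
    unfolding span_rels_iff[OF keys_lin_boundary[OF kR[OF that]]]
    using boundary_urels rv.span_base rels_subset that by blast
  show "lin ?B (?B g) \<in> rv.span (rels dl (k + 2))" if "g \<in> plain_gen k" for g
    using span_rels_iff[OF keys_lin_boundary[OF D[OF that]]] boundary_boundary that
    by (simp add: plain_generators_iff add.assoc)
qed

lemma chord_complex: "presented_complex (chord_gen) (HH_rel) (boundary True)"
  unfolding presented_complex_def
proof (intro allI conjI ballI)
  let ?B = "boundary True"
  fix k
  show kH: "keys r \<subseteq> chord_gen k" if "r \<in> HH_rel k" for r
    using that unfolding HH_relations_eq by (rule keys_hrels)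
  show D: "keys (?B g) \<subseteq> chord_gen (k + 1)" if "g \<in> chord_gen k" for g
    using keys_HH_boundary[OF keys_bv[OF that]] by simp
  show "lin ?B r \<in> rv.span (HH_rel (k + 1))" if "r \<in> HH_rel k" for r
    unfolding span_HH_iff[OF keys_HH_boundary[OF kH[OF that]]]
    by (rule boundary_chord_null[OF span_HH_subset[OF rv.span_base[OF that]]])
  show "lin ?B (?B g) \<in> rv.span (HH_rel (k + 2))" if "g \<in> chord_gen k" for g
  proof -
    have k: "keys (lin ?B (?B g)) \<subseteq> chord_gen (k + 2)"
      using keys_HH_boundary[OF D[OF that]] by (simp add: add.assoc)
    have "lin ?B (?B g) \<in> chord_null"
      by (rule chordal_keys_null[OF boundary_boundary]) (use k that in "auto simp: chord_generators_iff chordal_def")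
    thus ?thesis by (simp add: span_HH_iff[OF k])
  qed
qed

lemma plain_good: "keys x \<subseteq> plain_gen k \<Longrightarrow> keys x \<subseteq> {G. good G}"
  by (auto simp: plain_generators_iff)

text \<open>The flag \<open>dl\<close> selects the source among the two complexes of plain graphs;
  the differential of the target is \<open>boundary True\<close> in either case, and
  \<open>chord_part_boundary\<close> bridges the difference.\<close>

theorem projection_quasi_isomorphism:
  "quasi_isomorphism (\<lambda>k. presented (plain_gen k) (rels dl k))
    (\<lambda>k. presented_map (plain_gen (k + 1)) (rels dl (k + 1)) (boundary dl))
    (\<lambda>k. presented (chord_gen k) (HH_rel k))
    (\<lambda>k. presented_map (chord_gen (k + 1)) (HH_rel (k + 1)) (boundary True))
    (\<lambda>k. presented_map (chord_gen k) (HH_rel k) chord_part)"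
proof (rule presented_quasi_isomorphism[OF plain_complex chord_complex])
  let ?B = "boundary"
  show P: "keys (chord_part g) \<subseteq> chord_gen k" if "g \<in> plain_gen k" for g k
    using keys_chord_part[OF keys_bv[OF that]] by simp
  have D: "keys (?B dl g) \<subseteq> plain_gen (k + 1)" if "g \<in> plain_gen k" for g k
    using keys_lin_boundary[OF keys_bv[OF that]] by simp
  show "lin chord_part r \<in> rv.span (HH_rel k)" if "r \<in> rels dl k" for r k
    unfolding span_HH_iff[OF keys_chord_part[OF keys_rels[OF that]]] chord_part_iff[OF plain_good[OF keys_rels[OF that]]]
    using chordal_urels rv.span_base rels_subset that by blast
  show "lin chord_part (?B dl g) - lin (?B True) (chord_part g) \<in> rv.span (HH_rel (k + 1))"
    if "g \<in> plain_gen k" for g k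
  proof (subst span_HH_iff)
    show "keys (lin chord_part (?B dl g) - lin (?B True) (chord_part g)) \<subseteq> chord_gen (k + 1)"
      by (rule subset_trans[OF keys_diff_subset Un_least[OF keys_chord_part[OF D[OF that]] keys_HH_boundary[OF P[OF that]]]])
  qed (use chord_part_boundary that in "simp add: plain_generators_iff")
  show "g \<in> plain_gen k \<and> bv g - chord_part g \<in> rv.span (HH_rel k)"
    if g: "g \<in> chord_gen k" for g k
  proof
    show c: "g \<in> plain_gen k" using g by (auto simp: chord_generators_iff plain_generators_iff chordal_def)
    have "keys (bv g - chord_part g) \<subseteq> chord_gen k"
      by (rule subset_trans[OF keys_diff_subset Un_least[OF keys_bv[OF g] P[OF c]]])
    moreover have "bv g - chord_part g \<in> chord_null"
      using chord_null_diff[OF _ chord_part_diff[of "bv g"], of 0] restrict_to_id[of "bv g" chordal] g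
      by (simp add: chordal_def chord_null_def rv.span_zero chord_generators_iff)
    ultimately show "bv g - chord_part g \<in> rv.span (HH_rel k)" by (simp add: span_HH_iff)
  qed
  fix k x
  assume x: "keys x \<subseteq> plain_gen (k + 1)" "lin chord_part x \<in> rv.span (HH_rel (k + 1))"
    "lin (?B dl) x \<in> rv.span (rels dl (k + 2))"
  have "restrict_to chordal x \<in> chord_null"
    using span_HH_subset[OF x(2)] by (simp add: chord_part_iff[OF plain_good[OF x(1)]])
  moreover have "lin (?B dl) x \<in> uspan dl" using rv.span_mono[OF rels_subset] x(3) by blast
  ultimately obtain y where y: "keys y \<subseteq> plain_gen k" "restrict_to chordal y \<in> chord_null"
    "x - lin (?B dl) y \<in> uspan dl" using acyclic_degree[OF x(1)] by blast
  have "keys (x - lin (?B dl) y) \<subseteq> plain_gen (k + 1)"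
    by (rule subset_trans[OF keys_diff_subset Un_least[OF x(1) keys_lin_boundary[OF y(1)]]])
  thus "\<exists>y. keys y \<subseteq> plain_gen k \<and> lin chord_part y \<in> rv.span (HH_rel k) \<and>
      x - lin (?B dl) y \<in> rv.span (rels dl (k + 1))"
    using y by (intro exI[of _ y]) (simp add: span_rels_iff span_HH_iff keys_chord_part chord_part_iff plain_good)
qed

section \<open>The projection between the two complexes of plain graphs\<close>

lemma simple_part_diff:
  assumes "keys x \<subseteq> {G. good G}"
  shows "lin simple_part x - x \<in> uspan True"
proof -
  have "lin simple_part x - lin bv x \<in> uspan True"
  proof (rule lin_diff_in_span)
    fix G assume "G \<in> keys x"
    hence "- bv G \<in> uspan True" if "has_double_or_loop G"
      using that assms by (intro rv.span_neg rv.span_base) (auto simp: urels_def double_loop_relations_def)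
    thus "simple_part G - bv G \<in> uspan True" by (simp add: simple_part_def rv.span_zero)
  qed
  thus ?thesis by simp
qed

lemma simple_part_iff: "keys x \<subseteq> {G. good G} \<Longrightarrow> lin simple_part x \<in> uspan True \<longleftrightarrow> x \<in> uspan True"
  by (rule span_cong[OF simple_part_diff])

lemma keys_simple_part: "keys (lin simple_part x) \<subseteq> keys x"
  using keys_lin_subset[of simple_part x] by (fastforce simp: simple_part_def split: if_splits)

lemma boundary_True_iff:
  assumes "keys x \<subseteq> {G. good G}"
  shows "lin (boundary dl) x \<in> uspan True \<longleftrightarrow> lin (udiff True) x \<in> uspan True"
proof (rule span_cong)
  show "lin (boundary dl) x - lin (udiff True) x \<in> uspan True"
    using boundary_udiff[OF assms, of dl] urels_mono[of _ True] by (cases dl) auto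
qed

lemma simple_part_boundary:
  assumes "good g"
  shows "lin simple_part (boundary False g) - lin (boundary True) (simple_part g) \<in> uspan True"
proof -
  have g: "keys (bv g) \<subseteq> {G. good G}" using assms by simp
  have 1: "lin simple_part (boundary False g) - boundary False g \<in> uspan True"
    by (rule simple_part_diff[OF keys_boundary_good[OF assms]])
  have "lin (boundary True) (lin simple_part (bv g) - bv g) \<in> uspan True"
    by (rule boundary_urels[OF simple_part_diff[OF g]])
  hence 2: "lin (boundary True) (simple_part g) - boundary True g \<in> uspan True" by (simp add: lin_diff)
  have 3: "boundary False g - udiff True g \<in> uspan True"
    using urels_mono[OF boundary_udiff[OF g, of False]] by simp
  have 4: "boundary True g - udiff True g \<in> uspan True" using boundary_udiff[OF g, of True] by simp
  from rv.span_diff[OF rv.span_add[OF 1 3] rv.span_add[OF 2 4]] show ?thesis by simp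
qed

lemma simple_quasi_isomorphism:
  "quasi_isomorphism (\<lambda>k. presented (plain_gen k) (rels False k))
    (\<lambda>k. presented_map (plain_gen (k + 1)) (rels False (k + 1)) (boundary False))
    (\<lambda>k. presented (plain_gen k) (rels True k))
    (\<lambda>k. presented_map (plain_gen (k + 1)) (rels True (k + 1)) (boundary True))
    (\<lambda>k. presented_map (plain_gen k) (rels True k) simple_part)"
proof (rule presented_quasi_isomorphism[OF plain_complex plain_complex])
  let ?B = "boundary" and ?U = "\<lambda>dl. uspan dl"
  have P: "keys (lin simple_part x) \<subseteq> plain_gen k"
    if "keys x \<subseteq> plain_gen k" for x k using subset_trans[OF keys_simple_part that] .
  show P1: "keys (simple_part g) \<subseteq> plain_gen k" if "g \<in> plain_gen k" for g k
    using P[OF keys_bv[OF that]] by simp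
  show "lin simple_part r \<in> rv.span (rels True k)" if "r \<in> rels False k" for r k
  proof -
    have "r \<in> ?U True" by (rule urels_mono[OF rv.span_base[OF subsetD[OF rels_subset that]]])
    thus ?thesis
      unfolding span_rels_iff[OF P[OF keys_rels[OF that]]] simple_part_iff[OF plain_good[OF keys_rels[OF that]]] .
  qed
  show "lin simple_part (?B False g) - lin (?B True) (simple_part g) \<in> rv.span (rels True (k + 1))"
    if g: "g \<in> plain_gen k" for g k
  proof (subst span_rels_iff)
    have "keys (?B False g) \<subseteq> plain_gen (k + 1)" using keys_lin_boundary[OF keys_bv[OF g]] by simp
    thus "keys (lin simple_part (?B False g) - lin (?B True) (simple_part g)) \<subseteq> plain_gen (k + 1)"
      by (intro subset_trans[OF keys_diff_subset Un_least[OF P keys_lin_boundary[OF P1[OF g]]]])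
  qed (use simple_part_boundary g in "simp add: plain_generators_iff")
  show "g \<in> plain_gen k \<and> bv g - simple_part g \<in> rv.span (rels True k)"
    if g: "g \<in> plain_gen k" for g k
  proof (intro conjI g)
    have "keys (bv g - simple_part g) \<subseteq> plain_gen k"
      by (rule subset_trans[OF keys_diff_subset Un_least[OF keys_bv[OF g] P1[OF g]]])
    moreover have "bv g - simple_part g \<in> ?U True"
      using rv.span_neg[OF simple_part_diff[of "bv g"]] g by (simp add: plain_generators_iff)
    ultimately show "bv g - simple_part g \<in> rv.span (rels True k)" by (simp add: span_rels_iff)
  qed
  show "\<exists>y. keys y \<subseteq> plain_gen k \<and> lin simple_part y \<in> rv.span (rels True k) \<and>
      x - lin (?B False) y \<in> rv.span (rels False (k + 1))"
    if x: "keys x \<subseteq> plain_gen (k + 1)" "lin simple_part x \<in> rv.span (rels True (k + 1))"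
      "lin (?B False) x \<in> rv.span (rels False (k + 2))" for k x
  proof -
    \<comment> \<open>Lift to the kernel of the projection onto \<open>HH\<close> twice: the primitive \<open>y\<close> of \<open>x\<close> is a cycle modulo
      double edges and loops, hence itself a boundary there.\<close>
    have xU: "x \<in> ?U True" using x(2) by (simp add: span_rels_iff[OF P[OF x(1)]] simple_part_iff[OF plain_good[OF x(1)]])
    have "lin (?B False) x \<in> ?U False" using rv.span_mono[OF rels_subset] x(3) by blast
    then obtain y where y: "keys y \<subseteq> plain_gen k" "restrict_to chordal y \<in> chord_null"
      "x - lin (?B False) y \<in> ?U False" using acyclic_degree[OF x(1) chordal_urels[OF xU]] by blast
    have "lin (?B False) y \<in> ?U True" using rv.span_diff[OF xU urels_mono[OF y(3)]] by simp
    hence By: "lin (?B True) y \<in> ?U True" by (simp add: boundary_True_iff plain_good[OF y(1)])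
    obtain z where z: "keys z \<subseteq> plain_gen (k - 1)" "y - lin (?B True) z \<in> ?U True"
      using acyclic_degree[of y "k - 1", OF _ y(2) By] y(1) by auto
    have kz: "keys (lin (?B dl) z) \<subseteq> plain_gen k" for dl using keys_lin_boundary[OF z(1)] by simp
    \<comment> \<open>Subtracting the boundary of \<open>z\<close> in the larger complex changes the
      boundary of \<open>y\<close> only by relations. It also makes the primitive vanish modulo
      double edges and loops, since the two boundaries of \<open>z\<close> agree there.\<close>
    let ?w = "y - lin (?B False) z"
    have kw: "keys ?w \<subseteq> plain_gen k"
      by (rule subset_trans[OF keys_diff_subset Un_least[OF y(1) kz]])
    have "lin (?B True) z - lin (?B False) z \<in> ?U True"
      using rv.span_diff[OF boundary_udiff[OF plain_good[OF z(1)], of True] urels_mono[OF boundary_udiff[OF plain_good[OF z(1)], of False]]]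
      by simp
    from rv.span_add[OF z(2) this] have w: "?w \<in> ?U True" by simp
    have "lin (?B False) (lin (?B False) z) \<in> ?U False"
      unfolding lin_lin by (rule lin_in_span) (use boundary_boundary plain_good[OF z(1)] in blast)
    from rv.span_add[OF y(3) this] have "x - lin (?B False) ?w \<in> ?U False" by (simp add: lin_diff algebra_simps)
    moreover have "keys (x - lin (?B False) ?w) \<subseteq> plain_gen (k + 1)"
      by (rule subset_trans[OF keys_diff_subset Un_least[OF x(1) keys_lin_boundary[OF kw]]])
    ultimately show ?thesis
      using kw w by (intro exI[of _ ?w]) (simp add: span_rels_iff P simple_part_iff plain_good)
  qed
qed

end

theorem theorem0p3:
  fixes n j :: int
  assumes "j \<ge> 2" and "n - j \<ge> 2"
  shows "quasi_isomorphism (PGC n j) (PGC_diff n j) (HH n j) (HH_diff n j) (PGC_to_HH n j) \<and>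
         quasi_isomorphism (PGC' n j) (PGC'_diff n j) (HH n j) (HH_diff n j) (PGC'_to_HH n j) \<and>
         quasi_isomorphism (PGC' n j) (PGC'_diff n j) (PGC n j) (PGC_diff n j) (PGC'_to_PGC n j)"
proof -
  interpret degrees n j .
  have "PGC n j = (\<lambda>k. presented (plain_generators n j k) (rels True k))"
    "PGC' n j = (\<lambda>k. presented (plain_generators n j k) (rels False k))"
    "HH n j = (\<lambda>k. presented (chord_generators n j k) (HH_relations n j k))"
    "PGC_diff n j = (\<lambda>k. presented_map (plain_generators n j (k + 1)) (rels True (k + 1)) (boundary True))"
    "PGC'_diff n j = (\<lambda>k. presented_map (plain_generators n j (k + 1)) (rels False (k + 1)) (boundary False))"
    "HH_diff n j = (\<lambda>k. presented_map (chord_generators n j (k + 1)) (HH_relations n j (k + 1)) (boundary True))"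
    "PGC_to_HH n j = (\<lambda>k. presented_map (chord_generators n j k) (HH_relations n j k) chord_part)"
    "PGC'_to_HH n j = (\<lambda>k. presented_map (chord_generators n j k) (HH_relations n j k) chord_part)"
    "PGC'_to_PGC n j = (\<lambda>k. presented_map (plain_generators n j k) (rels True k) simple_part)"
    by (simp_all add: fun_eq_iff PGC_def PGC'_def HH_def PGC_diff_def PGC'_diff_def HH_diff_def PGC_to_HH_def
        PGC'_to_HH_def PGC'_to_PGC_def rels_def boundary_def)
  then show ?thesis by (simp only: projection_quasi_isomorphism simple_quasi_isomorphism simp_thms)
qed

end
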